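(* Let $s>2$ and $T>0$. Let $U_T\subseteq H^s(\mathbb R^2)$ be the set of those initial values $\theta_0\in H^s(\mathbb R^2)$ for which the solution $\theta$ of the inviscid SQG equation $$\partial_t\theta+(u\cdot\nabla)\theta=0,\qquad\theta(0)=\theta_0,\qquad u=(-\mathcal R_2\theta,\mathcal R_1\theta),$$ exists longer than time $T$. Then the solution map $$U_T\to H^s(\mathbb R^2),\qquad \theta_0\mapsto\theta(T),$$ is nowhere locally uniformly continuous, i.e. there is no $\theta_0\in U_T$ possessing a neighbourhood in $U_T$ on which this map is uniformly continuous (with respect to the $H^s$-norm on both sides).
   Context: $H^s(\mathbb R^2)$ is the real-valued $L^2$-based Sobolev space. The Riesz transforms are $\mathcal R_k=\partial_k(-\Delta)^{-1/2}$, $k=1,2$ (Fourier multipliers with symbol $i\xi_k/|\xi|$). A function $\theta\in C([0,T'];H^s(\mathbb R^2))$ is a solution of the SQG equation on $[0,T']$ with initial value $\theta_0$ if, with $u=(-\mathcal R_2\theta,\mathcal R_1\theta)$, $$\theta(t)=\theta_0+\int_0^t-(u\cdot\nabla)\theta\,ds\qquad\text{for all }0\le t\le T',$$ as an equality in $H^{s-1}(\mathbb R^2)$. For $s>2$ the problem is locally well-posed in $H^s(\mathbb R^2)$ (local existence, uniqueness, continuous dependence on the initial value), so that $\theta(T)$ is well defined for $\theta_0\in U_T$. "Exists longer than time $T$" means that there is a solution on $[0,T']$ for some $T'>T$. *)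

theory Defs
  imports "HOL-Analysis.Analysis"
begin

text \<open>
  Elements of the real-valued space $H^s(R^2)$, $s \ge 0$, are represented by Borel functions
  on \<^typ>\<open>real ^ 2\<close>. Two functions represent the same element iff they agree almost
  everywhere; every notion below is invariant under this identification, and operators whose
  values are only determined almost everywhere pick a representative by \<^const>\<open>Eps\<close>.
\<close>

type_synonym plane = "real ^ 2"

definition square_integrable :: "(plane \<Rightarrow> 'b::real_normed_vector) \<Rightarrow> bool" where
  "square_integrable f \<longleftrightarrow>
     f \<in> borel_measurable lborel \<and> integrable lborel (\<lambda>x. (norm (f x))\<^sup>2)"

definition fourier_integral :: "(plane \<Rightarrow> real) \<Rightarrow> plane \<Rightarrow> complex" where
  "fourier_integral f \<xi> =
     (LINT x|lborel. complex_of_real (f x) * exp (- \<i> * complex_of_real (x \<bullet> \<xi>))) / (2 * pi)"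

text \<open>
  The Plancherel transform: the $L^2$-limit of the (absolutely convergent) Fourier integrals
  of the truncations of \<open>f\<close> to balls. The normalisation above makes it unitary.
\<close>

definition fourier :: "(plane \<Rightarrow> real) \<Rightarrow> plane \<Rightarrow> complex" where
  "fourier f = (SOME g. square_integrable g \<and>
     (\<lambda>n. \<integral>\<^sup>+\<xi>. ennreal ((cmod (fourier_integral
              (\<lambda>x. indicator (cball 0 (real n)) x * f x) \<xi> - g \<xi>))\<^sup>2) \<partial>lborel)
       \<longlonglongrightarrow> 0)"

definition sobolev :: "real \<Rightarrow> (plane \<Rightarrow> real) set" where
  "sobolev s = {f. square_integrable f \<and>
     integrable lborel (\<lambda>\<xi>. (1 + (norm \<xi>)\<^sup>2) powr s * (cmod (fourier f \<xi>))\<^sup>2)}"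

definition sobolev_norm :: "real \<Rightarrow> (plane \<Rightarrow> real) \<Rightarrow> real" where
  "sobolev_norm s f =
     sqrt (LINT \<xi>|lborel. (1 + (norm \<xi>)\<^sup>2) powr s * (cmod (fourier f \<xi>))\<^sup>2)"

definition sobolev_dist :: "real \<Rightarrow> (plane \<Rightarrow> real) \<Rightarrow> (plane \<Rightarrow> real) \<Rightarrow> real" where
  "sobolev_dist s f g = sobolev_norm s (\<lambda>x. f x - g x)"

text \<open>
  Fourier multiplier with symbol \<open>m\<close>. The result is meant to be real-valued, so \<open>m\<close> has to
  satisfy $m(-\xi) = \overline{m(\xi)}$, as the symbols used below do.
\<close>

definition fourier_multiplier :: "(plane \<Rightarrow> complex) \<Rightarrow> (plane \<Rightarrow> real) \<Rightarrow> plane \<Rightarrow> real" where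
  "fourier_multiplier m f = (SOME g. square_integrable g \<and>
     (AE \<xi> in lborel. fourier g \<xi> = m \<xi> * fourier f \<xi>))"

definition partial_deriv :: "2 \<Rightarrow> (plane \<Rightarrow> real) \<Rightarrow> plane \<Rightarrow> real" where
  "partial_deriv k = fourier_multiplier (\<lambda>\<xi>. \<i> * complex_of_real (\<xi> $ k))"

definition riesz :: "2 \<Rightarrow> (plane \<Rightarrow> real) \<Rightarrow> plane \<Rightarrow> real" where
  "riesz k = fourier_multiplier (\<lambda>\<xi>. \<i> * complex_of_real (\<xi> $ k / norm \<xi>))"

definition sqg_velocity :: "(plane \<Rightarrow> real) \<Rightarrow> plane \<Rightarrow> real ^ 2" where
  "sqg_velocity \<theta> x = vector [- riesz 2 \<theta> x, riesz 1 \<theta> x]"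

definition sqg_convection :: "(plane \<Rightarrow> real) \<Rightarrow> plane \<Rightarrow> real" where
  "sqg_convection \<theta> x = (\<Sum>k\<in>UNIV. sqg_velocity \<theta> x $ k * partial_deriv k \<theta> x)"

definition sobolev_continuous_on :: "real \<Rightarrow> real set \<Rightarrow> (real \<Rightarrow> plane \<Rightarrow> real) \<Rightarrow> bool" where
  "sobolev_continuous_on s A \<theta> \<longleftrightarrow> (\<forall>t\<in>A. \<theta> t \<in> sobolev s) \<and>
     (\<forall>t\<in>A. \<forall>e>0. \<exists>d>0. \<forall>\<tau>\<in>A. \<bar>\<tau> - t\<bar> < d \<longrightarrow> sobolev_dist s (\<theta> \<tau>) (\<theta> t) < e)"

text \<open>
  The Riemann integral over $[a,b]$ of a function with values in $H^r$. Compare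
  \<open>has_integral\<close>: the gauge is constant here, and the sums converge in the $H^r$-norm.
\<close>

definition has_sobolev_integral ::
  "real \<Rightarrow> (real \<Rightarrow> plane \<Rightarrow> real) \<Rightarrow> (plane \<Rightarrow> real) \<Rightarrow> real \<Rightarrow> real \<Rightarrow> bool" where
  "has_sobolev_integral r F I a b \<longleftrightarrow>
     (\<forall>\<tau>\<in>{a..b}. F \<tau> \<in> sobolev r) \<and> I \<in> sobolev r \<and>
     (\<forall>e>0. \<exists>d>0. \<forall>p. p tagged_division_of {a..b} \<and> (\<lambda>\<tau>. ball \<tau> d) fine p \<longrightarrow>
        sobolev_dist r (\<lambda>x. \<Sum>(\<tau>, K)\<in>p. measure lborel K * F \<tau> x) I < e)"

definition sqg_solution ::
  "real \<Rightarrow> real \<Rightarrow> (plane \<Rightarrow> real) \<Rightarrow> (real \<Rightarrow> plane \<Rightarrow> real) \<Rightarrow> bool" where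
  "sqg_solution s T' \<theta>0 \<theta> \<longleftrightarrow>
     sobolev_continuous_on s {0..T'} \<theta> \<and>
     (\<forall>t\<in>{0..T'}. \<exists>I.
        has_sobolev_integral (s - 1) (\<lambda>\<tau> x. - sqg_convection (\<theta> \<tau>) x) I 0 t \<and>
        (AE x in lborel. \<theta> t x = \<theta>0 x + I x))"

definition sqg_domain :: "real \<Rightarrow> real \<Rightarrow> (plane \<Rightarrow> real) set" where
  "sqg_domain s T = {\<theta>0 \<in> sobolev s. \<exists>T'>T. \<exists>\<theta>. sqg_solution s T' \<theta>0 \<theta>}"

text \<open>By uniqueness of solutions, the value is determined up to almost everywhere equality.\<close>

definition sqg_solution_map :: "real \<Rightarrow> real \<Rightarrow> (plane \<Rightarrow> real) \<Rightarrow> plane \<Rightarrow> real" where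
  "sqg_solution_map s T \<theta>0 = (SOME \<eta>. \<exists>T'>T. \<exists>\<theta>. sqg_solution s T' \<theta>0 \<theta> \<and> \<eta> = \<theta> T)"

definition sobolev_neighbourhood_in ::
  "real \<Rightarrow> (plane \<Rightarrow> real) set \<Rightarrow> (plane \<Rightarrow> real) \<Rightarrow> (plane \<Rightarrow> real) set \<Rightarrow> bool" where
  "sobolev_neighbourhood_in s U f V \<longleftrightarrow>
     V \<subseteq> U \<and> (\<exists>r>0. {g \<in> U. sobolev_dist s g f < r} \<subseteq> V)"

definition sobolev_uniformly_continuous_on ::
  "real \<Rightarrow> (plane \<Rightarrow> real) set \<Rightarrow> ((plane \<Rightarrow> real) \<Rightarrow> plane \<Rightarrow> real) \<Rightarrow> bool" where
  "sobolev_uniformly_continuous_on s V \<Phi> \<longleftrightarrow>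
     (\<forall>e>0. \<exists>d>0. \<forall>f\<in>V. \<forall>g\<in>V. sobolev_dist s f g < d \<longrightarrow> sobolev_dist s (\<Phi> f) (\<Phi> g) < e)"

end

theory Submission
  imports Defs "HOL-Probability.Probability"
begin

text \<open>
  On the Fourier side the equation is $\partial_t a = B(a, a)$ with a quadratic form losing one
  derivative. A frequency-truncated Euler scheme yields smooth solutions on the whole life span of a
  given $H^s$ solution, from all smooth data that are bounded in $H^s$ and close to it in $L^2$:
  closeness in $L^2$ persists, and by interpolation it controls the Lipschitz norm on which the energy
  estimates depend.

  The flow is reversible in time and invariant under $\theta(t) \mapsto \lambda\theta(\lambda t)$. Hence the
  solution map at time $T$, applied to $\lambda f$ with $\lambda$ slightly above 1, shows the solution
  from $f$ at the time $\lambda T$, and uniform continuity of the map would make a bounded family of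
  solutions equicontinuous in time near a time $T_1 > T$. To refute this, perturb a nonzero state
  $a(T_1)$ by profiles of fixed small $H^s$ norm at frequency $n$ and solve backwards. The smooth part
  transports such a profile by an amount of order $n$ per unit of time; all other contributions are of
  lower order since the perturbation tends to 0 in $H^{s-1}$. So the solutions move by a fixed amount in
  $H^s$ within the time $\kappa / n$, whereas the data $\lambda f$ in question differ by $O(1/n)$ only.
\<close>

text \<open>Uniform continuity compares states at one fixed time, whereas a high-frequency
  perturbation reveals itself by moving fast in time. The scaling converts a time shift into
  multiplication of the datum by a scalar, which is harmless in H^s. The fast motion has to occur
  near the final time, but a frequency profile can be prescribed only where the datum is chosen;
  hence the reversal. It forces the perturbed solutions to be followed over the whole interval
  although their norms in H^{s+1} and H^{s+2} are unbounded in n: life span and H^s bound may depend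
  on the data through H^s norm and L2 distance only, and the stability constant may see higher norms
  of the unperturbed solution alone. That solution gets two extra derivatives since each comparison
  of two times costs one. Velocities are bounded by weighted L1 norms of transforms, so that Riesz
  transforms require no singular integrals; the solution map, defined by a choice, is identified
  through uniqueness in L2.\<close>

lemmas LINT_cong = Bochner_Integration.integral_cong
lemmas integrable_dominated = Bochner_Integration.integrable_bound
lemmas LINT_add = Bochner_Integration.integral_add
lemmas LINT_diff = Bochner_Integration.integral_diff

section \<open>Square-integrable functions: norm, pairing and completeness\<close>

type_synonym cfun = "plane \<Rightarrow> complex"

abbreviation sqi :: "cfun \<Rightarrow> bool" where "sqi \<equiv> square_integrable"

text \<open>Informative only together with \<open>sqi\<close>: when
  \<open>(cmod (f x))\<^sup>2\<close> is not integrable, the Bochner integral and hence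
  \<open>l2norm f\<close> are 0.\<close>

definition l2norm :: "cfun \<Rightarrow> real" where
  "l2norm f = sqrt (LINT x|lborel. (cmod (f x))\<^sup>2)"

abbreviation l2dist :: "cfun \<Rightarrow> cfun \<Rightarrow> real" where
  "l2dist f g \<equiv> l2norm (\<lambda>x. f x - g x)"

lemma borel_measurable_cnj [measurable (raw)]:
  "f \<in> borel_measurable M \<Longrightarrow> (\<lambda>x. cnj (f x)) \<in> borel_measurable M"
  by (rule measurable_compose[of f M borel cnj])
    (auto intro!: borel_measurable_continuous_onI continuous_intros)

lemma l2norm_nonneg [simp]: "0 \<le> l2norm f" by (simp add: l2norm_def)

lemma l2norm_square: "(l2norm f)\<^sup>2 = (LINT x|lborel. (cmod (f x))\<^sup>2)" by (simp add: l2norm_def)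

lemma sqi_measurable [measurable_dest]: "sqi f \<Longrightarrow> f \<in> borel_measurable borel" by (simp add: square_integrable_def)

lemma sqi_integrable: "sqi f \<Longrightarrow> integrable lborel (\<lambda>x. (cmod (f x))\<^sup>2)" by (simp add: square_integrable_def)

lemma sqi_dominated:
  assumes "sqi g" and [measurable]: "f \<in> borel_measurable borel" and le: "\<And>x. cmod (f x) \<le> C * cmod (g x)"
  shows "sqi f"
proof -
  have "integrable lborel (\<lambda>x. (cmod (f x))\<^sup>2)"
  proof (rule integrable_dominated)
    show "integrable lborel (\<lambda>x. C\<^sup>2 * (cmod (g x))\<^sup>2)" using sqi_integrable[OF assms(1)] by simp
    show "AE x in lborel. norm ((cmod (f x))\<^sup>2) \<le> norm (C\<^sup>2 * (cmod (g x))\<^sup>2)"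
      using power_mono[OF le norm_ge_zero, where n=2] by (auto simp: power_mult_distrib)
  qed simp
  then show ?thesis by (simp add: square_integrable_def)
qed

lemma sqi_zero [simp, intro]: "sqi (\<lambda>x. 0)" by (simp add: square_integrable_def)

lemma sqi_add [intro]:
  assumes f: "sqi f" and g: "sqi g" shows "sqi (\<lambda>x. f x + g x)"
proof -
  note [measurable] = sqi_measurable[OF f] sqi_measurable[OF g]
  have "integrable lborel (\<lambda>x. (cmod (f x + g x))\<^sup>2)"
  proof (rule integrable_dominated)
    show "integrable lborel (\<lambda>x. 2 * (cmod (f x))\<^sup>2 + 2 * (cmod (g x))\<^sup>2)"
      using sqi_integrable[OF f] sqi_integrable[OF g] by simp
    have "(cmod (f x + g x))\<^sup>2 \<le> 2 * (cmod (f x))\<^sup>2 + 2 * (cmod (g x))\<^sup>2" for x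
    proof -
      have "(cmod (f x + g x))\<^sup>2 \<le> (cmod (f x) + cmod (g x))\<^sup>2" by (intro power_mono norm_triangle_ineq) simp
      also have "\<dots> \<le> 2 * (cmod (f x))\<^sup>2 + 2 * (cmod (g x))\<^sup>2"
        using sum_squares_bound[of "cmod (f x)" "cmod (g x)"] by (simp add: power2_sum)
      finally show ?thesis .
    qed
    then show "AE x in lborel. norm ((cmod (f x + g x))\<^sup>2)
        \<le> norm (2 * (cmod (f x))\<^sup>2 + 2 * (cmod (g x))\<^sup>2)" by (auto intro!: AE_I2)
  qed simp
  then show ?thesis by (simp add: square_integrable_def)
qed

lemma sqi_mult_left [intro]: "sqi f \<Longrightarrow> sqi (\<lambda>x. c * f x)"
  by (rule sqi_dominated[of f _ "cmod c"]) (auto simp: norm_mult)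

lemma sqi_uminus [intro]: "sqi f \<Longrightarrow> sqi (\<lambda>x. - f x)" using sqi_mult_left[of f "-1"] by simp

lemma sqi_diff [intro]: "sqi f \<Longrightarrow> sqi g \<Longrightarrow> sqi (\<lambda>x. f x - g x)"
  using sqi_add[of f "\<lambda>x. - g x"] sqi_uminus[of g] by simp

lemma sqi_cnj [intro]: "sqi f \<Longrightarrow> sqi (\<lambda>x. cnj (f x))" by (rule sqi_dominated[of f _ 1]) auto

lemma sqi_sum [intro]: "(\<And>i. i \<in> A \<Longrightarrow> sqi (f i)) \<Longrightarrow> sqi (\<lambda>x. \<Sum>i\<in>A. f i x)"
  by (induction A rule: infinite_finite_induct) auto

lemma nn_integral_l2norm:
  assumes "sqi f" shows "(\<integral>\<^sup>+x. ennreal ((cmod (f x))\<^sup>2) \<partial>lborel) = ennreal ((l2norm f)\<^sup>2)"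
  using nn_integral_eq_integral[OF sqi_integrable[OF assms]] by (simp add: l2norm_square)

lemma sqi_nn_integralI:
  assumes [measurable]: "f \<in> borel_measurable borel"
    and le: "(\<integral>\<^sup>+x. ennreal ((cmod (f x))\<^sup>2) \<partial>lborel) \<le> ennreal (C\<^sup>2)" and "0 \<le> C"
  shows "sqi f" "l2norm f \<le> C"
proof -
  have "integrable lborel (\<lambda>x. (cmod (f x))\<^sup>2)" using le by (auto simp: integrable_iff_bounded intro: le_less_trans)
  then show f: "sqi f" by (simp add: square_integrable_def)
  have "(l2norm f)\<^sup>2 \<le> C\<^sup>2" using le by (simp add: nn_integral_l2norm[OF f])
  then show "l2norm f \<le> C" using \<open>0 \<le> C\<close> by (rule power2_le_imp_le)
qed

lemma sqi_mult_integrable: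
  assumes f: "sqi f" and g: "sqi g" shows "integrable lborel (\<lambda>x. f x * g x)"
proof (rule integrable_dominated)
  show "integrable lborel (\<lambda>x. (cmod (f x))\<^sup>2 + (cmod (g x))\<^sup>2)"
    using sqi_integrable[OF f] sqi_integrable[OF g] by simp
  have "cmod (f x * g x) \<le> (cmod (f x))\<^sup>2 + (cmod (g x))\<^sup>2" for x using sum_squares_bound[of "cmod (f x)" "cmod (g x)"]
      mult_nonneg_nonneg[OF norm_ge_zero[of "f x"] norm_ge_zero[of "g x"]] unfolding norm_mult by linarith
  then show "AE x in lborel. norm (f x * g x) \<le> norm ((cmod (f x))\<^sup>2 + (cmod (g x))\<^sup>2)" by auto
  show "(\<lambda>x. f x * g x) \<in> borel_measurable lborel" using sqi_measurable[OF f] sqi_measurable[OF g] by simp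
qed

lemma l2norm_Cauchy_Schwarz:
  assumes f: "sqi f" and g: "sqi g"
  shows "(LINT x|lborel. cmod (f x) * cmod (g x)) \<le> l2norm f * l2norm g"
proof -
  note [measurable] = sqi_measurable[OF f] sqi_measurable[OF g]
  have int: "integrable lborel (\<lambda>x. cmod (f x) * cmod (g x))"
    using integrable_norm[OF sqi_mult_integrable[OF f g]] by (simp add: norm_mult)
  have "(\<integral>\<^sup>+x. ennreal (cmod (f x)) * ennreal (cmod (g x)) \<partial>lborel)\<^sup>2 \<le>
     (\<integral>\<^sup>+x. (ennreal (cmod (f x)))\<^sup>2 \<partial>lborel) * (\<integral>\<^sup>+x. (ennreal (cmod (g x)))\<^sup>2 \<partial>lborel)"
    by (rule Cauchy_Schwarz_nn_integral) auto
  also have "\<dots> = ennreal ((l2norm f * l2norm g)\<^sup>2)"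
    by (simp add: ennreal_power nn_integral_l2norm f g ennreal_mult power_mult_distrib)
  also have "(\<integral>\<^sup>+x. ennreal (cmod (f x)) * ennreal (cmod (g x)) \<partial>lborel)
      = ennreal (LINT x|lborel. cmod (f x) * cmod (g x))" using nn_integral_eq_integral[OF int] by (simp add: ennreal_mult)
  finally have "(LINT x|lborel. cmod (f x) * cmod (g x))\<^sup>2 \<le> (l2norm f * l2norm g)\<^sup>2" by (simp add: ennreal_power)
  then show ?thesis by (rule power2_le_imp_le) simp
qed

lemma l2norm_Cauchy_Schwarz_complex:
  assumes f: "sqi f" and g: "sqi g"
  shows "cmod (LINT x|lborel. f x * g x) \<le> l2norm f * l2norm g"
proof -
  have "cmod (LINT x|lborel. f x * g x) \<le> (LINT x|lborel. cmod (f x * g x))" by (rule integral_norm_bound)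
  then show ?thesis using l2norm_Cauchy_Schwarz[OF f g] by (simp add: norm_mult)
qed

lemma l2norm_cnj [simp]: "l2norm (\<lambda>x. cnj (f x)) = l2norm f" by (simp add: l2norm_def)

lemma l2norm_mult_left [simp]: "l2norm (\<lambda>x. c * f x) = cmod c * l2norm f"
  by (simp add: l2norm_def norm_mult power_mult_distrib real_sqrt_mult)

lemma l2norm_uminus [simp]: "l2norm (\<lambda>x. - f x) = l2norm f" by (simp add: l2norm_def)

lemma l2norm_zero [simp]: "l2norm (\<lambda>x. 0) = 0" by (simp add: l2norm_def)

lemma l2norm_minus_commute: "l2dist f g = l2dist g f" by (simp add: l2norm_def norm_minus_commute)

lemma l2norm_mono_AE:
  assumes "AE x in lborel. cmod (f x) \<le> C * cmod (g x)" "sqi f" "sqi g" "0 \<le> C"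
  shows "l2norm f \<le> C * l2norm g"
proof -
  have "(LINT x|lborel. (cmod (f x))\<^sup>2) \<le> (LINT x|lborel. C\<^sup>2 * (cmod (g x))\<^sup>2)"
  proof (intro integral_mono_AE)
    show "AE x in lborel. (cmod (f x))\<^sup>2 \<le> C\<^sup>2 * (cmod (g x))\<^sup>2"
      using assms(1) by eventually_elim (auto simp: power_mult_distrib[symmetric] intro: power_mono)
  qed (use assms in \<open>simp_all add: sqi_integrable\<close>)
  then have "(l2norm f)\<^sup>2 \<le> (C * l2norm g)\<^sup>2" by (simp add: l2norm_square power_mult_distrib)
  then show ?thesis by (rule power2_le_imp_le) (simp add: assms(4))
qed

lemma l2norm_cong_AE:
  assumes "AE x in lborel. f x = g x" "f \<in> borel_measurable borel" "g \<in> borel_measurable borel"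
  shows "l2norm f = l2norm g" unfolding l2norm_def using assms by (intro arg_cong[where f=sqrt] integral_cong_AE) auto

lemma sqi_cong_AE:
  assumes "AE x in lborel. f x = g x" "sqi f" "g \<in> borel_measurable borel"
  shows "sqi g"
proof -
  have "integrable lborel (\<lambda>x. (cmod (g x))\<^sup>2)"
    by (rule integrable_cong_AE_imp[OF sqi_integrable[OF assms(2)]]) (use assms in auto)
  then show ?thesis using assms by (simp add: square_integrable_def)
qed

lemma l2norm_eq_0_AE:
  assumes "sqi f" "l2norm f = 0" shows "AE x in lborel. f x = 0"
  using assms integral_nonneg_eq_0_iff_AE[OF sqi_integrable[OF assms(1)]] by (simp add: l2norm_def)

lemma l2norm_add_square:
  assumes f: "sqi f" and g: "sqi g"
  shows "(l2norm (\<lambda>x. f x + g x))\<^sup>2 =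
    (l2norm f)\<^sup>2 + 2 * Re (LINT x|lborel. f x * cnj (g x)) + (l2norm g)\<^sup>2"
proof -
  have *: "integrable lborel (\<lambda>x. f x * cnj (g x))" using f g by (auto intro: sqi_mult_integrable)
  have "(l2norm (\<lambda>x. f x + g x))\<^sup>2
      = (LINT x|lborel. (cmod (f x))\<^sup>2 + 2 * Re (f x * cnj (g x)) + (cmod (g x))\<^sup>2)" unfolding l2norm_square
    by (intro LINT_cong)
      (auto simp: cmod_power2 power2_sum algebra_simps)
  also have "\<dots> = (l2norm f)\<^sup>2 + (LINT x|lborel. 2 * Re (f x * cnj (g x))) + (l2norm g)\<^sup>2"
    using integrable_Re[OF *] sqi_integrable[OF f] sqi_integrable[OF g] by (simp add: l2norm_square del: times_complex.sel)
  also have "(LINT x|lborel. 2 * Re (f x * cnj (g x))) = 2 * Re (LINT x|lborel. f x * cnj (g x))"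
    using integral_Re[OF *] by (simp del: times_complex.sel)
  finally show ?thesis .
qed

lemma l2norm_triangle:
  assumes f: "sqi f" and g: "sqi g"
  shows "l2norm (\<lambda>x. f x + g x) \<le> l2norm f + l2norm g"
proof -
  have "Re (LINT x|lborel. f x * cnj (g x)) \<le> l2norm f * l2norm g"
    using l2norm_Cauchy_Schwarz_complex[OF f sqi_cnj[OF g]] complex_Re_le_cmod order_trans by fastforce
  then have "(l2norm (\<lambda>x. f x + g x))\<^sup>2 \<le> (l2norm f + l2norm g)\<^sup>2"
    unfolding l2norm_add_square[OF f g] by (simp add: power2_sum)
  then show ?thesis by (rule power2_le_imp_le) simp
qed

lemma l2norm_triangle_diff:
  assumes "sqi f" "sqi g" shows "l2dist f g \<le> l2norm f + l2norm g" using l2norm_triangle[of f "\<lambda>x. - g x"] assms by auto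

lemma l2norm_triangle_via:
  assumes "sqi f" "sqi g" "sqi h"
  shows "l2dist f h \<le> l2dist f g + l2dist g h" using l2norm_triangle[of "\<lambda>x. f x - g x" "\<lambda>x. g x - h x"] assms by auto

lemma l2norm_sum_le:
  assumes "\<And>i. i \<in> A \<Longrightarrow> sqi (f i)"
  shows "l2norm (\<lambda>x. \<Sum>i\<in>A. f i x) \<le> (\<Sum>i\<in>A. l2norm (f i))" using assms
proof (induction A rule: infinite_finite_induct)
  case (insert i A)
  then show ?case using l2norm_triangle[of "f i" "\<lambda>x. \<Sum>i\<in>A. f i x"] by (auto simp: sqi_sum intro: order_trans)
qed auto

text \<open>Riesz-Fischer for a fast sequence: the partial sums of the absolute increments are
  bounded by 2 in L2, hence bounded almost everywhere by monotone convergence, which gives a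
  pointwise limit. Fatou's lemma then turns the geometric tail bound into convergence in
  norm.\<close>

lemma sqi_fast_Cauchy_limit:
  assumes f: "\<And>n. sqi (f n)" and C: "\<And>n. l2dist (f (Suc n)) (f n) \<le> (1/2)^n"
  shows "\<exists>g. sqi g \<and> (\<lambda>n. l2dist (f n) g) \<longlonglongrightarrow> 0"
proof -
  note [measurable] = sqi_measurable[OF f]
  define d where "d n x = f (Suc n) x - f n x" for n x
  have d: "sqi (d n)" for n unfolding d_def using f by auto
  note [measurable] = sqi_measurable[OF d]
  define S where "S n x = (\<Sum>i<n. cmod (d i x))" for n x
  have [measurable]: "S n \<in> borel_measurable borel" for n unfolding S_def by measurable
  have "l2norm (\<lambda>x. of_real (S n x)) \<le> 2" for n
  proof -
    have sq: "sqi (\<lambda>x. of_real (cmod (d i x)))" for i by (rule sqi_dominated[OF d[of i], of _ 1]) auto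
    have "l2norm (\<lambda>x. of_real (S n x)) = l2norm (\<lambda>x. \<Sum>i<n. of_real (cmod (d i x)))" by (simp add: S_def)
    also have "\<dots> \<le> (\<Sum>i<n. l2norm (\<lambda>x. of_real (cmod (d i x))))" by (rule l2norm_sum_le) (rule sq)
    also have "\<dots> \<le> (\<Sum>i<n. (1/2)^i)" using C by (intro sum_mono) (simp add: l2norm_def d_def)
    also have "\<dots> \<le> 2" by (subst geometric_sum) (auto simp: field_simps)
    finally show ?thesis .
  qed
  moreover have sqS: "sqi (\<lambda>x. of_real (S n x))" for n
  proof -
    have "sqi (\<lambda>x. \<Sum>i<n. of_real (cmod (d i x)))" by (rule sqi_sum, rule sqi_dominated[OF d, of _ 1]) auto
    then show ?thesis by (simp add: S_def)
  qed
  ultimately have bound: "(\<integral>\<^sup>+x. ennreal ((S n x)\<^sup>2) \<partial>lborel) \<le> ennreal 4" for n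
  proof -
    have "(l2norm (\<lambda>x. of_real (S n x)))\<^sup>2 \<le> 2\<^sup>2"
      using \<open>\<And>n. l2norm (\<lambda>x. of_real (S n x)) \<le> 2\<close> by (intro power_mono) auto
    then show ?thesis using nn_integral_l2norm[OF sqS[of n]] ennreal_leI[of _ 4] by simp
  qed
  have S0: "0 \<le> S n x" for n x by (simp add: S_def sum_nonneg)
  have Smono: "S n x \<le> S m x" if "n \<le> m" for n m x unfolding S_def using that by (intro sum_mono2) auto
  have fin: "(\<integral>\<^sup>+x. (SUP n. ennreal ((S n x)\<^sup>2)) \<partial>lborel) \<le> ennreal 4"
  proof -
    have "(\<integral>\<^sup>+x. (SUP n. ennreal ((S n x)\<^sup>2)) \<partial>lborel) = (SUP n. \<integral>\<^sup>+x. ennreal ((S n x)\<^sup>2) \<partial>lborel)"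
      using Smono S0 by (intro nn_integral_monotone_convergence_SUP)
        (auto simp: incseq_def le_fun_def intro!: ennreal_leI power_mono)
    also have "\<dots> \<le> ennreal 4" by (rule SUP_least) (rule bound)
    finally show ?thesis .
  qed
  have "AE x in lborel. (SUP n. ennreal ((S n x)\<^sup>2)) \<noteq> \<infinity>"
    using fin by (intro nn_integral_PInf_AE) (auto simp: top_unique)
  then have conv: "AE x in lborel. convergent (\<lambda>n. f n x)"
  proof eventually_elim
    case (elim x)
    then obtain r where r: "0 \<le> r" "(SUP n. ennreal ((S n x)\<^sup>2)) = ennreal r"
      by (cases "(SUP n. ennreal ((S n x)\<^sup>2))") auto
    have "S n x \<le> sqrt r" for n
    proof -
      have "ennreal ((S n x)\<^sup>2) \<le> ennreal r" unfolding r(2)[symmetric] by (rule SUP_upper) simp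
      then show ?thesis using r(1) by (simp add: real_le_rsqrt)
    qed
    then have "summable (\<lambda>i. cmod (d i x))" by (intro summableI_nonneg_bounded[of _ "sqrt r"]) (simp_all add: S_def)
    then have "summable (\<lambda>i. d i x)" by (rule summable_norm_cancel)
    then have "convergent (\<lambda>n. f 0 x + (\<Sum>i<n. d i x))"
      by (intro convergent_add convergent_const) (simp add: summable_iff_convergent)
    moreover have "f 0 x + (\<Sum>i<n. d i x) = f n x" for n using sum_lessThan_telescope[of "\<lambda>n. f n x" n] by (simp add: d_def)
    ultimately show ?case by simp
  qed
  \<comment> \<open>Off the convergence set \<open>lim\<close> takes an unspecified value; the
    exceptional set is null, so only measurability of \<open>g\<close> matters there.\<close>
  define g where "g x = lim (\<lambda>n. f n x)" for x
  have [measurable]: "g \<in> borel_measurable borel" unfolding g_def by measurable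
  have tail: "l2dist (f m) (f n) \<le> 2 * (1/2)^n" if "n \<le> m" for n m
  proof -
    have "l2dist (f m) (f n) = l2norm (\<lambda>x. \<Sum>i=n..<m. d i x)"
      using that sum_Suc_diff'[of n m "\<lambda>i. f i _"] by (simp add: d_def)
    also have "\<dots> \<le> (\<Sum>i=n..<m. l2norm (d i))" by (rule l2norm_sum_le) (rule d)
    also have "\<dots> \<le> (\<Sum>i=n..<m. (1/2)^i)" using C by (intro sum_mono) (simp add: d_def[abs_def])
    also have "\<dots> = (\<Sum>i<m-n. (1/2)^n * (1/2)^i)" by (rule sum.reindex_bij_witness[of _ "\<lambda>i. i + n" "\<lambda>i. i - n"])
        (auto simp: power_add[symmetric])
    also have "\<dots> = (1/2)^n * (\<Sum>i<m-n. (1/2)^i)" by (simp add: sum_distrib_left)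
    also have "\<dots> \<le> (1/2)^n * 2" by (intro mult_left_mono, subst geometric_sum) (auto simp: field_simps)
    finally show ?thesis by simp
  qed
  have lim: "sqi (\<lambda>x. g x - f n x) \<and> l2dist g (f n) \<le> 2 * (1/2)^n" for n
  proof -
    have "(\<integral>\<^sup>+x. ennreal ((cmod (g x - f n x))\<^sup>2) \<partial>lborel)
       = (\<integral>\<^sup>+x. liminf (\<lambda>m. ennreal ((cmod (f m x - f n x))\<^sup>2)) \<partial>lborel)"
    proof (rule nn_integral_cong_AE, use conv in eventually_elim)
      case (elim x)
      then have "(\<lambda>m. f m x) \<longlonglongrightarrow> g x" by (simp add: g_def convergent_LIMSEQ_iff)
      then have "(\<lambda>m. ennreal ((cmod (f m x - f n x))\<^sup>2)) \<longlonglongrightarrow> ennreal ((cmod (g x - f n x))\<^sup>2)"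
        by (intro tendsto_intros)
      then show ?case by (intro lim_imp_Liminf[symmetric]) auto
    qed
    also have "\<dots> \<le> liminf (\<lambda>m. \<integral>\<^sup>+x. ennreal ((cmod (f m x - f n x))\<^sup>2) \<partial>lborel)"
      by (rule nn_integral_liminf) auto
    also have "\<dots> \<le> ennreal ((2 * (1/2)^n)\<^sup>2)"
    proof (rule Liminf_le)
      show "\<forall>\<^sub>F m in sequentially. (\<integral>\<^sup>+x. ennreal ((cmod (f m x - f n x))\<^sup>2) \<partial>lborel) \<le> ennreal ((2 * (1/2)^n)\<^sup>2)"
        using eventually_ge_at_top[of n]
      proof eventually_elim
        case (elim m)
        have "(\<integral>\<^sup>+x. ennreal ((cmod (f m x - f n x))\<^sup>2) \<partial>lborel) = ennreal ((l2dist (f m) (f n))\<^sup>2)"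
          using f by (intro nn_integral_l2norm) auto
        then show ?case using tail[OF elim] by (simp only: ennreal_leI power_mono l2norm_nonneg)
      qed
    qed simp
    finally show ?thesis using sqi_nn_integralI[of "\<lambda>x. g x - f n x" "2 * (1/2)^n"] by auto
  qed
  have "sqi (\<lambda>x. (g x - f 0 x) + f 0 x)" using lim[of 0] f[of 0] by (intro sqi_add) auto
  then have "sqi g" by simp
  moreover have "(\<lambda>n. l2dist (f n) g) \<longlonglongrightarrow> 0"
  proof (rule Lim_null_comparison)
    show "\<forall>\<^sub>F n in sequentially. norm (l2dist (f n) g) \<le> 2 * (1/2)^n"
      using lim by (simp add: l2norm_minus_commute[of "f _"])
    show "(\<lambda>n. 2 * (1/2::real)^n) \<longlonglongrightarrow> 0" by (intro tendsto_mult_right_zero LIMSEQ_power_zero) simp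
  qed
  ultimately show ?thesis by blast
qed

lemma sqi_complete:
  assumes f: "\<And>n. sqi (f n)"
    and Cauchy: "\<And>e. 0 < e \<Longrightarrow> \<exists>N. \<forall>m\<ge>N. \<forall>n\<ge>N. l2dist (f m) (f n) < e"
  shows "\<exists>g. sqi g \<and> (\<lambda>n. l2dist (f n) g) \<longlonglongrightarrow> 0"
proof -
  have "\<exists>N. \<forall>m\<ge>N. \<forall>n\<ge>N. l2dist (f m) (f n) < (1/2)^k" for k :: nat by (rule Cauchy) simp
  then obtain N where N: "\<And>k m n. N k \<le> m \<Longrightarrow> N k \<le> n \<Longrightarrow> l2dist (f m) (f n) < (1/2)^k" by metis
  \<comment> \<open>Partial sums make \<open>r\<close> increasing with \<open>N k \<le> r k\<close>,
    so the thresholds need not be chosen recursively.\<close>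
  define r where "r k = (\<Sum>i\<le>k. N i)" for k
  have rN: "N k \<le> r k" for k unfolding r_def by (rule member_le_sum) auto
  have r_Suc: "r k \<le> r (Suc k)" for k by (simp add: r_def)
  have "l2dist (f (r (Suc k))) (f (r k)) \<le> (1/2)^k" for k by (rule less_imp_le, rule N) (use rN[of k] r_Suc[of k] in linarith)+
  then obtain g where g: "sqi g" "(\<lambda>n. l2dist (f (r n)) g) \<longlonglongrightarrow> 0"
    using sqi_fast_Cauchy_limit[of "\<lambda>k. f (r k)"] f by blast
  have "(\<lambda>n. l2dist (f n) g) \<longlonglongrightarrow> 0"
  proof (rule LIMSEQ_I)
    fix e :: real assume "0 < e"
    then obtain M where M: "\<And>m n. M \<le> m \<Longrightarrow> M \<le> n \<Longrightarrow> l2dist (f m) (f n) < e/2"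
      using Cauchy[of "e/2"] by auto
    obtain k1 where k1: "\<And>k. k1 \<le> k \<Longrightarrow> l2dist (f (r k)) g < e/2"
      using LIMSEQ_D[OF g(2), of "e/2"] \<open>0 < e\<close> by auto
    obtain k2 :: nat where k2: "(1/2)^k2 < e/2" using real_arch_pow_inv[of "e/2" "1/2"] \<open>0 < e\<close> by auto
    define k where "k = max k1 k2"
    have "l2dist (f n) g < e" if n: "N k \<le> n" for n
    proof -
      have "l2dist (f n) g \<le> l2dist (f n) (f (r k)) + l2dist (f (r k)) g" by (rule l2norm_triangle_via) (use f g in auto)
      also have "l2dist (f n) (f (r k)) < (1/2)^k" using N[OF n rN] .
      also have "(1/2::real)^k \<le> (1/2)^k2" unfolding k_def by (intro power_decreasing) auto
      finally show ?thesis using k1[of k] k2 by (simp add: k_def)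
    qed
    then show "\<exists>no. \<forall>n\<ge>no. norm (l2dist (f n) g - 0) < e" by auto
  qed
  with g show ?thesis by blast
qed

section \<open>Translations and convolutions\<close>

lemma nn_integral_affine_plane:
  fixes c :: real and t :: plane
  assumes [measurable]: "f \<in> borel_measurable borel" and c: "c \<noteq> 0"
  shows "(\<integral>\<^sup>+x. f x \<partial>lborel) = ennreal (c\<^sup>2) * (\<integral>\<^sup>+x. f (t + c *\<^sub>R x) \<partial>lborel)"
  by (subst lborel_affine[OF c, of t])
    (simp add: nn_integral_density nn_integral_distr nn_integral_cmult power2_eq_square)

lemma integrable_affine_plane:
  fixes f :: "plane \<Rightarrow> 'a :: {banach, second_countable_topology}"
  assumes f: "integrable lborel f" and c: "c \<noteq> 0"
  shows "integrable lborel (\<lambda>x. f (t + c *\<^sub>R x))"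
  using f f[THEN borel_measurable_integrable] c unfolding integrable_iff_bounded
  by (subst (asm) nn_integral_affine_plane[where c=c and t=t]) (auto simp: ennreal_mult_less_top)

lemma integral_affine_plane:
  fixes f :: "plane \<Rightarrow> 'a :: {banach, second_countable_topology}"
  assumes [measurable]: "f \<in> borel_measurable borel" and c: "c \<noteq> 0"
  shows "(LINT x|lborel. f x) = c\<^sup>2 *\<^sub>R (LINT x|lborel. f (t + c *\<^sub>R x))" by (subst lborel_affine[OF c, of t])
    (simp add: integral_density integral_distr power2_eq_square)

lemma nn_integral_reflect_plane:
  fixes t :: plane assumes "f \<in> borel_measurable borel"
  shows "(\<integral>\<^sup>+x. f (t - x) \<partial>lborel) = (\<integral>\<^sup>+x. f x \<partial>lborel)"
  using nn_integral_affine_plane[OF assms, of "-1" t] by simp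

lemma nn_integral_translate_plane:
  fixes t :: plane assumes "f \<in> borel_measurable borel"
  shows "(\<integral>\<^sup>+x. f (x - t) \<partial>lborel) = (\<integral>\<^sup>+x. f x \<partial>lborel)"
  using nn_integral_affine_plane[OF assms, of 1 "-t"] by (simp add: add.commute[of "-t"])

lemma integral_reflect_plane:
  fixes f :: "plane \<Rightarrow> 'a :: {banach, second_countable_topology}"
  assumes "f \<in> borel_measurable borel"
  shows "(LINT x|lborel. f (t - x)) = (LINT x|lborel. f x)" using integral_affine_plane[OF assms, of "-1" t] by simp

lemma integral_translate_plane:
  fixes f :: "plane \<Rightarrow> 'a :: {banach, second_countable_topology}"
  assumes "f \<in> borel_measurable borel"
  shows "(LINT x|lborel. f (x - t)) = (LINT x|lborel. f x)"
  using integral_affine_plane[OF assms, of 1 "-t"] by (simp add: add.commute[of "-t"])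

lemma integrable_reflect_plane:
  fixes f :: "plane \<Rightarrow> 'a :: {banach, second_countable_topology}"
  assumes "integrable lborel f" shows "integrable lborel (\<lambda>x. f (t - x))"
  using integrable_affine_plane[OF assms, of "-1" t] by simp

lemma integrable_translate_plane:
  fixes f :: "plane \<Rightarrow> 'a :: {banach, second_countable_topology}"
  assumes "integrable lborel f" shows "integrable lborel (\<lambda>x. f (x - t))"
  using integrable_affine_plane[OF assms, of 1 "-t"] by (simp add: add.commute[of "-t"])

lemma sqi_reflect: "sqi f \<Longrightarrow> sqi (\<lambda>x. f (t - x))"
  using integrable_reflect_plane[of "\<lambda>x. (cmod (f x))\<^sup>2" t] by (auto simp: square_integrable_def)

lemma sqi_translate: "sqi f \<Longrightarrow> sqi (\<lambda>x. f (x - t))"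
  using integrable_translate_plane[of "\<lambda>x. (cmod (f x))\<^sup>2" t] by (auto simp: square_integrable_def)

lemma l2norm_reflect: "sqi f \<Longrightarrow> l2norm (\<lambda>x. f (t - x)) = l2norm f"
  unfolding l2norm_def by (subst integral_reflect_plane) auto

lemma l2norm_translate: "sqi f \<Longrightarrow> l2norm (\<lambda>x. f (x - t)) = l2norm f"
  unfolding l2norm_def by (subst integral_translate_plane) auto

lemma AE_reflect_plane:
  fixes t :: plane
  assumes "AE x in lborel. P x" shows "AE x in lborel. P (t - x)"
proof -
  obtain N where N: "N \<in> null_sets lborel" "{x. \<not> P x} \<subseteq> N" using assms by (auto simp: eventually_ae_filter)
  have [measurable]: "N \<in> sets borel" using N by auto
  have "(\<lambda>x. t - x) -` N \<in> sets borel" using measurable_sets_borel[of "\<lambda>x. t - x" borel N] by auto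
  moreover have "emeasure lborel ((\<lambda>x. t - x) -` N) = 0"
  proof -
    have "emeasure lborel ((\<lambda>x. t - x) -` N) = (\<integral>\<^sup>+x. indicator ((\<lambda>x. t - x) -` N) x \<partial>lborel)"
      using calculation by simp
    also have "\<dots> = (\<integral>\<^sup>+x. indicator N (t - x) \<partial>lborel)"
      by (intro nn_integral_cong) (auto simp: indicator_def)
    also have "\<dots> = (\<integral>\<^sup>+x. indicator N x \<partial>lborel)" by (rule nn_integral_reflect_plane) simp
    finally show ?thesis using N by auto
  qed
  ultimately have "(\<lambda>x. t - x) -` N \<in> null_sets lborel" by auto
  then show ?thesis by (rule AE_I') (use N in auto)
qed

lemma integrable_pair_mult:
  fixes f g :: "cfun"
  assumes f: "integrable lborel f" and g: "integrable lborel g"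
  shows "integrable (lborel \<Otimes>\<^sub>M lborel) (\<lambda>(x, y). f x * g y)"
proof (rule lborel_pair.Fubini_integrable)
  note [measurable] = borel_measurable_integrable[OF f] borel_measurable_integrable[OF g]
  show "(\<lambda>(x, y). f x * g y) \<in> borel_measurable (lborel \<Otimes>\<^sub>M lborel)" by simp
  show "integrable lborel (\<lambda>x. LINT y|lborel. norm (case (x, y) of (x, y) \<Rightarrow> f x * g y))"
    using f by (simp add: norm_mult)
  show "AE x in lborel. integrable lborel (\<lambda>y. case (x, y) of (x, y) \<Rightarrow> f x * g y)" using g by simp
qed

text \<open>Young's inequality for $L^1 * L^2$: the inner integral is split as
  $\sqrt{k} \cdot \sqrt{k}\, f$ before Cauchy--Schwarz.\<close>

lemma Young_nn_integral:
  fixes k f :: "plane \<Rightarrow> ennreal"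
  assumes [measurable]: "k \<in> borel_measurable borel" "f \<in> borel_measurable borel"
  shows "(\<integral>\<^sup>+x. (\<integral>\<^sup>+y. k (x - y) * f y \<partial>lborel)\<^sup>2 \<partial>lborel)
    \<le> (\<integral>\<^sup>+x. k x \<partial>lborel)\<^sup>2 * (\<integral>\<^sup>+x. (f x)\<^sup>2 \<partial>lborel)"
proof -
  define K where "K = (\<integral>\<^sup>+x. k x \<partial>lborel)"
  define r where "r z = (if k z = \<infinity> then \<infinity> else ennreal (sqrt (enn2real (k z))))" for z
  have [measurable]: "r \<in> borel_measurable borel" unfolding r_def by measurable
  have r: "r z * r z = k z" for z by (cases "k z") (auto simp: r_def ennreal_mult[symmetric])
  have "(\<integral>\<^sup>+y. k (x - y) * f y \<partial>lborel)\<^sup>2 \<le> K * (\<integral>\<^sup>+y. k (x - y) * (f y)\<^sup>2 \<partial>lborel)" for x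
  proof -
    have "(\<integral>\<^sup>+y. k (x - y) * f y \<partial>lborel)\<^sup>2 = (\<integral>\<^sup>+y. r (x - y) * (r (x - y) * f y) \<partial>lborel)\<^sup>2"
      by (simp add: r[symmetric] mult.assoc)
    also have "\<dots> \<le> (\<integral>\<^sup>+y. (r (x - y))\<^sup>2 \<partial>lborel) * (\<integral>\<^sup>+y. (r (x - y) * f y)\<^sup>2 \<partial>lborel)"
      by (rule Cauchy_Schwarz_nn_integral) auto
    also have "(\<integral>\<^sup>+y. (r (x - y))\<^sup>2 \<partial>lborel) = K"
      using nn_integral_reflect_plane[of k x] by (simp add: power2_eq_square r K_def)
    also have "(\<integral>\<^sup>+y. (r (x - y) * f y)\<^sup>2 \<partial>lborel) = (\<integral>\<^sup>+y. k (x - y) * (f y)\<^sup>2 \<partial>lborel)"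
      by (simp add: power_mult_distrib) (simp add: power2_eq_square r)
    finally show ?thesis .
  qed
  then have "(\<integral>\<^sup>+x. (\<integral>\<^sup>+y. k (x - y) * f y \<partial>lborel)\<^sup>2 \<partial>lborel)
      \<le> (\<integral>\<^sup>+x. K * (\<integral>\<^sup>+y. k (x - y) * (f y)\<^sup>2 \<partial>lborel) \<partial>lborel)"
    by (rule nn_integral_mono)
  also have "\<dots> = K * (\<integral>\<^sup>+x. (\<integral>\<^sup>+y. k (x - y) * (f y)\<^sup>2 \<partial>lborel) \<partial>lborel)"
    by (rule nn_integral_cmult) simp
  also have "(\<integral>\<^sup>+x. (\<integral>\<^sup>+y. k (x - y) * (f y)\<^sup>2 \<partial>lborel) \<partial>lborel)
      = (\<integral>\<^sup>+y. (\<integral>\<^sup>+x. k (x - y) * (f y)\<^sup>2 \<partial>lborel) \<partial>lborel)"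
    by (rule lborel_pair.Fubini') simp
  also have "\<dots> = (\<integral>\<^sup>+y. K * (f y)\<^sup>2 \<partial>lborel)"
  proof (rule nn_integral_cong)
    fix y
    have "(\<integral>\<^sup>+x. k (x - y) * (f y)\<^sup>2 \<partial>lborel) = (\<integral>\<^sup>+x. k (x - y) \<partial>lborel) * (f y)\<^sup>2"
      by (rule nn_integral_multc) simp
    then show "(\<integral>\<^sup>+x. k (x - y) * (f y)\<^sup>2 \<partial>lborel) = K * (f y)\<^sup>2"
      by (simp add: nn_integral_translate_plane K_def)
  qed
  also have "\<dots> = K * (\<integral>\<^sup>+x. (f x)\<^sup>2 \<partial>lborel)" by (rule nn_integral_cmult) simp
  finally show ?thesis by (simp add: K_def power2_eq_square mult.assoc)
qed

text \<open>Where the integrand is not integrable the value is 0; by Young's inequality this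
  concerns a null set only when one factor is in L1 and the other in L2.\<close>

definition conv :: "cfun \<Rightarrow> cfun \<Rightarrow> cfun" where
  "conv k f x = (LINT y|lborel. k (x - y) * f y)"

lemma borel_measurable_conv [measurable]:
  assumes [measurable]: "k \<in> borel_measurable borel" "f \<in> borel_measurable borel"
  shows "conv k f \<in> borel_measurable borel" unfolding conv_def by measurable

lemma Young_AE_integrable:
  assumes k: "integrable lborel k" and f: "sqi f"
  shows "AE x in lborel. integrable lborel (\<lambda>y. k (x - y) * f y :: complex)"
proof -
  have [measurable]: "k \<in> borel_measurable borel" "f \<in> borel_measurable borel" using k f by auto
  have "(\<integral>\<^sup>+x. (\<integral>\<^sup>+y. ennreal (cmod (k (x - y))) * ennreal (cmod (f y)) \<partial>lborel)\<^sup>2 \<partial>lborel)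
     \<le> (\<integral>\<^sup>+x. ennreal (cmod (k x)) \<partial>lborel)\<^sup>2 * (\<integral>\<^sup>+x. (ennreal (cmod (f x)))\<^sup>2 \<partial>lborel)"
    by (rule Young_nn_integral) auto
  also have "\<dots> < \<infinity>" using k nn_integral_l2norm[OF f]
    by (auto simp: integrable_iff_bounded ennreal_power power2_eq_square ennreal_mult_less_top
        ennreal_mult[symmetric])
  finally have "AE x in lborel. (\<integral>\<^sup>+y. ennreal (cmod (k (x - y))) * ennreal (cmod (f y)) \<partial>lborel)\<^sup>2 \<noteq> \<infinity>"
    by (intro nn_integral_PInf_AE) auto
  then show ?thesis
  proof eventually_elim
    case (elim x)
    then have "(\<integral>\<^sup>+y. ennreal (cmod (k (x - y))) * ennreal (cmod (f y)) \<partial>lborel) \<noteq> \<infinity>"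
      by (auto simp: power2_eq_square ennreal_mult_eq_top_iff)
    then show ?case by (auto simp: integrable_iff_bounded norm_mult ennreal_mult less_top)
  qed
qed

lemma
  assumes k: "integrable lborel k" and f: "sqi f"
  shows sqi_conv: "sqi (conv k f)" and l2norm_conv: "l2norm (conv k f) \<le> (LINT x|lborel. cmod (k x)) * l2norm f"
proof -
  have [measurable]: "k \<in> borel_measurable borel" "f \<in> borel_measurable borel" using k f by auto
  let ?C = "(LINT x|lborel. cmod (k x)) * l2norm f"
  have "(\<integral>\<^sup>+x. ennreal ((cmod (conv k f x))\<^sup>2) \<partial>lborel)
      \<le> (\<integral>\<^sup>+x. (\<integral>\<^sup>+y. ennreal (cmod (k (x - y))) * ennreal (cmod (f y)) \<partial>lborel)\<^sup>2 \<partial>lborel)"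
  proof (rule nn_integral_mono)
    fix x
    have "ennreal (cmod (conv k f x)) \<le> (\<integral>\<^sup>+y. ennreal (cmod (k (x - y))) * ennreal (cmod (f y)) \<partial>lborel)"
    proof (cases "integrable lborel (\<lambda>y. k (x - y) * f y)")
      case True
      from integral_norm_bound_ennreal[OF True] show ?thesis by (simp add: conv_def norm_mult ennreal_mult)
    qed (simp add: conv_def not_integrable_integral_eq)
    then have "(ennreal (cmod (conv k f x)))\<^sup>2
        \<le> (\<integral>\<^sup>+y. ennreal (cmod (k (x - y))) * ennreal (cmod (f y)) \<partial>lborel)\<^sup>2"
      by (rule power_mono) simp
    then show "ennreal ((cmod (conv k f x))\<^sup>2)
        \<le> (\<integral>\<^sup>+y. ennreal (cmod (k (x - y))) * ennreal (cmod (f y)) \<partial>lborel)\<^sup>2"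
      by (simp add: ennreal_power)
  qed
  also have "\<dots> \<le> (\<integral>\<^sup>+x. ennreal (cmod (k x)) \<partial>lborel)\<^sup>2 * (\<integral>\<^sup>+x. (ennreal (cmod (f x)))\<^sup>2 \<partial>lborel)"
    by (rule Young_nn_integral) auto
  also have "\<dots> = ennreal (?C\<^sup>2)" using nn_integral_eq_integral[OF integrable_norm[OF k]] nn_integral_l2norm[OF f]
    by (simp add: ennreal_power ennreal_mult[symmetric] power_mult_distrib)
  finally have "(\<integral>\<^sup>+x. ennreal ((cmod (conv k f x))\<^sup>2) \<partial>lborel) \<le> ennreal (?C\<^sup>2)" .
  moreover have "0 \<le> ?C" by simp
  ultimately show "sqi (conv k f)" "l2norm (conv k f) \<le> ?C" by (auto intro: sqi_nn_integralI)
qed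

lemma conv_commute:
  assumes [measurable]: "k \<in> borel_measurable borel" "f \<in> borel_measurable borel"
  shows "conv k f x = conv f k x" using integral_reflect_plane[of "\<lambda>y. k (x - y) * f y" x] by (simp add: conv_def mult.commute)

section \<open>The Fourier integral\<close>

text \<open>The complex-valued counterpart of \<open>fourier_integral\<close>: the transform has to
  be iterated and applied to complex kernels, while \<open>fourier_integral\<close> accepts real
  functions only.\<close>

definition FI :: "cfun \<Rightarrow> cfun" where
  "FI f z = (LINT x|lborel. f x * exp (- \<i> * of_real (x \<bullet> z))) / (2 * pi)"

lemma fourier_integral_FI: "fourier_integral f = FI (\<lambda>x. of_real (f x))" by (simp add: fun_eq_iff fourier_integral_def FI_def)

lemma borel_measurable_FI [measurable]:
  assumes [measurable]: "f \<in> borel_measurable borel"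
  shows "FI f \<in> borel_measurable borel" unfolding FI_def by measurable

lemma FI_integrable: "integrable lborel f \<Longrightarrow>
   integrable lborel (\<lambda>x. f x * exp (- \<i> * of_real (x \<bullet> z)))"
  by (rule integrable_dominated[of _ f]) (auto simp: norm_mult)

lemma FI_bound:
  assumes "integrable lborel f" shows "cmod (FI f z) \<le> (LINT x|lborel. cmod (f x)) / (2 * pi)"
proof -
  have "cmod (LINT x|lborel. f x * exp (- \<i> * of_real (x \<bullet> z)))
     \<le> (LINT x|lborel. cmod (f x * exp (- \<i> * of_real (x \<bullet> z))))" by (rule integral_norm_bound)
  then show ?thesis by (simp add: FI_def norm_divide norm_mult divide_right_mono)
qed

lemma FI_add: "integrable lborel f \<Longrightarrow> integrable lborel g \<Longrightarrow> FI (\<lambda>x. f x + g x) z = FI f z + FI g z"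
  using FI_integrable[of f z] FI_integrable[of g z] by (simp add: FI_def distrib_right add_divide_distrib)

lemma FI_mult_left: "FI (\<lambda>x. c * f x) z = c * FI f z" by (simp add: FI_def mult.assoc)

lemma FI_diff: "integrable lborel f \<Longrightarrow> integrable lborel g \<Longrightarrow> FI (\<lambda>x. f x - g x) z = FI f z - FI g z"
  using FI_integrable[of f z] FI_integrable[of g z] by (simp add: FI_def left_diff_distrib diff_divide_distrib)

text \<open>Fubini and the symmetry of the kernel in \<open>x\<close> and \<open>z\<close>. The
  route to Plancherel's theorem rests on this identity.\<close>

lemma FI_multiplication:
  assumes f: "integrable lborel f" and g: "integrable lborel g"
  shows "(LINT z|lborel. FI f z * g z) = (LINT x|lborel. f x * FI g x)"
proof -
  note [measurable] = borel_measurable_integrable[OF f] borel_measurable_integrable[OF g]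
  let ?e = "\<lambda>x z. exp (- \<i> * of_real (x \<bullet> z)) / (2 * of_real pi)"
  have int: "integrable (lborel \<Otimes>\<^sub>M lborel) (\<lambda>(x, z). f x * g z * ?e x z)"
  proof (rule integrable_dominated)
    show "integrable (lborel \<Otimes>\<^sub>M lborel) (\<lambda>p. (1/(2*pi)) *\<^sub>R (case p of (x, y) \<Rightarrow> f x * g y))"
      by (intro integrable_scaleR_right integrable_pair_mult f g)
    show "(\<lambda>(x, z). f x * g z * ?e x z) \<in> borel_measurable (lborel \<Otimes>\<^sub>M lborel)" by measurable
  qed (auto simp: norm_mult norm_divide)
  have "(LINT z|lborel. FI f z * g z) = (LINT z|lborel. LINT x|lborel. f x * g z * ?e x z)"
    unfolding FI_def by (intro LINT_cong refl)
      (simp add: algebra_simps integral_mult_right_zero[symmetric] integral_divide_zero[symmetric]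
        del: integral_mult_right_zero integral_mult_left_zero integral_divide_zero)
  also have "\<dots> = (LINT x|lborel. LINT z|lborel. f x * g z * ?e x z)" by (rule lborel_pair.Fubini_integral[OF int])
  also have "\<dots> = (LINT x|lborel. f x * FI g x)" unfolding FI_def by (intro LINT_cong refl)
      (simp add: algebra_simps inner_commute integral_mult_right_zero[symmetric] integral_divide_zero[symmetric]
        del: integral_mult_right_zero integral_mult_left_zero integral_divide_zero)
  finally show ?thesis .
qed

section \<open>Gaussians and Plancherel's theorem\<close>

text \<open>The characteristic function of the standard normal law, evaluated at \<open>-t\<close>
  and freed of its normalising constant.\<close>

lemma std_gauss_integral:
  fixes t :: real
  shows "integrable lborel (\<lambda>x. of_real (exp (- (x\<^sup>2 / 2))) * exp (- (\<i> * of_real (x * t))))"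
    and "(LINT x|lborel. of_real (exp (- (x\<^sup>2 / 2))) * exp (- (\<i> * of_real (x * t))))
      = of_real (sqrt (2 * pi) * exp (- (t\<^sup>2 / 2)))"
proof -
  have int: "integrable lborel (\<lambda>x::real. exp (- (x\<^sup>2 / 2)))"
    using integrable_mult_right[OF integrable_std_normal_moment_abs[of 0], of "sqrt (2 * pi)"] by (simp add: std_normal_density_def)
  show "integrable lborel (\<lambda>x. of_real (exp (- (x\<^sup>2 / 2))) * exp (- (\<i> * of_real (x * t))))"
    by (rule integrable_dominated[OF int]) (auto simp: norm_mult simp del: of_real_mult)
  have "char std_normal_distribution (-t)
     = (LINT x|lborel. std_normal_density x *\<^sub>R exp (\<i> * of_real (- t * x)))" unfolding char_def by (rule integral_density) auto
  also have "\<dots> = (LINT x|lborel. of_real (1 / sqrt (2 * pi)) *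
      (of_real (exp (- (x\<^sup>2 / 2))) * exp (- (\<i> * of_real (x * t)))))" by (intro LINT_cong refl)
      (simp add: std_normal_density_def scaleR_conv_of_real mult.commute)
  also have "\<dots> = of_real (1 / sqrt (2 * pi)) *
     (LINT x|lborel. (of_real (exp (- (x\<^sup>2 / 2))) * exp (- (\<i> * of_real (x * t)))))" by (rule integral_mult_right_zero)
  finally show "(LINT x|lborel. of_real (exp (- (x\<^sup>2 / 2))) * exp (- (\<i> * of_real (x * t))))
      = of_real (sqrt (2 * pi) * exp (- (t\<^sup>2 / 2)))"
    by (simp add: char_std_normal_distribution field_simps del: of_real_exp flip: of_real_mult)
qed

lemma gauss_integral_1d:
  fixes t e :: real
  assumes e: "0 < e"
  defines "g \<equiv> \<lambda>x. of_real (exp (- (e * x\<^sup>2 / 2))) * exp (- (\<i> * of_real (x * t)))"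
  shows "integrable lborel g" and "(LINT x|lborel. g x) = of_real (sqrt (2 * pi / e) * exp (- (t\<^sup>2 / (2 * e))))"
proof -
  let ?h = "\<lambda>x. of_real (exp (- (x\<^sup>2 / 2))) * exp (- (\<i> * of_real (x * (t / sqrt e))))"
  have g: "g x = ?h (0 + sqrt e * x)" for x using e by (simp add: g_def power_mult_distrib)
  show "integrable lborel g" unfolding g by (rule lborel_integrable_real_affine[OF std_gauss_integral(1)]) (use e in simp)
  have "(LINT x|lborel. ?h x) = \<bar>sqrt e\<bar> *\<^sub>R (LINT x|lborel. ?h (0 + sqrt e * x))"
    by (rule lborel_integral_real_affine) (use e in simp)
  then have "of_real (sqrt (2 * pi) * exp (- ((t / sqrt e)\<^sup>2 / 2))) = sqrt e *\<^sub>R (LINT x|lborel. g x)"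
    unfolding std_gauss_integral(2) g using e by simp
  then show "(LINT x|lborel. g x) = of_real (sqrt (2 * pi / e) * exp (- (t\<^sup>2 / (2 * e))))"
    using e by (simp add: scaleR_conv_of_real power_divide real_sqrt_divide field_simps)
qed

lemma lborel_integral_prod:
  fixes f :: "'a::euclidean_space \<Rightarrow> real \<Rightarrow> complex"
  assumes f: "\<And>b. b \<in> Basis \<Longrightarrow> integrable lborel (f b)"
  shows "integrable lborel (\<lambda>x. \<Prod>b\<in>Basis. f b (x \<bullet> b))"
    and "(LINT x|lborel. (\<Prod>b\<in>Basis. f b (x \<bullet> b))) = (\<Prod>b\<in>Basis. LINT x|lborel. f b x)"
proof -
  interpret product_sigma_finite "\<lambda>_::'a. lborel :: real measure" ..
  have [measurable]: "b \<in> Basis \<Longrightarrow> f b \<in> borel_measurable borel" for b using f[of b] by auto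
  have *: "(\<Prod>b\<in>Basis. f b ((\<Sum>b\<in>Basis. x b *\<^sub>R b) \<bullet> b)) = (\<Prod>b\<in>Basis. f b (x b))" for x
    by (intro prod.cong) auto
  have [measurable]: "(\<lambda>x. \<Prod>b\<in>Basis. f b (x \<bullet> b)) \<in> borel_measurable borel"
  proof (rule borel_measurable_prod)
    fix b :: 'a assume b: "b \<in> Basis"
    show "(\<lambda>x. f b (x \<bullet> b)) \<in> borel_measurable borel"
      by (rule measurable_compose[of "\<lambda>x. x \<bullet> b" borel borel "f b"]) (use b in auto)
  qed
  have [measurable]: "(\<lambda>f. \<Sum>b\<in>Basis. f b *\<^sub>R b) \<in> (\<Pi>\<^sub>M b\<in>(Basis::'a set). lborel) \<rightarrow>\<^sub>M borel"
    by (intro borel_measurable_sum borel_measurable_scaleR) (auto intro: measurable_component_singleton)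
  have "integrable (\<Pi>\<^sub>M b\<in>Basis. lborel) (\<lambda>x. \<Prod>b\<in>Basis. f b (x b))"
    by (rule product_integrable_prod) (auto simp: f)
  then show "integrable lborel (\<lambda>x. \<Prod>b\<in>Basis. f b (x \<bullet> b))"
    by (subst lborel_eq) (simp add: integrable_distr_eq *)
  have "(LINT x|lborel. (\<Prod>b\<in>Basis. f b (x \<bullet> b)))
     = (LINT x|(\<Pi>\<^sub>M b\<in>Basis. lborel). (\<Prod>b\<in>Basis. f b (x b)))" by (subst lborel_eq) (simp add: integral_distr *)
  also have "\<dots> = (\<Prod>b\<in>Basis. LINT x|lborel. f b x)" by (rule product_integral_prod) (auto simp: f)
  finally show "(LINT x|lborel. (\<Prod>b\<in>Basis. f b (x \<bullet> b))) = (\<Prod>b\<in>Basis. LINT x|lborel. f b x)" .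
qed

definition gauss :: "real \<Rightarrow> cfun" where
  "gauss e x = of_real (exp (- (e * (norm x)\<^sup>2 / 2)))"

lemma borel_measurable_gauss [measurable]: "gauss e \<in> borel_measurable borel" unfolding gauss_def by measurable

lemma gauss_prod:
  "gauss e x * exp (- (\<i> * of_real (x \<bullet> z))) = (\<Prod>b\<in>Basis.
     of_real (exp (- (e * (x \<bullet> b)\<^sup>2 / 2))) * exp (- (\<i> * of_real ((x \<bullet> b) * (z \<bullet> b)))))"
proof -
  have "(norm x)\<^sup>2 = (\<Sum>b\<in>Basis. (x \<bullet> b)\<^sup>2)"
    unfolding power2_norm_eq_inner by (subst euclidean_inner) (simp add: power2_eq_square)
  then have "gauss e x = (\<Prod>b\<in>Basis. of_real (exp (- (e * (x \<bullet> b)\<^sup>2 / 2))))"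
    unfolding gauss_def of_real_prod[symmetric] by (subst exp_sum[symmetric]) (simp_all add: sum_negf sum_distrib_left sum_divide_distrib)
  moreover have "exp (- (\<i> * of_real (x \<bullet> z)))
     = (\<Prod>b\<in>Basis. exp (- (\<i> * of_real ((x \<bullet> b) * (z \<bullet> b)))))"
    by (subst exp_sum[symmetric]) (simp_all add: euclidean_inner[of x z] sum_negf sum_distrib_left)
  ultimately show ?thesis by (simp add: prod.distrib)
qed

lemma integrable_gauss: assumes "0 < e" shows "integrable lborel (gauss e)"
proof -
  have "integrable lborel (\<lambda>x. gauss e x * exp (- (\<i> * of_real (x \<bullet> 0))))"
    unfolding gauss_prod by (rule lborel_integral_prod(1)) (rule gauss_integral_1d[OF assms])
  then show ?thesis by simp
qed

lemma FI_gauss: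
  assumes e: "0 < e" shows "FI (gauss e) z = complex_of_real (1 / e) * gauss (1 / e) z"
proof -
  have "(LINT x|lborel. gauss e x * exp (- (\<i> * complex_of_real (x \<bullet> z))))
     = (\<Prod>b\<in>(Basis::plane set). complex_of_real (sqrt (2 * pi / e) * exp (- ((z \<bullet> b)\<^sup>2 / (2 * e)))))"
    unfolding gauss_prod using gauss_integral_1d[OF e] by (subst lborel_integral_prod(2)) auto
  also have "\<dots> = complex_of_real (2 * pi / e) * (\<Prod>b\<in>(Basis::plane set). complex_of_real (exp (- ((z \<bullet> b)\<^sup>2 / (2 * e)))))"
  proof -
    have "complex_of_real (sqrt (2 * pi / e)) ^ 2 = complex_of_real (2 * pi / e)"
      unfolding of_real_power[symmetric] using e by (subst real_sqrt_pow2) auto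
    then show ?thesis unfolding of_real_mult prod.distrib by simp
  qed
  also have "(\<Prod>b\<in>(Basis::plane set). complex_of_real (exp (- ((z \<bullet> b)\<^sup>2 / (2 * e))))) = gauss (1/e) z"
    using gauss_prod[of "1/e" z 0] by (simp add: mult.commute)
  finally show ?thesis by (simp add: FI_def)
qed

lemma integral_gauss:
  assumes "0 < e" shows "(LINT x|lborel. gauss e x) = of_real (2 * pi / e)"
  using FI_gauss[OF assms, of 0] by (simp add: FI_def gauss_def field_simps)

lemma integral_norm_gauss:
  assumes "0 < e" shows "(LINT x|lborel. cmod (gauss e x)) = 2 * pi / e"
proof -
  have "of_real (LINT x|lborel. cmod (gauss e x)) = (LINT x|lborel. gauss e x)" by (simp add: gauss_def flip: integral_complex_of_real)
  then show ?thesis unfolding integral_gauss[OF assms] of_real_eq_iff .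
qed

text \<open>Twice the multiplication formula turns the Gaussian means of $|\hat f|^2$ into the
  pairing of $f$ with its Gaussian regularisation.\<close>

lemma FI_gauss_mean:
  assumes f: "integrable lborel f" and e: "0 < e"
  shows "(LINT z|lborel. of_real ((cmod (FI f z))\<^sup>2) * gauss e z)
    = (LINT x|lborel. f x * (conv (\<lambda>y. cnj (f y)) (FI (gauss e)) x / (2 * pi)))"
proof -
  have [measurable]: "f \<in> borel_measurable borel" using f by auto
  define g where "g z = cnj (FI f z) * gauss e z" for z
  have g: "integrable lborel g" unfolding g_def
  proof (rule integrable_dominated)
    define C where "C = (LINT x|lborel. cmod (f x)) / (2 * pi)"
    have C: "0 \<le> C" "\<And>z. cmod (FI f z) \<le> C" using FI_bound[OF f] by (auto simp: C_def)
    show "integrable lborel (\<lambda>z. of_real C * gauss e z)" using integrable_gauss[OF e] by simp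
    show "AE z in lborel. norm (cnj (FI f z) * gauss e z) \<le> norm (of_real C * gauss e z)"
      using C by (auto simp: norm_mult intro!: mult_right_mono)
  qed measurable
  \<comment> \<open>A phase factor on the conjugate transform is a reflection and translation of
    \<open>f\<close>; the multiplication formula then turns \<open>FI g\<close> into a
    convolution.\<close>
  have shift: "cnj (FI f z) * exp (- \<i> * of_real (z \<bullet> x)) = FI (\<lambda>y. cnj (f (x - y))) z" for x z
  proof -
    have "(LINT y|lborel. cnj (f (x - y)) * exp (- \<i> * of_real (y \<bullet> z)))
       = (LINT y|lborel. cnj (f y) * exp (- \<i> * of_real ((x - y) \<bullet> z)))"
      using integral_reflect_plane[of "\<lambda>y. cnj (f y) * exp (- \<i> * of_real ((x - y) \<bullet> z))" x] by simp
    also have "\<dots> = (LINT y|lborel. cnj (f y * exp (- \<i> * of_real (y \<bullet> z)))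
         * exp (- \<i> * of_real (z \<bullet> x)))" by (intro LINT_cong refl)
        (simp add: exp_cnj inner_diff_left inner_commute algebra_simps flip: exp_add)
    also have "\<dots> = cnj (LINT y|lborel. f y * exp (- \<i> * of_real (y \<bullet> z)))
         * exp (- \<i> * of_real (z \<bullet> x))" unfolding integral_mult_left_zero by (simp only: Bochner_Integration.integral_cnj)
    finally show ?thesis by (simp add: FI_def)
  qed
  have "FI g x = conv (\<lambda>y. cnj (f y)) (FI (gauss e)) x / (2 * pi)" for x
  proof -
    have "(LINT z|lborel. g z * exp (- \<i> * of_real (z \<bullet> x)))
       = (LINT z|lborel. FI (\<lambda>y. cnj (f (x - y))) z * gauss e z)" unfolding g_def shift[symmetric] by (simp add: mult_ac)
    also have "\<dots> = (LINT y|lborel. cnj (f (x - y)) * FI (gauss e) y)"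
      by (rule FI_multiplication) (use integrable_reflect_plane[OF f] integrable_gauss[OF e] in auto)
    finally show ?thesis by (simp add: FI_def[of g] conv_def)
  qed
  then have "(LINT x|lborel. f x * (conv (\<lambda>y. cnj (f y)) (FI (gauss e)) x / (2 * pi)))
     = (LINT x|lborel. f x * FI g x)" by simp
  also have "\<dots> = (LINT z|lborel. FI f z * g z)" by (rule FI_multiplication[OF f g, symmetric])
  finally show ?thesis by (simp only: g_def complex_norm_square mult.assoc)
qed

lemma gauss_mean_real:
  assumes f: "integrable lborel f" and e: "0 < e"
  shows "(LINT z|lborel. of_real ((cmod (FI f z))\<^sup>2) * gauss e z)
    = of_real (LINT z|lborel. (cmod (FI f z))\<^sup>2 * exp (- (e * (norm z)\<^sup>2 / 2)))"
    and "integrable lborel (\<lambda>z. (cmod (FI f z))\<^sup>2 * exp (- (e * (norm z)\<^sup>2 / 2)))"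
proof -
  have [measurable]: "f \<in> borel_measurable borel" using f by auto
  show "(LINT z|lborel. of_real ((cmod (FI f z))\<^sup>2) * gauss e z)
    = of_real (LINT z|lborel. (cmod (FI f z))\<^sup>2 * exp (- (e * (norm z)\<^sup>2 / 2)))"
    by (simp add: gauss_def flip: integral_complex_of_real)
  show "integrable lborel (\<lambda>z. (cmod (FI f z))\<^sup>2 * exp (- (e * (norm z)\<^sup>2 / 2)))"
  proof (rule integrable_dominated)
    define C where "C = (LINT x|lborel. cmod (f x)) / (2 * pi)"
    have C: "(cmod (FI f z))\<^sup>2 \<le> C\<^sup>2" for z
      using power_mono[OF FI_bound[OF f] norm_ge_zero, where n=2] by (auto simp: C_def)
    show "integrable lborel (\<lambda>z. of_real (C\<^sup>2) * gauss e z)" using integrable_gauss[OF e] by simp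
    show "AE z in lborel. norm ((cmod (FI f z))\<^sup>2 * exp (- (e * (norm z)\<^sup>2 / 2)))
        \<le> norm (of_real (C\<^sup>2) * gauss e z)" using C by (auto simp: norm_mult gauss_def norm_power)
  qed measurable
qed

text \<open>The Gaussian means of the squared modulus equal the pairing of \<open>f\<close> with the
  convolution of its conjugate by a Gaussian of integral 1, so Young's inequality and Cauchy-Schwarz
  bound them by the squared norm of \<open>f\<close>. As the Gaussian weight flattens out to 1,
  Fatou's lemma keeps the bound.\<close>

lemma FI_contraction:
  assumes f: "integrable lborel f" "sqi f"
  shows "sqi (FI f)" "l2norm (FI f) \<le> l2norm f"
proof -
  have [measurable]: "f \<in> borel_measurable borel" using f by auto
  have mean: "(LINT z|lborel. (cmod (FI f z))\<^sup>2 * exp (- (e * (norm z)\<^sup>2 / 2))) \<le> (l2norm f)\<^sup>2"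
    if e: "0 < e" for e
  proof -
    define G where "G y = FI (gauss e) y / (2 * pi)" for y
    have G: "G = (\<lambda>y. of_real (1 / (2 * pi * e)) * gauss (1/e) y)" by (auto simp: G_def FI_gauss[OF e])
    have "integrable lborel G" using integrable_gauss[of "1/e"] e by (simp add: G)
    moreover have "(LINT y|lborel. cmod (G y)) = 1" using integral_norm_gauss[of "1/e"] e by (simp add: G norm_mult norm_divide)
    ultimately have K: "sqi (conv G (\<lambda>y. cnj (f y)))" "l2norm (conv G (\<lambda>y. cnj (f y))) \<le> l2norm f"
      using l2norm_conv[of G "\<lambda>y. cnj (f y)"] sqi_conv[of G "\<lambda>y. cnj (f y)"] f by auto
    have "conv (\<lambda>y. cnj (f y)) (FI (gauss e)) x / (2 * pi) = conv G (\<lambda>y. cnj (f y)) x" for x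
    proof -
      have "conv (\<lambda>y. cnj (f y)) (FI (gauss e)) x / (2 * pi) = conv (\<lambda>y. cnj (f y)) G x" by (simp add: conv_def G_def)
      also have "\<dots> = conv G (\<lambda>y. cnj (f y)) x" by (rule conv_commute) (auto simp: G)
      finally show ?thesis .
    qed
    then have "of_real (LINT z|lborel. (cmod (FI f z))\<^sup>2 * exp (- (e * (norm z)\<^sup>2 / 2)))
       = (LINT x|lborel. f x * conv G (\<lambda>y. cnj (f y)) x)" using FI_gauss_mean[OF f(1) e] gauss_mean_real[OF f(1) e] by simp
    then have "\<bar>LINT z|lborel. (cmod (FI f z))\<^sup>2 * exp (- (e * (norm z)\<^sup>2 / 2))\<bar>
       = cmod (LINT x|lborel. f x * conv G (\<lambda>y. cnj (f y)) x)" by (simp only: norm_of_real[symmetric, where 'a=complex])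
    also have "\<dots> \<le> l2norm f * l2norm (conv G (\<lambda>y. cnj (f y)))" by (rule l2norm_Cauchy_Schwarz_complex[OF f(2) K(1)])
    also have "\<dots> \<le> l2norm f * l2norm f" by (intro mult_left_mono K) simp
    finally show ?thesis by (simp add: power2_eq_square)
  qed
  let ?g = "\<lambda>n z. ennreal ((cmod (FI f z))\<^sup>2 * exp (- (1 / real (Suc n) * (norm z)\<^sup>2 / 2)))"
  have "(\<integral>\<^sup>+z. ennreal ((cmod (FI f z))\<^sup>2) \<partial>lborel) = (\<integral>\<^sup>+z. liminf (\<lambda>n. ?g n z) \<partial>lborel)"
  proof (rule nn_integral_cong)
    fix z :: plane
    have "(\<lambda>n. 1 / real (Suc n)) \<longlonglongrightarrow> 0" by (rule LIMSEQ_Suc[OF lim_1_over_n])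
    then have "(\<lambda>n. (cmod (FI f z))\<^sup>2 * exp (- (1 / real (Suc n) * (norm z)\<^sup>2 / 2)))
        \<longlonglongrightarrow> (cmod (FI f z))\<^sup>2 * exp (- (0 * (norm z)\<^sup>2 / 2))" by (intro tendsto_intros) auto
    then have "(\<lambda>n. ?g n z) \<longlonglongrightarrow> ennreal ((cmod (FI f z))\<^sup>2)" by (intro tendsto_ennrealI) simp
    then show "ennreal ((cmod (FI f z))\<^sup>2) = liminf (\<lambda>n. ?g n z)" by (intro lim_imp_Liminf[symmetric]) auto
  qed
  also have "\<dots> \<le> liminf (\<lambda>n. \<integral>\<^sup>+z. ?g n z \<partial>lborel)" by (rule nn_integral_liminf) auto
  also have "\<dots> \<le> ennreal ((l2norm f)\<^sup>2)"
  proof (rule Liminf_le)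
    show "\<forall>\<^sub>F n in sequentially. (\<integral>\<^sup>+z. ?g n z \<partial>lborel) \<le> ennreal ((l2norm f)\<^sup>2)"
    proof (rule always_eventually, rule allI)
      fix n
      have "(\<integral>\<^sup>+z. ?g n z \<partial>lborel) = ennreal (LINT z|lborel. (cmod (FI f z))\<^sup>2 * exp (- (1 / real (Suc n) * (norm z)\<^sup>2 / 2)))"
        by (rule nn_integral_eq_integral[OF gauss_mean_real(2)[OF f(1)]]) auto
      also have "\<dots> \<le> ennreal ((l2norm f)\<^sup>2)" by (intro ennreal_leI mean) simp
      finally show "(\<integral>\<^sup>+z. ?g n z \<partial>lborel) \<le> ennreal ((l2norm f)\<^sup>2)" .
    qed
  qed simp
  finally have "(\<integral>\<^sup>+z. ennreal ((cmod (FI f z))\<^sup>2) \<partial>lborel) \<le> ennreal ((l2norm f)\<^sup>2)" .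
  then show "sqi (FI f)" "l2norm (FI f) \<le> l2norm f" by (auto intro!: sqi_nn_integralI)
qed

section \<open>Density of compactly supported continuous functions and the isometry\<close>

lemma l2norm_tendsto_zero:
  assumes [measurable]: "\<And>n. f n \<in> borel_measurable borel" and w: "integrable lborel w"
    and bound: "\<And>n x. (cmod (f n x))\<^sup>2 \<le> w x" and lim: "AE x in lborel. (\<lambda>n. f n x) \<longlonglongrightarrow> 0"
  shows "(\<lambda>n. l2norm (f n)) \<longlonglongrightarrow> 0"
proof -
  have "(\<lambda>n. LINT x|lborel. (cmod (f n x))\<^sup>2) \<longlonglongrightarrow> (LINT x|(lborel :: plane measure). (0::real))"
  proof (rule integral_dominated_convergence[where w=w])
    show "AE x in lborel. (\<lambda>n. (cmod (f n x))\<^sup>2) \<longlonglongrightarrow> 0" using lim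
    proof eventually_elim
      case (elim x)
      show ?case using tendsto_power[OF tendsto_norm_zero[OF elim], of 2] by simp
    qed
  qed (use bound w in auto)
  from tendsto_real_sqrt[OF this] show ?thesis by (simp add: l2norm_def)
qed

lemma l2norm_cong: "(\<And>x. f x = g x) \<Longrightarrow> l2norm f = l2norm g" by (simp add: l2norm_def)

text \<open>Serves on both sides of the transform: in physical space as the cut-off in the
  Plancherel limit, in frequency space as the projection of the Euler scheme.\<close>

definition trunc :: "cfun \<Rightarrow> nat \<Rightarrow> cfun" where
  "trunc f n x = indicator (cball 0 (real n)) x * f x"

lemma borel_measurable_trunc [measurable]:
  "f \<in> borel_measurable borel \<Longrightarrow> trunc f n \<in> borel_measurable borel"
  unfolding trunc_def[abs_def] by (intro borel_measurable_times borel_measurable_indicator) auto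

lemma integrable_indicator_cball: "integrable lborel (\<lambda>x::plane. indicator (cball a r) x :: real)"
  using emeasure_bounded_finite[of "cball a r"] by (intro integrable_real_indicator) auto

lemma sqi_indicator: "bounded A \<Longrightarrow> A \<in> sets borel \<Longrightarrow> sqi (indicator A)"
proof -
  assume A: "bounded A" "A \<in> sets borel"
  have "integrable lborel (indicat_real A)" using A emeasure_bounded_finite[of A] by (intro integrable_real_indicator) auto
  moreover have "(cmod (indicator A x))\<^sup>2 = indicat_real A x" for x by (simp add: indicator_def)
  ultimately show ?thesis using A by (simp add: square_integrable_def)
qed

lemma sqi_trunc: "sqi f \<Longrightarrow> sqi (trunc f n)" by (rule sqi_dominated[of f _ 1]) (auto simp: trunc_def indicator_def)

lemma integrable_trunc: assumes "sqi f" shows "integrable lborel (trunc f n)"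
proof -
  have "sqi (indicator (cball 0 (real n)))" by (rule sqi_indicator) auto
  from sqi_mult_integrable[OF this assms] show ?thesis by (simp add: trunc_def[abs_def])
qed

lemma trunc_tendsto:
  assumes f: "sqi f" shows "(\<lambda>n. l2dist (trunc f n) f) \<longlonglongrightarrow> 0"
proof (rule l2norm_tendsto_zero[OF _ sqi_integrable[OF f]])
  show "(\<lambda>x. trunc f n x - f x) \<in> borel_measurable borel" for n using sqi_measurable[OF f] by simp
  show "(cmod (trunc f n x - f x))\<^sup>2 \<le> (cmod (f x))\<^sup>2" for n x by (auto simp: trunc_def indicator_def)
  have "(\<lambda>n. trunc f n x - f x) \<longlonglongrightarrow> 0" for x
  proof (rule tendsto_eventually)
    show "\<forall>\<^sub>F n in sequentially. trunc f n x - f x = 0" using eventually_ge_at_top[of "nat \<lceil>norm x\<rceil>"]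
      by eventually_elim (auto simp: trunc_def indicator_def nat_le_iff ceiling_le_iff)
  qed
  then show "AE x in lborel. (\<lambda>n. trunc f n x - f x) \<longlonglongrightarrow> 0" by simp
qed

lemma compact_continuous_dense_bounded:
  assumes [measurable]: "h \<in> borel_measurable borel" and h: "\<And>x. cmod (h x) \<le> B" "\<And>x. R < norm x \<Longrightarrow> h x = 0"
    and "0 < e" "0 < B"
  shows "\<exists>\<phi>. continuous_on UNIV \<phi> \<and> (\<forall>x::plane. R + 1 < norm x \<longrightarrow> \<phi> x = 0) \<and> l2dist h \<phi> < e"
proof -
  note [measurable] = borel_closed[OF closed_cball]
  \<comment> \<open>Measurability in this sense provides continuous functions converging pointwise
    off a negligible set; below they are capped in size by \<open>B\<close> and cut off by
    \<open>\<psi>\<close>, so that dominated convergence applies.\<close>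
  have "h measurable_on UNIV" by (rule lebesgue_measurable_imp_measurable_on) (auto intro: measurable_completion)
  then obtain N g where N: "negligible N" and g: "\<And>n. continuous_on UNIV (g n)"
    "\<And>x. x \<notin> N \<Longrightarrow> (\<lambda>n. g n x) \<longlonglongrightarrow> h x" by (auto simp: measurable_on_def)
  define \<psi> where "\<psi> x = max 0 (min 1 (R + 1 - norm x))" for x :: plane
  define k where "k n x = of_real (\<psi> x * (B / max B (cmod (g n x)))) * g n x" for n x
  have k: "continuous_on UNIV (k n)" for n
    unfolding k_def \<psi>_def using \<open>0 < B\<close> by (intro continuous_intros g) (auto simp: max_def)
  then have [measurable]: "k n \<in> borel_measurable borel" for n by (rule borel_measurable_continuous_onI)
  have kB: "cmod (k n x) \<le> B * \<psi> x" for n x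
  proof -
    have "B / max B c * c \<le> B" for c :: real using \<open>0 < B\<close> by (auto simp: divide_le_eq max_def mult_left_mono)
    from mult_right_mono[OF this, of "\<psi> x"] have "B / max B (cmod (g n x)) * cmod (g n x) * \<psi> x \<le> B * \<psi> x"
      by (simp add: \<psi>_def)
    moreover have "\<bar>\<psi> x * (B / max B (cmod (g n x)))\<bar> = \<psi> x * (B / max B (cmod (g n x)))"
      using \<open>0 < B\<close> by (intro abs_of_nonneg mult_nonneg_nonneg divide_nonneg_nonneg) (auto simp: \<psi>_def)
    ultimately show ?thesis by (simp only: k_def norm_mult norm_of_real mult_ac)
  qed
  have \<psi>: "0 \<le> \<psi> x" "\<psi> x \<le> indicator (cball 0 (R+1)) x" for x by (auto simp: \<psi>_def indicator_def)
  have \<psi>h: "of_real (\<psi> x) * h x = h x" for x using h(2)[of x] by (cases "norm x \<le> R") (auto simp: \<psi>_def)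
  have "(\<lambda>n. l2dist h (k n)) \<longlonglongrightarrow> 0"
  proof (rule l2norm_tendsto_zero)
    show "integrable lborel (\<lambda>x::plane. (2 * B)\<^sup>2 * indicator (cball 0 (R+1)) x :: real)"
      by (intro integrable_mult_right integrable_indicator_cball)
    show "(cmod (h x - k n x))\<^sup>2 \<le> (2 * B)\<^sup>2 * indicator (cball 0 (R+1)) x" for n x
    proof -
      have "cmod (h x) \<le> B * indicator (cball 0 (R+1)) x" using h(1)[of x] h(2)[of x] by (auto simp: indicator_def)
      moreover have "cmod (k n x) \<le> B * indicator (cball 0 (R+1)) x"
        using kB[of n x] mult_left_mono[OF \<psi>(2)[of x], of B] \<open>0 < B\<close> by linarith
      ultimately have "cmod (h x - k n x) \<le> 2 * B * indicator (cball 0 (R+1)) x"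
        using norm_triangle_ineq4[of "h x" "k n x"] by linarith
      then have "(cmod (h x - k n x))\<^sup>2 \<le> (2 * B * indicator (cball 0 (R+1)) x)\<^sup>2" by (rule power_mono) simp
      moreover have "(indicat_real (cball 0 (R+1)) x)\<^sup>2 = indicator (cball 0 (R+1)) x" by (simp add: indicator_def)
      ultimately show ?thesis by (simp only: power_mult_distrib)
    qed
    have "AE x in lebesgue. x \<notin> N" using N by (auto simp: negligible_iff_null_sets intro: AE_not_in)
    then have "AE x in lborel. x \<notin> N" by (simp add: AE_completion_iff)
    then show "AE x in lborel. (\<lambda>n. h x - k n x) \<longlonglongrightarrow> 0"
    proof eventually_elim
      case (elim x)
      have "(\<lambda>n. k n x) \<longlonglongrightarrow> of_real (\<psi> x * (B / max B (cmod (h x)))) * h x"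
        unfolding k_def using \<open>0 < B\<close> by (intro tendsto_intros g elim) auto
      also have "of_real (\<psi> x * (B / max B (cmod (h x)))) * h x = h x"
        using h(1)[of x] \<open>0 < B\<close> \<psi>h[of x] by (simp add: max_absorb1)
      finally show ?case by (auto intro!: tendsto_eq_intros)
    qed
  qed measurable
  from LIMSEQ_D[OF this \<open>0 < e\<close>] obtain n where "l2dist h (k n) < e" by auto
  moreover have "k n x = 0" if "R + 1 < norm x" for x using that by (simp add: k_def \<psi>_def)
  ultimately show ?thesis using k by blast
qed

lemma sqi_compact_support:
  assumes "continuous_on UNIV \<phi>" "\<forall>x. R < norm x \<longrightarrow> \<phi> x = 0"
  shows "sqi \<phi>" "integrable lborel \<phi>" "\<exists>B>0. \<forall>x. cmod (\<phi> x) \<le> B"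
proof -
  have [measurable]: "\<phi> \<in> borel_measurable borel" using assms(1) by (rule borel_measurable_continuous_onI)
  have "compact (\<phi> ` cball 0 R)" by (intro compact_continuous_image continuous_on_subset[OF assms(1)]) auto
  then obtain B where B: "0 < B" "\<And>x. x \<in> cball 0 R \<Longrightarrow> cmod (\<phi> x) \<le> B"
    using compact_imp_bounded bounded_pos by (metis imageI)
  have le: "cmod (\<phi> x) \<le> B * indicator (cball 0 R) x" for x
  proof (cases "norm x \<le> R")
    case True
    then show ?thesis using B(2)[of x] by (simp add: indicator_def)
  next
    case False
    then have "\<phi> x = 0" using assms(2) by simp
    then show ?thesis using B(1) by simp
  qed
  have "B * indicator (cball 0 R) x \<le> B" for x :: plane using B(1) by (auto simp: indicator_def)
  then have "cmod (\<phi> x) \<le> B" for x using le[of x] by (rule order_trans[rotated])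
  then show "\<exists>B>0. \<forall>x. cmod (\<phi> x) \<le> B" using B(1) by auto
  have "sqi (indicator (cball 0 R))" by (rule sqi_indicator) auto
  then show "sqi \<phi>"
  proof (rule sqi_dominated)
    show "cmod (\<phi> x) \<le> B * cmod (indicator (cball 0 R) x)" for x using le[of x] by (auto simp: indicator_def)
  qed measurable
  show "integrable lborel \<phi>"
  proof (rule integrable_dominated)
    show "integrable lborel (\<lambda>x::plane. B * indicator (cball 0 R) x)" by (intro integrable_mult_right integrable_indicator_cball)
    show "AE x in lborel. norm (\<phi> x) \<le> norm (B * indicator (cball 0 R) x)" using le B(1) by (simp add: abs_mult)
  qed measurable
qed

lemma compact_continuous_dense:
  assumes f: "sqi f" and e: "0 < e"
  shows "\<exists>\<phi> R. continuous_on UNIV \<phi> \<and> (\<forall>x. R < norm x \<longrightarrow> \<phi> x = 0) \<and> l2dist f \<phi> < e"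
proof -
  have [measurable]: "f \<in> borel_measurable borel" using f by auto
  define h where "h n x = (if norm x \<le> real n \<and> cmod (f x) \<le> real n then f x else 0)" for n x
  have [measurable]: "h n \<in> borel_measurable borel" for n unfolding h_def by measurable
  have "(\<lambda>n. l2dist (h n) f) \<longlonglongrightarrow> 0"
  proof (rule l2norm_tendsto_zero[OF _ sqi_integrable[OF f]])
    show "(cmod (h n x - f x))\<^sup>2 \<le> (cmod (f x))\<^sup>2" for n x by (auto simp: h_def)
    have "(\<lambda>n. h n x - f x) \<longlonglongrightarrow> 0" for x
    proof (rule tendsto_eventually)
      show "\<forall>\<^sub>F n in sequentially. h n x - f x = 0"
        using eventually_ge_at_top[of "nat \<lceil>norm x\<rceil>"] eventually_ge_at_top[of "nat \<lceil>cmod (f x)\<rceil>"]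
        by eventually_elim (auto simp: h_def nat_le_iff ceiling_le_iff)
    qed
    then show "AE x in lborel. (\<lambda>n. h n x - f x) \<longlonglongrightarrow> 0" by simp
  qed measurable
  from LIMSEQ_D[OF this, of "e/2"] e obtain n where n: "l2dist (h n) f < e/2" by auto
  have "\<exists>\<phi>. continuous_on UNIV \<phi> \<and> (\<forall>x. real n + 1 < norm x \<longrightarrow> \<phi> x = 0) \<and> l2dist (h n) \<phi> < e/2"
    by (rule compact_continuous_dense_bounded[where B="real n + 1"]) (use e in \<open>auto simp: h_def\<close>)
  then obtain \<phi> where \<phi>: "continuous_on UNIV \<phi>" "\<forall>x. real n + 1 < norm x \<longrightarrow> \<phi> x = 0"
    "l2dist (h n) \<phi> < e/2" by blast
  have "l2dist f \<phi> \<le> l2dist f (h n) + l2dist (h n) \<phi>" by (rule l2norm_triangle_via)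
      (use f sqi_compact_support[OF \<phi>(1,2)] in \<open>auto simp: h_def intro!: sqi_dominated[OF f, of _ 1]\<close>)
  then have "l2dist f \<phi> < e" using n \<phi>(3) by (simp add: l2norm_minus_commute[of f])
  then show ?thesis using \<phi> by blast
qed

text \<open>For continuous \<open>\<phi>\<close> the Gaussian regularisations converge pointwise and
  boundedly, so the Gaussian means of the squared transform tend to the squared norm of
  \<open>\<phi>\<close>, while each mean is at most the squared norm of
  \<open>FI \<phi>\<close>.\<close>

lemma FI_isometry_compact:
  assumes \<phi>: "continuous_on UNIV \<phi>" "\<forall>x. R < norm x \<longrightarrow> \<phi> x = 0"
  shows "l2norm \<phi> \<le> l2norm (FI \<phi>)"
proof -
  obtain B where B: "0 < B" "\<And>x. cmod (\<phi> x) \<le> B" using sqi_compact_support[OF \<phi>] by auto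
  note \<phi>' = sqi_compact_support(1,2)[OF \<phi>]
  have [measurable]: "\<phi> \<in> borel_measurable borel" using \<phi>' by auto
  \<comment> \<open>The parameter \<open>1 / (real (Suc n))\<^sup>2\<close> is chosen so that a
    change of variables yields steps \<open>1 / real (Suc n)\<close> under one fixed
    Gaussian.\<close>
  define K where "K n x = conv (\<lambda>y. cnj (\<phi> y)) (FI (gauss (1 / (real (Suc n))\<^sup>2))) x / (2 * pi)" for n x
  have [measurable]: "K n \<in> borel_measurable borel" for n unfolding K_def by measurable
  have K: "K n x = (LINT z|lborel. cnj (\<phi> (x - (1 / real (Suc n)) *\<^sub>R z)) * gauss 1 z) / (2 * pi)" for n x
  proof -
    define r where "r = real (Suc n)"
    have r: "0 < r" by (simp add: r_def)
    have "conv (\<lambda>y. cnj (\<phi> y)) (FI (gauss (1 / r\<^sup>2))) x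
       = (LINT y|lborel. cnj (\<phi> (x - y)) * (of_real (r\<^sup>2) * gauss (r\<^sup>2) y))"
      unfolding conv_def using r by (simp add: FI_gauss)
    also have "\<dots> = (1 / r)\<^sup>2 *\<^sub>R (LINT z|lborel. cnj (\<phi> (x - (0 + (1 / r) *\<^sub>R z))) *
        (of_real (r\<^sup>2) * gauss (r\<^sup>2) (0 + (1 / r) *\<^sub>R z)))" by (rule integral_affine_plane) (use r in auto)
    also have "\<dots> = (1 / r)\<^sup>2 *\<^sub>R (LINT z|lborel. of_real (r\<^sup>2) * (cnj (\<phi> (x - (1 / r) *\<^sub>R z)) * gauss 1 z))"
      using r by (simp add: gauss_def power_divide power_mult_distrib mult_ac)
    also have "\<dots> = (LINT z|lborel. cnj (\<phi> (x - (1 / r) *\<^sub>R z)) * gauss 1 z)"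
      unfolding integral_mult_right_zero using r by (simp add: scaleR_conv_of_real power_divide)
    finally show ?thesis by (simp add: K_def r_def)
  qed
  have Kint: "integrable lborel (\<lambda>z. cnj (\<phi> (x - (1 / real (Suc n)) *\<^sub>R z)) * gauss 1 z)" for n x
  proof (rule integrable_dominated)
    show "integrable lborel (\<lambda>z. of_real B * gauss 1 z)" by (intro integrable_mult_right integrable_gauss) simp
  qed (use B in \<open>auto simp: norm_mult intro!: mult_right_mono\<close>)
  have KB: "cmod (K n x) \<le> B" for n x
  proof -
    have "cmod (LINT z|lborel. cnj (\<phi> (x - (1 / real (Suc n)) *\<^sub>R z)) * gauss 1 z)
       \<le> (LINT z|lborel. B * cmod (gauss 1 z))" by (rule Bochner_Integration.integral_norm_bound_integral[OF Kint])
        (use B integrable_gauss[of 1] in \<open>auto simp: norm_mult intro!: mult_right_mono\<close>)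
    also have "\<dots> = B * (2 * pi)" using integral_norm_gauss[of 1] by simp
    finally show ?thesis unfolding K by (simp add: norm_divide norm_mult field_simps)
  qed
  have Klim: "(\<lambda>n. K n x) \<longlonglongrightarrow> cnj (\<phi> x)" for x
  proof -
    have "(\<lambda>n. LINT z|lborel. cnj (\<phi> (x - (1 / real (Suc n)) *\<^sub>R z)) * gauss 1 z)
       \<longlonglongrightarrow> (LINT z|lborel. cnj (\<phi> x) * gauss 1 z)"
    proof (rule integral_dominated_convergence)
      show "integrable lborel (\<lambda>z. B * cmod (gauss 1 z))" using integrable_gauss[of 1] by simp
      show "AE z in lborel. norm (cnj (\<phi> (x - (1 / real (Suc n)) *\<^sub>R z)) * gauss 1 z) \<le> B * cmod (gauss 1 z)" for n
        using B by (auto simp: norm_mult intro!: mult_right_mono)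
      have "(\<lambda>n. cnj (\<phi> (x - (1 / real (Suc n)) *\<^sub>R z)) * gauss 1 z) \<longlonglongrightarrow> cnj (\<phi> x) * gauss 1 z" for z
      proof -
        have "(\<lambda>n. 1 / real (Suc n)) \<longlonglongrightarrow> 0" by (rule LIMSEQ_Suc[OF lim_1_over_n])
        then have "(\<lambda>n. x - (1 / real (Suc n)) *\<^sub>R z) \<longlonglongrightarrow> x - 0 *\<^sub>R z" by (intro tendsto_intros)
        then have "(\<lambda>n. \<phi> (x - (1 / real (Suc n)) *\<^sub>R z)) \<longlonglongrightarrow> \<phi> x"
          using \<phi>(1) by (auto simp: continuous_on_eq_continuous_at intro: isCont_tendsto_compose)
        then show ?thesis by (intro tendsto_intros)
      qed
      then show "AE z in lborel. (\<lambda>n. cnj (\<phi> (x - (1 / real (Suc n)) *\<^sub>R z)) * gauss 1 z) \<longlonglongrightarrow> cnj (\<phi> x) * gauss 1 z"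
        by simp
    qed measurable
    then have "(\<lambda>n. (LINT z|lborel. cnj (\<phi> (x - (1 / real (Suc n)) *\<^sub>R z)) * gauss 1 z) / of_real (2 * pi))
       \<longlonglongrightarrow> (LINT z|lborel. cnj (\<phi> x) * gauss 1 z) / of_real (2 * pi)" by (intro tendsto_intros) auto
    then show ?thesis unfolding K by (simp add: integral_gauss)
  qed
  have "(\<lambda>n. LINT x|lborel. \<phi> x * K n x) \<longlonglongrightarrow> (LINT x|lborel. \<phi> x * cnj (\<phi> x))"
  proof (rule integral_dominated_convergence)
    show "integrable lborel (\<lambda>x. B * cmod (\<phi> x))" using \<phi>' by simp
    show "AE x in lborel. norm (\<phi> x * K n x) \<le> B * cmod (\<phi> x)" for n
      using KB[of n] mult_right_mono[OF KB[of n] norm_ge_zero[of "\<phi> _"]] by (auto simp: norm_mult mult.commute)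
    show "AE x in lborel. (\<lambda>n. \<phi> x * K n x) \<longlonglongrightarrow> \<phi> x * cnj (\<phi> x)"
      by (intro AE_I2 tendsto_intros Klim)
  qed measurable
  also have "(LINT x|lborel. \<phi> x * cnj (\<phi> x)) = of_real ((l2norm \<phi>)\<^sup>2)"
    by (simp only: l2norm_square complex_norm_square[symmetric] integral_complex_of_real)
  finally have "(\<lambda>n. cmod (LINT x|lborel. \<phi> x * K n x)) \<longlonglongrightarrow> cmod (of_real ((l2norm \<phi>)\<^sup>2))"
    by (rule tendsto_norm)
  moreover have "cmod (LINT x|lborel. \<phi> x * K n x) \<le> (l2norm (FI \<phi>))\<^sup>2" for n
  proof -
    define e where "e = 1 / (real (Suc n))\<^sup>2"
    have e: "0 < e" by (simp add: e_def)
    have "(LINT x|lborel. \<phi> x * K n x)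
        = of_real (LINT w|lborel. (cmod (FI \<phi> w))\<^sup>2 * exp (- (e * (norm w)\<^sup>2 / 2)))" unfolding K_def e_def[symmetric]
      using gauss_mean_real(1)[OF \<phi>'(2) e] FI_gauss_mean[OF \<phi>'(2) e] by simp
    moreover have "0 \<le> (LINT w|lborel. (cmod (FI \<phi> w))\<^sup>2 * exp (- (e * (norm w)\<^sup>2 / 2)))" by simp
    moreover have "(LINT w|lborel. (cmod (FI \<phi> w))\<^sup>2 * exp (- (e * (norm w)\<^sup>2 / 2))) \<le> (l2norm (FI \<phi>))\<^sup>2"
      unfolding l2norm_square
      by (intro integral_mono gauss_mean_real(2) \<phi>' e sqi_integrable FI_contraction) (use e in \<open>auto simp: mult_left_le\<close>)
    ultimately show ?thesis by simp
  qed
  ultimately have "cmod (of_real ((l2norm \<phi>)\<^sup>2)) \<le> (l2norm (FI \<phi>))\<^sup>2" by (auto intro: LIMSEQ_le_const2)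
  then have "(l2norm \<phi>)\<^sup>2 \<le> (l2norm (FI \<phi>))\<^sup>2" unfolding norm_of_real by simp
  then show ?thesis by (rule power2_le_imp_le) simp
qed

lemma FI_isometry:
  assumes f: "integrable lborel f" "sqi f" shows "l2norm (FI f) = l2norm f"
proof (rule antisym)
  show "l2norm (FI f) \<le> l2norm f" by (rule FI_contraction[OF f])
  show "l2norm f \<le> l2norm (FI f)"
  proof (rule field_le_epsilon)
    fix e :: real assume "0 < e"
    then obtain \<phi> R where \<phi>: "continuous_on UNIV \<phi>" "\<forall>x. R < norm x \<longrightarrow> \<phi> x = 0"
      "l2dist f \<phi> < e / 2" using compact_continuous_dense[OF f(2), of "e/2"] by auto
    note \<phi>' = sqi_compact_support(1,2)[OF \<phi>(1,2)]
    have F: "sqi (FI f)" "sqi (FI \<phi>)" using FI_contraction f \<phi>' by auto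
    have "l2norm f \<le> l2dist f \<phi> + l2norm \<phi>" using l2norm_triangle[of "\<lambda>x. f x - \<phi> x" \<phi>] f \<phi>' by auto
    also have "l2norm \<phi> \<le> l2norm (FI \<phi>)" by (rule FI_isometry_compact[OF \<phi>(1,2)])
    also have "l2norm (FI \<phi>) \<le> l2dist (FI \<phi>) (FI f) + l2norm (FI f)"
      using l2norm_triangle[of "\<lambda>x. FI \<phi> x - FI f x" "FI f"] F by auto
    also have "l2dist (FI \<phi>) (FI f) = l2norm (FI (\<lambda>x. f x - \<phi> x))"
      using f \<phi>' by (subst l2norm_minus_commute) (simp add: FI_diff cong: l2norm_cong)
    also have "\<dots> \<le> l2dist f \<phi>" by (rule FI_contraction) (use f \<phi>' in auto)
    finally show "l2norm f \<le> l2norm (FI f) + e" using \<phi>(3) by simp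
  qed
qed

definition plancherel :: "cfun \<Rightarrow> cfun" where
  "plancherel f = (SOME g. square_integrable g \<and>
     (\<lambda>n. \<integral>\<^sup>+x. ennreal ((cmod (FI (trunc f n) x - g x))\<^sup>2) \<partial>lborel) \<longlonglongrightarrow> 0)"

text \<open>An equality of functions, not only almost everywhere: both choices are made from
  literally the same predicate.\<close>

lemma fourier_plancherel: "fourier f = plancherel (\<lambda>x. of_real (f x))"
proof -
  have "(\<lambda>x. of_real (indicator (cball 0 (real n)) x * f x)) = trunc (\<lambda>x. of_real (f x)) n" for n
    by (auto simp: trunc_def fun_eq_iff indicator_def)
  then show ?thesis by (simp add: fourier_def plancherel_def fourier_integral_FI)
qed

lemma FI_trunc: "sqi f \<Longrightarrow> sqi (FI (trunc f n))" by (intro FI_contraction integrable_trunc sqi_trunc)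

lemma plancherel_exists:
  assumes f: "sqi f"
  shows "\<exists>g. sqi g \<and> (\<lambda>n. l2dist (FI (trunc f n)) g) \<longlonglongrightarrow> 0"
proof (rule sqi_complete[OF FI_trunc[OF f]])
  fix e :: real assume e: "0 < e"
  then obtain N where N: "\<And>n. N \<le> n \<Longrightarrow> l2dist (trunc f n) f < e / 2"
    using LIMSEQ_D[OF trunc_tendsto[OF f], of "e/2"] by auto
  have "l2dist (FI (trunc f m)) (FI (trunc f n)) < e" if mn: "N \<le> m" "N \<le> n" for m n
  proof -
    have "l2dist (FI (trunc f m)) (FI (trunc f n)) = l2norm (FI (\<lambda>x. trunc f m x - trunc f n x))"
      using f by (simp add: FI_diff integrable_trunc cong: l2norm_cong)
    also have "\<dots> \<le> l2dist (trunc f m) (trunc f n)" by (rule FI_contraction) (use f integrable_trunc sqi_trunc in auto)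
    also have "\<dots> \<le> l2dist (trunc f m) f + l2dist f (trunc f n)" by (rule l2norm_triangle_via) (use f sqi_trunc in auto)
    also have "\<dots> < e" using N[OF mn(1)] N[OF mn(2)] by (simp add: l2norm_minus_commute[of f])
    finally show ?thesis .
  qed
  then show "\<exists>N. \<forall>m\<ge>N. \<forall>n\<ge>N. l2dist (FI (trunc f m)) (FI (trunc f n)) < e" by blast
qed

lemma nn_integral_l2norm_tendsto_iff:
  assumes "\<And>n. sqi (f n)"
  shows "(\<lambda>n. \<integral>\<^sup>+x. ennreal ((cmod (f n x))\<^sup>2) \<partial>lborel) \<longlonglongrightarrow> 0 \<longleftrightarrow> (\<lambda>n. l2norm (f n)) \<longlonglongrightarrow> 0"
proof -
  have "(\<lambda>n. \<integral>\<^sup>+x. ennreal ((cmod (f n x))\<^sup>2) \<partial>lborel) \<longlonglongrightarrow> 0 \<longleftrightarrow> (\<lambda>n. ennreal ((l2norm (f n))\<^sup>2)) \<longlonglongrightarrow> ennreal 0"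
    by (simp add: nn_integral_l2norm[OF assms])
  also have "\<dots> \<longleftrightarrow> (\<lambda>n. (l2norm (f n))\<^sup>2) \<longlonglongrightarrow> 0"
    by (rule tendsto_ennreal_iff) auto
  also have "\<dots> \<longleftrightarrow> (\<lambda>n. l2norm (f n)) \<longlonglongrightarrow> 0"
  proof
    assume "(\<lambda>n. (l2norm (f n))\<^sup>2) \<longlonglongrightarrow> 0"
    from tendsto_real_sqrt[OF this] show "(\<lambda>n. l2norm (f n)) \<longlonglongrightarrow> 0" by simp
  next
    assume "(\<lambda>n. l2norm (f n)) \<longlonglongrightarrow> 0"
    from tendsto_power[OF this, of 2] show "(\<lambda>n. (l2norm (f n))\<^sup>2) \<longlonglongrightarrow> 0" by simp
  qed
  finally show ?thesis .
qed

lemma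
  assumes f: "sqi f"
  shows sqi_plancherel: "sqi (plancherel f)"
    and plancherel_tendsto: "(\<lambda>n. l2dist (FI (trunc f n)) (plancherel f)) \<longlonglongrightarrow> 0"
proof -
  obtain g where g: "sqi g" "(\<lambda>n. l2dist (FI (trunc f n)) g) \<longlonglongrightarrow> 0" using plancherel_exists[OF f] by blast
  have "sqi (\<lambda>x. FI (trunc f n) x - g x)" for n using g(1) FI_trunc[OF f] by (rule sqi_diff[rotated])
  then have "\<exists>g. sqi g \<and> (\<lambda>n. \<integral>\<^sup>+x. ennreal ((cmod (FI (trunc f n) x - g x))\<^sup>2) \<partial>lborel) \<longlonglongrightarrow> 0"
    using g nn_integral_l2norm_tendsto_iff[of "\<lambda>n x. FI (trunc f n) x - g x"] by blast
  from someI_ex[OF this] have *: "sqi (plancherel f)"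
    "(\<lambda>n. \<integral>\<^sup>+x. ennreal ((cmod (FI (trunc f n) x - plancherel f x))\<^sup>2) \<partial>lborel) \<longlonglongrightarrow> 0"
    by (simp_all add: plancherel_def)
  then show "sqi (plancherel f)" by simp
  show "(\<lambda>n. l2dist (FI (trunc f n)) (plancherel f)) \<longlonglongrightarrow> 0"
    using * FI_trunc[OF f] by (subst (asm) nn_integral_l2norm_tendsto_iff) auto
qed

lemma AE_eq_l2normI:
  assumes "sqi f" "sqi g" "l2dist f g = 0" shows "AE x in lborel. f x = g x"
  using l2norm_eq_0_AE[of "\<lambda>x. f x - g x"] assms by auto

lemma l2norm_AE_eq_0:
  assumes "AE x in lborel. f x = g x" shows "l2dist f g = 0"
proof -
  have "(LINT x|lborel. (cmod (f x - g x))\<^sup>2) = 0" by (rule integral_eq_zero_AE) (use assms in \<open>eventually_elim, simp\<close>)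
  then show ?thesis by (simp add: l2norm_def)
qed

lemma l2norm_le_diff_add:
  assumes "sqi f" "sqi g" shows "l2norm f \<le> l2dist f g + l2norm g" using l2norm_triangle[OF sqi_diff[OF assms] assms(2)] by simp

lemma plancherel_eqI:
  assumes f: "sqi f" and g: "sqi g" and lim: "(\<lambda>n. l2dist (FI (trunc f n)) g) \<longlonglongrightarrow> 0"
  shows "AE x in lborel. plancherel f x = g x"
proof (rule AE_eq_l2normI[OF sqi_plancherel[OF f] g])
  have "(\<lambda>n. l2dist (FI (trunc f n)) (plancherel f) + l2dist (FI (trunc f n)) g) \<longlonglongrightarrow> 0 + 0"
    by (intro tendsto_add plancherel_tendsto f lim)
  moreover have "l2dist (plancherel f) g
     \<le> l2dist (FI (trunc f n)) (plancherel f) + l2dist (FI (trunc f n)) g" for n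
    using l2norm_triangle_via[OF sqi_plancherel[OF f] FI_trunc[OF f] g, of n] by (simp add: l2norm_minus_commute[of "plancherel f"])
  ultimately have "l2dist (plancherel f) g \<le> 0 + 0" by (intro LIMSEQ_le_const) auto
  then show "l2dist (plancherel f) g = 0" using l2norm_nonneg by (simp add: antisym)
qed

lemma plancherel_add:
  assumes f: "sqi f" and g: "sqi g"
  shows "AE z in lborel. plancherel (\<lambda>x. f x + g x) z = plancherel f z + plancherel g z"
proof (rule plancherel_eqI)
  show "(\<lambda>n. l2norm (\<lambda>z. FI (trunc (\<lambda>x. f x + g x) n) z - (plancherel f z + plancherel g z))) \<longlonglongrightarrow> 0"
  proof (rule Lim_null_comparison)
    show "(\<lambda>n. l2dist (FI (trunc f n)) (plancherel f) + l2dist (FI (trunc g n)) (plancherel g)) \<longlonglongrightarrow> 0"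
      using tendsto_add[OF plancherel_tendsto[OF f] plancherel_tendsto[OF g]] by simp
    have "FI (trunc (\<lambda>x. f x + g x) n) z = FI (trunc f n) z + FI (trunc g n) z" for n z
      using FI_add[OF integrable_trunc[OF f] integrable_trunc[OF g], of n n z] by (simp add: trunc_def[abs_def] distrib_left)
    then have "l2norm (\<lambda>z. FI (trunc (\<lambda>x. f x + g x) n) z - (plancherel f z + plancherel g z))
       = l2norm (\<lambda>z. (FI (trunc f n) z - plancherel f z) + (FI (trunc g n) z - plancherel g z))" for n by (intro l2norm_cong) simp
    also have "\<dots> n \<le> l2dist (FI (trunc f n)) (plancherel f) + l2dist (FI (trunc g n)) (plancherel g)" for n
      by (rule l2norm_triangle) (use f g FI_trunc sqi_plancherel in auto)
    finally show "\<forall>\<^sub>F n in sequentially. norm (l2norm (\<lambda>z. FI (trunc (\<lambda>x. f x + g x) n) z - (plancherel f z + plancherel g z)))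
      \<le> l2dist (FI (trunc f n)) (plancherel f) + l2dist (FI (trunc g n)) (plancherel g)" by simp
  qed
qed (use f g sqi_plancherel in auto)

lemma plancherel_mult_left:
  assumes f: "sqi f"
  shows "AE z in lborel. plancherel (\<lambda>x. c * f x) z = c * plancherel f z"
proof (rule plancherel_eqI)
  have "FI (trunc (\<lambda>x. c * f x) n) z = c * FI (trunc f n) z" for n z
    using FI_mult_left[of c "trunc f n" z] by (simp add: trunc_def[abs_def] mult_ac)
  then have "l2norm (\<lambda>z. FI (trunc (\<lambda>x. c * f x) n) z - c * plancherel f z)
     = cmod c * l2dist (FI (trunc f n)) (plancherel f)" for n using l2norm_mult_left[of c "\<lambda>z. FI (trunc f n) z - plancherel f z"]
    by (simp add: right_diff_distrib)
  then show "(\<lambda>n. l2norm (\<lambda>z. FI (trunc (\<lambda>x. c * f x) n) z - c * plancherel f z)) \<longlonglongrightarrow> 0"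
    using plancherel_tendsto[OF f] by (auto intro: tendsto_mult_right_zero)
qed (use f sqi_plancherel in auto)

lemma plancherel_FI:
  assumes f: "integrable lborel f" "sqi f"
  shows "AE z in lborel. plancherel f z = FI f z"
proof (rule plancherel_eqI)
  have "l2dist (FI (trunc f n)) (FI f) = l2norm (FI (\<lambda>x. trunc f n x - f x))" for n
    using f integrable_trunc by (intro l2norm_cong) (simp add: FI_diff)
  also have "\<dots> n = l2dist (trunc f n) f" for n by (rule FI_isometry) (use f integrable_trunc sqi_trunc in auto)
  finally show "(\<lambda>n. l2dist (FI (trunc f n)) (FI f)) \<longlonglongrightarrow> 0" using trunc_tendsto[OF f(2)] by simp
qed (use f FI_contraction in auto)

lemma l2norm_tendsto:
  assumes "\<And>n. sqi (f n)" "sqi g" "(\<lambda>n. l2dist (f n) g) \<longlonglongrightarrow> 0"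
  shows "(\<lambda>n. l2norm (f n)) \<longlonglongrightarrow> l2norm g"
proof -
  have "\<bar>l2norm (f n) - l2norm g\<bar> \<le> l2dist (f n) g" for n
    using l2norm_le_diff_add[OF assms(1)[of n] assms(2)] l2norm_le_diff_add[OF assms(2) assms(1)[of n]]
      l2norm_minus_commute[of g "f n"] by linarith
  then have "(\<lambda>n. l2norm (f n) - l2norm g) \<longlonglongrightarrow> 0" by (intro Lim_null_comparison[OF _ assms(3)]) auto
  then show ?thesis by (simp add: LIM_zero_iff)
qed

lemma l2norm_plancherel [simp]:
  assumes f: "sqi f" shows "l2norm (plancherel f) = l2norm f"
proof -
  have "(\<lambda>n. l2norm (FI (trunc f n))) \<longlonglongrightarrow> l2norm (plancherel f)"
    by (rule l2norm_tendsto[OF _ _ plancherel_tendsto[OF f]]) (use f FI_trunc sqi_plancherel in auto)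
  moreover have "l2norm (FI (trunc f n)) = l2norm (trunc f n)" for n by (rule FI_isometry) (use f integrable_trunc sqi_trunc in auto)
  moreover have "(\<lambda>n. l2norm (trunc f n)) \<longlonglongrightarrow> l2norm f"
    by (rule l2norm_tendsto[OF _ _ trunc_tendsto[OF f]]) (use f sqi_trunc in auto)
  ultimately show ?thesis by (metis (no_types, lifting) LIMSEQ_unique ext)
qed

lemma plancherel_cong_AE:
  assumes "AE x in lborel. f x = g x" and f: "sqi f" and g: "sqi g"
  shows "AE z in lborel. plancherel f z = plancherel g z"
proof -
  have *: "sqi (\<lambda>x. f x - g x)" using f g by auto
  have "l2norm (plancherel (\<lambda>x. f x - g x)) = 0" using l2norm_AE_eq_0[OF assms(1)] * by simp
  then have "AE z in lborel. plancherel (\<lambda>x. f x - g x) z = 0" using l2norm_eq_0_AE sqi_plancherel[OF *] by blast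
  moreover have "AE z in lborel. plancherel (\<lambda>x. (f x - g x) + g x) z = plancherel (\<lambda>x. f x - g x) z + plancherel g z"
    by (rule plancherel_add[OF * g])
  ultimately show ?thesis by eventually_elim simp
qed

lemma l2_pairing_tendsto:
  assumes f: "\<And>n. sqi (f n)" "sqi f'" "(\<lambda>n. l2dist (f n) f') \<longlonglongrightarrow> 0"
    and g: "\<And>n. sqi (g n)" "sqi g'" "(\<lambda>n. l2dist (g n) g') \<longlonglongrightarrow> 0"
  shows "(\<lambda>n. LINT x|lborel. f n x * g n x) \<longlonglongrightarrow> (LINT x|lborel. f' x * g' x)"
proof -
  have d: "sqi (\<lambda>x. f n x - f' x)" "sqi (\<lambda>x. g n x - g' x)" for n using f g by auto
  have bound: "cmod ((LINT x|lborel. f n x * g n x) - (LINT x|lborel. f' x * g' x))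
     \<le> l2dist (f n) f' * l2norm (g n) + l2norm f' * l2dist (g n) g'" for n
  proof -
    have "(LINT x|lborel. f n x * g n x) - (LINT x|lborel. f' x * g' x)
       = (LINT x|lborel. f n x * g n x - f' x * g' x)"
      using f g by (intro LINT_diff[symmetric] sqi_mult_integrable)
    also have "\<dots> = (LINT x|lborel. (f n x - f' x) * g n x + f' x * (g n x - g' x))" by (simp add: algebra_simps)
    also have "\<dots> = (LINT x|lborel. (f n x - f' x) * g n x) + (LINT x|lborel. f' x * (g n x - g' x))"
      using f g d by (intro LINT_add sqi_mult_integrable)
    finally have eq: "(LINT x|lborel. f n x * g n x) - (LINT x|lborel. f' x * g' x)
       = (LINT x|lborel. (f n x - f' x) * g n x) + (LINT x|lborel. f' x * (g n x - g' x))" .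
    show ?thesis unfolding eq using norm_triangle_ineq[of "LINT x|lborel. (f n x - f' x) * g n x" "LINT x|lborel. f' x * (g n x - g' x)"]
        l2norm_Cauchy_Schwarz_complex[OF d(1) g(1), of n n] l2norm_Cauchy_Schwarz_complex[OF f(2) d(2), of n] by linarith
  qed
  have "(\<lambda>n. l2dist (f n) f' * l2norm (g n) + l2norm f' * l2dist (g n) g') \<longlonglongrightarrow> 0 * l2norm g' + l2norm f' * 0"
    by (intro tendsto_add tendsto_mult f(3) g(3) l2norm_tendsto[OF g] tendsto_const)
  then have lim: "(\<lambda>n. l2dist (f n) f' * l2norm (g n) + l2norm f' * l2dist (g n) g') \<longlonglongrightarrow> 0" by simp
  show ?thesis by (rule iffD1[OF LIM_zero_iff], rule Lim_null_comparison[OF _ lim], rule always_eventually, rule allI, rule bound)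
qed

lemma plancherel_multiplication:
  assumes f: "sqi f" and g: "sqi g"
  shows "(LINT z|lborel. plancherel f z * g z) = (LINT x|lborel. f x * plancherel g x)"
proof (rule LIMSEQ_unique)
  show "(\<lambda>n. LINT z|lborel. FI (trunc f n) z * trunc g n z) \<longlonglongrightarrow> (LINT z|lborel. plancherel f z * g z)"
    by (intro l2_pairing_tendsto plancherel_tendsto trunc_tendsto FI_trunc sqi_trunc sqi_plancherel f g)
  have "(\<lambda>n. LINT x|lborel. trunc f n x * FI (trunc g n) x) \<longlonglongrightarrow> (LINT x|lborel. f x * plancherel g x)"
    by (intro l2_pairing_tendsto plancherel_tendsto trunc_tendsto FI_trunc sqi_trunc sqi_plancherel f g)
  then show "(\<lambda>n. LINT z|lborel. FI (trunc f n) z * trunc g n z) \<longlonglongrightarrow> (LINT x|lborel. f x * plancherel g x)"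
    by (simp add: FI_multiplication integrable_trunc f g)
qed

text \<open>Polarisation: expanding the norm of the sum of \<open>f\<close> and \<open>g\<close>
  gives the real part, and the same with \<open>\<i> * g\<close> in place of \<open>g\<close> gives
  the imaginary part.\<close>

lemma plancherel_parseval:
  assumes f: "sqi f" and g: "sqi g"
  shows "(LINT z|lborel. plancherel f z * cnj (plancherel g z)) = (LINT x|lborel. f x * cnj (g x))"
proof -
  have Re: "Re (LINT z|lborel. plancherel f z * cnj (plancherel g z)) = Re (LINT x|lborel. f x * cnj (g x))"
    if g: "sqi g" for g
  proof -
    have "(l2norm (\<lambda>z. plancherel f z + plancherel g z))\<^sup>2 = (l2norm (plancherel (\<lambda>x. f x + g x)))\<^sup>2"
      using plancherel_add[OF f g] f g by (intro arg_cong[where f="\<lambda>x. x\<^sup>2"] l2norm_cong_AE)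
        (auto intro!: sqi_measurable sqi_plancherel sqi_add)
    also have "\<dots> = (l2norm (\<lambda>x. f x + g x))\<^sup>2" using f g by (simp add: sqi_add)
    finally show ?thesis using l2norm_add_square[OF sqi_plancherel[OF f] sqi_plancherel[OF g]] l2norm_add_square[OF f g] f g by simp
  qed
  have ig: "sqi (\<lambda>x. \<i> * g x)" using g by auto
  have "(LINT z|lborel. plancherel f z * cnj (plancherel (\<lambda>x. \<i> * g x) z))
      = (LINT z|lborel. - \<i> * (plancherel f z * cnj (plancherel g z)))"
    using plancherel_mult_left[OF g, of \<i>] sqi_plancherel[OF f] sqi_plancherel[OF g] sqi_plancherel[OF ig]
    by (intro integral_cong_AE) (auto elim!: eventually_mono)
  also have "\<dots> = - \<i> * (LINT z|lborel. plancherel f z * cnj (plancherel g z))" by (rule integral_mult_right_zero)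
  finally have "Re (- \<i> * (LINT z|lborel. plancherel f z * cnj (plancherel g z)))
      = Re (LINT x|lborel. - \<i> * (f x * cnj (g x)))" using Re[OF ig] by (simp add: mult_ac)
  then have "Im (LINT z|lborel. plancherel f z * cnj (plancherel g z)) = Im (LINT x|lborel. f x * cnj (g x))"
    unfolding integral_mult_right_zero by simp
  with Re[OF g] show ?thesis by (rule complex_eqI)
qed

text \<open>The inverse transform in the form conjugation, transform, conjugation. By the
  multiplication formula and Parseval's identity the difference of the two sides pairs to 0 with
  every square-integrable function, in particular with its own conjugate.\<close>

lemma plancherel_inversion:
  assumes f: "sqi f"
  shows "AE x in lborel. plancherel (\<lambda>z. cnj (plancherel f z)) x = cnj (f x)"
proof (rule AE_eq_l2normI)
  have c: "sqi (\<lambda>z. cnj (plancherel f z))" using sqi_plancherel[OF f] by auto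
  show s: "sqi (plancherel (\<lambda>z. cnj (plancherel f z)))" "sqi (\<lambda>x. cnj (f x))" using sqi_plancherel[OF c] f by auto
  define d where "d x = plancherel (\<lambda>z. cnj (plancherel f z)) x - cnj (f x)" for x
  have d: "sqi d" unfolding d_def using s by auto
  have pair: "(LINT x|lborel. d x * g x) = 0" if g: "sqi g" for g
  proof -
    have "(LINT x|lborel. plancherel (\<lambda>z. cnj (plancherel f z)) x * g x)
       = (LINT z|lborel. cnj (plancherel f z * cnj (plancherel g z)))" using plancherel_multiplication[OF c g] by simp
    also have "\<dots> = cnj (LINT x|lborel. f x * cnj (g x))"
      by (simp only: Bochner_Integration.integral_cnj plancherel_parseval[OF f g])
    also have "\<dots> = (LINT x|lborel. cnj (f x) * g x)" by (simp flip: Bochner_Integration.integral_cnj)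
    finally show ?thesis unfolding d_def left_diff_distrib
      by (subst LINT_diff) (use s g in \<open>auto intro: sqi_mult_integrable\<close>)
  qed
  have "of_real ((l2norm d)\<^sup>2) = (LINT x|lborel. d x * cnj (d x))"
    by (simp only: l2norm_square complex_norm_square[symmetric] integral_complex_of_real)
  also have "\<dots> = 0" using pair[of "\<lambda>x. cnj (d x)"] d by auto
  finally have "l2norm d = 0" by simp
  then show "l2norm (\<lambda>x. plancherel (\<lambda>z. cnj (plancherel f z)) x - cnj (f x)) = 0" by (simp add: d_def[abs_def])
qed

section \<open>The Fourier transform of real functions\<close>

definition herm :: "cfun \<Rightarrow> bool" where
  "herm a \<longleftrightarrow> (\<forall>x. a (- x) = cnj (a x))"

text \<open>\<^const>\<open>fourier\<close> is Hermitian only up to a null set; symmetrising it gives a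
  representative that is Hermitian everywhere.\<close>

definition ft :: "(plane \<Rightarrow> real) \<Rightarrow> cfun" where
  "ft f x = (fourier f x + cnj (fourier f (- x))) / 2"

lemma sqi_of_real: "sqi (\<lambda>x. complex_of_real (f x)) \<longleftrightarrow> square_integrable f"
proof
  assume "sqi (\<lambda>x. complex_of_real (f x))"
  then have "integrable lborel (\<lambda>x. (f x)\<^sup>2)" and m: "(\<lambda>x. complex_of_real (f x)) \<in> borel_measurable borel"
    by (auto simp: square_integrable_def)
  moreover have "f \<in> borel_measurable borel" using measurable_compose[OF m borel_measurable_Re] by simp
  ultimately show "square_integrable f" by (simp add: square_integrable_def)
qed (auto simp: square_integrable_def)

lemma herm_ft: "herm (ft f)" by (simp add: herm_def ft_def add.commute)

lemma sqi_fourier: "square_integrable f \<Longrightarrow> sqi (fourier f)" by (simp add: fourier_plancherel sqi_plancherel sqi_of_real)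

text \<open>Real truncations have exactly Hermitian Fourier integrals, so the reflected conjugate of
  their L2 limit is again a limit, and limits agree almost everywhere.\<close>

lemma fourier_ft_AE:
  assumes f: "square_integrable f" shows "AE z in lborel. fourier f z = ft f z"
proof -
  let ?f = "\<lambda>x. of_real (f x)"
  have f': "sqi ?f" using f by (simp add: sqi_of_real)
  have F: "sqi (\<lambda>z. cnj (plancherel ?f (- z)))" using sqi_cnj[OF sqi_reflect[OF sqi_plancherel[OF f'], of 0]] by simp
  have "cnj (trunc ?f n x) = trunc ?f n x" for n x by (simp add: trunc_def indicator_def of_bool_def)
  then have FI: "FI (trunc ?f n) z = cnj (FI (trunc ?f n) (- z))" for n z
    unfolding FI_def by (simp add: exp_cnj flip: Bochner_Integration.integral_cnj)
  have "l2norm (\<lambda>z. FI (trunc ?f n) z - cnj (plancherel ?f (- z)))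
     = l2dist (FI (trunc ?f n)) (plancherel ?f)" for n
  proof -
    have "l2norm (\<lambda>z. FI (trunc ?f n) z - cnj (plancherel ?f (- z)))
       = l2norm (\<lambda>z. cnj (FI (trunc ?f n) (0 - z) - plancherel ?f (0 - z)))"
      by (intro l2norm_cong) (simp add: FI[of n, symmetric])
    also have "\<dots> = l2norm (\<lambda>z. FI (trunc ?f n) (0 - z) - plancherel ?f (0 - z))" by (rule l2norm_cnj)
    also have "\<dots> = l2dist (FI (trunc ?f n)) (plancherel ?f)"
      by (rule l2norm_reflect[of "\<lambda>z. FI (trunc ?f n) z - plancherel ?f z"])
        (use FI_trunc[OF f'] sqi_plancherel[OF f'] in auto)
    finally show ?thesis .
  qed
  then have "AE z in lborel. plancherel ?f z = cnj (plancherel ?f (- z))"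
    using plancherel_tendsto[OF f'] by (intro plancherel_eqI f' F) simp
  then show ?thesis by eventually_elim (simp add: ft_def fourier_plancherel)
qed

lemma sqi_ft: "square_integrable f \<Longrightarrow> sqi (ft f)"
proof -
  assume f: "square_integrable f"
  have "sqi (\<lambda>x. (1/2) * (fourier f x + cnj (fourier f (0 - x))))"
    by (intro sqi_mult_left sqi_add sqi_cnj sqi_reflect sqi_fourier f)
  then show "sqi (ft f)" by (simp add: ft_def[abs_def])
qed

lemma square_integrable_sum:
  fixes F :: "'i \<Rightarrow> plane \<Rightarrow> real"
  assumes "\<And>i. i \<in> A \<Longrightarrow> square_integrable (F i)"
  shows "square_integrable (\<lambda>x. \<Sum>i\<in>A. c i * F i x)"
proof -
  have "sqi (\<lambda>x. \<Sum>i\<in>A. of_real (c i) * of_real (F i x))"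
    using assms by (intro sqi_sum sqi_mult_left) (simp add: sqi_of_real)
  then show ?thesis by (simp flip: sqi_of_real)
qed

lemma fourier_sum:
  assumes "finite A" "\<And>i. i \<in> A \<Longrightarrow> square_integrable (F i)"
  shows "AE z in lborel. fourier (\<lambda>x. \<Sum>i\<in>A. c i * F i x) z = (\<Sum>i\<in>A. of_real (c i) * fourier (F i) z)"
  using assms
proof (induction A)
  case empty
  have "AE z in lborel. plancherel (\<lambda>x. 0 * 0) z = 0 * plancherel (\<lambda>x. 0) z" by (rule plancherel_mult_left) simp
  then show ?case by (simp add: fourier_plancherel)
next
  case (insert i A)
  have sq: "sqi (\<lambda>x. of_real (F j x))" if "j \<in> insert i A" for j using insert.prems that by (simp add: sqi_of_real)
  have "AE z in lborel. plancherel (\<lambda>x. of_real (c i) * of_real (F i x)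
      + (\<Sum>j\<in>A. of_real (c j) * of_real (F j x))) z
     = plancherel (\<lambda>x. of_real (c i) * of_real (F i x)) z
      + plancherel (\<lambda>x. \<Sum>j\<in>A. of_real (c j) * of_real (F j x)) z"
    using sq by (intro plancherel_add sqi_mult_left sqi_sum) auto
  moreover have "AE z in lborel. plancherel (\<lambda>x. of_real (c i) * of_real (F i x)) z
     = of_real (c i) * plancherel (\<lambda>x. of_real (F i x)) z" using sq by (intro plancherel_mult_left) auto
  moreover have "AE z in lborel. fourier (\<lambda>x. \<Sum>i\<in>A. c i * F i x) z = (\<Sum>i\<in>A. of_real (c i) * fourier (F i) z)"
    by (rule insert.IH) (use insert.prems in auto)
  ultimately show ?case by eventually_elim (use insert.hyps in \<open>simp add: fourier_plancherel\<close>)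
qed

lemma ft_sum:
  assumes "finite A" "\<And>i. i \<in> A \<Longrightarrow> square_integrable (F i)"
  shows "AE z in lborel. ft (\<lambda>x. \<Sum>i\<in>A. c i * F i x) z = (\<Sum>i\<in>A. of_real (c i) * ft (F i) z)"
proof -
  have "AE z in lborel. \<forall>i\<in>A. fourier (F i) z = ft (F i) z" using assms fourier_ft_AE by (intro AE_finite_allI) auto
  moreover have "AE z in lborel. fourier (\<lambda>x. \<Sum>i\<in>A. c i * F i x) z = (\<Sum>i\<in>A. of_real (c i) * fourier (F i) z)"
    by (rule fourier_sum) (use assms in auto)
  moreover have "AE z in lborel. fourier (\<lambda>x. \<Sum>i\<in>A. c i * F i x) z = ft (\<lambda>x. \<Sum>i\<in>A. c i * F i x) z"
    by (intro fourier_ft_AE square_integrable_sum assms)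
  ultimately show ?thesis by eventually_elim (auto intro!: sum.cong)
qed

lemma square_integrable_diff:
  fixes f g :: "plane \<Rightarrow> real"
  assumes "square_integrable f" "square_integrable g" shows "square_integrable (\<lambda>x. f x - g x)"
  using square_integrable_sum[of UNIV "\<lambda>b. if b then f else g" "\<lambda>b. if b then 1 else -1"] assms by (simp add: UNIV_bool)

lemma ft_diff:
  assumes "square_integrable f" "square_integrable g"
  shows "AE z in lborel. ft (\<lambda>x. f x - g x) z = ft f z - ft g z"
  using ft_sum[of UNIV "\<lambda>b. if b then f else g" "\<lambda>b. if b then 1 else -1"] assms by (simp add: UNIV_bool)

lemma fourier_cong_AE:
  assumes "AE x in lborel. f x = g x" "square_integrable f" "square_integrable g"
  shows "AE z in lborel. fourier f z = fourier g z" unfolding fourier_plancherel using assms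
  by (intro plancherel_cong_AE) (auto simp: sqi_of_real elim: eventually_mono)

text \<open>The inverse transform of \<open>a\<close> has a real part \<open>f\<close> and an
  imaginary part \<open>g\<close>, whence \<open>a\<close> is \<open>ft f\<close> plus
  \<open>\<i>\<close> times \<open>ft g\<close>. Both transforms being Hermitian, the symmetry of
  \<open>a\<close> forces \<open>ft g\<close> to vanish. This is the source of all real functions
  with a prescribed transform.\<close>

lemma herm_imp_fourier:
  assumes a: "sqi a" "herm a"
  shows "\<exists>f. square_integrable f \<and> (AE z in lborel. fourier f z = a z)"
proof -
  have ca: "sqi (\<lambda>z. cnj (a z))" using a by auto
  define F where "F x = cnj (plancherel (\<lambda>z. cnj (a z)) x)" for x
  have F: "sqi F" unfolding F_def using sqi_plancherel[OF ca] by auto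
  define f g where "f x = Re (F x)" and "g x = Im (F x)" for x
  have [measurable]: "F \<in> borel_measurable borel" using F by auto
  have "sqi (\<lambda>x. of_real (f x))" "sqi (\<lambda>x. of_real (g x))" by (rule sqi_dominated[OF F, of _ 1];
        simp add: f_def[abs_def] g_def[abs_def] abs_Re_le_cmod abs_Im_le_cmod)+
  then have f: "square_integrable f" and g: "square_integrable g"
    and fg: "sqi (\<lambda>x. of_real (f x))" "sqi (\<lambda>x. of_real (g x))" by (simp_all add: sqi_of_real)
  have "F = (\<lambda>x. of_real (f x) + \<i> * of_real (g x))" by (simp add: fun_eq_iff f_def g_def complex_eq)
  then have "AE z in lborel. plancherel F z = plancherel (\<lambda>x. of_real (f x)) z
      + plancherel (\<lambda>x. \<i> * of_real (g x)) z" using plancherel_add[OF fg(1) sqi_mult_left[OF fg(2), of \<i>]] by simp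
  moreover have "AE z in lborel. plancherel F z = cnj (cnj (a z))" unfolding F_def by (rule plancherel_inversion[OF ca])
  moreover have "AE z in lborel. plancherel (\<lambda>x. \<i> * of_real (g x)) z
      = \<i> * plancherel (\<lambda>x. of_real (g x)) z" by (rule plancherel_mult_left[OF fg(2)])
  ultimately have *: "AE z in lborel. a z = ft f z + \<i> * ft g z"
    using fourier_ft_AE[OF f] fourier_ft_AE[OF g] by eventually_elim (simp add: fourier_plancherel)
  have "AE z in lborel. a (0 - z) = ft f (0 - z) + \<i> * ft g (0 - z)" by (rule AE_reflect_plane[OF *])
  with * have "AE z in lborel. ft g z = 0"
  proof eventually_elim
    case (elim z)
    have "cnj (ft f z + \<i> * ft g z) = cnj (ft f z) + \<i> * cnj (ft g z)"
      using elim a(2) herm_ft[of f] herm_ft[of g] by (simp add: herm_def)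
    then show ?case by (simp add: complex_eq_iff)
  qed
  with * have "AE z in lborel. fourier f z = a z" using fourier_ft_AE[OF f] by eventually_elim simp
  with f show ?thesis by blast
qed

section \<open>Convolution theorem and Fourier transforms of products\<close>

lemma integrable_pair_conv:
  fixes a b :: "cfun"
  assumes a: "integrable lborel a" and b: "integrable lborel b"
  shows "integrable (lborel \<Otimes>\<^sub>M lborel) (\<lambda>(x, y). a (x - y) * b y)"
proof (rule integrableI_bounded)
  have [measurable]: "a \<in> borel_measurable borel" "b \<in> borel_measurable borel" using a b by auto
  show "(\<lambda>(x, y). a (x - y) * b y) \<in> borel_measurable (lborel \<Otimes>\<^sub>M lborel)" by measurable
  have "(\<integral>\<^sup>+p. ennreal (norm (case p of (x, y) \<Rightarrow> a (x - y) * b y)) \<partial>(lborel \<Otimes>\<^sub>M lborel))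
     = (\<integral>\<^sup>+y. \<integral>\<^sup>+x. ennreal (cmod (a (x - y) * b y)) \<partial>lborel \<partial>lborel)"
    by (subst lborel_pair.nn_integral_snd[symmetric]) auto
  also have "\<dots> = (\<integral>\<^sup>+y. (\<integral>\<^sup>+x. ennreal (cmod (a x)) \<partial>lborel) * ennreal (cmod (b y)) \<partial>lborel)"
  proof (rule nn_integral_cong)
    fix y
    have "(\<integral>\<^sup>+x. ennreal (cmod (a (x - y) * b y)) \<partial>lborel)
       = (\<integral>\<^sup>+x. ennreal (cmod (a (x - y))) * ennreal (cmod (b y)) \<partial>lborel)" by (simp add: norm_mult ennreal_mult)
    also have "\<dots> = (\<integral>\<^sup>+x. ennreal (cmod (a (x - y))) \<partial>lborel) * ennreal (cmod (b y))"
      by (rule nn_integral_multc) simp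
    finally show "(\<integral>\<^sup>+x. ennreal (cmod (a (x - y) * b y)) \<partial>lborel)
       = (\<integral>\<^sup>+x. ennreal (cmod (a x)) \<partial>lborel) * ennreal (cmod (b y))"
      by (simp add: nn_integral_translate_plane[of "\<lambda>x. ennreal (cmod (a x))"])
  qed
  also have "\<dots> = (\<integral>\<^sup>+x. ennreal (cmod (a x)) \<partial>lborel) * (\<integral>\<^sup>+y. ennreal (cmod (b y)) \<partial>lborel)"
    by (rule nn_integral_cmult) simp
  also have "\<dots> < \<infinity>" using a b by (auto simp: integrable_iff_bounded ennreal_mult_less_top)
  finally show "(\<integral>\<^sup>+p. ennreal (norm (case p of (x, y) \<Rightarrow> a (x - y) * b y)) \<partial>(lborel \<Otimes>\<^sub>M lborel)) < \<infinity>" .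
qed

lemma integrable_conv:
  assumes a: "integrable lborel a" and b: "integrable lborel b"
  shows "integrable lborel (conv a b)"
  unfolding conv_def[abs_def] using lborel_pair.integrable_fst[OF integrable_pair_conv[OF a b]] by simp

lemma FI_conv:
  assumes a: "integrable lborel a" and b: "integrable lborel b"
  shows "FI (conv a b) x = 2 * pi * FI a x * FI b x"
proof -
  have [measurable]: "a \<in> borel_measurable borel" "b \<in> borel_measurable borel" using a b by auto
  let ?e = "\<lambda>z. exp (- \<i> * of_real (z \<bullet> x))"
  have int: "integrable (lborel \<Otimes>\<^sub>M lborel) (\<lambda>(z, y). a (z - y) * b y * ?e z)"
    by (rule integrable_dominated[OF integrable_pair_conv[OF a b]])
      (auto simp: norm_mult)
  have "(LINT z|lborel. conv a b z * ?e z) = (LINT z|lborel. LINT y|lborel. a (z - y) * b y * ?e z)"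
    by (simp add: conv_def flip: integral_mult_left_zero)
  also have "\<dots> = (LINT y|lborel. LINT z|lborel. a (z - y) * b y * ?e z)" by (rule lborel_pair.Fubini_integral[OF int, symmetric])
  also have "\<dots> = (LINT y|lborel. (LINT z|lborel. a z * ?e z) * (b y * ?e y))"
  proof (intro LINT_cong refl)
    fix y
    have "(LINT z|lborel. a (z - y) * b y * ?e z)
       = (LINT z|lborel. (a (z - y) * ?e (z - y)) * (b y * ?e y))" by (intro LINT_cong refl)
        (simp add: inner_diff_left mult_ac flip: exp_add, simp add: algebra_simps)
    also have "\<dots> = (LINT z|lborel. a (z - y) * ?e (z - y)) * (b y * ?e y)" by (rule integral_mult_left_zero)
    also have "(LINT z|lborel. a (z - y) * ?e (z - y)) = (LINT z|lborel. a z * ?e z)" by (rule integral_translate_plane) measurable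
    finally show "(LINT z|lborel. a (z - y) * b y * ?e z) = (LINT z|lborel. a z * ?e z) * (b y * ?e y)" .
  qed
  also have "\<dots> = (LINT z|lborel. a z * ?e z) * (LINT y|lborel. b y * ?e y)" by (rule integral_mult_right_zero)
  finally show ?thesis by (simp add: FI_def field_simps)
qed

lemma fourier_inversion:
  assumes f: "square_integrable f" and a: "AE z in lborel. fourier f z = a z" and L1: "integrable lborel a" "sqi a"
  shows "AE x in lborel. of_real (f x) = FI (\<lambda>z. cnj (a z)) x"
proof -
  have f': "sqi (\<lambda>x. of_real (f x))" using f by (simp add: sqi_of_real)
  have "AE x in lborel. plancherel (\<lambda>z. cnj (plancherel (\<lambda>x. of_real (f x)) z)) x
      = plancherel (\<lambda>z. cnj (a z)) x" by (rule plancherel_cong_AE)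
      (use a L1 sqi_plancherel[OF f'] in \<open>auto simp: fourier_plancherel elim: eventually_mono\<close>)
  moreover note plancherel_inversion[OF f']
  moreover have "AE x in lborel. plancherel (\<lambda>z. cnj (a z)) x = FI (\<lambda>z. cnj (a z)) x"
    by (rule plancherel_FI) (use L1 in auto)
  ultimately show ?thesis by eventually_elim simp
qed

text \<open>Inversion expresses both functions as Fourier integrals of integrable functions; the
  product of these is the Fourier integral of a convolution, and a second inversion reads off its
  transform. Hence both L1 and L2 are demanded of the transforms.\<close>

lemma fourier_product:
  assumes f: "square_integrable f" "AE z in lborel. fourier f z = a z" and a: "integrable lborel a" "sqi a"
    and g: "square_integrable g" "AE z in lborel. fourier g z = b z" and b: "integrable lborel b" "sqi b"
  shows "square_integrable (\<lambda>x. f x * g x)" and "AE z in lborel. fourier (\<lambda>x. f x * g x) z = conv a b z / (2 * pi)"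
proof -
  have [measurable]: "a \<in> borel_measurable borel" "b \<in> borel_measurable borel"
    "f \<in> borel_measurable borel" "g \<in> borel_measurable borel" using a b f(1) g(1) by (auto simp: square_integrable_def)
  define h where "h x = FI (\<lambda>z. cnj (a z)) x * FI (\<lambda>z. cnj (b z)) x" for x
  have fg: "AE x in lborel. of_real (f x * g x) = h x"
    using fourier_inversion[OF f a] fourier_inversion[OF g b] by eventually_elim (simp add: h_def)
  define q where "q z = conv a b z / (2 * pi)" for z
  have q: "integrable lborel q" "sqi q"
    unfolding q_def using integrable_conv[OF a(1) b(1)] sqi_mult_left[OF sqi_conv[OF a(1) b(2)], of "1 / (2 * pi)"] by auto
  have hq: "h x = FI (\<lambda>z. cnj (q z)) x" for x
  proof -
    have "cnj (q z) = (1 / (2 * pi)) * conv (\<lambda>z. cnj (a z)) (\<lambda>z. cnj (b z)) z" for z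
      by (simp add: q_def conv_def flip: Bochner_Integration.integral_cnj)
    then have "FI (\<lambda>z. cnj (q z)) x = (1 / (2 * pi)) * FI (conv (\<lambda>z. cnj (a z)) (\<lambda>z. cnj (b z))) x"
      by (simp only: FI_mult_left)
    also have "\<dots> = h x" using a b by (subst FI_conv) (auto simp: h_def)
    finally show ?thesis by simp
  qed
  have h: "sqi h" unfolding hq[abs_def] by (rule FI_contraction) (use q in auto)
  have sq: "sqi (\<lambda>x. of_real (f x * g x))" by (rule sqi_cong_AE[OF _ h]) (use fg in \<open>auto elim: eventually_mono\<close>)
  then show "square_integrable (\<lambda>x. f x * g x)" by (simp only: sqi_of_real)
  have cq: "sqi (\<lambda>z. cnj (q z))" using q by auto
  have "AE x in lborel. plancherel (\<lambda>z. cnj (q z)) x = FI (\<lambda>z. cnj (q z)) x"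
    by (rule plancherel_FI[OF _ cq]) (use q in auto)
  with fg have "AE x in lborel. of_real (f x * g x) = cnj (plancherel (\<lambda>z. cnj (q z)) x)"
  proof eventually_elim
    case (elim x)
    then have "plancherel (\<lambda>z. cnj (q z)) x = of_real (f x * g x)" by (simp add: hq)
    then show ?case by simp
  qed
  then have "AE z in lborel. plancherel (\<lambda>x. of_real (f x * g x)) z
      = plancherel (\<lambda>x. cnj (plancherel (\<lambda>z. cnj (q z)) x)) z"
    by (rule plancherel_cong_AE) (use sq sqi_plancherel[OF cq] in auto)
  with plancherel_inversion[OF cq] show "AE z in lborel. fourier (\<lambda>x. f x * g x) z = conv a b z / (2 * pi)"
    by eventually_elim (simp add: fourier_plancherel q_def)
qed

section \<open>Weighted spaces\<close>

text \<open>The Japanese bracket, comparable to \<open>1 + norm x\<close>.\<close>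

definition jb :: "plane \<Rightarrow> real" where "jb x = sqrt (1 + (norm x)\<^sup>2)"

lemma jb_ge_1: "1 \<le> jb x" by (simp add: jb_def)

lemma jb_pos [simp]: "0 < jb x" "0 \<le> jb x" "jb x \<noteq> 0" "\<not> jb x < 0" using jb_ge_1[of x] by linarith+

lemma norm_le_jb: "norm x \<le> jb x" unfolding jb_def by (rule real_le_rsqrt) simp

lemma borel_measurable_jb [measurable]: "jb \<in> borel_measurable borel" unfolding jb_def[abs_def] by measurable

lemma jb_powr_square: "(jb x powr s)\<^sup>2 = (1 + (norm x)\<^sup>2) powr s"
proof -
  have "(1 + (norm x)\<^sup>2) powr s = (jb x * jb x) powr s" by (simp add: jb_def flip: power2_eq_square)
  then show ?thesis by (simp add: powr_mult power2_eq_square)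
qed

lemma jb_powr_mono: "k \<le> m \<Longrightarrow> jb x powr k \<le> jb x powr m" by (rule powr_mono[OF _ jb_ge_1])

lemma jb_add_le: "jb (x + y) \<le> jb x + norm y"
proof -
  have "(norm (x + y))\<^sup>2 \<le> (norm x + norm y)\<^sup>2" by (intro power_mono norm_triangle_ineq) simp
  moreover have "norm x * norm y \<le> jb x * norm y" by (intro mult_right_mono norm_le_jb) simp
  ultimately have "1 + (norm (x + y))\<^sup>2 \<le> (jb x + norm y)\<^sup>2" by (simp add: power2_sum jb_def)
  then show ?thesis unfolding jb_def[of "x + y"] by (intro real_le_lsqrt) (auto simp: add_nonneg_nonneg)
qed

lemma jb_le_split: "jb x \<le> jb (x - y) + jb y" using jb_add_le[of "x - y" y] norm_le_jb[of y] by simp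

lemma jb_lipschitz: "\<bar>jb x - jb y\<bar> \<le> norm (x - y)"
  using jb_add_le[of y "x - y"] jb_add_le[of x "y - x"] by (simp add: norm_minus_commute)

lemma sum_powr_le:
  fixes a b m :: real assumes "0 \<le> m" "0 \<le> a" "0 \<le> b"
  shows "(a + b) powr m \<le> 2 powr m * (a powr m + b powr m)"
proof -
  have "(a + b) powr m \<le> (2 * max a b) powr m" using assms by (intro powr_mono2) auto
  also have "\<dots> = 2 powr m * (max a b) powr m" using assms by (simp add: powr_mult)
  also have "(max a b) powr m \<le> a powr m + b powr m" by (auto simp: max_def)
  finally show ?thesis by simp
qed

lemma jb_powr_split:
  assumes "0 \<le> m" shows "jb x powr m \<le> 2 powr m * (jb (x - y) powr m + jb y powr m)"
proof -
  have "jb x powr m \<le> (jb (x - y) + jb y) powr m" using assms by (intro powr_mono2 jb_le_split) auto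
  also have "\<dots> \<le> 2 powr m * (jb (x - y) powr m + jb y powr m)" using assms by (intro sum_powr_le) auto
  finally show ?thesis .
qed

lemma jb_powr_submult:
  assumes "0 \<le> m" shows "jb x powr m \<le> 2 powr m * (jb (x - y) powr m * jb y powr m)"
proof -
  have "jb x \<le> 2 * (jb (x - y) * jb y)"
  proof -
    have "jb (x - y) * 1 \<le> jb (x - y) * jb y" "1 * jb y \<le> jb (x - y) * jb y"
      using jb_ge_1 by (intro mult_left_mono mult_right_mono; simp)+
    then show ?thesis using jb_le_split[of x y] by linarith
  qed
  then have "jb x powr m \<le> (2 * (jb (x - y) * jb y)) powr m" using assms by (intro powr_mono2) auto
  then show ?thesis by (simp add: powr_mult)
qed

lemma powr_diff_le:
  fixes a b m :: real assumes "1 \<le> m" "0 < a" "0 < b"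
  shows "\<bar>a powr m - b powr m\<bar> \<le> m * \<bar>a - b\<bar> * (max a b) powr (m - 1)"
proof -
  have *: "b powr m - a powr m \<le> m * (b - a) * b powr (m - 1)" if ab: "0 < a" "a < b" for a b :: real
  proof -
    have "\<exists>z>a. z < b \<and> b powr m - a powr m = (b - a) * (m * z powr (m - 1))"
      using ab by (intro MVT2) (auto intro!: DERIV_fun_powr[where g="\<lambda>x. x", simplified] derivative_eq_intros)
    then obtain z where z: "a < z" "z < b" "b powr m - a powr m = (b - a) * (m * z powr (m - 1))" by blast
    have "z powr (m - 1) \<le> b powr (m - 1)" using z ab assms(1) by (intro powr_mono2) auto
    then have "(b - a) * (m * z powr (m - 1)) \<le> (b - a) * (m * b powr (m - 1))" using ab assms(1) by (intro mult_left_mono) auto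
    then show ?thesis using z(3) by (simp add: mult_ac)
  qed
  consider "a < b" | "a = b" | "b < a" by linarith
  then show ?thesis
  proof cases
    case 1
    moreover have "a powr m \<le> b powr m" using 1 assms by (intro powr_mono2) auto
    ultimately show ?thesis using *[of a b] assms by (simp add: max_def)
  next
    case 3
    moreover have "b powr m \<le> a powr m" using 3 assms by (intro powr_mono2) auto
    ultimately show ?thesis using *[of b a] assms by (simp add: max_def)
  qed simp
qed

text \<open>Mean value theorem for the power: a difference of weights trades one power for a factor
  \<open>norm (x - y)\<close>, which will fall on the transporting factor. This is what saves the
  derivative in the energy estimate.\<close>

lemma jb_powr_commutator:
  assumes m: "1 \<le> m"
  shows "\<bar>jb x powr m - jb y powr m\<bar>
    \<le> m * 2 powr (m - 1) * norm (x - y) * (jb (x - y) powr (m - 1) + jb y powr (m - 1))"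
proof -
  have "max (jb x) (jb y) \<le> jb (x - y) + jb y" using jb_le_split[of x y] by auto
  then have "(max (jb x) (jb y)) powr (m - 1) \<le> (jb (x - y) + jb y) powr (m - 1)"
    using m by (intro powr_mono2) (auto simp: le_max_iff_disj)
  also have "\<dots> \<le> 2 powr (m - 1) * (jb (x - y) powr (m - 1) + jb y powr (m - 1))" using m by (intro sum_powr_le) auto
  finally have max: "(max (jb x) (jb y)) powr (m - 1)
     \<le> 2 powr (m - 1) * (jb (x - y) powr (m - 1) + jb y powr (m - 1))" .
  have "\<bar>jb x powr m - jb y powr m\<bar> \<le> m * \<bar>jb x - jb y\<bar> * (max (jb x) (jb y)) powr (m - 1)"
    using m by (intro powr_diff_le) auto
  also have "\<dots> \<le> m * norm (x - y) * (2 powr (m - 1) * (jb (x - y) powr (m - 1) + jb y powr (m - 1)))"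
    using m by (intro mult_mono max jb_lipschitz mult_nonneg_nonneg) auto
  finally show ?thesis by (simp add: mult_ac)
qed

definition wt :: "real \<Rightarrow> cfun \<Rightarrow> cfun" where
  "wt m a x = of_real (jb x powr m) * a x"

text \<open>\<open>inH m\<close> and \<open>N m\<close> are membership and norm in H^m read off the
  transform; the analysis of the equation takes place on this side.\<close>

definition inH :: "real \<Rightarrow> cfun \<Rightarrow> bool" where "inH m a \<longleftrightarrow> sqi (wt m a)"

definition N :: "real \<Rightarrow> cfun \<Rightarrow> real" where "N m a = l2norm (wt m a)"

abbreviation Nd :: "real \<Rightarrow> cfun \<Rightarrow> cfun \<Rightarrow> real" where
  "Nd m a b \<equiv> N m (\<lambda>x. a x - b x)"

lemma cmod_wt: "cmod (wt m a x) = jb x powr m * cmod (a x)" by (simp add: wt_def norm_mult)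

lemma wt_0: "wt 0 a = a" by (simp add: wt_def fun_eq_iff)

lemma wt_wt: "wt k (wt m a) = wt (k + m) a" by (simp add: wt_def fun_eq_iff powr_add)

lemma borel_measurable_wt [measurable]: "a \<in> borel_measurable borel \<Longrightarrow> wt m a \<in> borel_measurable borel"
  unfolding wt_def[abs_def] by measurable

lemma inH_measurable [measurable_dest]: assumes "inH m a" shows "a \<in> borel_measurable borel"
proof -
  have "wt (-m) (wt m a) \<in> borel_measurable borel" using assms by (auto simp: inH_def)
  then show ?thesis by (simp add: wt_wt wt_0)
qed

lemma inH_0: "inH 0 a \<longleftrightarrow> sqi a" by (simp add: inH_def wt_0)

lemma N_0: "N 0 a = l2norm a" by (simp add: N_def wt_0)

lemma inH_wt: "inH k (wt m a) \<longleftrightarrow> inH (k + m) a" by (simp add: inH_def wt_wt)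

lemma N_nonneg [simp]: "0 \<le> N m a" by (simp add: N_def)

lemma wt_add: "wt m (\<lambda>x. a x + b x) = (\<lambda>x. wt m a x + wt m b x)"
  and wt_diff: "wt m (\<lambda>x. a x - b x) = (\<lambda>x. wt m a x - wt m b x)"
  and wt_mult_left: "wt m (\<lambda>x. c * a x) = (\<lambda>x. c * wt m a x)"
  and wt_uminus: "wt m (\<lambda>x. - a x) = (\<lambda>x. - wt m a x)"
  and wt_sum: "wt m (\<lambda>x. \<Sum>i\<in>A. f i x) = (\<lambda>x. \<Sum>i\<in>A. wt m (f i) x)"
  by (simp_all add: wt_def fun_eq_iff algebra_simps sum_distrib_left)

lemma inH_zero [simp]: "inH m (\<lambda>x. 0)" by (simp add: inH_def wt_def[abs_def])
lemma N_zero [simp]: "N m (\<lambda>x. 0) = 0" by (simp add: N_def wt_def[abs_def])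

lemma inH_add [intro]: "inH m a \<Longrightarrow> inH m b \<Longrightarrow> inH m (\<lambda>x. a x + b x)"
  by (simp add: inH_def wt_add sqi_add)
lemma inH_diff [intro]: "inH m a \<Longrightarrow> inH m b \<Longrightarrow> inH m (\<lambda>x. a x - b x)"
  by (simp add: inH_def wt_diff sqi_diff)
lemma inH_mult_left [intro]: "inH m a \<Longrightarrow> inH m (\<lambda>x. c * a x)" by (simp add: inH_def wt_mult_left sqi_mult_left)
lemma inH_uminus [intro]: "inH m a \<Longrightarrow> inH m (\<lambda>x. - a x)" by (simp add: inH_def wt_uminus sqi_uminus)
lemma inH_sum [intro]: "(\<And>i. i \<in> A \<Longrightarrow> inH m (f i)) \<Longrightarrow> inH m (\<lambda>x. \<Sum>i\<in>A. f i x)"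
  by (simp add: inH_def wt_sum sqi_sum)

lemma N_triangle: "inH m a \<Longrightarrow> inH m b \<Longrightarrow> N m (\<lambda>x. a x + b x) \<le> N m a + N m b"
  unfolding inH_def N_def wt_add by (rule l2norm_triangle)
lemma N_triangle_diff: "inH m a \<Longrightarrow> inH m b \<Longrightarrow> Nd m a b \<le> N m a + N m b"
  unfolding inH_def N_def wt_diff by (rule l2norm_triangle_diff)
lemma N_triangle_via: "inH m a \<Longrightarrow> inH m b \<Longrightarrow> inH m c \<Longrightarrow>
   Nd m a c \<le> Nd m a b + Nd m b c" unfolding inH_def N_def wt_diff by (rule l2norm_triangle_via)
lemma N_le_diff_add: "inH m a \<Longrightarrow> inH m b \<Longrightarrow> N m a \<le> Nd m a b + N m b"
  unfolding inH_def N_def wt_diff by (rule l2norm_le_diff_add)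
lemma N_mult_left [simp]: "N m (\<lambda>x. c * a x) = cmod c * N m a" by (simp add: N_def wt_mult_left)
lemma N_uminus [simp]: "N m (\<lambda>x. - a x) = N m a" by (simp add: N_def wt_uminus)
lemma N_minus_commute: "Nd m a b = Nd m b a" unfolding N_def wt_diff by (rule l2norm_minus_commute)
lemma N_sum_le: "(\<And>i. i \<in> A \<Longrightarrow> inH m (f i)) \<Longrightarrow> N m (\<lambda>x. \<Sum>i\<in>A. f i x) \<le> (\<Sum>i\<in>A. N m (f i))"
  unfolding inH_def N_def wt_sum by (rule l2norm_sum_le)

lemma inH_dominated:
  assumes "inH m b" and [measurable]: "a \<in> borel_measurable borel" and "\<And>x. cmod (a x) \<le> C * cmod (b x)"
  shows "inH m a" unfolding inH_def
proof (rule sqi_dominated)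
  show "sqi (wt m b)" using assms(1) by (simp add: inH_def)
  show "cmod (wt m a x) \<le> C * cmod (wt m b x)" for x
    using mult_left_mono[OF assms(3)[of x], of "jb x powr m"] by (simp add: cmod_wt mult_ac)
qed measurable

lemma N_dominated:
  assumes "inH m b" and [measurable]: "a \<in> borel_measurable borel" and le: "\<And>x. cmod (a x) \<le> C * cmod (b x)" and "0 \<le> C"
  shows "N m a \<le> C * N m b" unfolding N_def
proof (rule l2norm_mono_AE)
  show "AE x in lborel. cmod (wt m a x) \<le> C * cmod (wt m b x)"
    using mult_left_mono[OF le, of "jb _ powr m"] by (auto simp: cmod_wt mult_ac)
qed (use inH_dominated[OF assms(1-3)] assms(1,4) in \<open>simp_all add: inH_def\<close>)

lemma
  assumes km: "k \<le> m" and a: "inH m a"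
  shows inH_mono: "inH k a" and N_mono: "N k a \<le> N m a"
proof -
  have le: "cmod (wt k a x) \<le> 1 * cmod (wt m a x)" for x using km by (simp add: cmod_wt mult_right_mono jb_powr_mono)
  have [measurable]: "a \<in> borel_measurable borel" using a by auto
  show "inH k a" unfolding inH_def by (rule sqi_dominated[OF _ _ le]) (use a in \<open>auto simp: inH_def\<close>)
  then have "l2norm (wt k a) \<le> 1 * l2norm (wt m a)" by (intro l2norm_mono_AE AE_I2 le) (use a in \<open>auto simp: inH_def\<close>)
  then show "N k a \<le> N m a" by (simp add: N_def)
qed

definition L1i :: "real \<Rightarrow> cfun \<Rightarrow> bool" where "L1i k a \<longleftrightarrow> integrable lborel (wt k a)"

text \<open>Weighted L1 norm of a transform. Up to a constant it bounds, for \<open>k = 0\<close>,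
  the supremum of the function and of its Riesz transforms and, for \<open>k = 1\<close>, also those
  of the gradients; it replaces Lipschitz norms throughout.\<close>

definition L1 :: "real \<Rightarrow> cfun \<Rightarrow> real" where "L1 k a = (LINT x|lborel. cmod (wt k a x))"

lemma L1_nonneg [simp]: "0 \<le> L1 k a" by (simp add: L1_def)

lemma L1i_measurable: assumes "L1i k a" shows "a \<in> borel_measurable borel"
proof -
  have "wt (-k) (wt k a) \<in> borel_measurable borel" using assms by (auto simp: L1i_def)
  then show ?thesis by (simp add: wt_wt wt_0)
qed

lemma L1_triangle: "L1i k a \<Longrightarrow> L1i k b \<Longrightarrow> L1 k (\<lambda>x. a x + b x) \<le> L1 k a + L1 k b"
proof -
  assume ab: "L1i k a" "L1i k b"
  then have "(LINT x|lborel. cmod (wt k a x + wt k b x)) \<le> (LINT x|lborel. cmod (wt k a x) + cmod (wt k b x))"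
    by (intro integral_mono norm_triangle_ineq) (auto simp: L1i_def)
  with ab show ?thesis by (simp add: L1_def L1i_def wt_add)
qed

lemma
  assumes km: "k \<le> m" and a: "L1i m a"
  shows L1i_mono: "L1i k a" and L1_mono: "L1 k a \<le> L1 m a"
proof -
  have le: "cmod (wt k a x) \<le> cmod (wt m a x)" for x using km by (simp add: cmod_wt mult_right_mono jb_powr_mono)
  have [measurable]: "a \<in> borel_measurable borel" using a by (rule L1i_measurable)
  show "L1i k a" unfolding L1i_def
    by (rule integrable_dominated[of _ "wt m a"]) (use a le in \<open>auto simp: L1i_def\<close>)
  then show "L1 k a \<le> L1 m a" unfolding L1_def using a le by (intro integral_mono) (auto simp: L1i_def)
qed

lemma integrable_powr_1d:
  fixes p :: real assumes p: "1 < p"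
  shows "(\<integral>\<^sup>+x. ennreal ((1 + x\<^sup>2) powr (- p / 2)) \<partial>(lborel :: real measure)) < \<infinity>"
proof -
  have bound: "ennreal ((1 + x\<^sup>2) powr (- p / 2))
     \<le> indicator {-1..1} x + (ennreal (x powr (-p)) * indicator {1..} x + ennreal ((-x) powr (-p)) * indicator {1..} (-x))" for x
  proof -
    have big: "(1 + x\<^sup>2) powr (- p / 2) \<le> y powr (-p)" if "1 \<le> y" "y\<^sup>2 = x\<^sup>2" for y
    proof -
      have "(1 + x\<^sup>2) powr (- p / 2) \<le> (y\<^sup>2) powr (- p / 2)" using p that by (intro powr_mono2') auto
      also have "y\<^sup>2 = y powr 2" using that by simp
      finally show ?thesis by (simp add: powr_powr)
    qed
    consider "x \<in> {-1..1}" | "1 < x" | "x < -1" by fastforce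
    then show ?thesis
    proof cases
      case 1
      have "(1 + x\<^sup>2) powr (- p / 2) \<le> 1" using powr_mono[of "-p/2" 0 "1 + x\<^sup>2"] p by (simp split: if_splits)
      then have "ennreal ((1 + x\<^sup>2) powr (- p / 2)) \<le> 1" by (metis ennreal_1 ennreal_leI)
      with 1 show ?thesis by (auto intro: order_trans add_increasing2)
    next
      case 2 then show ?thesis using big[of x] by (auto simp: indicator_def intro!: ennreal_leI)
    next
      case 3 then show ?thesis using big[of "-x"] by (auto simp: indicator_def intro!: ennreal_leI)
    qed
  qed
  have I: "(\<integral>\<^sup>+x. ennreal (x powr (-p)) * indicator {1..} x \<partial>lborel) < \<infinity>"
  proof -
    have "((\<lambda>x. x powr (-p)) has_integral - (1 powr (-p + 1)) / (-p + 1)) {1..}"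
      by (rule has_integral_powr_to_inf) (use p in auto)
    then have "(\<integral>\<^sup>+x. ennreal (x powr (-p)) * indicator {1..} x \<partial>lborel) = ennreal (- (1 powr (-p + 1)) / (-p + 1))"
      by (intro nn_integral_has_integral_lebesgue') auto
    then show ?thesis by simp
  qed
  have I': "(\<integral>\<^sup>+x. ennreal ((-x) powr (-p)) * indicator {1..} (-x) \<partial>lborel) < \<infinity>"
    using nn_integral_real_affine[of "\<lambda>x. ennreal (x powr (-p)) * indicator {1..} x" "-1" 0] I by simp
  have "(\<integral>\<^sup>+x. ennreal ((1 + x\<^sup>2) powr (- p / 2)) \<partial>lborel)
     \<le> (\<integral>\<^sup>+x. indicator {-1..1} x + (ennreal (x powr (-p)) * indicator {1..} x + ennreal ((-x) powr (-p)) * indicator {1..} (-x)) \<partial>lborel)"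
    by (intro nn_integral_mono bound)
  also have "\<dots> = (\<integral>\<^sup>+x. indicator {-1..1::real} x \<partial>lborel) + ((\<integral>\<^sup>+x. ennreal (x powr (-p)) * indicator {1..} x \<partial>lborel)
       + (\<integral>\<^sup>+x. ennreal ((-x) powr (-p)) * indicator {1..} (-x) \<partial>lborel))"
    by (subst nn_integral_add nn_integral_add) (auto intro!: nn_integral_add)
  also have "\<dots> < \<infinity>" using I I' by simp
  finally show ?thesis .
qed

text \<open>The weight is at most a product of one-dimensional weights with exponent
  \<open>q / 2 > 1\<close>, so Tonelli suffices and polar coordinates are avoided.\<close>

lemma integrable_jb_powr:
  assumes q: "2 < q" shows "integrable lborel (\<lambda>z. jb z powr (- q))"
proof (rule integrableI_bounded)
  define f where "f x = (1 + x\<^sup>2) powr (- (q / 2) / 2)" for x :: real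
  have [measurable]: "f \<in> borel_measurable borel" unfolding f_def by measurable
  have le: "jb z powr (- q) \<le> (\<Prod>b\<in>Basis. f (z \<bullet> b))" for z
  proof -
    have f_ge: "jb z powr (- (q / 2)) \<le> f (z \<bullet> b)" if "b \<in> Basis" for b
    proof -
      have "(z \<bullet> b)\<^sup>2 \<le> (norm z)\<^sup>2"
        using Basis_le_norm[OF that, of z] by (metis abs_ge_zero power2_abs power_mono)
      then have "(1 + (norm z)\<^sup>2) powr (- (q / 2) / 2) \<le> f (z \<bullet> b)"
        unfolding f_def using q by (intro powr_mono2') (auto intro: add_pos_nonneg)
      moreover have "(1 + (norm z)\<^sup>2) = jb z powr 2" by (simp add: jb_def)
      ultimately have "(jb z powr 2) powr (- (q / 2) / 2) \<le> f (z \<bullet> b)" by simp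
      then show ?thesis unfolding powr_powr by simp
    qed
    have "jb z powr (- q) = (\<Prod>b\<in>(Basis::plane set). jb z powr (- (q / 2)))" by (simp add: power2_eq_square flip: powr_add)
    also have "\<dots> \<le> (\<Prod>b\<in>Basis. f (z \<bullet> b))" by (intro prod_mono conjI f_ge) auto
    finally show ?thesis .
  qed
  have "(\<integral>\<^sup>+z. ennreal (norm (jb z powr (- q))) \<partial>lborel) \<le> (\<integral>\<^sup>+z. ennreal (\<Prod>b\<in>Basis. f (z \<bullet> b)) \<partial>(lborel :: plane measure))"
    using le by (intro nn_integral_mono ennreal_leI) auto
  also have "\<dots> = (\<integral>\<^sup>+z. (\<Prod>b\<in>Basis. ennreal (f ((z::plane) \<bullet> b))) \<partial>lborel)"
    by (simp add: prod_ennreal f_def)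
  also have "\<dots> = (\<Prod>b\<in>(Basis::plane set). \<integral>\<^sup>+x. ennreal (f x) \<partial>lborel)"
    by (rule nn_integral_lborel_prod[of "\<lambda>_ x. ennreal (f x)"]) auto
  also have "\<dots> < \<infinity>" using integrable_powr_1d[of "q / 2"] q by (simp add: f_def power2_eq_square ennreal_mult_less_top)
  finally show "(\<integral>\<^sup>+z. ennreal (norm (jb z powr (- q))) \<partial>lborel) < \<infinity>" .
qed measurable

definition jbc :: "real \<Rightarrow> cfun" where "jbc p x = of_real (jb x powr (- p))"

lemma sqi_jbc: assumes "1 < p" shows "sqi (jbc p)"
proof -
  have "(cmod (jbc p x))\<^sup>2 = jb x powr (- (2 * p))" for x
    by (simp add: jbc_def powr_powr[symmetric] flip: powr_add power2_eq_square)
       (simp add: power2_eq_square flip: powr_add)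
  moreover have "jbc p \<in> borel_measurable borel" unfolding jbc_def[abs_def] by measurable
  ultimately show ?thesis using integrable_jb_powr[of "2 * p"] assms by (simp add: square_integrable_def)
qed

text \<open>Cauchy-Schwarz against \<open>jbc (m - k)\<close>, which is square-integrable on the
  plane as soon as \<open>m - k > 1\<close>. With \<open>k = 1\<close> and \<open>m = s\<close> this
  is where \<open>s > 2\<close> enters.\<close>

lemma
  assumes km: "k + 1 < m" and a: "inH m a"
  shows inH_L1i: "L1i k a" and L1_le_N: "L1 k a \<le> l2norm (jbc (m - k)) * N m a"
proof -
  have *: "wt k a x = jbc (m - k) x * wt m a x" for x by (simp add: wt_def jbc_def flip: of_real_mult powr_add)
  have j: "sqi (jbc (m - k))" using km by (intro sqi_jbc) simp
  have w: "sqi (wt m a)" using a by (simp add: inH_def)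
  show "L1i k a" unfolding L1i_def using sqi_mult_integrable[OF j w] by (simp add: *[abs_def])
  show "L1 k a \<le> l2norm (jbc (m - k)) * N m a" using l2norm_Cauchy_Schwarz[OF j w] by (simp add: L1_def * norm_mult N_def)
qed

text \<open>Frequencies whose bracket exceeds \<open>R\<close> are absorbed by
  \<open>e * N m a\<close>, the others are paid for by the L2 norm. The exponent in \<open>C\<close>
  is \<open>\<bar>k\<bar>\<close> because \<open>k\<close> may be negative.\<close>

lemma N_interpolation:
  assumes km: "k < m" "0 \<le> m" and e: "0 < e"
  shows "\<exists>C\<ge>0. \<forall>a. inH m a \<longrightarrow> N k a \<le> e * N m a + C * N 0 a"
proof -
  define R where "R = max 1 (e powr (- 1 / (m - k)))"
  define C where "C = R powr \<bar>k\<bar>"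
  have R: "1 \<le> R" by (simp add: R_def)
  have bound: "jb x powr k \<le> e * jb x powr m + C" for x
  proof (cases "jb x \<le> R")
    case True
    have "jb x powr k \<le> jb x powr \<bar>k\<bar>" by (rule jb_powr_mono) simp
    also have "\<dots> \<le> C" unfolding C_def using True by (intro powr_mono2) auto
    finally show ?thesis using e by (simp add: add_increasing)
  next
    case False
    have "jb x powr (- (m - k)) \<le> R powr (- (m - k))" using False R km by (intro powr_mono2') auto
    also have "\<dots> \<le> (e powr (- 1 / (m - k))) powr (- (m - k))" using e km by (intro powr_mono2') (auto simp: R_def)
    also have "\<dots> = e"
    proof -
      have "- 1 / (m - k) * - (m - k) = 1" using km by (simp add: field_simps)
      then show ?thesis using e by (simp only: powr_powr powr_one)
    qed
    finally have "jb x powr m * jb x powr (- (m - k)) \<le> jb x powr m * e" by (intro mult_left_mono) auto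
    then have "jb x powr k \<le> e * jb x powr m" by (simp add: mult.commute flip: powr_add)
    then show ?thesis by (simp add: C_def add_increasing2)
  qed
  have "N k a \<le> e * N m a + C * N 0 a" if a: "inH m a" for a
  proof -
    have s: "sqi (wt m a)" "sqi (wt 0 a)" "sqi (wt k a)" using a inH_mono[of 0 m a] inH_mono[of k m a] km by (auto simp: inH_def)
    have c: "sqi (\<lambda>x. of_real (cmod (wt m a x)))" "sqi (\<lambda>x. of_real (cmod (wt 0 a x)))"
      by (rule sqi_dominated[OF s(1), of _ 1] sqi_dominated[OF s(2), of _ 1]; use s in simp)+
    let ?h = "\<lambda>x. of_real e * of_real (cmod (wt m a x)) + of_real C * of_real (cmod (wt 0 a x))"
    have "cmod (wt k a x) \<le> 1 * cmod (?h x)" for x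
    proof -
      have "cmod (wt k a x) \<le> (e * jb x powr m + C) * cmod (a x)" unfolding cmod_wt by (intro mult_right_mono bound) simp
      also have "\<dots> = e * cmod (wt m a x) + C * cmod (wt 0 a x)" by (simp add: cmod_wt algebra_simps)
      also have "\<dots> \<le> cmod (?h x)" using complex_Re_le_cmod[of "?h x"] by simp
      finally show ?thesis by simp
    qed
    then have "l2norm (wt k a) \<le> 1 * l2norm ?h" using s c by (intro l2norm_mono_AE) auto
    also have "\<dots> \<le> l2norm (\<lambda>x. of_real e * of_real (cmod (wt m a x)))
        + l2norm (\<lambda>x. of_real C * of_real (cmod (wt 0 a x)))" unfolding mult_1 using c by (intro l2norm_triangle sqi_mult_left)
    also have "\<dots> = e * N m a + C * N 0 a" using e by (simp add: N_def C_def) (simp add: l2norm_def)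
    finally show ?thesis by (simp add: N_def)
  qed
  then show ?thesis by (intro exI[of _ C]) (auto simp: C_def)
qed

text \<open>An exponent strictly between \<open>k + 1\<close> and \<open>m\<close> leaves room both
  for the embedding into weighted L1 and for interpolation; \<open>p\<close> is the
  midpoint.\<close>

lemma L1_interpolation:
  assumes km: "k + 1 < m" "0 \<le> m" and e: "0 < e"
  shows "\<exists>C\<ge>0. \<forall>a. inH m a \<longrightarrow> L1 k a \<le> e * N m a + C * N 0 a"
proof -
  define p where "p = (k + 1 + m) / 2"
  have p: "k + 1 < p" "p < m" using km by (auto simp: p_def)
  define c where "c = l2norm (jbc (p - k)) + 1"
  have c: "0 < c" by (simp add: c_def add_nonneg_pos)
  obtain C where C: "0 \<le> C" "\<And>a. inH m a \<Longrightarrow> N p a \<le> (e / c) * N m a + C * N 0 a"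
    using N_interpolation[OF p(2) km(2), of "e / c"] e c by auto
  have "L1 k a \<le> e * N m a + c * C * N 0 a" if a: "inH m a" for a
  proof -
    have ap: "inH p a" using inH_mono[of p m a] p a by simp
    have "L1 k a \<le> l2norm (jbc (p - k)) * N p a" by (rule L1_le_N[OF p(1) ap])
    also have "\<dots> \<le> c * N p a" by (intro mult_right_mono) (auto simp: c_def)
    also have "\<dots> \<le> c * ((e / c) * N m a + C * N 0 a)" using C(2)[OF a] c by (intro mult_left_mono) auto
    also have "\<dots> = e * N m a + c * C * N 0 a" using c by (simp add: field_simps)
    finally show ?thesis .
  qed
  then show ?thesis using C(1) c by (intro exI[of _ "c * C"]) auto
qed

section \<open>The bilinear form of the equation\<close>

text \<open>\<open>B a a\<close> is the Fourier transform of $-(u \cdot \nabla)\theta$ when \<open>a\<close> is that of $\theta$, so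
  that the equation reads $\partial_t a = B(a, a)$.\<close>

definition K :: "plane \<Rightarrow> plane \<Rightarrow> real" where
  "K \<zeta> y = (\<zeta> $ 1 * y $ 2 - \<zeta> $ 2 * y $ 1) / norm \<zeta>"

definition B :: "cfun \<Rightarrow> cfun \<Rightarrow> cfun" where
  "B a b x = (LINT y|lborel. of_real (K (x - y) y) * a (x - y) * b y) / (2 * pi)"

abbreviation Bq :: "cfun \<Rightarrow> cfun" where "Bq a \<equiv> B a a"

text \<open>Residual of \<open>b\<close> as one explicit Euler step of length \<open>h\<close> from
  \<open>a\<close>. Approximate and exact solutions alike are handled through bounds on it, so that
  no derivative in time has to be formed.\<close>

abbreviation defect :: "real \<Rightarrow> cfun \<Rightarrow> cfun \<Rightarrow> cfun" where
  "defect h a b \<equiv> (\<lambda>x. b x - a x - of_real h * Bq a x)"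

lemma norm_plane: "(norm (x::plane))\<^sup>2 = (x $ 1)\<^sup>2 + (x $ 2)\<^sup>2" by (simp add: norm_vec_def L2_set_def sum_2)

lemma cross_le: "\<bar>\<zeta> $ 1 * y $ 2 - \<zeta> $ 2 * y $ 1\<bar> \<le> norm (\<zeta>::plane) * norm (y::plane)"
proof -
  have "(\<zeta> $ 1 * y $ 2 - \<zeta> $ 2 * y $ 1)\<^sup>2 + (\<zeta> $ 1 * y $ 1 + \<zeta> $ 2 * y $ 2)\<^sup>2
     = (norm \<zeta> * norm y)\<^sup>2" unfolding power_mult_distrib norm_plane by (simp add: power2_eq_square algebra_simps)
  then have "\<bar>\<zeta> $ 1 * y $ 2 - \<zeta> $ 2 * y $ 1\<bar>\<^sup>2 \<le> (norm \<zeta> * norm y)\<^sup>2"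
    unfolding power2_abs using zero_le_power2[of "\<zeta> $ 1 * y $ 1 + \<zeta> $ 2 * y $ 2"] by linarith
  then show ?thesis by (rule power2_le_imp_le) simp
qed

lemma K_le_norm: "\<bar>K \<zeta> y\<bar> \<le> norm y"
  using cross_le[of \<zeta> y] by (cases "\<zeta> = 0") (auto simp: K_def field_simps)

lemma K_le_jb: "\<bar>K \<zeta> y\<bar> \<le> jb y" using K_le_norm norm_le_jb order_trans by blast

lemma borel_measurable_K [measurable (raw)]:
  assumes [measurable]: "f \<in> borel_measurable M" "g \<in> borel_measurable M"
  shows "(\<lambda>x. K (f x) (g x)) \<in> borel_measurable M"
proof -
  have [measurable]: "(\<lambda>x. h x $ i) \<in> borel_measurable M" if "h \<in> borel_measurable M" for h :: "_ \<Rightarrow> plane" and i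
    by (rule measurable_compose[OF that, of "\<lambda>x. x $ i"])
      (auto intro!: borel_measurable_continuous_onI continuous_intros)
  show ?thesis unfolding K_def by measurable
qed

lemma borel_measurable_B [measurable]:
  assumes [measurable]: "a \<in> borel_measurable borel" "b \<in> borel_measurable borel"
  shows "B a b \<in> borel_measurable borel" unfolding B_def[abs_def] by measurable

lemma B_integrable:
  assumes a: "sqi a" and b: "inH 1 b"
  shows "integrable lborel (\<lambda>y. of_real (K (x - y) y) * a (x - y) * b y)"
proof (rule integrable_dominated)
  have [measurable]: "a \<in> borel_measurable borel" "b \<in> borel_measurable borel" using a b by auto
  show "integrable lborel (\<lambda>y. a (x - y) * wt 1 b y)" using b by (intro sqi_mult_integrable sqi_reflect a) (simp add: inH_def)
  show "AE y in lborel. norm (of_real (K (x - y) y) * a (x - y) * b y) \<le> norm (a (x - y) * wt 1 b y)"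
  proof (rule AE_I2)
    fix y
    have "\<bar>K (x - y) y\<bar> * (cmod (a (x - y)) * cmod (b y)) \<le> jb y * (cmod (a (x - y)) * cmod (b y))"
      by (intro mult_right_mono K_le_jb) simp
    then show "norm (of_real (K (x - y) y) * a (x - y) * b y) \<le> norm (a (x - y) * wt 1 b y)" by (simp add: norm_mult cmod_wt mult_ac)
  qed
  show "(\<lambda>y. of_real (K (x - y) y) * a (x - y) * b y) \<in> borel_measurable lborel" by simp
qed

lemma B_diff_left:
  assumes "sqi a" "sqi a'" "inH 1 b" shows "B (\<lambda>x. a x - a' x) b x = B a b x - B a' b x"
  using B_integrable[OF assms(1,3), of x] B_integrable[OF assms(2,3), of x]
  by (simp add: B_def left_diff_distrib right_diff_distrib diff_divide_distrib)

lemma B_diff_right: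
  assumes "sqi a" "inH 1 b" "inH 1 b'" shows "B a (\<lambda>x. b x - b' x) x = B a b x - B a b' x"
  using B_integrable[OF assms(1,2), of x] B_integrable[OF assms(1,3), of x]
  by (simp add: B_def left_diff_distrib right_diff_distrib diff_divide_distrib)

lemma B_mult: "B (\<lambda>x. c * a x) (\<lambda>x. d * b x) x = c * d * B a b x"
proof -
  have "(LINT y|lborel. of_real (K (x - y) y) * (c * a (x - y)) * (d * b y))
     = (LINT y|lborel. (c * d) * (of_real (K (x - y) y) * a (x - y) * b y))" by (simp add: mult_ac)
  then show ?thesis unfolding integral_mult_right_zero by (simp add: B_def)
qed

lemma B_minus: "B (\<lambda>x. - a x) (\<lambda>x. - b x) x = B a b x" using B_mult[of "-1" a "-1" b x] by simp

lemma herm_diff: "herm a \<Longrightarrow> herm b \<Longrightarrow> herm (\<lambda>x. a x - b x)" by (simp add: herm_def)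
lemma herm_add: "herm a \<Longrightarrow> herm b \<Longrightarrow> herm (\<lambda>x. a x + b x)" by (simp add: herm_def)
lemma herm_real_mult: "herm a \<Longrightarrow> herm (\<lambda>x. of_real c * a x)" by (simp add: herm_def)

lemma herm_B:
  assumes a: "herm a" and b: "herm b" and [measurable]: "a \<in> borel_measurable borel" "b \<in> borel_measurable borel"
  shows "herm (B a b)" unfolding herm_def
proof
  fix x
  have "(LINT y|lborel. of_real (K (- x - y) y) * a (- x - y) * b y)
     = (LINT y|lborel. of_real (K (- x - (0 - y)) (0 - y)) * a (- x - (0 - y)) * b (0 - y))"
    by (rule integral_reflect_plane[symmetric]) measurable
  also have "\<dots> = (LINT y|lborel. cnj (of_real (K (x - y) y) * a (x - y) * b y))"
  proof (intro LINT_cong refl)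
    fix y
    have "K (- x + y) (- y) = K (x - y) y" by (simp add: K_def norm_minus_commute algebra_simps)
    moreover have "a (- x + y) = cnj (a (x - y))" "b (- y) = cnj (b y)"
      using a b unfolding herm_def by (metis minus_diff_eq uminus_add_conv_diff, metis)
    ultimately show "of_real (K (- x - (0 - y)) (0 - y)) * a (- x - (0 - y)) * b (0 - y)
      = cnj (of_real (K (x - y) y) * a (x - y) * b y)" by simp
  qed
  also have "\<dots> = cnj (LINT y|lborel. of_real (K (x - y) y) * a (x - y) * b y)" by (rule Bochner_Integration.integral_cnj)
  finally show "B a b (- x) = cnj (B a b x)" by (simp add: B_def)
qed

text \<open>Pointwise splitting of the weights combined with Young's inequality yields all
  Sobolev bounds on \<^const>\<open>B\<close>.\<close>

lemma Young_kernel: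
  fixes k :: "plane \<Rightarrow> cfun"
  assumes [measurable]: "(\<lambda>(z, y). k z y) \<in> borel_measurable (borel \<Otimes>\<^sub>M borel)"
    and le: "\<And>z y. cmod (k z y) \<le> C1 * (cmod (f1 (z - y)) * cmod (g1 y)) + C2 * (cmod (f2 (z - y)) * cmod (g2 y))"
    and f1: "integrable lborel f1" and g1: "sqi g1" and f2: "sqi f2" and g2: "integrable lborel g2" and C: "0 \<le> C1" "0 \<le> C2"
  shows "sqi (\<lambda>z. LINT y|lborel. k z y)" and "l2norm (\<lambda>z. LINT y|lborel. k z y)
      \<le> C1 * ((LINT x|lborel. cmod (f1 x)) * l2norm g1) + C2 * ((LINT x|lborel. cmod (g2 x)) * l2norm f2)"
proof -
  have [measurable]: "f1 \<in> borel_measurable borel" "g1 \<in> borel_measurable borel"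
    "f2 \<in> borel_measurable borel" "g2 \<in> borel_measurable borel" using f1 f2 g1 g2 by auto
  define c where "c f x = complex_of_real (cmod (f x))" for f :: "cfun" and x
  have cm [measurable]: "c f \<in> borel_measurable borel" if "f \<in> borel_measurable borel" for f
    using that unfolding c_def by measurable
  have c1: "integrable lborel (c f1)" "integrable lborel (c g2)"
    using integrable_norm[OF f1] integrable_norm[OF g2] by (simp_all add: c_def[abs_def])
  have c2: "sqi (c g1)" "sqi (c f2)" by (rule sqi_dominated[OF g1, of _ 1] sqi_dominated[OF f2, of _ 1]; simp add: c_def[abs_def])+
  define h where "h z = complex_of_real C1 * conv (c f1) (c g1) z + complex_of_real C2 * conv (c g2) (c f2) z" for z
  have h: "sqi h" unfolding h_def using sqi_conv[OF c1(1) c2(1)] sqi_conv[OF c1(2) c2(2)] by auto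
  have "AE z in lborel. cmod (LINT y|lborel. k z y) \<le> 1 * cmod (h z)"
    using Young_AE_integrable[OF c1(1) c2(1)] Young_AE_integrable[OF c1(2) c2(2)]
  proof eventually_elim
    case (elim z)
    \<comment> \<open>In the second term the factors exchange roles: the integrable function
      \<open>g2\<close> sits at \<open>y\<close>, so a reflection is needed to see a convolution of
      L1 with L2.\<close>
    have i2: "integrable lborel (\<lambda>y. c g2 y * c f2 (z - y))" using integrable_reflect_plane[OF elim(2), of z] by simp
    have e2: "conv (c g2) (c f2) z = (LINT y|lborel. c g2 y * c f2 (z - y))" by (subst conv_commute) (auto simp: conv_def mult.commute)
    let ?r = "\<lambda>y. C1 * (cmod (f1 (z - y)) * cmod (g1 y)) + C2 * (cmod (f2 (z - y)) * cmod (g2 y))"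
    have r: "integrable lborel ?r" using integrable_norm[OF elim(1)] integrable_norm[OF i2] by (simp add: c_def norm_mult mult.commute)
    have kr: "cmod (LINT y|lborel. k z y) \<le> (LINT y|lborel. ?r y)"
    proof (cases "integrable lborel (k z)")
      case True
      then show ?thesis by (intro Bochner_Integration.integral_norm_bound_integral r le)
    next
      case False
      then show ?thesis using C by (simp add: not_integrable_integral_eq)
    qed
    have "complex_of_real (LINT y|lborel. ?r y) = h z"
    proof -
      have "h z = (LINT y|lborel. complex_of_real C1 * (c f1 (z - y) * c g1 y))
          + (LINT y|lborel. complex_of_real C2 * (c g2 y * c f2 (z - y)))" unfolding h_def e2 by (simp add: conv_def)
      also have "\<dots> = (LINT y|lborel. complex_of_real C1 * (c f1 (z - y) * c g1 y)
          + complex_of_real C2 * (c g2 y * c f2 (z - y)))" using elim(1) i2 by (intro LINT_add[symmetric]) auto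
      also have "\<dots> = (LINT y|lborel. complex_of_real (?r y))"
        by (intro LINT_cong refl) (simp add: c_def mult_ac)
      finally show ?thesis by (simp only: integral_complex_of_real)
    qed
    then have "cmod (h z) = \<bar>LINT y|lborel. ?r y\<bar>"
      by (simp only: norm_of_real flip: \<open>complex_of_real (LINT y|lborel. ?r y) = h z\<close>)
    with kr show ?case by linarith
  qed
  then have *: "AE z in lborel. cmod (LINT y|lborel. k z y) \<le> 1 * cmod (h z)" .
  have [measurable]: "(\<lambda>z. LINT y|lborel. k z y) \<in> borel_measurable borel" by measurable
  have "integrable lborel (\<lambda>z. (cmod (LINT y|lborel. k z y))\<^sup>2)"
  proof (rule integrable_dominated[OF sqi_integrable[OF h]])
    show "AE z in lborel. norm ((cmod (LINT y|lborel. k z y))\<^sup>2) \<le> norm ((cmod (h z))\<^sup>2)"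
      using * by eventually_elim (auto intro: power_mono)
  qed measurable
  then show s: "sqi (\<lambda>z. LINT y|lborel. k z y)" by (simp add: square_integrable_def)
  have "l2norm (\<lambda>z. LINT y|lborel. k z y) \<le> 1 * l2norm h" by (rule l2norm_mono_AE[OF * s h]) simp
  also have "\<dots> \<le> l2norm (\<lambda>z. complex_of_real C1 * conv (c f1) (c g1) z) + l2norm (\<lambda>z. complex_of_real C2 * conv (c g2) (c f2) z)"
    unfolding h_def[abs_def] mult_1 by (intro l2norm_triangle sqi_mult_left sqi_conv c1 c2)
  also have "\<dots> = C1 * l2norm (conv (c f1) (c g1)) + C2 * l2norm (conv (c g2) (c f2))" using C by simp
  also have "\<dots> \<le> C1 * ((LINT x|lborel. cmod (c f1 x)) * l2norm (c g1)) + C2 * ((LINT x|lborel. cmod (c g2 x)) * l2norm (c f2))"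
    using C by (intro add_mono mult_left_mono l2norm_conv c1 c2)
  also have "\<dots> = C1 * ((LINT x|lborel. cmod (f1 x)) * l2norm g1) + C2 * ((LINT x|lborel. cmod (g2 x)) * l2norm f2)"
    by (simp add: c_def l2norm_def)
  finally show "l2norm (\<lambda>z. LINT y|lborel. k z y)
      \<le> C1 * ((LINT x|lborel. cmod (f1 x)) * l2norm g1) + C2 * ((LINT x|lborel. cmod (g2 x)) * l2norm f2)" .
qed


lemma wt_B:
  "wt m (B a b) x = (1 / (2 * of_real pi)) *
    (LINT y|lborel. of_real (jb x powr m * K (x - y) y) * a (x - y) * b y)"
proof -
  have "(LINT y|lborel. of_real (jb x powr m * K (x - y) y) * a (x - y) * b y)
     = (LINT y|lborel. of_real (jb x powr m) * (of_real (K (x - y) y) * a (x - y) * b y))" by (simp add: mult_ac)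
  then show ?thesis unfolding integral_mult_right_zero by (simp add: wt_def B_def)
qed

lemma inverse_2pi_le_1: "cmod (1 / (2 * of_real pi)) \<le> 1" using pi_ge_two by (simp add: norm_divide norm_mult)

text \<open>The common engine: each bound on \<open>B\<close> amounts to one way of distributing
  \<open>jb x powr m * jb y\<close> over the two factors. Of the kernel only
  \<open>\<bar>K (x - y) y\<bar> \<le> jb y\<close> is used, which is the loss of one
  derivative.\<close>

lemma B_estimate:
  assumes le: "\<And>x y. jb x powr m * jb y \<le> C1 * (jb (x - y) powr p1 * jb y powr q1)
      + C2 * (jb (x - y) powr p2 * jb y powr q2)"
    and a: "L1i p1 a" "inH p2 a" and b: "inH q1 b" "L1i q2 b" and C: "0 \<le> C1" "0 \<le> C2"
  shows "inH m (B a b)" and "N m (B a b) \<le> C1 * (L1 p1 a * N q1 b) + C2 * (L1 q2 b * N p2 a)"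
proof -
  have [measurable]: "a \<in> borel_measurable borel" "b \<in> borel_measurable borel" using a b by auto
  define k where "k x y = of_real (jb x powr m * K (x - y) y) * a (x - y) * b y" for x y
  have k: "cmod (k x y) \<le> C1 * (cmod (wt p1 a (x - y)) * cmod (wt q1 b y))
      + C2 * (cmod (wt p2 a (x - y)) * cmod (wt q2 b y))" for x y
  proof -
    have "cmod (k x y) = (jb x powr m * \<bar>K (x - y) y\<bar>) * (cmod (a (x - y)) * cmod (b y))"
      by (simp add: k_def norm_mult abs_mult)
    also have "\<dots> \<le> (jb x powr m * jb y) * (cmod (a (x - y)) * cmod (b y))"
      by (intro mult_right_mono mult_left_mono K_le_jb) auto
    also have "\<dots> \<le> (C1 * (jb (x - y) powr p1 * jb y powr q1)
      + C2 * (jb (x - y) powr p2 * jb y powr q2)) * (cmod (a (x - y)) * cmod (b y))" by (intro mult_right_mono le) auto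
    finally show ?thesis by (simp add: cmod_wt algebra_simps)
  qed
  have m: "(\<lambda>(x, y). k x y) \<in> borel_measurable (borel \<Otimes>\<^sub>M borel)" unfolding k_def by measurable
  have eq: "wt m (B a b) = (\<lambda>x. (1 / (2 * of_real pi)) * (LINT y|lborel. k x y))" by (simp add: fun_eq_iff wt_B k_def)
  note Y = Young_kernel[OF m k a(1)[unfolded L1i_def] b(1)[unfolded inH_def] a(2)[unfolded inH_def]
      b(2)[unfolded L1i_def] C]
  show "inH m (B a b)" unfolding inH_def eq by (rule sqi_mult_left[OF Y(1)])
  have "N m (B a b) \<le> 1 * l2norm (\<lambda>x. LINT y|lborel. k x y)"
    unfolding N_def eq l2norm_mult_left by (intro mult_right_mono inverse_2pi_le_1) simp
  also have "\<dots> \<le> C1 * (L1 p1 a * N q1 b) + C2 * (L1 q2 b * N p2 a)" using Y(2) by (simp add: L1_def N_def)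
  finally show "N m (B a b) \<le> C1 * (L1 p1 a * N q1 b) + C2 * (L1 q2 b * N p2 a)" .
qed

lemma jb_powr_Suc: "jb y powr m * jb y = jb y powr (m + 1)" by (simp add: powr_add)

text \<open>Tame form: the high weight falls on one factor at a time, the other being measured in
  weighted L1.\<close>

lemma
  assumes m: "0 \<le> m" and a: "inH m a" "L1i 0 a" and b: "inH (m + 1) b" "L1i 1 b"
  shows inH_B: "inH m (B a b)" and N_B: "N m (B a b) \<le> 2 powr m * (L1 0 a * N (m + 1) b + N m a * L1 1 b)"
proof -
  have le: "jb x powr m * jb y \<le> 2 powr m * (jb (x - y) powr 0 * jb y powr (m + 1))
      + 2 powr m * (jb (x - y) powr m * jb y powr 1)" for x y using mult_right_mono[OF jb_powr_split[OF m, of x y], of "jb y"]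
    by (simp add: algebra_simps powr_add)
  note E = B_estimate[OF le a(2,1) b]
  from E show "inH m (B a b)" by simp
  from E show "N m (B a b) \<le> 2 powr m * (L1 0 a * N (m + 1) b + N m a * L1 1 b)" by (simp add: algebra_simps)
qed

text \<open>All the weight is put on the first factor in L1: meant for a smooth \<open>a\<close> and
  a \<open>b\<close> of which nothing beyond \<open>inH (m + 1)\<close> is known.\<close>

lemma
  assumes m: "0 \<le> m" and a: "sqi a" "L1i m a" and b: "inH (m + 1) b"
  shows inH_B': "inH m (B a b)" and N_B': "N m (B a b) \<le> 2 powr m * (L1 m a * N (m + 1) b)"
proof -
  \<comment> \<open>The second summand is void; its exponents are chosen such that the integrability
    of \<open>b\<close> demanded by \<open>B_estimate\<close> follows from
    \<open>inH (m + 1) b\<close>.\<close>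
  have le: "jb x powr m * jb y \<le> 2 powr m * (jb (x - y) powr m * jb y powr (m + 1))
      + 0 * (jb (x - y) powr 0 * jb y powr (m - 1))" for x y using mult_right_mono[OF jb_powr_submult[OF m, of x y], of "jb y"]
    unfolding jb_powr_Suc[symmetric] by (simp add: mult_ac)
  have "L1i (m - 1) b" by (rule inH_L1i[OF _ b]) simp
  note E = B_estimate[OF le a(2) a(1)[folded inH_0] b this]
  from E show "inH m (B a b)" "N m (B a b) \<le> 2 powr m * (L1 m a * N (m + 1) b)" by simp_all
qed

text \<open>The derivative falls entirely on \<open>b\<close>, so that \<open>a\<close> may be
  merely square-integrable, as befits a difference of solutions measured in L2.\<close>

lemma
  assumes a: "sqi a" and b: "sqi b" "L1i 1 b"
  shows inH_B'': "sqi (B a b)" and N_B'': "l2norm (B a b) \<le> l2norm a * L1 1 b"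
proof -
  \<comment> \<open>The void first summand gets the exponent -2, for which \<open>L1i (-2) a\<close>
    holds for every square-integrable \<open>a\<close>.\<close>
  have le: "jb x powr 0 * jb y \<le> 0 * (jb (x - y) powr (-2) * jb y powr 0)
      + 1 * (jb (x - y) powr 0 * jb y powr 1)" for x y by simp
  have "L1i (-2) a" by (rule inH_L1i[of _ 0]) (use a in \<open>simp_all add: inH_0\<close>)
  note E = B_estimate[OF le this a[folded inH_0] b(1)[folded inH_0] b(2)]
  from E show "sqi (B a b)" "l2norm (B a b) \<le> l2norm a * L1 1 b" by (simp_all add: inH_0 N_0 mult.commute)
qed

text \<open>Incompressibility: exchanging the two frequencies maps the trilinear integrand to
  minus its conjugate.\<close>

lemma B_antisym:
  assumes a: "herm a" "L1i 0 a" and g: "inH 1 g"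
  shows "Re (LINT x|lborel. B a g x * cnj (g x)) = 0"
proof -
  have g0: "sqi g" using inH_mono[of 0 1 g] g by (simp add: inH_0)
  have a1: "integrable lborel a" using a by (simp add: L1i_def wt_0)
  have [measurable]: "a \<in> borel_measurable borel" "g \<in> borel_measurable borel" using a1 g by auto
  define h where "h x y = complex_of_real (K (x - y) y) * a (x - y) * g y * cnj (g x)" for x y
  define A G where "A x = complex_of_real (cmod (a x))" and "G x = complex_of_real (cmod (wt 1 g x))" for x
  have A: "integrable lborel A" unfolding A_def using integrable_norm[OF a1] by simp
  have G: "sqi G" by (rule sqi_dominated[of "wt 1 g" _ 1]) (use g in \<open>simp_all add: inH_def G_def[abs_def]\<close>)
  have [measurable]: "(\<lambda>(x, y). h x y) \<in> borel_measurable (lborel \<Otimes>\<^sub>M lborel)" unfolding h_def by measurable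
  have hle: "cmod (h x y) \<le> cmod (g x) * cmod (A (x - y) * G y)" for x y
  proof -
    have "\<bar>K (x - y) y\<bar> * (cmod (a (x - y)) * cmod (g y) * cmod (g x))
       \<le> jb y * (cmod (a (x - y)) * cmod (g y) * cmod (g x))" by (intro mult_right_mono K_le_jb) simp
    then show ?thesis by (simp add: h_def A_def G_def norm_mult cmod_wt mult_ac)
  qed
  \<comment> \<open>Domination by a product of L2 functions makes the double integral absolutely
    convergent, as the exchange of variables below requires.\<close>
  have AE: "AE x in lborel. integrable lborel (h x) \<and>
     (LINT y|lborel. cmod (h x y)) \<le> cmod (g x * conv A G x)" using Young_AE_integrable[OF A G]
  proof eventually_elim
    case (elim x)
    have 1: "integrable lborel (\<lambda>y. cmod (g x) * cmod (A (x - y) * G y))" using integrable_norm[OF elim] by simp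
    have 2: "integrable lborel (h x)"
      by (rule integrable_dominated[OF 1]) (use hle in \<open>auto intro: order_trans simp: h_def abs_mult\<close>)
    have "(LINT y|lborel. cmod (h x y)) \<le> (LINT y|lborel. cmod (g x) * cmod (A (x - y) * G y))"
      using 1 2 hle by (intro integral_mono) auto
    also have "\<dots> = cmod (g x) * (LINT y|lborel. cmod (A (x - y) * G y))" by (rule integral_mult_right_zero)
    also have "(LINT y|lborel. cmod (A (x - y) * G y)) = cmod (conv A G x)"
    proof -
      have "conv A G x = (LINT y|lborel. complex_of_real (cmod (A (x - y) * G y)))"
        unfolding conv_def by (intro LINT_cong refl) (simp add: A_def G_def norm_mult)
      then have "conv A G x = complex_of_real (LINT y|lborel. cmod (A (x - y) * G y))" by (simp only: integral_complex_of_real)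
      then show ?thesis by simp
    qed
    finally show ?case using 2 by (simp add: norm_mult)
  qed
  have hint: "integrable (lborel \<Otimes>\<^sub>M lborel) (\<lambda>(x, y). h x y)"
  proof (rule lborel_pair.Fubini_integrable)
    show "integrable lborel (\<lambda>x. LINT y|lborel. norm (case (x, y) of (x, y) \<Rightarrow> h x y))"
    proof (rule integrable_dominated)
      show "integrable lborel (\<lambda>x. g x * conv A G x)" by (intro sqi_mult_integrable g0 sqi_conv A G)
      show "AE x in lborel. norm (LINT y|lborel. norm (case (x, y) of (x, y) \<Rightarrow> h x y)) \<le> norm (g x * conv A G x)"
        using AE by eventually_elim (simp add: abs_of_nonneg)
    qed measurable
    show "AE x in lborel. integrable lborel (\<lambda>y. case (x, y) of (x, y) \<Rightarrow> h x y)" using AE by eventually_elim simp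
  qed measurable
  have swap: "h y x = - cnj (h x y)" for x y
  proof -
    have "K (y - x) x = - K (x - y) y"
    proof -
      have "(y - x) $ 1 * x $ 2 - (y - x) $ 2 * x $ 1 = - ((x - y) $ 1 * y $ 2 - (x - y) $ 2 * y $ 1)" by (simp add: algebra_simps)
      then show ?thesis unfolding K_def norm_minus_commute[of y] by (simp only: minus_divide_left)
    qed
    moreover have "a (y - x) = cnj (a (x - y))" using a(1) unfolding herm_def by (metis minus_diff_eq)
    ultimately show ?thesis by (simp add: h_def mult_ac)
  qed
  define X where "X = (LINT x|lborel. LINT y|lborel. h x y)"
  have "X = (LINT y|lborel. LINT x|lborel. h x y)" unfolding X_def by (rule lborel_pair.Fubini_integral[OF hint, symmetric])
  also have "\<dots> = (LINT y|lborel. LINT x|lborel. - cnj (h y x))" by (subst swap) simp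
  also have "\<dots> = - cnj X" by (simp add: X_def)
  finally have "Re X = 0" by (simp add: complex_eq_iff)
  moreover have "(LINT x|lborel. B a g x * cnj (g x)) = X / (2 * pi)"
    by (simp add: X_def B_def h_def flip: integral_divide_zero integral_mult_left_zero)
  ultimately show ?thesis by simp
qed

section \<open>Weighted inner products and the commutator estimate\<close>

definition ip :: "real \<Rightarrow> cfun \<Rightarrow> cfun \<Rightarrow> real" where
  "ip m a b = Re (LINT x|lborel. wt m a x * cnj (wt m b x))"

lemma N_add_square:
  "inH m a \<Longrightarrow> inH m b \<Longrightarrow> (N m (\<lambda>x. a x + b x))\<^sup>2 = (N m a)\<^sup>2 + 2 * ip m a b + (N m b)\<^sup>2"
  unfolding inH_def N_def wt_add ip_def by (rule l2norm_add_square)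

lemma ip_le: "inH m a \<Longrightarrow> inH m b \<Longrightarrow> \<bar>ip m a b\<bar> \<le> N m a * N m b" unfolding inH_def N_def ip_def
  using l2norm_Cauchy_Schwarz_complex[of "wt m a" "\<lambda>x. cnj (wt m b x)"] abs_Re_le_cmod order_trans by (fastforce simp: sqi_cnj)

lemma ip_add_left:
  assumes "inH m a" "inH m b" "inH m c" shows "ip m (\<lambda>x. a x + b x) c = ip m a c + ip m b c"
  using assms unfolding inH_def ip_def wt_add by (simp add: distrib_right sqi_mult_integrable sqi_cnj)

lemma ip_mult_right: "ip m a (\<lambda>x. of_real r * b x) = r * ip m a b"
proof -
  have "(LINT x|lborel. wt m a x * cnj (of_real r * wt m b x))
     = (LINT x|lborel. of_real r * (wt m a x * cnj (wt m b x)))" by (simp add: mult_ac)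
  then show ?thesis unfolding ip_def wt_mult_left integral_mult_right_zero by simp
qed

lemma ip_commute: "ip m a b = ip m b a"
proof -
  have "(LINT x|lborel. wt m a x * cnj (wt m b x)) = (LINT x|lborel. cnj (wt m b x * cnj (wt m a x)))" by (simp add: mult_ac)
  then show ?thesis unfolding ip_def Bochner_Integration.integral_cnj by simp
qed

text \<open>Kato--Ponce type cancellation: the commutator of the weight with the transport term
  costs no derivative.\<close>

lemma ip_B:
  assumes m: "1 \<le> m" and a: "herm a" "L1i 1 a" "inH m a" and b: "inH (m + 1) b" "L1i 1 b"
  shows "\<bar>ip m (B a b) b\<bar> \<le> m * 2 powr (m - 1) * (L1 1 a * N m b + L1 1 b * N m a) * N m b"
proof -
  have a0: "L1i 0 a" "sqi a" using L1i_mono[OF _ a(2)] inH_mono[of 0 m a] a(3) m by (auto simp: inH_0)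
  have bm: "inH m b" "inH 1 b" "inH 1 (wt m b)"
    using inH_mono[of m "m + 1" b] inH_mono[of 1 "m + 1" b] b m by (auto simp: inH_wt add.commute)
  have [measurable]: "a \<in> borel_measurable borel" "b \<in> borel_measurable borel" using a b by auto
  define C where "C = m * 2 powr (m - 1)"
  have C: "0 \<le> C" using m by (simp add: C_def)
  \<comment> \<open>Kernel of the commutator of the weight with transport by \<open>a\<close>. What
    remains is \<open>B a (wt m b)\<close>, whose pairing with \<open>wt m b\<close> has real part 0
    by incompressibility.\<close>
  define k where "k x y = of_real ((jb x powr m - jb y powr m) * K (x - y) y) * a (x - y) * b y" for x y
  have pw: "jb z * jb z powr (m - 1) = jb z powr m" for z using jb_powr_Suc[of z "m - 1"] by (simp add: mult.commute)
  have kle: "cmod (k x y) \<le> C * (cmod (wt 1 a (x - y)) * cmod (wt m b y))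
      + C * (cmod (wt m a (x - y)) * cmod (wt 1 b y))" for x y
  proof -
    have "\<bar>jb x powr m - jb y powr m\<bar> \<le> C * jb (x - y) * (jb (x - y) powr (m - 1) + jb y powr (m - 1))"
      unfolding C_def using m by (intro order_trans[OF jb_powr_commutator[OF m]] mult_right_mono mult_left_mono norm_le_jb) auto
    also have "\<dots> = C * (jb (x - y) powr m + jb (x - y) * jb y powr (m - 1))" by (simp add: algebra_simps flip: pw)
    finally have "\<bar>jb x powr m - jb y powr m\<bar> * \<bar>K (x - y) y\<bar>
       \<le> (C * (jb (x - y) powr m + jb (x - y) * jb y powr (m - 1))) * jb y" using C by (intro mult_mono K_le_jb) auto
    also have "\<dots> = C * (jb (x - y) * jb y powr m) + C * (jb (x - y) powr m * jb y)" by (simp add: algebra_simps flip: pw[of y])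
    finally have "\<bar>jb x powr m - jb y powr m\<bar> * \<bar>K (x - y) y\<bar> * (cmod (a (x - y)) * cmod (b y))
       \<le> (C * (jb (x - y) * jb y powr m) + C * (jb (x - y) powr m * jb y)) * (cmod (a (x - y)) * cmod (b y))"
      by (intro mult_right_mono) auto
    moreover have "cmod (k x y) = \<bar>jb x powr m - jb y powr m\<bar> * \<bar>K (x - y) y\<bar> * (cmod (a (x - y)) * cmod (b y))"
      by (simp only: k_def norm_mult norm_of_real abs_mult mult.assoc)
    ultimately show ?thesis by (simp add: cmod_wt algebra_simps)
  qed
  have km: "(\<lambda>(x, y). k x y) \<in> borel_measurable (borel \<Otimes>\<^sub>M borel)" unfolding k_def by measurable
  note Y = Young_kernel[OF km kle a(2)[unfolded L1i_def] bm(1)[unfolded inH_def] a(3)[unfolded inH_def]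
      b(2)[unfolded L1i_def] C C]
  define R where "R x = (1 / (2 * of_real pi)) * (LINT y|lborel. k x y)" for x
  have R: "sqi R" unfolding R_def by (rule sqi_mult_left[OF Y(1)])
  have "l2norm R \<le> 1 * l2norm (\<lambda>x. LINT y|lborel. k x y)"
    unfolding R_def[abs_def] l2norm_mult_left by (intro mult_right_mono inverse_2pi_le_1) simp
  also have "\<dots> \<le> C * (L1 1 a * N m b + L1 1 b * N m a)" using Y(2) by (simp add: L1_def N_def distrib_left)
  finally have Rle: "l2norm R \<le> C * (L1 1 a * N m b + L1 1 b * N m a)" .
  have BG: "sqi (B a (wt m b))" using inH_B'[of 0 a "wt m b"] a0 bm by (simp add: inH_0)
  have eq: "wt m (B a b) x = B a (wt m b) x + R x" for x
  proof -
    have i1: "integrable lborel (\<lambda>y. of_real (K (x - y) y) * a (x - y) * wt m b y)" by (rule B_integrable[OF a0(2) bm(3)])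
    have i2: "integrable lborel (\<lambda>y. of_real (jb x powr m) * (of_real (K (x - y) y) * a (x - y) * b y))"
      by (intro integrable_mult_right B_integrable[OF a0(2) bm(2)])
    have "(LINT y|lborel. of_real (jb x powr m * K (x - y) y) * a (x - y) * b y)
       = (LINT y|lborel. of_real (K (x - y) y) * a (x - y) * wt m b y) + (LINT y|lborel. k x y)"
    proof -
      have "k x y = of_real (jb x powr m) * (of_real (K (x - y) y) * a (x - y) * b y)
          - of_real (K (x - y) y) * a (x - y) * wt m b y" for y by (simp add: k_def wt_def algebra_simps)
      then have "(LINT y|lborel. k x y) = (LINT y|lborel. of_real (jb x powr m) * (of_real (K (x - y) y) * a (x - y) * b y))
          - (LINT y|lborel. of_real (K (x - y) y) * a (x - y) * wt m b y)" using i1 i2 by (simp only: LINT_diff)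
      then show ?thesis by (simp add: mult_ac)
    qed
    then show ?thesis by (simp only: wt_B B_def R_def distrib_left) simp
  qed
  have "(LINT x|lborel. wt m (B a b) x * cnj (wt m b x))
     = (LINT x|lborel. B a (wt m b) x * cnj (wt m b x)) + (LINT x|lborel. R x * cnj (wt m b x))"
    unfolding eq distrib_right using BG R bm(1) by (intro LINT_add sqi_mult_integrable) (auto simp: inH_def)
  then have "ip m (B a b) b = Re (LINT x|lborel. R x * cnj (wt m b x))" unfolding ip_def using B_antisym[OF a(1) a0(1) bm(3)] by simp
  also have "\<bar>\<dots>\<bar> \<le> l2norm R * l2norm (\<lambda>x. cnj (wt m b x))"
    using bm(1) by (intro order_trans[OF abs_Re_le_cmod] l2norm_Cauchy_Schwarz_complex R) (auto simp: inH_def)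
  also have "\<dots> \<le> C * (L1 1 a * N m b + L1 1 b * N m a) * N m b" using Rle by (simp add: N_def mult_right_mono)
  finally show ?thesis by (simp add: C_def)
qed

section \<open>Energy estimates for an explicit scheme\<close>

lemma trunc_herm: "herm a \<Longrightarrow> herm (trunc a n)" by (simp add: herm_def trunc_def indicator_def of_bool_def)

lemma trunc_trunc [simp]: "trunc (trunc a n) n = trunc a n" by (auto simp: trunc_def indicator_def fun_eq_iff)

lemma trunc_add: "trunc (\<lambda>x. a x + b x) n = (\<lambda>x. trunc a n x + trunc b n x)"
  by (simp add: trunc_def fun_eq_iff algebra_simps)

lemma trunc_mult: "trunc (\<lambda>x. c * a x) n = (\<lambda>x. c * trunc a n x)" by (simp add: trunc_def fun_eq_iff algebra_simps)

lemma inH_trunc: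
  assumes a: "sqi a" shows "inH m (trunc a n)" unfolding inH_def
proof (rule sqi_dominated[OF a])
  show "wt m (trunc a n) \<in> borel_measurable borel" using a by measurable
  show "cmod (wt m (trunc a n) x) \<le> (1 + real n) powr \<bar>m\<bar> * cmod (a x)" for x
  proof (cases "norm x \<le> real n")
    case True
    have "jb x \<le> 1 + real n" using jb_add_le[of 0 x] True by (simp add: jb_def)
    then have "jb x powr \<bar>m\<bar> \<le> (1 + real n) powr \<bar>m\<bar>" by (intro powr_mono2) auto
    moreover have "jb x powr m \<le> jb x powr \<bar>m\<bar>" by (rule jb_powr_mono) simp
    ultimately have "jb x powr m \<le> (1 + real n) powr \<bar>m\<bar>" by linarith
    with True show ?thesis by (simp add: cmod_wt trunc_def mult_right_mono)
  qed (simp add: cmod_wt trunc_def)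
qed

lemma N_trunc_le: assumes "inH m a" shows "N m (trunc a n) \<le> N m a"
  using N_dominated[OF assms, of "trunc a n" 1] assms inH_measurable[OF assms] by (auto simp: trunc_def indicator_def)

lemma inH_trunc': "inH m a \<Longrightarrow> inH m (trunc a n)" by (rule inH_dominated[of m a _ 1]) (auto simp: trunc_def indicator_def)

lemma N_Suc_trunc: 
  assumes a: "sqi a" shows "N (m + 1) (trunc a n) \<le> (1 + real n) * N m (trunc a n)" unfolding N_def
proof (rule l2norm_mono_AE, rule AE_I2)
  show "cmod (wt (m + 1) (trunc a n) x) \<le> (1 + real n) * cmod (wt m (trunc a n) x)" for x
  proof (cases "norm x \<le> real n")
    case True
    have "jb x \<le> 1 + real n" using jb_add_le[of 0 x] True by (simp add: jb_def)
    then have "jb x * (jb x powr m * cmod (a x)) \<le> (1 + real n) * (jb x powr m * cmod (a x))" by (intro mult_right_mono) auto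
    with True show ?thesis by (simp add: cmod_wt trunc_def powr_add mult_ac)
  qed (simp add: cmod_wt trunc_def)
qed (use inH_trunc[OF a] in \<open>simp_all add: inH_def\<close>)

lemma N_diff_trunc:
  assumes a: "inH (m + 1) a" and n: "0 < n"
  shows "Nd m a (trunc a n) \<le> 1 / real n * N (m + 1) a" unfolding N_def
proof (rule l2norm_mono_AE, rule AE_I2)
  have am: "inH m a" using inH_mono[of m "m + 1" a] a by simp
  show "sqi (wt m (\<lambda>x. a x - trunc a n x))" "sqi (wt (m + 1) a)" using am inH_trunc'[OF am] a unfolding inH_def wt_diff by auto
  show "cmod (wt m (\<lambda>x. a x - trunc a n x) x) \<le> 1 / real n * cmod (wt (m + 1) a x)" for x
  proof (cases "norm x \<le> real n")
    case False
    then have "real n \<le> jb x" using norm_le_jb[of x] by linarith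
    then have "real n * (jb x powr m * cmod (a x)) \<le> jb x * (jb x powr m * cmod (a x))" by (intro mult_right_mono) auto
    with False n show ?thesis by (simp add: cmod_wt trunc_def powr_add field_simps)
  qed (simp add: cmod_wt trunc_def)
qed simp

lemma ip_trunc: "ip m (trunc x n) (trunc y n) = ip m (trunc x n) y" unfolding ip_def
  by (intro arg_cong[where f=Re] LINT_cong refl)
    (auto simp: wt_def trunc_def indicator_def)

text \<open>A constant for the embedding of H^s into L1 with weight 1. Only the difference
  \<open>s - 1\<close> of the exponents matters, so it also serves H^{s-1} with weight 0. The added
  1 gives \<open>1 \<le> cL s\<close>.\<close>

definition cL :: "real \<Rightarrow> real" where "cL s = l2norm (jbc (s - 1)) + 1"

lemma cL_ge_1: "1 \<le> cL s" by (simp add: cL_def)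

lemma
  assumes s: "2 < s" and a: "inH s a"
  shows L1i_1: "L1i 1 a" and L1i_0: "L1i 0 a" and L1_1_le: "L1 1 a \<le> cL s * N s a" and L1_0_le: "L1 0 a \<le> cL s * N s a"
proof -
  show 1: "L1i 1 a" by (rule inH_L1i[OF _ a]) (use s in simp)
  show "L1i 0 a" using L1i_mono[OF _ 1] by simp
  have "L1 1 a \<le> l2norm (jbc (s - 1)) * N s a" by (rule L1_le_N[OF _ a]) (use s in simp)
  also have "\<dots> \<le> cL s * N s a" by (intro mult_right_mono) (auto simp: cL_def)
  finally show 2: "L1 1 a \<le> cL s * N s a" .
  show "L1 0 a \<le> cL s * N s a" using L1_mono[OF _ 1, of 0] 2 by simp
qed

text \<open>The form used most: \<open>B\<close> loses one derivative, provided that the arguments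
  are at least in H^s and so have finite Lipschitz quantity \<open>L1 1\<close>.\<close>

lemma
  assumes s: "2 < s" and m: "0 \<le> m" "s \<le> m + 1" and a: "inH (m + 1) a" and b: "inH (m + 1) b"
  shows inH_B_quad: "inH m (B a b)" and N_B_quad: "N m (B a b) \<le> 2 powr (m + 1) * cL s * N (m + 1) a * N (m + 1) b"
proof -
  have as: "inH s a" "N s a \<le> N (m + 1) a" "inH m a" "N m a \<le> N (m + 1) a"
    using inH_mono[OF m(2) a] N_mono[OF m(2) a] inH_mono[of m "m + 1" a] N_mono[of m "m + 1" a] a by auto
  have bs: "inH s b" "N s b \<le> N (m + 1) b" using inH_mono[OF m(2) b] N_mono[OF m(2) b] by auto
  note La = L1i_0[OF s as(1)] L1_0_le[OF s as(1)]
  note Lb = L1i_1[OF s bs(1)] L1_1_le[OF s bs(1)]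
  have c: "0 \<le> cL s" using cL_ge_1[of s] by simp
  show "inH m (B a b)" by (rule inH_B[OF m(1) as(3) La(1) b Lb(1)])
  have "N m (B a b) \<le> 2 powr m * (L1 0 a * N (m + 1) b + N m a * L1 1 b)" by (rule N_B[OF m(1) as(3) La(1) b Lb(1)])
  also have "\<dots> \<le> 2 powr m * ((cL s * N (m + 1) a) * N (m + 1) b + N (m + 1) a * (cL s * N (m + 1) b))" using La(2) Lb(2) as bs c
    by (intro mult_left_mono add_mono mult_right_mono mult_mono order_trans[OF La(2)] order_trans[OF Lb(2)]) auto
  also have "\<dots> = 2 powr (m + 1) * cL s * N (m + 1) a * N (m + 1) b" by (simp add: powr_add algebra_simps)
  finally show "N m (B a b) \<le> 2 powr (m + 1) * cL s * N (m + 1) a * N (m + 1) b" .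
qed

lemma discrete_Gronwall:
  fixes y :: "nat \<Rightarrow> real"
  assumes step: "\<And>k. k < n \<Longrightarrow> y (Suc k) \<le> (1 + c * h) * y k + h * E"
    and nn: "0 \<le> c" "0 \<le> h" "0 \<le> E" "0 \<le> y 0"
  shows "k \<le> n \<Longrightarrow> y k \<le> exp (c * (real k * h)) * (y 0 + real k * h * E)"
proof (induction k)
  case (Suc k)
  then have IH: "y k \<le> exp (c * (real k * h)) * (y 0 + real k * h * E)" by simp
  have e1: "1 \<le> exp (c * (real (Suc k) * h))" using nn by simp
  have "y (Suc k) \<le> (1 + c * h) * y k + h * E" using Suc.prems by (intro step) simp
  also have "\<dots> \<le> (1 + c * h) * (exp (c * (real k * h)) * (y 0 + real k * h * E)) + h * E"
    using IH nn by (intro add_right_mono mult_left_mono) auto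
  also have "\<dots> \<le> exp (c * h) * (exp (c * (real k * h)) * (y 0 + real k * h * E)) + exp (c * (real (Suc k) * h)) * (h * E)"
    using nn e1 mult_right_mono[OF e1, of "h * E"] exp_ge_add_one_self[of "c * h"] by (intro add_mono mult_right_mono) auto
  also have "\<dots> = exp (c * (real (Suc k) * h)) * (y 0 + real (Suc k) * h * E)" by (simp add: algebra_simps flip: exp_add)
  finally show ?case .
qed simp

text \<open>\<open>v'\<close> is an Euler step from \<open>v\<close> with velocity \<open>D\<close>,
  up to a residual \<open>e * h\<close>. In the expanded square the drift
  \<open>2 * h * ip m v D\<close> is where cancellations enter; the squared velocity and the
  residual add \<open>h\<close> times a quantity of order \<open>h + e\<close>, hence order
  \<open>h + e\<close> after summation over a bounded time.\<close>

lemma energy_step: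
  assumes v: "inH m v" "inH m v'" and D: "inH m D"
    and ip: "ip m v D \<le> C * (N m v)\<^sup>2" and D0: "N m D \<le> D0" and M: "N m v \<le> M"
    and err: "N m (\<lambda>x. v' x - v x - of_real h * D x) \<le> e * h" and h: "0 \<le> h" "h \<le> 1" and e: "0 \<le> e" "e \<le> 1"
  shows "(N m v')\<^sup>2 \<le> (1 + 2 * C * h) * (N m v)\<^sup>2 + h * (h * D0\<^sup>2 + (2 * M + 2 * D0 + 1) * e)"
proof -
  define w where "w x = v x + of_real h * D x" for x
  have hD: "inH m (\<lambda>x. of_real h * D x)" using D by auto
  have w: "inH m w" unfolding w_def using v hD by auto
  have D00: "0 \<le> D0" using D0 N_nonneg order_trans by blast
  have M0: "0 \<le> M" using M N_nonneg order_trans by blast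
  have "(N m w)\<^sup>2 = (N m v)\<^sup>2 + 2 * (h * ip m v D) + (h * N m D)\<^sup>2"
    unfolding w_def N_add_square[OF v(1) hD] using h by (simp add: ip_mult_right)
  also have "\<dots> \<le> (N m v)\<^sup>2 + 2 * (h * (C * (N m v)\<^sup>2)) + (h * D0)\<^sup>2"
    using ip D0 h by (intro add_mono mult_left_mono power_mono) auto
  finally have w2: "(N m w)\<^sup>2 \<le> (1 + 2 * C * h) * (N m v)\<^sup>2 + h\<^sup>2 * D0\<^sup>2" by (simp add: algebra_simps)
  have "N m w \<le> N m v + h * N m D" using N_triangle[OF v(1) hD] h by (simp add: w_def[abs_def])
  also have "\<dots> \<le> M + 1 * D0" using M D0 h D00 by (intro add_mono mult_mono) auto
  finally have wM: "N m w \<le> M + D0" by simp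
  have "N m v' \<le> Nd m v' w + N m w" by (rule N_le_diff_add[OF v(2) w])
  also have "Nd m v' w \<le> e * h" using err by (simp add: w_def diff_diff_eq)
  finally have "N m v' \<le> e * h + N m w" by simp
  then have "(N m v')\<^sup>2 \<le> (e * h + N m w)\<^sup>2" by (intro power_mono) auto
  also have "\<dots> = (N m w)\<^sup>2 + 2 * (e * h * N m w) + (e * h) * (e * h)" by (simp add: power2_eq_square algebra_simps)
  also have "\<dots> \<le> (N m w)\<^sup>2 + 2 * (e * h * (M + D0)) + 1 * (e * h)"
    using wM e h mult_le_one[of e h] by (intro add_mono mult_left_mono mult_right_mono) auto
  finally show ?thesis using w2 by (simp add: power2_eq_square algebra_simps)
qed

lemma energy_Gronwall:
  fixes v D :: "nat \<Rightarrow> cfun"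
  assumes v: "\<And>k. k \<le> n \<Longrightarrow> inH m (v k)" and D: "\<And>k. k < n \<Longrightarrow> inH m (D k)"
    and ip: "\<And>k. k < n \<Longrightarrow> ip m (v k) (D k) \<le> C * (N m (v k))\<^sup>2"
    and D0: "\<And>k. k < n \<Longrightarrow> N m (D k) \<le> D0" and M: "\<And>k. k < n \<Longrightarrow> N m (v k) \<le> M"
    and err: "\<And>k. k < n \<Longrightarrow> N m (\<lambda>x. v (Suc k) x - v k x - of_real h * D k x) \<le> e * h"
    and h: "0 \<le> h" "h \<le> 1" and e: "0 \<le> e" "e \<le> 1" and nn: "0 \<le> C" "0 \<le> D0" "0 \<le> M"
  shows "(N m (v n))\<^sup>2 \<le> exp (2 * C * (real n * h)) *
     ((N m (v 0))\<^sup>2 + real n * h * (h * D0\<^sup>2 + (2 * M + 2 * D0 + 1) * e))"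
proof (rule discrete_Gronwall[of n "\<lambda>k. (N m (v k))\<^sup>2"])
  show "(N m (v (Suc k)))\<^sup>2 \<le> (1 + 2 * C * h) * (N m (v k))\<^sup>2 + h * (h * D0\<^sup>2 + (2 * M + 2 * D0 + 1) * e)"
    if "k < n" for k using that by (intro energy_step[where D="D k"] v D ip D0 M err h e) auto
qed (use nn h e in auto)

text \<open>Frequencies above \<open>n\<close> are cut off; the time step \<open>h\<close> is to be small against \<open>1 / n\<^sup>2\<close>.\<close>

primrec euler :: "nat \<Rightarrow> real \<Rightarrow> cfun \<Rightarrow> nat \<Rightarrow> cfun" where
  "euler n h a 0 = trunc a n"
| "euler n h a (Suc k) = (\<lambda>x. euler n h a k x + of_real h * trunc (Bq (euler n h a k)) n x)"

lemma euler_props: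
  assumes a: "sqi a" "herm a"
  shows "trunc (euler n h a k) n = euler n h a k \<and> (\<forall>m. inH m (euler n h a k)) \<and> herm (euler n h a k)"
proof (induction k)
  case 0
  then show ?case using a by (simp add: inH_trunc trunc_herm)
next
  case (Suc k)
  let ?x = "euler n h a k"
  have x: "trunc ?x n = ?x" "\<And>m. inH m ?x" "herm ?x" using Suc by auto
  \<comment> \<open>Any admissible exponents would serve, as a truncated function is in every
    \<open>inH m\<close>.\<close>
  have "sqi (Bq ?x)" using inH_B_quad[of 3 2 ?x ?x] inH_mono[of 0 2] x by (simp add: inH_0)
  moreover have "herm (Bq ?x)" by (rule herm_B) (use x in auto)
  ultimately show ?case using x
    by (auto simp: trunc_add trunc_mult intro!: inH_add inH_mult_left inH_trunc herm_add herm_real_mult trunc_herm)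
qed

lemmas euler_inH = euler_props[THEN conjunct2, THEN conjunct1, rule_format]
lemmas euler_herm = euler_props[THEN conjunct2, THEN conjunct2]

text \<open>Growth rate of the squared norm along the scheme. The first summand is the commutator
  estimate with both arguments equal, the second comes from the squared velocity, whose frequency
  factor the step-size condition consumes.\<close>

definition cE :: "real \<Rightarrow> real \<Rightarrow> real" where
  "cE m \<Lambda> = 4 * (m * 2 powr (m - 1)) * \<Lambda> + 4 powr (m + 1) * \<Lambda>\<^sup>2"

lemma cE_nonneg: "1 \<le> m \<Longrightarrow> 0 \<le> \<Lambda> \<Longrightarrow> 0 \<le> cE m \<Lambda>" by (simp add: cE_def)

text \<open>The projection is symmetric and fixes the iterate, so it drops out of the inner product
  and the commutator estimate applies. In \<open>h\<^sup>2 * (N m F)\<^sup>2\<close> the lost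
  derivative costs \<open>(1 + real n)\<^sup>2\<close>, which is compensated by
  \<open>h * (1 + real n)\<^sup>2 \<le> 1\<close>.\<close>

lemma euler_energy_step:
  assumes a: "sqi a" "herm a" and m: "1 \<le> m" and h: "0 \<le> h" "h * (1 + real n)\<^sup>2 \<le> 1"
    and L: "L1 1 (euler n h a k) \<le> \<Lambda>"
  shows "(N m (euler n h a (Suc k)))\<^sup>2 \<le> (1 + cE m \<Lambda> * h) * (N m (euler n h a k))\<^sup>2"
proof -
  define x where "x = euler n h a k"
  have x: "trunc x n = x" "\<And>m. inH m x" "herm x" unfolding x_def using euler_props[OF a] by auto
  have L1: "L1i 1 x" "L1i 0 x" using L1i_1[of 3 x] L1i_0[of 3 x] x by auto
  have L': "L1 1 x \<le> \<Lambda>" "L1 0 x \<le> \<Lambda>" using L L1_mono[OF _ L1(1), of 0] by (auto simp: x_def)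
  have \<Lambda>: "0 \<le> \<Lambda>" using L'(1) L1_nonneg order_trans by blast
  define F where "F = trunc (Bq x) n"
  have Bx: "inH m (Bq x)" by (rule inH_B) (use m x L1 in auto)
  have F: "inH m F" unfolding F_def by (rule inH_trunc'[OF Bx])
  have Nn: "N (m + 1) x \<le> (1 + real n) * N m x" using N_Suc_trunc[of x m n] x inH_0[of x] by auto
  have "N m F \<le> N m (Bq x)" unfolding F_def by (rule N_trunc_le[OF Bx])
  also have "\<dots> \<le> 2 powr m * (L1 0 x * N (m + 1) x + N m x * L1 1 x)" by (rule N_B) (use m x L1 in auto)
  also have "\<dots> \<le> 2 powr m * (\<Lambda> * ((1 + real n) * N m x) + N m x * \<Lambda>)"
    using L' \<Lambda> Nn by (intro mult_left_mono add_mono mult_mono) auto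
  also have "\<dots> \<le> 2 powr m * (\<Lambda> * ((1 + real n) * N m x) + (1 + real n) * N m x * \<Lambda>)"
    using \<Lambda> by (intro mult_left_mono add_left_mono mult_right_mono) (auto simp: algebra_simps)
  also have "\<dots> = 2 powr (m + 1) * \<Lambda> * (1 + real n) * N m x" by (simp add: powr_add algebra_simps)
  finally have "(N m F)\<^sup>2 \<le> (2 powr (m + 1) * \<Lambda> * (1 + real n) * N m x)\<^sup>2" by (intro power_mono) auto
  also have "\<dots> = (4 powr (m + 1) * \<Lambda>\<^sup>2 * (N m x)\<^sup>2) * (1 + real n)\<^sup>2"
  proof -
    have "(2 powr (m + 1) * 2 powr (m + 1) :: real) = 4 powr (m + 1)" by (subst powr_mult[symmetric]) auto
    then show ?thesis by (simp add: power2_eq_square mult_ac)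
  qed
  finally have F2: "(N m F)\<^sup>2 \<le> (4 powr (m + 1) * \<Lambda>\<^sup>2 * (N m x)\<^sup>2) * (1 + real n)\<^sup>2" .
  have "h\<^sup>2 * (N m F)\<^sup>2 \<le> h\<^sup>2 * ((4 powr (m + 1) * \<Lambda>\<^sup>2 * (N m x)\<^sup>2) * (1 + real n)\<^sup>2)"
    by (intro mult_left_mono F2) auto
  also have "\<dots> = (h * (4 powr (m + 1) * \<Lambda>\<^sup>2 * (N m x)\<^sup>2)) * (h * (1 + real n)\<^sup>2)"
    by (simp add: power2_eq_square)
  also have "\<dots> \<le> (h * (4 powr (m + 1) * \<Lambda>\<^sup>2 * (N m x)\<^sup>2)) * 1" using h by (intro mult_left_mono) auto
  finally have F3: "h\<^sup>2 * (N m F)\<^sup>2 \<le> h * (4 powr (m + 1) * \<Lambda>\<^sup>2 * (N m x)\<^sup>2)" by simp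
  have "ip m x F = ip m (trunc x n) (trunc (Bq x) n)" using x by (simp add: F_def)
  also have "\<dots> = ip m (Bq x) x" unfolding ip_trunc using x by (simp add: ip_commute)
  also have "\<dots> \<le> m * 2 powr (m - 1) * (L1 1 x * N m x + L1 1 x * N m x) * N m x"
    using ip_B[OF m x(3) L1(1) x(2) x(2) L1(1)] by (rule abs_le_D1)
  also have "\<dots> = 2 * (m * 2 powr (m - 1)) * L1 1 x * (N m x)\<^sup>2" by (simp add: power2_eq_square)
  also have "\<dots> \<le> 2 * (m * 2 powr (m - 1)) * \<Lambda> * (N m x)\<^sup>2"
    using L' m by (intro mult_right_mono mult_left_mono) auto
  finally have ip: "ip m x F \<le> 2 * (m * 2 powr (m - 1)) * \<Lambda> * (N m x)\<^sup>2" .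
  have hF: "inH m (\<lambda>z. of_real h * F z)" using F by auto
  have "euler n h a (Suc k) = (\<lambda>z. x z + of_real h * F z)" by (simp add: x_def F_def)
  then have "(N m (euler n h a (Suc k)))\<^sup>2 = (N m x)\<^sup>2 + 2 * (h * ip m x F) + h\<^sup>2 * (N m F)\<^sup>2"
    using N_add_square[OF x(2) hF] h by (simp add: ip_mult_right power_mult_distrib)
  also have "\<dots> \<le> (N m x)\<^sup>2 + 2 * (h * (2 * (m * 2 powr (m - 1)) * \<Lambda> * (N m x)\<^sup>2)) + h * (4 powr (m + 1) * \<Lambda>\<^sup>2 * (N m x)\<^sup>2)"
    using ip F3 h by (intro add_mono mult_left_mono) auto
  also have "\<dots> = (1 + cE m \<Lambda> * h) * (N m x)\<^sup>2" by (simp add: cE_def algebra_simps)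
  finally show ?thesis by (simp add: x_def)
qed

text \<open>One bound \<open>\<Lambda>\<close> on the Lipschitz quantity controls the norms of every
  order \<open>m\<close>, so a bootstrap carried out at order \<open>s\<close> propagates to order
  \<open>s + 2\<close>.\<close>

lemma euler_energy:
  assumes a: "inH m a" "sqi a" "herm a" and m: "1 \<le> m" and h: "0 \<le> h" "h * (1 + real n)\<^sup>2 \<le> 1"
    and L: "\<And>j. j < k \<Longrightarrow> L1 1 (euler n h a j) \<le> \<Lambda>" and \<Lambda>: "0 \<le> \<Lambda>" and S: "real k * h \<le> S"
  shows "N m (euler n h a k) \<le> exp (cE m \<Lambda> * S) * N m a"
proof -
  have c: "0 \<le> cE m \<Lambda>" by (rule cE_nonneg[OF m \<Lambda>])
  have "(N m (euler n h a k))\<^sup>2 \<le> exp (cE m \<Lambda> * (real k * h)) * ((N m (euler n h a 0))\<^sup>2 + real k * h * 0)"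
    by (rule discrete_Gronwall[of k "\<lambda>k. (N m (euler n h a k))\<^sup>2"])
      (use euler_energy_step[OF a(2,3) m h L] c h in auto)
  also have "\<dots> \<le> exp (cE m \<Lambda> * S) * (N m a)\<^sup>2"
    using c S N_trunc_le[OF a(1), of n] by (intro mult_mono) (auto intro!: mult_left_mono power_mono)
  \<comment> \<open>Doubling the exponent makes the right-hand side a perfect square.\<close>
  also have "\<dots> \<le> exp (cE m \<Lambda> * S) * exp (cE m \<Lambda> * S) * (N m a)\<^sup>2"
  proof -
    have "0 \<le> S" using S h by (meson mult_nonneg_nonneg of_nat_0_le_iff order_trans)
    then have "1 \<le> exp (cE m \<Lambda> * S)" using c by simp
    then show ?thesis by (intro mult_right_mono) auto
  qed
  also have "\<dots> = (exp (cE m \<Lambda> * S) * N m a)\<^sup>2" by (simp add: power2_eq_square mult_ac)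
  finally show ?thesis by (rule power2_le_imp_le) simp
qed

section \<open>Stability of approximate solutions in L2\<close>

lemma B_diff:
  assumes a: "inH 1 a" and b: "inH 1 b"
  shows "Bq a x - Bq b x = B a (\<lambda>x. a x - b x) x + B (\<lambda>x. a x - b x) b x"
proof -
  have "sqi a" "sqi b" using inH_mono[of 0 1] a b by (auto simp: inH_0)
  then show ?thesis using a b by (simp add: B_diff_left B_diff_right)
qed

text \<open>The velocities differ by \<open>B a v\<close> plus \<open>B v b\<close>. Transport by
  \<open>a\<close> preserves the L2 norm, and in \<open>B v b\<close> the derivative falls on
  \<open>b\<close>; so the growth rate involves no derivative of \<open>v\<close>.\<close>

lemma B_diff_L2:
  assumes s: "2 < s" and a: "inH s a" "herm a" and b: "inH s b" "herm b"
  defines "v \<equiv> \<lambda>x. a x - b x" and "D \<equiv> \<lambda>x. Bq a x - Bq b x"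
  shows "inH 0 D" "ip 0 v D \<le> cL s * N s b * (N 0 v)\<^sup>2"
    "N 0 D \<le> cL s * (N s a + N s b) * N 1 v"
proof -
  have 1: "inH 1 a" "inH 1 b" "sqi a" "sqi b" using inH_mono[of 1 s] inH_mono[of 0 s] a b s by (auto simp: inH_0)
  have v: "inH s v" "inH 1 v" "sqi v" "herm v" unfolding v_def using a b 1 by (auto intro: herm_diff)
  note La = L1i_0[OF s a(1)] L1_0_le[OF s a(1)] and Lb = L1i_1[OF s b(1)] L1_1_le[OF s b(1)]
  have D: "D = (\<lambda>x. B a v x + B v b x)" unfolding D_def v_def using B_diff[OF 1(1,2)] by auto
  have p1: "inH 0 (B a v)" "N 0 (B a v) \<le> 2 powr 0 * (L1 0 a * N (0 + 1) v)" using inH_B'[of 0 a v] N_B'[of 0 a v] 1 La v by auto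
  have p2: "inH 0 (B v b)" "N 0 (B v b) \<le> N 0 v * L1 1 b" using inH_B''[of v b] N_B''[of v b] 1 Lb v by (auto simp: inH_0 N_0)
  show "inH 0 D" unfolding D using p1 p2 by auto
  have "ip 0 (B a v) v = 0" unfolding ip_def wt_0 using B_antisym[OF a(2) La(1) v(2)] by simp
  moreover have "ip 0 v D = ip 0 (B a v) v + ip 0 (B v b) v" unfolding D using p1 p2 v by (subst ip_commute) (simp add: ip_add_left inH_0)
  moreover have "ip 0 (B v b) v \<le> N 0 (B v b) * N 0 v" using ip_le[of 0 "B v b" v] p2 v by (auto simp: inH_0)
  moreover have "N 0 (B v b) * N 0 v \<le> (N 0 v * (cL s * N s b)) * N 0 v"
    using order_trans[OF p2(2) mult_left_mono[OF Lb(2)]] by (intro mult_right_mono) auto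
  ultimately show "ip 0 v D \<le> cL s * N s b * (N 0 v)\<^sup>2" by (simp add: power2_eq_square mult_ac)
  have "N 0 D \<le> N 0 (B a v) + N 0 (B v b)" unfolding D by (rule N_triangle[OF p1(1) p2(1)])
  also have "\<dots> \<le> L1 0 a * N 1 v + N 0 v * L1 1 b" using p1 p2 by simp
  also have "\<dots> \<le> (cL s * N s a) * N 1 v + N 1 v * (cL s * N s b)"
    using La Lb v N_mono[of 0 1 v] cL_ge_1[of s] by (intro add_mono mult_mono) auto
  finally show "N 0 D \<le> cL s * (N s a + N s b) * N 1 v" by (simp add: algebra_simps)
qed

text \<open>Collects the coefficients of \<open>h\<close> and \<open>e\<close> in
  \<open>stab_L2\<close>: \<open>4 * cL s * M * M\<close> bounds the difference of the velocities,
  and the factor 2 accounts for two sequences of residuals.\<close>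

definition stabK :: "real \<Rightarrow> real \<Rightarrow> real" where
  "stabK s M = (4 * cL s * M * M)\<^sup>2 + 2 * (4 * M + 2 * (4 * cL s * M * M) + 1)"

lemma stabK_nonneg: "0 \<le> M \<Longrightarrow> 0 \<le> stabK s M" using cL_ge_1[of s] by (simp add: stabK_def)

text \<open>Stated for sequences with small residuals, so that one proof compares Euler iterates
  with samples of a solution, interpolated iterates with each other, and samples of two
  solutions.\<close>

lemma stab_L2:
  fixes a b :: "nat \<Rightarrow> cfun"
  assumes s: "2 < s" and a: "\<And>k. k \<le> n \<Longrightarrow> inH s (a k) \<and> herm (a k)" and b: "\<And>k. k \<le> n \<Longrightarrow> inH s (b k) \<and> herm (b k)"
    and aM: "\<And>k. k < n \<Longrightarrow> N s (a k) \<le> M" and bM: "\<And>k. k < n \<Longrightarrow> N s (b k) \<le> M"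
    and aerr: "\<And>k. k < n \<Longrightarrow> N 0 (defect h (a k) (a (Suc k))) \<le> e * h"
    and berr: "\<And>k. k < n \<Longrightarrow> N 0 (defect h (b k) (b (Suc k))) \<le> e * h"
    and h: "0 \<le> h" "h \<le> 1" and e: "0 \<le> e" "2 * e \<le> 1" and T: "real n * h \<le> T" and M: "0 \<le> M"
  shows "(Nd 0 (a n) (b n))\<^sup>2 \<le> exp (2 * (cL s * M) * T) *
     ((Nd 0 (a 0) (b 0))\<^sup>2 + T * (stabK s M * (h + e)))"
proof -
  define v where "v k z = a k z - b k z" for k z
  define D where "D k z = Bq (a k) z - Bq (b k) z" for k z
  define D0 where "D0 = 4 * cL s * M * M"
  have c: "0 \<le> cL s" using cL_ge_1[of s] by simp
  have v: "inH s (v k)" if "k \<le> n" for k unfolding v_def using a[OF that] b[OF that] by auto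
  have v0: "inH 0 (v k)" if "k \<le> n" for k using inH_mono[OF _ v[OF that], of 0] s by simp
  have est: "inH 0 (D k)" "ip 0 (v k) (D k) \<le> cL s * N s (b k) * (N 0 (v k))\<^sup>2"
    "N 0 (D k) \<le> cL s * (N s (a k) + N s (b k)) * N 1 (v k)" if "k < n" for k
    using B_diff_L2[OF s, of "a k" "b k"] a[of k] b[of k] that unfolding v_def D_def by auto
  have vM: "N s (v k) \<le> 2 * M" if "k < n" for k
    using N_triangle_diff[of s "a k" "b k"] a[of k] b[of k] aM[of k] bM[of k] that by (simp add: v_def[abs_def])
  have vM': "N m (v k) \<le> 2 * M" if "k < n" "m \<le> s" for k m using vM[OF that(1)] N_mono[OF that(2) v[of k]] that by simp
  have ip: "ip 0 (v k) (D k) \<le> (cL s * M) * (N 0 (v k))\<^sup>2" if "k < n" for k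
    using est(2)[OF that] mult_right_mono[OF mult_left_mono[OF bM[OF that] c], of "(N 0 (v k))\<^sup>2"] by simp
  have D0: "N 0 (D k) \<le> D0" if "k < n" for k
  proof -
    have "cL s * (N s (a k) + N s (b k)) * N 1 (v k) \<le> cL s * (M + M) * (2 * M)"
      using that aM[OF that] bM[OF that] vM'[OF that, of 1] s c M by (intro mult_mono) auto
    then show ?thesis using est(3)[OF that] by (simp add: D0_def mult_ac)
  qed
  have err: "N 0 (\<lambda>z. v (Suc k) z - v k z - of_real h * D k z) \<le> (2 * e) * h" if "k < n" for k
  proof -
    define p where "p x k z = x (Suc k) z - x k z - of_real h * Bq (x k) z" for x :: "nat \<Rightarrow> cfun" and k z
    have p: "inH 0 (p x k)" if "inH s (x (Suc k))" "inH s (x k)" for x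
    proof -
      have "inH (s - 1) (Bq (x k))" using inH_B_quad[OF s, of "s - 1"] that s by simp
      then have "inH 0 (Bq (x k))" using inH_mono[of 0 "s - 1"] s by simp
      then show ?thesis unfolding p_def using that inH_mono[of 0 s] s by (intro inH_diff inH_mult_left) auto
    qed
    have "(\<lambda>z. v (Suc k) z - v k z - of_real h * D k z) = (\<lambda>z. p a k z - p b k z)"
      by (simp add: v_def D_def p_def algebra_simps)
    then have "N 0 (\<lambda>z. v (Suc k) z - v k z - of_real h * D k z) \<le> N 0 (p a k) + N 0 (p b k)"
      using N_triangle_diff[of 0 "p a k" "p b k"] p[of a] p[of b] a b that by simp
    also have "\<dots> \<le> e * h + e * h" unfolding p_def using aerr[OF that] berr[OF that] by simp
    finally show ?thesis by simp
  qed
  have "(N 0 (v n))\<^sup>2 \<le> exp (2 * (cL s * M) * (real n * h)) *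
     ((N 0 (v 0))\<^sup>2 + real n * h * (h * D0\<^sup>2 + (2 * (2 * M) + 2 * D0 + 1) * (2 * e)))"
    by (rule energy_Gronwall[where D=D]) (use v0 est(1) ip D0 vM'[of _ 0] s err h e c M in \<open>auto simp: D0_def\<close>)
  also have "\<dots> \<le> exp (2 * (cL s * M) * T) * ((N 0 (v 0))\<^sup>2 + T * (stabK s M * (h + e)))"
  proof -
    have "h * D0\<^sup>2 + (2 * (2 * M) + 2 * D0 + 1) * (2 * e) \<le> stabK s M * (h + e)"
      using h e c M by (simp add: stabK_def D0_def algebra_simps)
    moreover have "0 \<le> h * D0\<^sup>2 + (2 * (2 * M) + 2 * D0 + 1) * (2 * e)" using h e c M by (simp add: D0_def)
    moreover have "0 \<le> T" using T h by (meson mult_nonneg_nonneg of_nat_0_le_iff order_trans)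
    ultimately have A: "real n * h * (h * D0\<^sup>2 + (2 * (2 * M) + 2 * D0 + 1) * (2 * e)) \<le> T * (stabK s M * (h + e))"
      and A0: "0 \<le> real n * h * (h * D0\<^sup>2 + (2 * (2 * M) + 2 * D0 + 1) * (2 * e))" using T h by (auto intro!: mult_mono)
    have "exp (2 * (cL s * M) * (real n * h)) \<le> exp (2 * (cL s * M) * T)" using T c M by (simp add: mult_left_mono)
    then show ?thesis by (rule mult_mono[OF _ add_left_mono[OF A]]) (use A0 in auto)
  qed
  finally show ?thesis by (simp add: v_def[abs_def])
qed

abbreviation consistent :: "real \<Rightarrow> real \<Rightarrow> (real \<Rightarrow> cfun) \<Rightarrow> bool" where
  "consistent e S \<theta> \<equiv> \<exists>d>0. \<forall>r t. 0 \<le> r \<and> r \<le> t \<and> t \<le> S \<and> t - r < d \<longrightarrow>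
    N 0 (defect (t - r) (\<theta> r) (\<theta> t)) \<le> e * (t - r)"

text \<open>Rough solutions: bounded in H^s, with L2 residuals that are small per unit of time,
  uniformly in \<open>r\<close> and \<open>t\<close>. This is what L2 stability consumes and what
  the integral equation supplies.\<close>

definition rsol :: "real \<Rightarrow> real \<Rightarrow> real \<Rightarrow> (real \<Rightarrow> cfun) \<Rightarrow> bool" where
  "rsol s M S \<theta> \<longleftrightarrow> (\<forall>t\<in>{0..S}. inH s (\<theta> t) \<and> herm (\<theta> t) \<and> N s (\<theta> t) \<le> M) \<and>
    (\<forall>e>0. consistent e S \<theta>)"

text \<open>The residual of the scheme is the part of the velocity above frequency \<open>n\<close>.
  Because \<open>s - 1 > 1\<close>, the velocity has one derivative in L2 to spare, which yields the
  factor \<open>1 / real n\<close>.\<close>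

lemma euler_step_error:
  assumes s: "2 < s" and a: "sqi a" "herm a" and M: "N s (euler n h a k) \<le> M" and h: "0 \<le> h" and n: "0 < n"
  shows "N 0 (defect h (euler n h a k) (euler n h a (Suc k)))
    \<le> 2 powr s * cL s * M\<^sup>2 / real n * h"
proof -
  define x where "x = euler n h a k"
  have x: "inH m x" for m unfolding x_def by (rule euler_inH[OF a])
  have "inH s (Bq x)" by (rule inH_B_quad[OF s]) (use x s in auto)
  then have B: "inH 1 (Bq x)" using inH_mono[of 1 s] s by simp
  have "N 1 (Bq x) \<le> N (s - 1) (Bq x)" by (rule N_mono) (use s inH_B_quad[OF s, of "s - 1"] x in auto)
  also have "\<dots> \<le> 2 powr s * cL s * N s x * N s x" using N_B_quad[OF s, of "s - 1" x x] s x by simp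
  also have "\<dots> \<le> 2 powr s * cL s * M * M"
    using M cL_ge_1[of s] order_trans[OF N_nonneg M] by (intro mult_mono) (auto simp: x_def)
  finally have NB: "N 1 (Bq x) \<le> 2 powr s * cL s * M\<^sup>2" by (simp add: power2_eq_square)
  have "N 0 (defect h x (euler n h a (Suc k)))
      = N 0 (\<lambda>z. of_real (- h) * (Bq x z - trunc (Bq x) n z))" by (simp add: x_def algebra_simps)
  also have "\<dots> = h * Nd 0 (Bq x) (trunc (Bq x) n)" unfolding N_mult_left using h by simp
  also have "\<dots> \<le> h * (1 / real n * N 1 (Bq x))" using N_diff_trunc[of 0 "Bq x" n] B n h by (intro mult_left_mono) auto
  also have "\<dots> \<le> h * (1 / real n * (2 powr s * cL s * M\<^sup>2))" using NB h by (intro mult_left_mono) auto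
  finally show ?thesis by (simp add: x_def mult_ac)
qed

text \<open>The bootstrap: $L^2$-closeness to the reference solution and the energy bound in \<open>inH s\<close>
  control, by interpolation, the Lipschitz quantity \<open>L1 1\<close> on which that energy bound depends.\<close>

lemma euler_bounds:
  assumes s: "2 < s" and ref: "rsol s M S \<theta>" and S: "0 \<le> S" and R: "0 \<le> R"
  shows "\<exists>M' d0 h0 n0. 0 \<le> M' \<and> 0 < d0 \<and> 0 < h0 \<and> (\<forall>a n h. inH s a \<and> herm a \<and> N s a \<le> R \<and>
     Nd 0 a (\<theta> 0) < d0 \<and> n0 \<le> n \<and> 0 < n \<and> 0 < h \<and> h \<le> h0 \<and> h * (1 + real n)\<^sup>2 \<le> 1 \<longrightarrow>
     (\<forall>k. real k * h \<le> S \<longrightarrow> N s (euler n h a k) \<le> M' \<and> L1 1 (euler n h a k) \<le> M'))"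
proof -
  have \<theta>: "inH s (\<theta> t)" "herm (\<theta> t)" "N s (\<theta> t) \<le> M" if "t \<in> {0..S}" for t
    using ref that by (auto simp: rsol_def)
  have M0: "0 \<le> M" using \<theta>(3)[of 0] S order_trans[OF N_nonneg] by auto
  have c: "0 \<le> cL s" using cL_ge_1[of s] by simp
  \<comment> \<open>The reference solution has Lipschitz quantity at most \<open>cL s * M\<close>.
    The 1 is room for the deviation, split into halves for the two terms of the interpolation:
    \<open>e1\<close> serves the H^s part, \<open>y\<close> the L2 part.\<close>
  define \<Lambda> where "\<Lambda> = cL s * M + 1"
  have \<Lambda>: "0 \<le> \<Lambda>" using c M0 by (simp add: \<Lambda>_def)
  define M1 where "M1 = exp (cE s \<Lambda> * S) * R"
  define MM where "MM = max M M1"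
  have MM: "0 \<le> MM" "M \<le> MM" "M1 \<le> MM" using M0 by (auto simp: MM_def)
  define e1 where "e1 = 1 / (2 * (2 * MM + 1))"
  have e1: "0 < e1" "e1 * (2 * MM) \<le> 1 / 2" using MM by (auto simp: e1_def field_simps)
  obtain C' where C': "0 \<le> C'" "\<And>v. inH s v \<Longrightarrow> L1 1 v \<le> e1 * N s v + C' * N 0 v"
    using L1_interpolation[of 1 s e1] s e1 by auto
  define y where "y = 1 / (2 * (C' + 1))"
  have y: "0 < y" "C' * y \<le> 1 / 2" using C'(1) by (auto simp: y_def field_simps)
  define E where "E = exp (2 * (cL s * MM) * S)"
  define Q where "Q = E * S * stabK s MM + 1"
  have Q: "0 < Q" using S stabK_nonneg[OF MM(1), of s] by (simp add: Q_def E_def add_nonneg_pos)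
  have E: "0 < E" by (simp add: E_def)
  define e where "e = min (1/2) (y\<^sup>2 / (4 * Q))"
  have e: "0 < e" "2 * e \<le> 1" "Q * e \<le> y\<^sup>2 / 4"
  proof -
    show "0 < e" "2 * e \<le> 1" using y Q by (auto simp: e_def)
    have "Q * e \<le> Q * (y\<^sup>2 / (4 * Q))" using Q by (intro mult_left_mono) (auto simp: e_def)
    then show "Q * e \<le> y\<^sup>2 / 4" using Q by simp
  qed
  obtain d where d: "0 < d" "\<And>r t. 0 \<le> r \<Longrightarrow> r \<le> t \<Longrightarrow> t \<le> S \<Longrightarrow> t - r < d \<Longrightarrow>
      N 0 (defect (t - r) (\<theta> r) (\<theta> t)) \<le> e * (t - r)"
  proof -
    have "consistent e S \<theta>"
      using spec[OF conjunct2[OF ref[unfolded rsol_def]], of e] e(1) by (rule mp)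
    then show ?thesis using that by blast
  qed
  define h0 where "h0 = min (min 1 (d / 2)) e"
  have h0: "0 < h0" "h0 \<le> 1" "h0 < d" "h0 \<le> e" using d e by (auto simp: h0_def)
  \<comment> \<open>The truncated datum may deviate by twice \<open>d0\<close>, once through the
    datum and once through the cut-off, which \<open>n0\<close> below controls. The factor
    \<open>E\<close> is the amplification up to time \<open>S\<close>.\<close>
  define d0 where "d0 = y / (4 * (E + 1))"
  have d0: "0 < d0" using y E by (simp add: d0_def)
  have d02: "E * (2 * d0)\<^sup>2 \<le> y\<^sup>2 / 4"
  proof -
    have "2 * d0 = (y / 2) / (E + 1)" using E by (simp add: d0_def field_simps)
    then have "E * (2 * d0)\<^sup>2 = E / (E + 1)\<^sup>2 * (y\<^sup>2 / 4)" by (simp only: power_divide) simp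
    also have "E \<le> (E + 1)\<^sup>2" using E by (simp add: power2_eq_square algebra_simps)
    then have "E / (E + 1)\<^sup>2 * (y\<^sup>2 / 4) \<le> 1 * (y\<^sup>2 / 4)"
      using E by (intro mult_right_mono) (auto simp: divide_le_eq_1)
    finally show ?thesis by simp
  qed
  obtain n0 :: nat where n0: "R / d0 + 2 powr s * cL s * M1\<^sup>2 / e < real n0" using reals_Archimedean2 by blast
  have main: "N s (euler n h a k) \<le> max M1 \<Lambda> \<and> L1 1 (euler n h a k) \<le> max M1 \<Lambda>"
    if a: "inH s a" "herm a" "N s a \<le> R" "Nd 0 a (\<theta> 0) < d0" and n: "n0 \<le> n" "0 < n"
      and h: "0 < h" "h \<le> h0" "h * (1 + real n)\<^sup>2 \<le> 1" and k: "real k * h \<le> S" for a n h k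
  proof -
    have a0: "sqi a" using inH_mono[of 0 s a] a s by (simp add: inH_0)
    note eu = euler_inH[OF a0 a(2), of _ n h] euler_herm[OF a0 a(2), of n h]
    have energy: "N s (euler n h a j) \<le> M1"
      if L: "\<And>i. i < j \<Longrightarrow> L1 1 (euler n h a i) \<le> \<Lambda>" and j: "real j * h \<le> S" for j
    proof -
      have "N s (euler n h a j) \<le> exp (cE s \<Lambda> * S) * N s a"
        by (rule euler_energy[OF a(1) a0 a(2) _ _ h(3) L \<Lambda> j]) (use s h in auto)
      also have "\<dots> \<le> M1" unfolding M1_def using a by (intro mult_left_mono) auto
      finally show ?thesis .
    qed
    have Rn: "R / real n \<le> d0" and Mn: "2 powr s * cL s * M1\<^sup>2 / real n \<le> e"
    proof -
      have "0 \<le> R / d0" "0 \<le> 2 powr s * cL s * M1\<^sup>2 / e" using R d0 c e by auto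
      then have "R / d0 \<le> real n" "2 powr s * cL s * M1\<^sup>2 / e \<le> real n" using n0 n by linarith+
      then show "R / real n \<le> d0" "2 powr s * cL s * M1\<^sup>2 / real n \<le> e" using n d0 e by (auto simp: field_simps)
    qed
    have v0: "Nd 0 (euler n h a 0) (\<theta> 0) \<le> 2 * d0"
    proof -
      have i: "inH 0 a" "inH 0 (\<theta> 0)" "inH 0 (trunc a n)" "inH 1 a"
        using a0 inH_mono[of 0 s "\<theta> 0"] \<theta>(1)[of 0] S s inH_trunc[OF a0] inH_mono[of 1 s a] a by (auto simp: inH_0)
      have "Nd 0 (trunc a n) (\<theta> 0) \<le> Nd 0 (trunc a n) a + Nd 0 a (\<theta> 0)" by (rule N_triangle_via) (use i in auto)
      also have "Nd 0 (trunc a n) a \<le> 1 / real n * N 1 a"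
        using N_diff_trunc[of 0 a n] i n by (simp add: N_minus_commute[of 0 "trunc a n"])
      also have "\<dots> \<le> 1 / real n * R" using N_mono[of 1 s a] a s by (intro mult_left_mono) auto
      finally show ?thesis using Rn a by simp
    qed
    have "real k * h \<le> S \<Longrightarrow> L1 1 (euler n h a k) \<le> \<Lambda>" for k
    proof (induction k rule: less_induct)
      case (less k)
      have kS: "real j * h \<le> S" if "j \<le> k" for j
      proof -
        have "real j * h \<le> real k * h" using that h by (intro mult_right_mono) auto
        then show ?thesis using less.prems by simp
      qed
      \<comment> \<open>The energy bound for the iterate \<open>k\<close> needs the Lipschitz bound
        for earlier iterates only; together with L2 closeness it then yields the Lipschitz bound for
        \<open>k\<close>.\<close>
      have L: "L1 1 (euler n h a j) \<le> \<Lambda>" if "j < k" for j using less.IH[OF that] kS that by simp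
      have M1: "N s (euler n h a j) \<le> M1" if "j \<le> k" for j by (rule energy) (use L that kS in auto)
      have \<theta>k: "real j * h \<in> {0..S}" if "j \<le> k" for j using kS[OF that] h by simp
      have "(Nd 0 (euler n h a k) (\<theta> (real k * h)))\<^sup>2 \<le> exp (2 * (cL s * MM) * S) *
         ((Nd 0 (euler n h a 0) (\<theta> (real 0 * h)))\<^sup>2 + S * (stabK s MM * (h + e)))"
      proof (rule stab_L2[where a="euler n h a" and b="\<lambda>j. \<theta> (real j * h)", OF s])
        fix j assume j: "j < k"
        show "N s (euler n h a j) \<le> MM" using M1[of j] j MM by simp
        show "N s (\<theta> (real j * h)) \<le> MM" using \<theta>(3)[OF \<theta>k[of j]] j MM by simp
        have "N 0 (defect h (euler n h a j) (euler n h a (Suc j)))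
          \<le> 2 powr s * cL s * M1\<^sup>2 / real n * h" by (rule euler_step_error[OF s a0 a(2) M1]) (use j h n in auto)
        also have "\<dots> \<le> e * h" using Mn h by (intro mult_right_mono) auto
        finally show "N 0 (defect h (euler n h a j) (euler n h a (Suc j))) \<le> e * h" .
        have "real (Suc j) * h - real j * h = h" by (simp add: algebra_simps)
        then show "N 0 (defect h (\<theta> (real j * h)) (\<theta> (real (Suc j) * h))) \<le> e * h"
          using d(2)[of "real j * h" "real (Suc j) * h"] kS[of "Suc j"] j h h0 by simp
      qed (use eu \<theta>(1,2) \<theta>k h h0 e MM less.prems in auto)
      also have "\<dots> \<le> y\<^sup>2"
      proof -
        have y0: "(Nd 0 (euler n h a 0) (\<theta> (real 0 * h)))\<^sup>2 \<le> (2 * d0)\<^sup>2" using v0 by (intro power_mono) auto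
        have "E * (S * (stabK s MM * (h + e))) \<le> Q * (h + e)" using h e E by (simp add: Q_def algebra_simps)
        also have "\<dots> \<le> Q * (e + e)" using h h0 Q by (intro mult_left_mono) auto
        also have "\<dots> \<le> y\<^sup>2 / 2" using e by simp
        finally have "E * (S * (stabK s MM * (h + e))) \<le> y\<^sup>2 / 2" .
        moreover have "E * (Nd 0 (euler n h a 0) (\<theta> (real 0 * h)))\<^sup>2 \<le> y\<^sup>2 / 4"
          using order_trans[OF mult_left_mono[OF y0] d02] E by simp
        moreover have "0 \<le> y\<^sup>2" by simp
        ultimately show ?thesis unfolding E_def[symmetric] distrib_left by linarith
      qed
      finally have "(Nd 0 (euler n h a k) (\<theta> (real k * h)))\<^sup>2 \<le> y\<^sup>2" .
      then have v: "Nd 0 (euler n h a k) (\<theta> (real k * h)) \<le> y" by (rule power2_le_imp_le) (use y(1) in linarith)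
      have i: "inH s (euler n h a k)" "inH s (\<theta> (real k * h))" using eu \<theta>(1) \<theta>k[of k] by auto
      let ?v = "\<lambda>x. euler n h a k x - \<theta> (real k * h) x"
      have iv: "inH s ?v" using i by auto
      have "N s ?v \<le> 2 * MM" using N_triangle_diff[OF i] M1[of k] \<theta>(3)[OF \<theta>k[of k]] MM by simp
      then have "L1 1 ?v \<le> e1 * (2 * MM) + C' * y"
        using C'(2)[OF iv] mult_left_mono[of "N s ?v" "2 * MM" e1] mult_left_mono[OF v C'(1)] e1 by linarith
      then have Lv: "L1 1 ?v \<le> 1" using e1 y by linarith
      have "L1 1 (\<lambda>x. ?v x + \<theta> (real k * h) x) \<le> L1 1 ?v + L1 1 (\<theta> (real k * h))"
        by (rule L1_triangle) (use L1i_1[OF s] i iv in auto)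
      also have "\<dots> \<le> 1 + cL s * M" using Lv L1_1_le[OF s i(2)] mult_left_mono[OF \<theta>(3)[OF \<theta>k[of k]] c] by simp
      finally show ?case by (simp add: \<Lambda>_def)
    qed
    note L = this
    have "real i * h \<le> S" if "i < k" for i
    proof -
      have "real i * h \<le> real k * h" using that h by (intro mult_right_mono) auto
      then show ?thesis using k by simp
    qed
    then have "N s (euler n h a k) \<le> M1" by (intro energy L k)
    then show ?thesis using L[OF k] by auto
  qed
  show ?thesis by (rule exI[of _ "max M1 \<Lambda>"], rule exI[of _ d0], rule exI[of _ h0], rule exI[of _ n0])
      (use main d0 h0 \<Lambda> in auto)
qed

section \<open>Existence of smooth solutions\<close>

lemma N_trunc_bound:
  assumes a: "sqi a" shows "N m (trunc a n) \<le> (1 + real n) powr \<bar>m\<bar> * l2norm a" unfolding N_def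
proof (rule l2norm_mono_AE, rule AE_I2)
  show "cmod (wt m (trunc a n) x) \<le> (1 + real n) powr \<bar>m\<bar> * cmod (a x)" for x
  proof (cases "norm x \<le> real n")
    case True
    have "jb x \<le> 1 + real n" using jb_add_le[of 0 x] True by (simp add: jb_def)
    then have "jb x powr \<bar>m\<bar> \<le> (1 + real n) powr \<bar>m\<bar>" by (intro powr_mono2) auto
    moreover have "jb x powr m \<le> jb x powr \<bar>m\<bar>" by (rule jb_powr_mono) simp
    ultimately have "jb x powr m \<le> (1 + real n) powr \<bar>m\<bar>" by linarith
    with True show ?thesis by (simp add: cmod_wt trunc_def mult_right_mono)
  qed (simp add: cmod_wt trunc_def)
qed (use inH_trunc[OF a] a in \<open>simp_all add: inH_def\<close>)

text \<open>On a fixed ball of frequencies weighted norms are controlled by the L2 norm, so the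
  bound passes to the limit there; Fatou's lemma lets the ball grow. The bounds \<open>c n\<close>
  may vary with \<open>n\<close>, so that error terms of the scheme disappear in the limit.\<close>

lemma inH_lower_semicontinuous:
  assumes x: "\<And>n. inH 0 (x n)" "\<And>n. inH m (x n)" "\<And>n. N m (x n) \<le> c n" and c: "c \<longlonglongrightarrow> c0"
    and g: "inH 0 g" and lim: "(\<lambda>n. Nd 0 (x n) g) \<longlonglongrightarrow> 0"
  shows "inH m g" "N m g \<le> c0"
proof -
  have c0: "0 \<le> c0" using LIMSEQ_le_const[OF c, of 0] x(3) N_nonneg order_trans by blast
  have g0: "sqi g" "\<And>n. sqi (x n)" using g x by (auto simp: inH_0)
  have tr: "N m (trunc g R) \<le> c0" for R
  proof -
    have "N m (trunc g R) \<le> (1 + real R) powr \<bar>m\<bar> * Nd 0 (x n) g + c n" for n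
    proof -
      have "N m (trunc g R) \<le> Nd m (trunc g R) (trunc (x n) R) + N m (trunc (x n) R)" using g0 by (intro N_le_diff_add inH_trunc) auto
      also have "(\<lambda>z. trunc g R z - trunc (x n) R z) = trunc (\<lambda>z. g z - x n z) R"
        by (simp add: trunc_def fun_eq_iff algebra_simps)
      also have "N m \<dots> \<le> (1 + real R) powr \<bar>m\<bar> * l2dist g (x n)" using g0 by (intro N_trunc_bound) auto
      also have "N m (trunc (x n) R) \<le> c n" using N_trunc_le[OF x(2)] x(3) order_trans by blast
      finally show ?thesis by (simp add: N_0 l2norm_minus_commute[of g])
    qed
    moreover have "(\<lambda>n. (1 + real R) powr \<bar>m\<bar> * Nd 0 (x n) g + c n) \<longlonglongrightarrow> (1 + real R) powr \<bar>m\<bar> * 0 + c0"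
      by (intro tendsto_intros lim c)
    ultimately show ?thesis using LIMSEQ_le_const[of _ c0 "N m (trunc g R)"] by simp
  qed
  have [measurable]: "g \<in> borel_measurable borel" using g0 by auto
  have "(\<integral>\<^sup>+z. ennreal ((cmod (wt m g z))\<^sup>2) \<partial>lborel)
     = (\<integral>\<^sup>+z. liminf (\<lambda>R. ennreal ((cmod (wt m (trunc g R) z))\<^sup>2)) \<partial>lborel)"
  proof (rule nn_integral_cong)
    fix z :: plane
    have "(\<lambda>R. ennreal ((cmod (wt m (trunc g R) z))\<^sup>2)) \<longlonglongrightarrow> ennreal ((cmod (wt m g z))\<^sup>2)"
    proof (rule tendsto_eventually)
      show "\<forall>\<^sub>F R in sequentially. ennreal ((cmod (wt m (trunc g R) z))\<^sup>2) = ennreal ((cmod (wt m g z))\<^sup>2)"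
        using eventually_ge_at_top[of "nat \<lceil>norm z\<rceil>"]
        by eventually_elim (auto simp: wt_def trunc_def indicator_def nat_le_iff ceiling_le_iff)
    qed
    then show "ennreal ((cmod (wt m g z))\<^sup>2) = liminf (\<lambda>R. ennreal ((cmod (wt m (trunc g R) z))\<^sup>2))"
      by (intro lim_imp_Liminf[symmetric]) auto
  qed
  also have "\<dots> \<le> liminf (\<lambda>R. \<integral>\<^sup>+z. ennreal ((cmod (wt m (trunc g R) z))\<^sup>2) \<partial>lborel)"
    by (rule nn_integral_liminf) auto
  also have "\<dots> \<le> ennreal (c0\<^sup>2)"
  proof (rule Liminf_le)
    show "\<forall>\<^sub>F R in sequentially. (\<integral>\<^sup>+z. ennreal ((cmod (wt m (trunc g R) z))\<^sup>2) \<partial>lborel) \<le> ennreal (c0\<^sup>2)"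
    proof (rule always_eventually, rule allI)
      fix R
      have "(\<integral>\<^sup>+z. ennreal ((cmod (wt m (trunc g R) z))\<^sup>2) \<partial>lborel) = ennreal ((N m (trunc g R))\<^sup>2)"
        unfolding N_def by (rule nn_integral_l2norm) (use inH_trunc[OF g0(1), of m R] in \<open>simp add: inH_def\<close>)
      then show "(\<integral>\<^sup>+z. ennreal ((cmod (wt m (trunc g R) z))\<^sup>2) \<partial>lborel) \<le> ennreal (c0\<^sup>2)"
        using tr[of R] by (simp only: ennreal_leI power_mono N_nonneg)
    qed
  qed simp
  finally have "(\<integral>\<^sup>+z. ennreal ((cmod (wt m g z))\<^sup>2) \<partial>lborel) \<le> ennreal (c0\<^sup>2)" .
  then show "inH m g" "N m g \<le> c0" unfolding inH_def N_def using c0 by (auto intro: sqi_nn_integralI)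
qed

text \<open>The H^s norms need only be bounded, since interpolation multiplies them by an
  arbitrarily small factor.\<close>

lemma N_tendsto_interpolation:
  assumes s: "0 \<le> s" "k < s" and x: "\<And>n. inH s (x n)" "\<And>n. N s (x n) \<le> M" and g: "inH s g"
    and lim: "(\<lambda>n. Nd 0 (x n) g) \<longlonglongrightarrow> 0"
  shows "(\<lambda>n. Nd k (x n) g) \<longlonglongrightarrow> 0"
proof (rule LIMSEQ_I)
  fix e :: real assume e: "0 < e"
  define L where "L = M + N s g + 1"
  have M: "0 \<le> M" using x(2) N_nonneg order_trans by blast
  have L: "0 < L" using M N_nonneg[of s g] unfolding L_def by linarith
  obtain C where C: "0 \<le> C" "\<And>a. inH s a \<Longrightarrow> N k a \<le> e / (2 * L) * N s a + C * N 0 a"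
    using N_interpolation[OF s(2,1), of "e / (2 * L)"] e L by auto
  obtain n0 where n0: "\<And>n. n0 \<le> n \<Longrightarrow> Nd 0 (x n) g < e / (2 * (C + 1))"
    using LIMSEQ_D[OF lim, of "e / (2 * (C + 1))"] e C by auto
  have "Nd k (x n) g < e" if n: "n0 \<le> n" for n
  proof -
    have "Nd s (x n) g \<le> L" using N_triangle_diff[OF x(1) g, of n] x(2)[of n] by (simp add: L_def)
    then have "e / (2 * L) * Nd s (x n) g \<le> e / (2 * L) * L" using e L by (intro mult_left_mono) auto
    then have 1: "e / (2 * L) * Nd s (x n) g \<le> e / 2" using L by simp
    have "C * Nd 0 (x n) g \<le> C * (e / (2 * (C + 1)))" using n0[OF n] C by (intro mult_left_mono) auto
    also have "\<dots> < e / 2" using e C by (simp add: field_simps)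
    finally show ?thesis using 1 C(2)[OF inH_diff[OF x(1) g], of n] by linarith
  qed
  then show "\<exists>no. \<forall>n\<ge>no. norm (Nd k (x n) g - 0) < e" by auto
qed

text \<open>An L2 limit need be Hermitian almost everywhere only. Averaging it with its reflected
  conjugate gives a representative that is Hermitian everywhere and no farther from the
  sequence.\<close>

lemma herm_complete:
  assumes x: "\<And>n. inH 0 (x n)" "\<And>n. herm (x n)"
    and Cauchy: "\<And>e. 0 < e \<Longrightarrow> \<exists>n0. \<forall>m\<ge>n0. \<forall>n\<ge>n0. Nd 0 (x m) (x n) < e"
  shows "\<exists>g. inH 0 g \<and> herm g \<and> (\<lambda>n. Nd 0 (x n) g) \<longlonglongrightarrow> 0"
proof -
  have x0: "sqi (x n)" for n using x by (simp add: inH_0)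
  obtain g where g: "sqi g" "(\<lambda>n. l2dist (x n) g) \<longlonglongrightarrow> 0"
  proof -
    have "\<exists>g. sqi g \<and> (\<lambda>n. l2dist (x n) g) \<longlonglongrightarrow> 0"
      by (rule sqi_complete[OF x0]) (use Cauchy in \<open>simp add: N_0\<close>)
    then show ?thesis using that by blast
  qed
  define g' where "g' z = cnj (g (0 - z))" for z
  define G where "G z = (1/2) * (g z + g' z)" for z
  have g': "sqi g'" unfolding g'_def by (intro sqi_cnj sqi_reflect g)
  have G: "sqi G" unfolding G_def by (intro sqi_mult_left sqi_add g g')
  have "herm G" by (simp add: herm_def G_def g'_def add.commute)
  moreover have "(\<lambda>n. l2dist (x n) G) \<longlonglongrightarrow> 0"
  proof (rule Lim_null_comparison[OF _ g(2)], rule always_eventually, rule allI)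
    fix n
    have "l2dist (x n) g' = l2norm (\<lambda>z. cnj (x n (0 - z) - g (0 - z)))"
      using x(2)[of n] by (intro l2norm_cong) (simp add: g'_def herm_def)
    also have "\<dots> = l2norm (\<lambda>z. x n (0 - z) - g (0 - z))" by (rule l2norm_cnj)
    also have "\<dots> = l2dist (x n) g" using x0[of n] g by (intro l2norm_reflect[of "\<lambda>z. x n z - g z"]) auto
    finally have eq: "l2dist (x n) g' = l2dist (x n) g" .
    have "l2dist (x n) G = l2norm (\<lambda>z. (1/2) * (x n z - g z) + (1/2) * (x n z - g' z))"
      by (intro l2norm_cong) (simp add: G_def field_simps)
    also have "\<dots> \<le> l2norm (\<lambda>z. (1/2) * (x n z - g z)) + l2norm (\<lambda>z. (1/2) * (x n z - g' z))"
      using x0[of n] g g' by (intro l2norm_triangle sqi_mult_left sqi_diff) auto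
    also have "\<dots> = l2dist (x n) g" unfolding l2norm_mult_left eq by simp
    finally show "norm (l2dist (x n) G) \<le> l2dist (x n) g" by simp
  qed
  ultimately show ?thesis using G by (auto simp: inH_0 N_0)
qed

lemma N_B_diff:
  assumes s: "2 < s" and m: "0 \<le> m" "s \<le> m + 1" and a: "inH (m + 1) a" and b: "inH (m + 1) b"
  shows "Nd m (Bq a) (Bq b)
    \<le> 2 powr (m + 1) * cL s * (N (m + 1) a + N (m + 1) b) * Nd (m + 1) a b"
proof -
  let ?v = "\<lambda>x. a x - b x"
  have v: "inH (m + 1) ?v" using a b by auto
  have "inH 1 a" "inH 1 b" using inH_mono[of 1 "m + 1"] a b m by auto
  then have "Nd m (Bq a) (Bq b) = N m (\<lambda>x. B a ?v x + B ?v b x)" by (simp add: B_diff)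
  also have "\<dots> \<le> N m (B a ?v) + N m (B ?v b)" by (intro N_triangle inH_B_quad[OF s m] a b v)
  also have "\<dots> \<le> 2 powr (m + 1) * cL s * N (m + 1) a * N (m + 1) ?v + 2 powr (m + 1) * cL s * N (m + 1) ?v * N (m + 1) b"
    by (intro add_mono N_B_quad[OF s m] a b v)
  finally show ?thesis by (simp add: algebra_simps)
qed

text \<open>Smooth solutions. Each comparison of two times costs a derivative: bounded in H^{s+2},
  Lipschitz in H^{s+1}, residual of second order in H^s. The times \<open>r\<close> and
  \<open>t\<close> occur in either order, which makes the notion invariant under time
  reversal.\<close>

definition ssol :: "real \<Rightarrow> real \<Rightarrow> real \<Rightarrow> (real \<Rightarrow> cfun) \<Rightarrow> bool" where
  "ssol s M S G \<longleftrightarrow> (\<forall>t\<in>{0..S}. inH (s + 2) (G t) \<and> herm (G t) \<and> N (s + 2) (G t) \<le> M) \<and>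
    (\<forall>r\<in>{0..S}. \<forall>t\<in>{0..S}. Nd (s + 1) (G t) (G r) \<le> M * \<bar>t - r\<bar> \<and>
      N s (defect (t - r) (G r) (G t)) \<le> M * (t - r)\<^sup>2)"

lemma ssol_imp_rsol:
  assumes s: "2 < s" and G: "ssol s M S G" and M': "\<And>t. t \<in> {0..S} \<Longrightarrow> N s (G t) \<le> M'"
  shows "rsol s M' S G" unfolding rsol_def
proof (intro conjI ballI allI impI)
  fix t assume t: "t \<in> {0..S}"
  then show "inH s (G t)" using G inH_mono[of s "s + 2" "G t"] by (auto simp: ssol_def)
  show "herm (G t)" "N s (G t) \<le> M'" using G M' t by (auto simp: ssol_def)
next
  fix e :: real assume e: "0 < e"
  show "consistent e S G"
  proof (intro exI conjI allI impI)
    show "0 < e / (\<bar>M\<bar> + 1)" using e by simp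
    fix r t assume rt: "0 \<le> r \<and> r \<le> t \<and> t \<le> S \<and> t - r < e / (\<bar>M\<bar> + 1)"
    then have I: "r \<in> {0..S}" "t \<in> {0..S}" by auto
    have i: "inH (s + 2) (G r)" "inH (s + 2) (G t)" using G I by (auto simp: ssol_def)
    then have "inH s (Bq (G r))" using inH_B_quad[OF s, of s "G r" "G r"] inH_mono[of "s+1" "s+2"] s by auto
    then have "inH s (defect (t - r) (G r) (G t))"
      using inH_mono[OF _ i(1), of s] inH_mono[OF _ i(2), of s] by (intro inH_diff inH_mult_left) auto
    then have "N 0 (defect (t - r) (G r) (G t))
        \<le> N s (defect (t - r) (G r) (G t))" by (rule N_mono[rotated]) (use s in simp)
    also have "\<dots> \<le> M * (t - r)\<^sup>2" using G I unfolding ssol_def by blast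
    also have "\<dots> \<le> ((\<bar>M\<bar> + 1) * (t - r)) * (t - r)"
      by (simp add: power2_eq_square mult.assoc[symmetric]) (use rt in \<open>auto intro!: mult_right_mono\<close>)
    also have "\<dots> \<le> e * (t - r)" using rt by (intro mult_right_mono) (auto simp: field_simps)
    finally show "N 0 (defect (t - r) (G r) (G t)) \<le> e * (t - r)" .
  qed
qed

text \<open>Telescoping. For the second bound the velocities along the way are replaced by the one
  at step \<open>l\<close>: the Lipschitz bound for \<open>B\<close> gives the term quadratic in the
  elapsed time, the frequency cut-off gives \<open>Q / real n\<close>.\<close>

lemma euler_increment:
  assumes s: "2 < s" and a: "sqi a" "herm a" and h: "0 \<le> h" and n: "0 < n" and lk: "l \<le> k"
    and P: "\<And>j. j \<le> k \<Longrightarrow> N (s + 2) (euler n h a j) \<le> P"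
  defines "Q \<equiv> 2 powr (s + 2) * cL s * P * P"
  shows "Nd (s + 1) (euler n h a k) (euler n h a l) \<le> real (k - l) * h * Q" (is ?A)
    and "N s (defect (real (k - l) * h) (euler n h a l) (euler n h a k))
      \<le> real (k - l) * h * (2 powr (s + 2) * cL s * P * Q * (real (k - l) * h) + Q / real n)" (is ?B)
proof -
  define x where "x = euler n h a"
  have x: "inH m (x j)" "trunc (x j) n = x j" for m j unfolding x_def using euler_props[OF a] by auto
  have P0: "0 \<le> P" using P[of l] lk order_trans[OF N_nonneg] by blast
  have c: "0 \<le> cL s" using cL_ge_1[of s] by simp
  have Q0: "0 \<le> Q" using P0 c by (simp add: Q_def)
  have xP: "N (s + 2) (x j) \<le> P" if "j \<le> k" for j using P[OF that] by (simp add: x_def)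
  have iB: "inH m (Bq (x j))" if "s \<le> m + 1" for m j using inH_B_quad[OF s, of m "x j" "x j"] x that s by simp
  have NB: "N (s + 1) (Bq (x j)) \<le> Q" if "j \<le> k" for j
  proof -
    have "N (s + 1) (Bq (x j)) \<le> 2 powr (s + 2) * cL s * N (s + 2) (x j) * N (s + 2) (x j)"
      using N_B_quad[OF s, of "s + 1" "x j" "x j"] s x by (simp add: add.assoc)
    also have "\<dots> \<le> Q" unfolding Q_def using xP[OF that] P0 c by (intro mult_mono) auto
    finally show ?thesis .
  qed
  have sum: "x k' z - x l z = (\<Sum>j=l..<k'. of_real h * trunc (Bq (x j)) n z)" if "l \<le> k'" for k' z using that
  proof (induction k' rule: dec_induct)
    case (step k')
    then show ?case by (simp add: x_def)
  qed simp
  have inc: "Nd (s + 1) (x k') (x l) \<le> real (k' - l) * h * Q" if k': "l \<le> k'" "k' \<le> k" for k'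
  proof -
    have "Nd (s + 1) (x k') (x l) \<le> (\<Sum>j=l..<k'. N (s + 1) (\<lambda>z. of_real h * trunc (Bq (x j)) n z))"
      unfolding sum[OF k'(1)] by (intro N_sum_le inH_mult_left inH_trunc' iB) (use s in auto)
    also have "\<dots> \<le> (\<Sum>j=l..<k'. h * Q)"
    proof (rule sum_mono)
      fix j assume j: "j \<in> {l..<k'}"
      have "N (s + 1) (trunc (Bq (x j)) n) \<le> Q" using N_trunc_le[OF iB[of "s+1" j], of n] NB[of j] j k' s by simp
      then show "N (s + 1) (\<lambda>z. of_real h * trunc (Bq (x j)) n z) \<le> h * Q" using h by (simp add: mult_left_mono)
    qed
    finally show ?thesis using k' by (simp add: mult_ac)
  qed
  show ?A using inc[OF lk order_refl] by (simp add: x_def)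
  define Q1 where "Q1 = 2 powr (s + 2) * cL s * P * Q"
  have Q1: "0 \<le> Q1" using P0 Q0 c by (simp add: Q1_def)
  have trm: "N s (\<lambda>z. of_real h * (trunc (Bq (x j)) n z - Bq (x l) z))
      \<le> h * (Q1 * (real (k - l) * h) + Q / real n)" if j: "j \<in> {l..<k}" for j
  proof -
    have "Nd s (trunc (Bq (x j)) n) (Bq (x l))
       \<le> Nd s (trunc (Bq (x j)) n) (Bq (x j)) + Nd s (Bq (x j)) (Bq (x l))" by (intro N_triangle_via inH_trunc' iB) auto
    also have "Nd s (trunc (Bq (x j)) n) (Bq (x j)) \<le> 1 / real n * N (s + 1) (Bq (x j))"
      unfolding N_minus_commute[of s "trunc (Bq (x j)) n"] by (intro N_diff_trunc iB n) (use s in auto)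
    also have "\<dots> \<le> 1 / real n * Q" using NB[of j] j by (intro mult_left_mono) auto
    also have "Nd s (Bq (x j)) (Bq (x l))
       \<le> 2 powr (s + 1) * cL s * (N (s + 1) (x j) + N (s + 1) (x l)) * Nd (s + 1) (x j) (x l)"
      using s x by (intro N_B_diff[OF s]) auto
    also have "\<dots> \<le> 2 powr (s + 1) * cL s * (P + P) * (real (k - l) * h * Q)"
    proof -
      have 1: "N (s + 1) (x i) \<le> P" if "i \<le> k" for i
        using order_trans[OF N_mono[OF _ x(1)[of "s + 2" i], of "s + 1"] xP[OF that]] by simp
      have "Nd (s + 1) (x j) (x l) \<le> real (j - l) * h * Q" using j by (intro inc) auto
      also have "\<dots> \<le> real (k - l) * h * Q" using j h Q0 by (intro mult_right_mono) auto
      finally have 2: "Nd (s + 1) (x j) (x l) \<le> real (k - l) * h * Q" .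
      have 3: "N (s + 1) (x j) + N (s + 1) (x l) \<le> P + P" using 1[of j] 1[of l] j lk by simp
      show ?thesis by (rule mult_mono[OF mult_left_mono[OF 3] 2]) (use c P0 in auto)
    qed
    also have "\<dots> = Q1 * (real (k - l) * h)"
    proof -
      have "(2::real) powr (s + 2) = 2 powr (s + 1) * 2" using powr_add[of "2::real" "s + 1" 1] by (simp add: add.assoc)
      then show ?thesis by (simp add: Q1_def)
    qed
    finally have "Nd s (trunc (Bq (x j)) n) (Bq (x l)) \<le> Q1 * (real (k - l) * h) + Q / real n" by simp
    from mult_left_mono[OF this h] show ?thesis unfolding N_mult_left using h by simp
  qed
  have "(defect (real (k - l) * h) (x l) (x k))
     = (\<lambda>z. \<Sum>j=l..<k. of_real h * (trunc (Bq (x j)) n z - Bq (x l) z))"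
    unfolding sum[OF lk] by (simp add: fun_eq_iff right_diff_distrib sum_subtractf mult_ac)
  then have "N s (defect (real (k - l) * h) (x l) (x k))
     \<le> (\<Sum>j=l..<k. N s (\<lambda>z. of_real h * (trunc (Bq (x j)) n z - Bq (x l) z)))"
    by (simp only:) (intro N_sum_le inH_mult_left inH_diff inH_trunc' iB; simp)
  also have "\<dots> \<le> (\<Sum>j=l..<k. h * (Q1 * (real (k - l) * h) + Q / real n))" by (intro sum_mono trm)
  also have "\<dots> = real (k - l) * h * (Q1 * (real (k - l) * h) + Q / real n)" using lk by (simp add: mult_ac)
  finally show ?B by (simp add: x_def Q1_def)
qed

lemma nat_floor_divide:
  fixes t h :: real assumes "0 \<le> t" and h: "0 < h"
  shows "real (nat \<lfloor>t / h\<rfloor>) * h \<le> t" "t < (real (nat \<lfloor>t / h\<rfloor>) + 1) * h"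
proof -
  have e: "real (nat \<lfloor>t / h\<rfloor>) = of_int \<lfloor>t / h\<rfloor>" using assms by simp
  show "real (nat \<lfloor>t / h\<rfloor>) * h \<le> t" unfolding e by (rule iffD1[OF pos_le_divide_eq[OF h] of_int_floor_le])
  show "t < (real (nat \<lfloor>t / h\<rfloor>) + 1) * h" unfolding e by (rule iffD1[OF pos_divide_less_eq[OF h]]) linarith
qed

text \<open>The order of the quantifiers is the point: \<open>M'\<close> and \<open>d0\<close> do
  not depend on the datum \<open>a\<close>, whereas \<open>M2\<close> may. The oscillating data used
  later are bounded in H^s, but not in H^{s+2}.\<close>

lemma smooth_existence:
  assumes s: "2 < s" and ref: "rsol s M S \<theta>" and S: "0 < S" and R: "0 \<le> R"
  shows "\<exists>M' d0. 0 < d0 \<and> (\<forall>a. inH (s + 2) a \<and> herm a \<and> N s a \<le> R \<and> Nd 0 a (\<theta> 0) < d0 \<longrightarrow>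
     (\<exists>G M2. ssol s M2 S G \<and> G 0 = a \<and> (\<forall>t\<in>{0..S}. N s (G t) \<le> M')))"
proof -
  obtain M' d0 h0 n0 where M': "0 \<le> M'" and d0: "0 < d0" and h0: "0 < h0" and eb0:
    "\<forall>a n h. inH s a \<and> herm a \<and> N s a \<le> R \<and>
     Nd 0 a (\<theta> 0) < d0 \<and> n0 \<le> n \<and> 0 < n \<and> 0 < h \<and> h \<le> h0 \<and> h * (1 + real n)\<^sup>2 \<le> 1 \<longrightarrow>
     (\<forall>k. real k * h \<le> S \<longrightarrow> N s (euler n h a k) \<le> M' \<and> L1 1 (euler n h a k) \<le> M')"
    using euler_bounds[OF s ref less_imp_le[OF S] R] by (elim exE conjE) (rule that)
  have eb: "N s (euler n h a k) \<le> M' \<and> L1 1 (euler n h a k) \<le> M'"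
    if "inH s a" "herm a" "N s a \<le> R" "Nd 0 a (\<theta> 0) < d0" "n0 \<le> n" "0 < n" "0 < h" "h \<le> h0"
      "h * (1 + real n)\<^sup>2 \<le> 1" "real k * h \<le> S" for a n h k
    by (rule mp[OF spec[OF mp[OF spec[OF spec[OF spec[OF eb0]]]]]]) (intro conjI that)+
  have main: "\<exists>G M2. ssol s M2 S G \<and> G 0 = a \<and> (\<forall>t\<in>{0..S}. N s (G t) \<le> M')"
    if a: "inH (s + 2) a" "herm a" "N s a \<le> R" "Nd 0 a (\<theta> 0) < d0" for a
  proof -
    have as: "inH s a" "sqi a" "inH 1 a" using inH_mono[of _ "s + 2" a] a s by (auto simp: inH_0[symmetric])
    \<comment> \<open>The largest time step that the energy estimate admits.\<close>
    define H where "H n = 1 / (1 + real n)\<^sup>2" for n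
    have Hpos: "0 < H n" "H n \<le> 1" and HN: "H n * (1 + real n)\<^sup>2 \<le> 1" for n by (auto simp: H_def field_simps)
    have Hlim: "H \<longlonglongrightarrow> 0"
    proof -
      have "(\<lambda>n. 1 / real (Suc n) * (1 / real (Suc n))) \<longlonglongrightarrow> 0 * 0"
        by (intro tendsto_mult LIMSEQ_Suc[OF lim_1_over_n])
      then show ?thesis by (simp add: H_def[abs_def] power2_eq_square)
    qed
    have Hanti: "H m \<le> H n" if "n \<le> m" for m n unfolding H_def using that by (intro divide_left_mono power_mono mult_pos_pos) auto
    obtain n1 where n1: "n0 \<le> n1" "0 < n1" "H n1 \<le> h0"
    proof -
      obtain k where k: "\<And>n. k \<le> n \<Longrightarrow> H n < h0" using LIMSEQ_D[OF Hlim h0] Hpos by (auto simp: abs_of_pos)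
      show ?thesis by (rule that[of "n0 + k + 1"]) (use k[of "n0 + k + 1"] in auto)
    qed
    have Hh0: "H n \<le> h0" if "n1 \<le> n" for n using Hanti[OF that] n1 by simp
    define P where "P = exp (cE (s + 2) M' * S) * N (s + 2) a"
    have P: "0 \<le> P" by (simp add: P_def)
    define x where "x n = euler n (H n) a" for n
    have x: "inH m (x n j)" "herm (x n j)" for m n j unfolding x_def using euler_props[OF as(2) a(2)] by auto
    have xM: "N s (x n k) \<le> M'" "L1 1 (x n k) \<le> M'" if "n1 \<le> n" "real k * H n \<le> S" for n k
      using eb[OF as(1) a(2,3,4), of n "H n" k] that n1 Hpos HN Hh0 by (auto simp: x_def)
    have xP: "N (s + 2) (x n k) \<le> P" if n: "n1 \<le> n" and k: "real k * H n \<le> S" for n k unfolding x_def P_def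
    proof (rule euler_energy[OF a(1) as(2) a(2) _ less_imp_le[OF Hpos(1)] HN _ M' k])
      fix j assume j: "j < k"
      have "real j * H n \<le> real k * H n" using j Hpos[of n] by (intro mult_right_mono) auto
      then show "L1 1 (euler n (H n) a j) \<le> M'" using xM(2)[OF n, of j] k by (simp add: x_def)
    qed (use s in simp)
    define Q where "Q = 2 powr (s + 2) * cL s * P * P"
    define Q1 where "Q1 = 2 powr (s + 2) * cL s * P * Q"
    have Q: "0 \<le> Q" "0 \<le> Q1" using cL_ge_1[of s] P by (simp_all add: Q_def Q1_def)
    \<comment> \<open>Piecewise constant interpolation: \<open>ix n t\<close> is the number of the
      last grid point not after \<open>t\<close>.\<close>
    define ix where "ix n t = nat \<lfloor>t / H n\<rfloor>" for n t
    define X where "X n t = x n (ix n t)" for n t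
    have ix: "real (ix n t) * H n \<le> t" "t < (real (ix n t) + 1) * H n" if "0 \<le> t" for n t
      unfolding ix_def using nat_floor_divide[OF that Hpos(1)] by auto
    have ixmono: "ix n r \<le> ix n t" if "r \<le> t" for n r t
      unfolding ix_def using that Hpos[of n] by (intro nat_mono floor_mono divide_right_mono) auto
    have X: "inH m (X n t)" "herm (X n t)" for m n t using x by (auto simp: X_def)
    have XM: "N s (X n t) \<le> M'" "N (s + 2) (X n t) \<le> P" if "n1 \<le> n" "t \<in> {0..S}" for n t
      unfolding X_def using xM[OF that(1)] xP[OF that(1)] ix[of t n] that(2) by auto
    have NBX: "N s (Bq (X n t)) \<le> Q" if "n1 \<le> n" "t \<in> {0..S}" for n t
    proof -
      have "N s (Bq (X n t)) \<le> N (s + 1) (Bq (X n t))" using s X by (intro N_mono inH_B_quad[OF s]) auto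
      also have "\<dots> \<le> 2 powr (s + 2) * cL s * N (s + 2) (X n t) * N (s + 2) (X n t)"
        using N_B_quad[OF s, of "s + 1" "X n t" "X n t"] s X by (simp add: add.assoc)
      also have "\<dots> \<le> Q" unfolding Q_def using XM[OF that] P cL_ge_1[of s] by (intro mult_mono) auto
      finally show ?thesis .
    qed
    have inc: "Nd (s + 1) (X n t) (X n r) \<le> Q * (t - r + H n)"
      "N s (defect (t - r) (X n r) (X n t))
        \<le> (t - r + H n) * (Q1 * (t - r + H n) + Q / real n) + H n * Q"
      if n: "n1 \<le> n" and rt: "0 \<le> r" "r \<le> t" "t \<le> S" for n r t
    proof -
      let ?k = "ix n t" and ?l = "ix n r"
      define d where "d = real (?k - ?l) * H n"
      have lk: "?l \<le> ?k" by (rule ixmono[OF rt(2)])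
      have kS: "real j * H n \<le> S" if "j \<le> ?k" for j
      proof -
        have "real j * H n \<le> real ?k * H n" using that Hpos[of n] by (intro mult_right_mono) auto
        then show ?thesis using ix(1)[of t n] rt by simp
      qed
      have d: "\<bar>d - (t - r)\<bar> \<le> H n" "0 \<le> d"
      proof -
        have "d = real ?k * H n - real ?l * H n" using lk by (simp add: d_def of_nat_diff left_diff_distrib)
        then show "\<bar>d - (t - r)\<bar> \<le> H n" using ix[of t n] ix[of r n] rt by (simp add: distrib_right abs_le_iff)
        show "0 \<le> d" using Hpos[of n] by (simp add: d_def)
      qed
      then have d': "d \<le> t - r + H n" by linarith
      have n0': "0 < n" using n n1 by simp
      have hyp: "N (s + 2) (euler n (H n) a j) \<le> P" if "j \<le> ?k" for j using xP[OF n kS[OF that]] by (simp add: x_def)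
      have E: "Nd (s + 1) (X n t) (X n r) \<le> d * Q"
        "N s (defect d (X n r) (X n t)) \<le> d * (Q1 * d + Q / real n)" unfolding X_def x_def d_def Q1_def Q_def
        by (rule euler_increment[OF s as(2) a(2) less_imp_le[OF Hpos(1)] n0' lk hyp]; assumption)+
      have "Nd (s + 1) (X n t) (X n r) \<le> d * Q" using E(1) by (simp add: mult_ac)
      also have "\<dots> \<le> Q * (t - r + H n)" using mult_left_mono[OF d' Q(1)] by (simp add: mult.commute)
      finally show "Nd (s + 1) (X n t) (X n r) \<le> Q * (t - r + H n)" .
      let ?Br = "Bq (X n r)"
      have iB: "inH s ?Br" using s X by (intro inH_B_quad[OF s]) auto
      have "(\<lambda>z. X n t z - X n r z - of_real (t - r) * ?Br z)
         = (\<lambda>z. (X n t z - X n r z - of_real d * ?Br z) + of_real (d - (t - r)) * ?Br z)" by (simp add: algebra_simps)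
      then have "N s (\<lambda>z. X n t z - X n r z - of_real (t - r) * ?Br z)
         \<le> N s (\<lambda>z. X n t z - X n r z - of_real d * ?Br z) + N s (\<lambda>z. of_real (d - (t - r)) * ?Br z)"
        by (simp only:) (intro N_triangle inH_diff inH_mult_left iB X)
      also have "N s (\<lambda>z. of_real (d - (t - r)) * ?Br z) \<le> H n * Q"
        unfolding N_mult_left norm_of_real using d NBX[OF n, of r] rt by (intro mult_mono) auto
      also have "N s (\<lambda>z. X n t z - X n r z - of_real d * ?Br z) \<le> d * (Q1 * d + Q / real n)"
        using E(2) by (simp add: mult_ac)
      also have "\<dots> \<le> (t - r + H n) * (Q1 * (t - r + H n) + Q / real n)" using d d' Q by (intro mult_mono add_mono) auto
      finally show "N s (\<lambda>z. X n t z - X n r z - of_real (t - r) * ?Br z)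
        \<le> (t - r + H n) * (Q1 * (t - r + H n) + Q / real n) + H n * Q" by simp
    qed
    define E where "E = exp (2 * (cL s * M') * S)"
    define K where "K = stabK s M'"
    have EK: "0 \<le> E" "0 \<le> K" using stabK_nonneg[OF M'] by (simp_all add: E_def K_def)
    \<comment> \<open>Schemes with different \<open>n\<close> have different time grids, so both are
      sampled on a common grid of step \<open>h\<close>, coarser than their own. Rounding
      contributes \<open>H p / h\<close> to the residuals; hence \<open>h\<close> is fixed first,
      \<open>p\<close> made large depending on it, and only the resulting bound is small with
      \<open>h\<close>.\<close>
    have compare: "Nd 0 (X m t) (X n t)
        \<le> 2 * (Q * (h + H p)) + sqrt (E * ((2 / real p * N 1 a)\<^sup>2 + S * (K * (h + (4 * Q1 * h + 2 * Q / real p + Q * (H p / h))))))"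
      if p: "n1 \<le> p" "p \<le> m" "p \<le> n" and h: "0 < h" "h \<le> 1" "H p \<le> h"
        and e: "2 * (4 * Q1 * h + 2 * Q / real p + Q * (H p / h)) \<le> 1" and t: "t \<in> {0..S}" for m n p h t
    proof -
      define e where "e = 4 * Q1 * h + 2 * Q / real p + Q * (H p / h)"
      have e0: "0 \<le> e" using Q h Hpos[of p] by (simp add: e_def)
      define k where "k = nat \<lfloor>t / h\<rfloor>"
      have k: "real k * h \<le> t" "t < (real k + 1) * h" unfolding k_def using nat_floor_divide[OF _ h(1), of t] t by auto
      have jS: "real j * h \<in> {0..S}" if "j \<le> k" for j
      proof -
        have "real j * h \<le> real k * h" using that h by (intro mult_right_mono) auto
        moreover have "0 \<le> real j * h" using h by simp
        ultimately show ?thesis using k t unfolding atLeastAtMost_iff by linarith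
      qed
      have err: "N 0 (defect h (X q (real j * h)) (X q (real (Suc j) * h))) \<le> e * h"
        if q: "p \<le> q" and j: "j < k" for q j
      proof -
        have q1: "n1 \<le> q" "0 < q" using q p n1 by auto
        have diff: "real (Suc j) * h - real j * h = h" by (simp add: algebra_simps)
        have Hq: "H q \<le> H p" by (rule Hanti[OF q])
        have iB: "inH s (Bq (X q (real j * h)))" using s X by (intro inH_B_quad[OF s]) auto
        have "N 0 (defect h (X q (real j * h)) (X q (real (Suc j) * h)))
           \<le> N s (defect h (X q (real j * h)) (X q (real (Suc j) * h)))" using s by (intro N_mono inH_diff inH_mult_left iB X) auto
        also have "\<dots> \<le> (h + H q) * (Q1 * (h + H q) + Q / real q) + H q * Q"
          using inc(2)[OF q1(1), of "real j * h" "real (Suc j) * h"] jS[of j] jS[of "Suc j"] j h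
          unfolding diff by (simp add: mult_right_mono)
        also have "\<dots> \<le> (2 * h) * (Q1 * (2 * h) + Q / real p) + H p * Q"
          using Q h Hq Hpos[of q] q p n1 by (intro add_mono mult_mono divide_left_mono) auto
        also have "\<dots> = e * h" using h by (simp add: e_def algebra_simps)
        finally show ?thesis .
      qed
      have y0: "Nd 0 (X m (real 0 * h)) (X n (real 0 * h)) \<le> 2 / real p * N 1 a"
      proof -
        have tr: "Nd 0 a (trunc a q) \<le> 1 / real p * N 1 a" if "p \<le> q" for q
        proof -
          have "Nd 0 a (trunc a q) \<le> 1 / real q * N 1 a" using N_diff_trunc[of 0 a q] as p n1 that by simp
          also have "\<dots> \<le> 1 / real p * N 1 a" using that p n1 by (intro mult_right_mono divide_left_mono) auto
          finally show ?thesis .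
        qed
        have X0: "X q 0 = trunc a q" for q by (simp add: X_def x_def ix_def)
        have "Nd 0 (trunc a m) (trunc a n) \<le> Nd 0 (trunc a m) a + Nd 0 a (trunc a n)"
          by (rule N_triangle_via) (use as inH_trunc in \<open>auto simp: inH_0[symmetric]\<close>)
        also have "\<dots> \<le> 1 / real p * N 1 a + 1 / real p * N 1 a"
          using tr[of m] tr[of n] p by (simp add: N_minus_commute[of 0 "trunc a m"])
        finally show ?thesis by (simp add: X0)
      qed
      have "(Nd 0 (X m (real k * h)) (X n (real k * h)))\<^sup>2 \<le> exp (2 * (cL s * M') * S) *
         ((Nd 0 (X m (real 0 * h)) (X n (real 0 * h)))\<^sup>2 + S * (stabK s M' * (h + e)))"
        by (rule stab_L2[where a="\<lambda>j. X m (real j * h)" and b="\<lambda>j. X n (real j * h)", OF s])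
          (use X XM(1) p jS err h e e0 M' k t in \<open>auto simp: e_def\<close>)
      also have "\<dots> \<le> E * ((2 / real p * N 1 a)\<^sup>2 + S * (K * (h + e)))"
        unfolding E_def[symmetric] K_def[symmetric] using y0 EK by (intro mult_left_mono add_right_mono power_mono) auto
      finally have "Nd 0 (X m (real k * h)) (X n (real k * h)) \<le> sqrt (E * ((2 / real p * N 1 a)\<^sup>2 + S * (K * (h + e))))"
        by (rule real_le_rsqrt)
      moreover have near: "Nd 0 (X q t) (X q (real k * h)) \<le> Q * (h + H p)" if q: "p \<le> q" for q
      proof -
        have q1: "n1 \<le> q" using q p by auto
        have "Nd 0 (X q t) (X q (real k * h)) \<le> Nd (s + 1) (X q t) (X q (real k * h))" using s by (intro N_mono inH_diff X) auto
        also have "\<dots> \<le> Q * (t - real k * h + H q)" using inc(1)[OF q1, of "real k * h" t] k t h by simp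
        also have "\<dots> \<le> Q * (h + H p)" using k Hanti[OF q] Q by (intro mult_left_mono) (auto simp: algebra_simps)
        finally show ?thesis .
      qed
      have "Nd 0 (X m t) (X n t) \<le> Nd 0 (X m t) (X m (real k * h))
          + (Nd 0 (X m (real k * h)) (X n (real k * h)) + Nd 0 (X n (real k * h)) (X n t))"
        by (intro order_trans[OF N_triangle_via[of 0 "X m t" "X m (real k * h)" "X n t"]] add_left_mono N_triangle_via X)
      ultimately show ?thesis using near[OF p(2)] near[OF p(3)] unfolding N_minus_commute[of 0 "X n (real k * h)"] e_def by linarith
    qed
    have Cauchy: "\<exists>p. \<forall>m\<ge>p. \<forall>n\<ge>p. Nd 0 (X (m + n1) t) (X (n + n1) t) < \<epsilon>"
      if \<epsilon>: "0 < \<epsilon>" and t: "t \<in> {0..S}" for \<epsilon> t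
    proof -
      \<comment> \<open>\<open>\<gamma> h\<close> is the limit of the bound in
        \<open>compare\<close> as \<open>p\<close> grows.\<close>
      define \<gamma> where "\<gamma> h = 2 * (Q * h) + sqrt (E * (S * (K * (h + 4 * Q1 * h))))" for h
      have "(\<gamma> \<longlongrightarrow> 2 * (Q * 0) + sqrt (E * (S * (K * (0 + 4 * Q1 * 0))))) (at_right 0)"
        unfolding \<gamma>_def by (intro tendsto_intros)
      then have "(\<gamma> \<longlongrightarrow> 0) (at_right 0)" by simp
      then have "\<forall>\<^sub>F h in at_right 0. \<gamma> h < \<epsilon>" using \<epsilon> by (rule order_tendstoD)
      moreover have "\<forall>\<^sub>F h::real in at_right 0. h < 1" "\<forall>\<^sub>F h::real in at_right 0. 0 < h"
        by (auto simp: eventually_at_right_less intro: eventually_at_rightI[of 0 1])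
      moreover have "\<forall>\<^sub>F h in at_right 0. 8 * Q1 * h < 1"
      proof (rule order_tendstoD)
        show "((\<lambda>h. 8 * Q1 * h) \<longlongrightarrow> 8 * Q1 * 0) (at_right 0)" by (intro tendsto_intros)
      qed simp
      ultimately have "\<forall>\<^sub>F h in at_right 0. \<gamma> h < \<epsilon> \<and> h < 1 \<and> 0 < h \<and> 8 * Q1 * h < 1"
        by eventually_elim simp
      then obtain h where h: "\<gamma> h < \<epsilon>" "h < 1" "0 < h" "8 * Q1 * h < 1"
        using eventually_happens'[OF trivial_limit_at_right_real] by blast
      have inv: "(\<lambda>p. 1 / real p) \<longlonglongrightarrow> 0" by (rule lim_1_over_n)
      have "(\<lambda>p. 2 * (Q * (h + H p)) + sqrt (E * ((2 * (1 / real p) * N 1 a)\<^sup>2 + S * (K * (h + (4 * Q1 * h + 2 * Q * (1 / real p) + Q * (H p / h)))))))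
         \<longlonglongrightarrow> 2 * (Q * (h + 0)) + sqrt (E * ((2 * 0 * N 1 a)\<^sup>2 + S * (K * (h + (4 * Q1 * h + 2 * Q * 0 + Q * (0 / h))))))"
        using h by (intro tendsto_intros Hlim inv) auto
      also have "2 * (Q * (h + 0)) + sqrt (E * ((2 * 0 * N 1 a)\<^sup>2 + S * (K * (h + (4 * Q1 * h + 2 * Q * 0 + Q * (0 / h)))))) = \<gamma> h"
        by (simp add: \<gamma>_def)
      finally have "\<forall>\<^sub>F p in sequentially. 2 * (Q * (h + H p)) + sqrt (E * ((2 * (1 / real p) * N 1 a)\<^sup>2 + S * (K * (h + (4 * Q1 * h + 2 * Q * (1 / real p) + Q * (H p / h)))))) < \<epsilon>"
        using h(1) by (rule order_tendstoD)
      moreover have "\<forall>\<^sub>F p in sequentially. 2 * (4 * Q1 * h + 2 * Q * (1 / real p) + Q * (H p / h)) < 1"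
      proof (rule order_tendstoD)
        show "(\<lambda>p. 2 * (4 * Q1 * h + 2 * Q * (1 / real p) + Q * (H p / h))) \<longlonglongrightarrow> 2 * (4 * Q1 * h + 2 * Q * 0 + Q * (0 / h))"
          using h by (intro tendsto_intros Hlim inv) auto
      qed (use h in simp)
      moreover have "\<forall>\<^sub>F p in sequentially. H p < h" using Hlim h(3) by (rule order_tendstoD)
      moreover have "\<forall>\<^sub>F p in sequentially. n1 \<le> p" by (rule eventually_ge_at_top)
      ultimately have "\<forall>\<^sub>F p in sequentially. \<forall>m\<ge>p. \<forall>n\<ge>p. Nd 0 (X m t) (X n t) < \<epsilon>"
      proof eventually_elim
        case (elim p)
        show ?case
        proof (intro allI impI)
          fix m n assume mn: "p \<le> m" "p \<le> n"
          show "Nd 0 (X m t) (X n t) < \<epsilon>" using compare[OF elim(4) mn h(3) _ _ _ t] h elim(1,2,3) by (simp add: less_imp_le)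
        qed
      qed
      then obtain p where "\<forall>m\<ge>p. \<forall>n\<ge>p. Nd 0 (X m t) (X n t) < \<epsilon>" by (auto simp: eventually_sequentially)
      then show ?thesis by (intro exI[of _ p]) auto
    qed
    \<comment> \<open>At time 0 the limit is chosen to be \<open>a\<close> itself, so that
      \<open>G 0 = a\<close> holds exactly and not merely almost everywhere.\<close>
    have "\<forall>t\<in>{0..S}. \<exists>g. inH 0 g \<and> herm g \<and> (\<lambda>n. Nd 0 (X (n + n1) t) g) \<longlonglongrightarrow> 0 \<and> (t = 0 \<longrightarrow> g = a)"
    proof
      fix t assume t: "t \<in> {0..S}"
      show "\<exists>g. inH 0 g \<and> herm g \<and> (\<lambda>n. Nd 0 (X (n + n1) t) g) \<longlonglongrightarrow> 0 \<and> (t = 0 \<longrightarrow> g = a)"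
      proof (cases "t = 0")
        case True
        have "(\<lambda>n. Nd 0 (trunc a (n + n1)) a) \<longlonglongrightarrow> 0"
          using LIMSEQ_ignore_initial_segment[OF trunc_tendsto[OF as(2)], of n1] by (simp add: N_0)
        then have "(\<lambda>n. Nd 0 (X (n + n1) t) a) \<longlonglongrightarrow> 0" by (simp add: True X_def x_def ix_def)
        then show ?thesis using as a True by (auto simp: inH_0)
      next
        case False
        have "\<exists>g. inH 0 g \<and> herm g \<and> (\<lambda>n. Nd 0 (X (n + n1) t) g) \<longlonglongrightarrow> 0"
          by (rule herm_complete[OF X(1) X(2)]) (use Cauchy t in auto)
        then show ?thesis using False by blast
      qed
    qed
    from bchoice[OF this] obtain G where G0: "\<forall>t\<in>{0..S}. inH 0 (G t) \<and> herm (G t) \<and>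
        (\<lambda>n. Nd 0 (X (n + n1) t) (G t)) \<longlonglongrightarrow> 0 \<and> (t = 0 \<longrightarrow> G t = a)"
      by (elim exE) (rule that)
    have G: "inH 0 (G t)" "herm (G t)" "(\<lambda>n. Nd 0 (X (n + n1) t) (G t)) \<longlonglongrightarrow> 0"
      if "t \<in> {0..S}" for t using bspec[OF G0 that] by auto
    have Ga: "G 0 = a" using bspec[OF G0, of 0] S by simp
    have shift: "n1 \<le> n + n1" for n by simp
    have GP: "inH (s + 2) (G t)" "N (s + 2) (G t) \<le> P" if t: "t \<in> {0..S}" for t
      by (rule inH_lower_semicontinuous[OF X(1) X(1) XM(2)[OF shift t] tendsto_const G(1)[OF t] G(3)[OF t]])+
    have GM: "N s (G t) \<le> M'" if t: "t \<in> {0..S}" for t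
      by (rule inH_lower_semicontinuous[OF X(1) X(1) XM(1)[OF shift t] tendsto_const G(1)[OF t] G(3)[OF t]])
    have Hlim': "(\<lambda>n. H (n + n1)) \<longlonglongrightarrow> 0" by (rule LIMSEQ_ignore_initial_segment[OF Hlim])
    have inv': "(\<lambda>n. Q / real (n + n1)) \<longlonglongrightarrow> 0"
      using LIMSEQ_ignore_initial_segment[OF tendsto_mult[OF tendsto_const[of Q] lim_1_over_n], of n1] by simp
    have diff_lim: "(\<lambda>n. N 0 (\<lambda>z. (X (n + n1) t z - X (n + n1) r z) - (G t z - G r z))) \<longlonglongrightarrow> 0"
      if t: "t \<in> {0..S}" and r: "r \<in> {0..S}" for t r
    proof (rule Lim_null_comparison)
      show "(\<lambda>n. Nd 0 (X (n + n1) t) (G t) + Nd 0 (X (n + n1) r) (G r)) \<longlonglongrightarrow> 0"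
        using tendsto_add[OF G(3)[OF t] G(3)[OF r]] by simp
      have "(\<lambda>z. (X n t z - X n r z) - (G t z - G r z)) = (\<lambda>z. (X n t z - G t z) - (X n r z - G r z))" for n
        by (simp add: algebra_simps)
      then show "\<forall>\<^sub>F n in sequentially. norm (N 0 (\<lambda>z. (X (n + n1) t z - X (n + n1) r z) - (G t z - G r z)))
         \<le> Nd 0 (X (n + n1) t) (G t) + Nd 0 (X (n + n1) r) (G r)"
        using X G(1)[OF t] G(1)[OF r] by (intro always_eventually allI) (simp, intro N_triangle_diff inH_diff)
    qed
    have Lip: "Nd (s + 1) (G t) (G r) \<le> Q * (t - r)" if rt: "r \<in> {0..S}" "t \<in> {0..S}" "r \<le> t" for r t
    proof (rule inH_lower_semicontinuous(2)[OF _ _ _ _ _ diff_lim[OF rt(2,1)]])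
      show "Nd (s + 1) (X (n + n1) t) (X (n + n1) r) \<le> Q * (t - r + H (n + n1))" for n using inc(1)[OF shift] rt by simp
      have "(\<lambda>n. Q * (t - r + H (n + n1))) \<longlonglongrightarrow> Q * (t - r + 0)" by (intro tendsto_intros Hlim')
      then show "(\<lambda>n. Q * (t - r + H (n + n1))) \<longlonglongrightarrow> Q * (t - r)" by simp
    qed (use X G(1) rt in auto)
    have Fwd: "N s (defect (t - r) (G r) (G t)) \<le> Q1 * (t - r)\<^sup>2"
      if rt: "r \<in> {0..S}" "t \<in> {0..S}" "r \<le> t" for r t
    proof (rule inH_lower_semicontinuous(2))
      have iB: "inH m (Bq (X n r))" if "0 \<le> m" for m n
      proof -
        have "inH (m + s) (Bq (X n r))" using s X that by (intro inH_B_quad[OF s]) auto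
        then show ?thesis by (rule inH_mono[rotated]) (use s in simp)
      qed
      have iBG: "inH 0 (Bq (G r))"
      proof -
        have "inH (s + 1) (Bq (G r))" using s GP(1)[OF rt(1)] by (intro inH_B_quad[OF s]) (auto simp: add.assoc)
        then show ?thesis by (rule inH_mono[rotated]) (use s in simp)
      qed
      let ?x = "\<lambda>n z. X (n + n1) t z - X (n + n1) r z - of_real (t - r) * Bq (X (n + n1) r) z"
      let ?g = "\<lambda>z. G t z - G r z - of_real (t - r) * Bq (G r) z"
      show "inH 0 (?x n)" "inH s (?x n)" for n using iB s X by (intro inH_diff inH_mult_left; simp)+
      show "inH 0 ?g" using iBG G(1) rt by (intro inH_diff inH_mult_left)
      show "N s (?x n) \<le> (t - r + H (n + n1)) * (Q1 * (t - r + H (n + n1)) + Q / real (n + n1)) + H (n + n1) * Q" for n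
        using inc(2)[OF shift] rt by simp
      have "(\<lambda>n. (t - r + H (n + n1)) * (Q1 * (t - r + H (n + n1)) + Q / real (n + n1)) + H (n + n1) * Q)
         \<longlonglongrightarrow> (t - r + 0) * (Q1 * (t - r + 0) + 0) + 0 * Q" by (intro tendsto_intros Hlim' inv')
      then show "(\<lambda>n. (t - r + H (n + n1)) * (Q1 * (t - r + H (n + n1)) + Q / real (n + n1)) + H (n + n1) * Q)
         \<longlonglongrightarrow> Q1 * (t - r)\<^sup>2" by (simp add: power2_eq_square mult_ac)
      have GrS: "inH s (G r)" "N s (G r) \<le> M'" using inH_mono[OF _ GP(1)[OF rt(1)], of s] GM[OF rt(1)] by auto
      \<comment> \<open>Convergence in L2 together with the bound in H^s gives convergence in H^1,
        on which the L2 bound for the difference of velocities depends.\<close>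
      have lim1: "(\<lambda>n. Nd 1 (X (n + n1) r) (G r)) \<longlonglongrightarrow> 0"
        by (rule N_tendsto_interpolation[OF _ _ X(1) XM(1)[OF shift rt(1)] GrS(1) G(3)[OF rt(1)]]) (use s in auto)
      show "(\<lambda>n. Nd 0 (?x n) ?g) \<longlonglongrightarrow> 0"
      proof (rule Lim_null_comparison)
        have "(\<lambda>n. N 0 (\<lambda>z. (X (n + n1) t z - X (n + n1) r z) - (G t z - G r z))
           + (t - r) * (cL s * (M' + M') * Nd 1 (X (n + n1) r) (G r))) \<longlonglongrightarrow> 0 + (t - r) * (cL s * (M' + M') * 0)"
          by (intro tendsto_intros diff_lim rt lim1)
        then show "(\<lambda>n. N 0 (\<lambda>z. (X (n + n1) t z - X (n + n1) r z) - (G t z - G r z))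
           + (t - r) * (cL s * (M' + M') * Nd 1 (X (n + n1) r) (G r))) \<longlonglongrightarrow> 0" by simp
        have "Nd 0 (?x n) ?g \<le> N 0 (\<lambda>z. (X (n + n1) t z - X (n + n1) r z) - (G t z - G r z))
           + (t - r) * (cL s * (M' + M') * Nd 1 (X (n + n1) r) (G r))" for n
        proof -
          let ?D = "\<lambda>z. Bq (X (n + n1) r) z - Bq (G r) z"
          have D: "inH 0 ?D" using iB[of 0 "n + n1"] iBG by auto
          have "N 0 ?D \<le> cL s * (N s (X (n + n1) r) + N s (G r)) * Nd 1 (X (n + n1) r) (G r)"
            by (rule B_diff_L2(3)[OF s X(1) X(2) GrS(1) G(2)[OF rt(1)]])
          also have "\<dots> \<le> cL s * (M' + M') * Nd 1 (X (n + n1) r) (G r)"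
            using XM(1)[OF shift rt(1)] GrS cL_ge_1[of s] by (intro mult_right_mono mult_left_mono add_mono) auto
          finally have ND: "N 0 ?D \<le> cL s * (M' + M') * Nd 1 (X (n + n1) r) (G r)" .
          have "(\<lambda>z. ?x n z - ?g z) = (\<lambda>z. ((X (n + n1) t z - X (n + n1) r z) - (G t z - G r z)) + of_real (-(t - r)) * ?D z)"
            by (simp add: algebra_simps)
          then have "Nd 0 (?x n) ?g \<le> N 0 (\<lambda>z. (X (n + n1) t z - X (n + n1) r z) - (G t z - G r z))
             + N 0 (\<lambda>z. of_real (-(t - r)) * ?D z)" by (simp only:) (intro N_triangle inH_diff inH_mult_left[OF D] X G(1) rt)
          also have "N 0 (\<lambda>z. of_real (-(t - r)) * ?D z) = (t - r) * N 0 ?D" unfolding N_mult_left norm_of_real using rt by simp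
          finally show ?thesis using mult_left_mono[OF ND, of "t - r"] rt by simp
        qed
        then show "\<forall>\<^sub>F n in sequentially. norm (Nd 0 (?x n) ?g) \<le> N 0 (\<lambda>z. (X (n + n1) t z - X (n + n1) r z) - (G t z - G r z))
           + (t - r) * (cL s * (M' + M') * Nd 1 (X (n + n1) r) (G r))" by (intro always_eventually allI) simp
      qed
    qed
    \<comment> \<open>The last summand pays for residuals backwards in time: there the velocity has
      to be moved from the earlier to the later of the two times.\<close>
    define M2 where "M2 = P + Q + Q1 + 2 powr (s + 1) * cL s * (P + P) * Q"
    have M2: "P \<le> M2" "Q \<le> M2" "Q1 + 2 powr (s + 1) * cL s * (P + P) * Q \<le> M2" using P Q cL_ge_1[of s] by (auto simp: M2_def)
    have "Nd (s + 1) (G t) (G r) \<le> M2 * \<bar>t - r\<bar> \<and>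
        N s (defect (t - r) (G r) (G t)) \<le> M2 * (t - r)\<^sup>2"
      if rt: "r \<in> {0..S}" "t \<in> {0..S}" for r t
    proof -
      have L: "Nd (s + 1) (G t) (G r) \<le> Q * \<bar>t - r\<bar>"
        using Lip[of r t] Lip[of t r] rt N_minus_commute[of "s + 1" "G t" "G r"] by (cases "r \<le> t") auto
      have "Q * \<bar>t - r\<bar> \<le> M2 * \<bar>t - r\<bar>" using M2 by (intro mult_right_mono) auto
      moreover have "N s (defect (t - r) (G r) (G t))
         \<le> (Q1 + 2 powr (s + 1) * cL s * (P + P) * Q) * (t - r)\<^sup>2"
      proof (cases "r \<le> t")
        case True
        have "Q1 * (t - r)\<^sup>2 \<le> (Q1 + 2 powr (s + 1) * cL s * (P + P) * Q) * (t - r)\<^sup>2"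
          using P Q cL_ge_1[of s] by (intro mult_right_mono) auto
        with Fwd[OF rt True] show ?thesis by simp
      next
        case False
        have iG: "inH (s + 1) (G q)" "N (s + 1) (G q) \<le> P" "inH s (G q)" "inH s (Bq (G q))" if "q \<in> {0..S}" for q
          using inH_mono[OF _ GP(1)[OF that]] N_mono[OF _ GP(1)[OF that], of "s + 1"] GP(2)[OF that] s
            inH_B_quad[OF s, of s "G q" "G q"] by auto
        let ?u = "\<lambda>z. G r z - G t z - of_real (r - t) * Bq (G t) z"
        let ?w = "\<lambda>z. Bq (G t) z - Bq (G r) z"
        have i: "inH s ?u" "inH s ?w" using iG rt by (auto intro!: inH_diff inH_mult_left)
        have "N s ?w \<le> 2 powr (s + 1) * cL s * (N (s + 1) (G t) + N (s + 1) (G r)) * Nd (s + 1) (G t) (G r)"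
          using iG rt s by (intro N_B_diff[OF s]) auto
        also have "\<dots> \<le> 2 powr (s + 1) * cL s * (P + P) * (Q * \<bar>t - r\<bar>)"
          using iG(2)[OF rt(1)] iG(2)[OF rt(2)] L cL_ge_1[of s] P by (intro mult_mono add_mono) auto
        finally have "\<bar>t - r\<bar> * N s ?w \<le> \<bar>t - r\<bar> * (2 powr (s + 1) * cL s * (P + P) * (Q * \<bar>t - r\<bar>))"
          by (intro mult_left_mono) auto
        also have "\<dots> = (2 powr (s + 1) * cL s * (P + P) * Q) * (t - r)\<^sup>2"
        proof -
          have "(t - r)\<^sup>2 = \<bar>t - r\<bar> * \<bar>t - r\<bar>" by (simp add: power2_eq_square flip: abs_mult)
          then show ?thesis by (simp only: mult_ac)
        qed
        finally have W: "\<bar>t - r\<bar> * N s ?w \<le> (2 powr (s + 1) * cL s * (P + P) * Q) * (t - r)\<^sup>2" .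
        have "(defect (t - r) (G r) (G t)) = (\<lambda>z. of_real (t - r) * ?w z - ?u z)" by (simp add: algebra_simps)
        then have "N s (defect (t - r) (G r) (G t))
           \<le> N s (\<lambda>z. of_real (t - r) * ?w z) + N s ?u" using i by (simp only:) (intro N_triangle_diff inH_mult_left)
        also have "N s (\<lambda>z. of_real (t - r) * ?w z) = \<bar>t - r\<bar> * N s ?w" unfolding N_mult_left norm_of_real ..
        finally have "N s (defect (t - r) (G r) (G t))
          \<le> \<bar>t - r\<bar> * N s ?w + N s ?u" .
        moreover have "N s ?u \<le> Q1 * (t - r)\<^sup>2" using Fwd[of t r] rt False by (simp add: power2_commute)
        ultimately show ?thesis unfolding distrib_right using W by linarith
      qed
      moreover have "(Q1 + 2 powr (s + 1) * cL s * (P + P) * Q) * (t - r)\<^sup>2 \<le> M2 * (t - r)\<^sup>2"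
        using M2 by (intro mult_right_mono) auto
      ultimately show ?thesis using L by linarith
    qed
    moreover have "inH (s + 2) (G t) \<and> herm (G t) \<and> N (s + 2) (G t) \<le> M2" if "t \<in> {0..S}" for t
      using GP[OF that] G(2)[OF that] M2 by auto
    ultimately have "ssol s M2 S G" unfolding ssol_def by blast
    then show ?thesis using GM Ga by blast
  qed
  show ?thesis by (rule exI[of _ M'], rule exI[of _ d0]) (use d0 main in blast)
qed

section \<open>Stability and symmetries of solutions\<close>

lemma rsol_D:
  assumes "rsol s M S \<theta>" "t \<in> {0..S}"
  shows "inH s (\<theta> t)" "herm (\<theta> t)" "N s (\<theta> t) \<le> M"
  using bspec[OF conjunct1[OF assms(1)[unfolded rsol_def]] assms(2)] by auto

lemma rsol_mono:
  assumes "rsol s M S \<theta>" "M \<le> M'" "S' \<le> S" shows "rsol s M' S' \<theta>" unfolding rsol_def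
proof (intro conjI ballI allI impI)
  fix t assume "t \<in> {0..S'}"
  then have "t \<in> {0..S}" using assms(3) by auto
  from rsol_D[OF assms(1) this] show "inH s (\<theta> t)" "herm (\<theta> t)" "N s (\<theta> t) \<le> M'" using assms(2) by auto
next
  fix e :: real assume e: "0 < e"
  obtain d where "0 < d" "\<forall>r t. 0 \<le> r \<and> r \<le> t \<and> t \<le> S \<and> t - r < d \<longrightarrow>
      N 0 (defect (t - r) (\<theta> r) (\<theta> t)) \<le> e * (t - r)"
    using mp[OF spec[OF conjunct2[OF assms(1)[unfolded rsol_def]]] e] by blast
  then show "consistent e S' \<theta>" using assms(3) by (intro exI[of _ d]) (auto intro: order_trans)
qed

text \<open>Both solutions are sampled on a grid that is refined: the residual terms of
  \<open>stab_L2\<close> disappear and the distance of the data remains.\<close>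

lemma rsol_stab:
  assumes s: "2 < s" and a: "rsol s M S a" and b: "rsol s M S b" and t: "t \<in> {0..S}"
  shows "(Nd 0 (a t) (b t))\<^sup>2 \<le> exp (2 * (cL s * M) * S) * (Nd 0 (a 0) (b 0))\<^sup>2"
proof (rule field_le_epsilon)
  fix \<epsilon> :: real assume \<epsilon>: "0 < \<epsilon>"
  have M: "0 \<le> M" by (rule order_trans[OF N_nonneg rsol_D(3)[OF a t]])
  define Q where "Q = exp (2 * (cL s * M) * S) * (S * stabK s M) + 1"
  have Q: "0 < Q" using t stabK_nonneg[OF M, of s] by (auto simp: Q_def intro!: add_nonneg_pos mult_nonneg_nonneg)
  define e where "e = min (1/2) (\<epsilon> / (2 * Q))"
  have e: "0 < e" "2 * e \<le> 1" "Q * (2 * e) \<le> \<epsilon>"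
  proof -
    show "0 < e" "2 * e \<le> 1" using \<epsilon> Q by (auto simp: e_def)
    have "Q * (2 * e) \<le> Q * (2 * (\<epsilon> / (2 * Q)))" using Q by (intro mult_left_mono) (auto simp: e_def)
    then show "Q * (2 * e) \<le> \<epsilon>" using Q by simp
  qed
  have D: "consistent e S x" if "rsol s M S x" for x
    by (rule mp[OF spec[OF conjunct2[OF that[unfolded rsol_def]]] e(1)])
  obtain d1 where d1: "0 < d1" "\<And>r t. 0 \<le> r \<and> r \<le> t \<and> t \<le> S \<and> t - r < d1 \<Longrightarrow>
      N 0 (defect (t - r) (a r) (a t)) \<le> e * (t - r)" using D[OF a] by blast
  obtain d2 where d2: "0 < d2" "\<And>r t. 0 \<le> r \<and> r \<le> t \<and> t \<le> S \<and> t - r < d2 \<Longrightarrow>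
      N 0 (defect (t - r) (b r) (b t)) \<le> e * (t - r)" using D[OF b] by blast
  define h0 where "h0 = min (min d1 d2) e"
  have h0: "0 < h0" using d1 d2 e by (simp add: h0_def)
  obtain n :: nat where n: "t / h0 < real n" using reals_Archimedean2 by blast
  have n0: "0 < n" using n t h0 by (cases n) (auto simp: divide_less_0_iff)
  define h where "h = t / real n"
  have h: "0 \<le> h" "h < h0" using n n0 t h0 by (auto simp: h_def field_simps)
  have hn: "real n * h = t" using n0 by (simp add: h_def)
  have kS: "real k * h \<in> {0..S}" if "k \<le> n" for k
  proof -
    have "real k * h \<le> real n * h" using that h by (intro mult_right_mono) auto
    then show ?thesis using hn t h by auto
  qed
  have diff: "real (Suc k) * h - real k * h = h" for k by (simp add: algebra_simps)
  have "(Nd 0 (a (real n * h)) (b (real n * h)))\<^sup>2 \<le> exp (2 * (cL s * M) * S) *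
     ((Nd 0 (a (real 0 * h)) (b (real 0 * h)))\<^sup>2 + S * (stabK s M * (h + e)))"
  proof (rule stab_L2[where a="\<lambda>k. a (real k * h)" and b="\<lambda>k. b (real k * h)", OF s])
    show "inH s (a (real k * h)) \<and> herm (a (real k * h))" "inH s (b (real k * h)) \<and> herm (b (real k * h))" if "k \<le> n" for k
      using rsol_D[OF a kS[OF that]] rsol_D[OF b kS[OF that]] by auto
    fix k assume k: "k < n"
    show "N s (a (real k * h)) \<le> M" "N s (b (real k * h)) \<le> M" using rsol_D(3)[OF a kS] rsol_D(3)[OF b kS] k by auto
    have *: "0 \<le> real k * h \<and> real k * h \<le> real (Suc k) * h \<and> real (Suc k) * h \<le> S \<and> real (Suc k) * h - real k * h < d"
      if "h < d" for d using kS[of k] kS[of "Suc k"] k that unfolding diff by (auto intro!: mult_right_mono h)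
    show "N 0 (defect h (a (real k * h)) (a (real (Suc k) * h))) \<le> e * h" using d1(2)[OF *] h unfolding diff by (simp add: h0_def)
    show "N 0 (defect h (b (real k * h)) (b (real (Suc k) * h))) \<le> e * h" using d2(2)[OF *] h unfolding diff by (simp add: h0_def)
  qed (use h e M hn t in \<open>auto simp: h0_def\<close>)
  also have "\<dots> \<le> exp (2 * (cL s * M) * S) * (Nd 0 (a 0) (b 0))\<^sup>2 + Q * (h + e)"
    using h e by (simp add: Q_def algebra_simps)
  also have "Q * (h + e) \<le> Q * (2 * e)" using h Q by (intro mult_left_mono) (auto simp: h0_def)
  finally show "(Nd 0 (a t) (b t))\<^sup>2 \<le> exp (2 * (cL s * M) * S) * (Nd 0 (a 0) (b 0))\<^sup>2 + \<epsilon>"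
    unfolding hn using e by simp
qed

lemma rsol_unique:
  assumes s: "2 < s" and a: "rsol s M S a" and b: "rsol s M' S b" and t: "t \<in> {0..S}" and eq: "Nd 0 (a 0) (b 0) = 0"
  shows "Nd 0 (a t) (b t) = 0" using rsol_stab[OF s rsol_mono[OF a, of "max M M'" S] rsol_mono[OF b, of "max M M'" S] t] eq by simp

lemma ssol_D:
  assumes G: "ssol s M S G" and s: "2 < s" and t: "t \<in> {0..S}"
  shows "inH (s + 2) (G t)" "herm (G t)" "N (s + 2) (G t) \<le> M" "inH (s + 1) (G t)" "inH s (G t)" "inH 0 (G t)"
    "N (s + 1) (G t) \<le> M" "N s (G t) \<le> M" "inH s (Bq (G t))" "inH (s + 1) (Bq (G t))"
proof -
  show i: "inH (s + 2) (G t)" "herm (G t)" "N (s + 2) (G t) \<le> M" using G t by (auto simp: ssol_def)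
  show i1: "inH (s + 1) (G t)" "inH s (G t)" "inH 0 (G t)" using inH_mono[OF _ i(1)] s by auto
  show "N (s + 1) (G t) \<le> M" "N s (G t) \<le> M" using N_mono[OF _ i(1), of "s + 1"] N_mono[OF _ i(1), of s] i(3) by auto
  show "inH s (Bq (G t))" using s i1 by (intro inH_B_quad[OF s]) auto
  show "inH (s + 1) (Bq (G t))" using s i by (intro inH_B_quad[OF s]) (auto simp: add.assoc)
qed

lemma ssol_lipschitz:
  assumes "ssol s M S G" "r \<in> {0..S}" "t \<in> {0..S}"
  shows "Nd (s + 1) (G t) (G r) \<le> M * \<bar>t - r\<bar>" using assms unfolding ssol_def by blast

lemma ssol_diff:
  assumes "ssol s M S G" "r \<in> {0..S}" "t \<in> {0..S}"
  shows "N s (defect (t - r) (G r) (G t)) \<le> M * (t - r)\<^sup>2" using assms unfolding ssol_def by blast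

lemma ssolI:
  assumes "\<And>t. t \<in> {0..S} \<Longrightarrow> inH (s + 2) (G t)" "\<And>t. t \<in> {0..S} \<Longrightarrow> herm (G t)" "\<And>t. t \<in> {0..S} \<Longrightarrow> N (s + 2) (G t) \<le> M"
    "\<And>r t. r \<in> {0..S} \<Longrightarrow> t \<in> {0..S} \<Longrightarrow> Nd (s + 1) (G t) (G r) \<le> M * \<bar>t - r\<bar>"
    "\<And>r t. r \<in> {0..S} \<Longrightarrow> t \<in> {0..S} \<Longrightarrow> N s (defect (t - r) (G r) (G t)) \<le> M * (t - r)\<^sup>2"
  shows "ssol s M S G" unfolding ssol_def using assms by blast

text \<open>The nonlinearity is even, so reflecting time and changing the sign preserves the
  equation. Residuals become residuals of \<open>G\<close> between reflected times in the opposite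
  order.\<close>

lemma ssol_reverse:
  assumes G: "ssol s M S G" and s: "2 < s" shows "ssol s M S (\<lambda>t x. - G (S - t) x)"
proof (rule ssolI)
  fix t assume t: "t \<in> {0..S}"
  then have t': "S - t \<in> {0..S}" by auto
  note D = ssol_D[OF G s t']
  show "inH (s + 2) (\<lambda>x. - G (S - t) x)" using D by auto
  show "herm (\<lambda>x. - G (S - t) x)" using D(2) by (simp add: herm_def)
  show "N (s + 2) (\<lambda>x. - G (S - t) x) \<le> M" using D by simp
  fix r assume r: "r \<in> {0..S}"
  then have r': "S - r \<in> {0..S}" by auto
  have "(\<lambda>x. - G (S - t) x - - G (S - r) x) = (\<lambda>x. - (G (S - t) x - G (S - r) x))" by auto
  then show "N (s + 1) (\<lambda>x. - G (S - t) x - - G (S - r) x) \<le> M * \<bar>t - r\<bar>"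
    using ssol_lipschitz[OF G r' t'] by (simp only: N_uminus) (simp add: abs_minus_commute)
  have "(\<lambda>x. - G (S - t) x - - G (S - r) x - of_real (t - r) * Bq (\<lambda>x. - G (S - r) x) x)
      = (\<lambda>x. - (G (S - t) x - G (S - r) x - of_real ((S - t) - (S - r)) * Bq (G (S - r)) x))" by (simp add: B_minus algebra_simps)
  then show "N s (\<lambda>x. - G (S - t) x - - G (S - r) x - of_real (t - r) * Bq (\<lambda>x. - G (S - r) x) x) \<le> M * (t - r)\<^sup>2"
    using ssol_diff[OF G r' t'] by (simp only: N_uminus) (simp add: power2_commute)
qed

text \<open>The nonlinearity is quadratic, so amplitude and speed scale alike. Size, Lipschitz
  constant and residual acquire the factors \<open>c\<close>, \<open>c\<^sup>2\<close> and
  \<open>c^3\<close>; their sum covers all three.\<close>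

lemma ssol_scale:
  assumes G: "ssol s M S G" and s: "2 < s" and c: "0 < c" and M: "0 \<le> M"
  shows "ssol s (M * (c + c\<^sup>2 + c^3)) (S / c) (\<lambda>t x. of_real c * G (c * t) x)"
proof (rule ssolI)
  have M': "c * M \<le> M * (c + c\<^sup>2 + c^3)" "c * (M * c) \<le> M * (c + c\<^sup>2 + c^3)" "c * (M * c\<^sup>2) \<le> M * (c + c\<^sup>2 + c^3)"
    using M c by (auto simp: algebra_simps power2_eq_square power3_eq_cube)
  fix t assume t: "t \<in> {0..S / c}"
  then have t': "c * t \<in> {0..S}" using c by (auto simp: field_simps)
  note D = ssol_D[OF G s t']
  show "inH (s + 2) (\<lambda>x. of_real c * G (c * t) x)" using D by auto
  show "herm (\<lambda>x. of_real c * G (c * t) x)" by (rule herm_real_mult[OF D(2)])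
  have "c * N (s + 2) (G (c * t)) \<le> c * M" using D c by (intro mult_left_mono) auto
  from order_trans[OF this M'(1)] show "N (s + 2) (\<lambda>x. of_real c * G (c * t) x) \<le> M * (c + c\<^sup>2 + c^3)" using c by simp
  fix r assume r: "r \<in> {0..S / c}"
  then have r': "c * r \<in> {0..S}" using c by (auto simp: field_simps)
  have "(\<lambda>x. of_real c * G (c * t) x - of_real c * G (c * r) x)
      = (\<lambda>x. of_real c * (G (c * t) x - G (c * r) x))" by (simp add: algebra_simps)
  then have "N (s + 1) (\<lambda>x. of_real c * G (c * t) x - of_real c * G (c * r) x)
      = c * Nd (s + 1) (G (c * t)) (G (c * r))" using c by simp
  also have "\<dots> \<le> c * (M * \<bar>c * t - c * r\<bar>)" using ssol_lipschitz[OF G r' t'] c by (intro mult_left_mono) auto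
  also have "\<dots> = c * (M * c) * \<bar>t - r\<bar>" using c by (simp add: abs_mult flip: right_diff_distrib)
  also have "\<dots> \<le> M * (c + c\<^sup>2 + c^3) * \<bar>t - r\<bar>" by (intro mult_right_mono M') simp
  finally show "N (s + 1) (\<lambda>x. of_real c * G (c * t) x - of_real c * G (c * r) x) \<le> M * (c + c\<^sup>2 + c^3) * \<bar>t - r\<bar>" .
  have "(\<lambda>x. of_real c * G (c * t) x - of_real c * G (c * r) x
        - of_real (t - r) * Bq (\<lambda>x. of_real c * G (c * r) x) x)
      = (\<lambda>x. of_real c * (G (c * t) x - G (c * r) x - of_real (c * t - c * r) * Bq (G (c * r)) x))"
    by (simp add: B_mult algebra_simps)
  then have "N s (\<lambda>x. of_real c * G (c * t) x - of_real c * G (c * r) x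
        - of_real (t - r) * Bq (\<lambda>x. of_real c * G (c * r) x) x)
      = c * N s (defect (c * t - c * r) (G (c * r)) (G (c * t)))" using c by simp
  also have "\<dots> \<le> c * (M * (c * t - c * r)\<^sup>2)" using ssol_diff[OF G r' t'] c by (intro mult_left_mono) auto
  also have "\<dots> = c * (M * c\<^sup>2) * (t - r)\<^sup>2" by (simp add: power_mult_distrib flip: right_diff_distrib)
  also have "\<dots> \<le> M * (c + c\<^sup>2 + c^3) * (t - r)\<^sup>2" by (intro mult_right_mono M') simp
  finally show "N s (\<lambda>x. of_real c * G (c * t) x - of_real c * G (c * r) x
        - of_real (t - r) * Bq (\<lambda>x. of_real c * G (c * r) x) x)
      \<le> M * (c + c\<^sup>2 + c^3) * (t - r)\<^sup>2" .
qed

text \<open>The first summand is the commutator estimate for transport by \<open>g\<close>; the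
  second bounds \<open>B v a\<close>, where the derivative falls on the smooth
  \<open>a\<close>.\<close>

definition stabC :: "real \<Rightarrow> real \<Rightarrow> real \<Rightarrow> real" where
  "stabC s M Ma = s * 2 powr (s - 1) * (2 * cL s * M) + 2 powr (s + 1) * cL s * Ma"

text \<open>The rate involves \<open>g\<close> only through its H^s bound \<open>M\<close>. Its
  higher norms, bounded by \<open>Mg\<close>, enter only through discretisation errors that vanish
  as the grid is refined. Thus the estimate is uniform over oscillating perturbations
  \<open>g\<close> of a fixed \<open>a\<close>.\<close>

lemma ssol_stab:
  assumes s: "2 < s" and g: "ssol s Mg S g" "\<And>t. t \<in> {0..S} \<Longrightarrow> N s (g t) \<le> M" and a: "ssol s Ma S a"
    and t: "t \<in> {0..S}"
  shows "(Nd s (g t) (a t))\<^sup>2 \<le> exp (2 * stabC s M Ma * S) * (Nd s (g 0) (a 0))\<^sup>2"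
proof (rule field_le_epsilon)
  fix \<epsilon> :: real assume \<epsilon>: "0 < \<epsilon>"
  define C where "C = stabC s M Ma"
  have M: "0 \<le> M" using g(2)[OF t] order_trans[OF N_nonneg] by blast
  have Mg: "0 \<le> Mg" using ssol_D(3)[OF g(1) s t] order_trans[OF N_nonneg] by blast
  have Ma: "0 \<le> Ma" using ssol_D(3)[OF a s t] order_trans[OF N_nonneg] by blast
  have c: "0 \<le> cL s" using cL_ge_1[of s] by simp
  have C: "0 \<le> C" using s c M Ma by (simp add: C_def stabC_def)
  define v where "v t z = g t z - a t z" for t z
  define D where "D t z = Bq (g t) z - Bq (a t) z" for t z
  have est: "inH s (v r)" "inH s (D r)" "ip s (v r) (D r) \<le> C * (N s (v r))\<^sup>2" "N s (v r) \<le> Mg + Ma"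
    "N s (D r) \<le> 2 powr (s + 1) * cL s * (Mg + Ma) * (Mg + Ma)" if r: "r \<in> {0..S}" for r
  proof -
    note gr = ssol_D[OF g(1) s r] and ar = ssol_D[OF a s r]
    have g1: "inH 1 (g r)" "inH 1 (a r)" using inH_mono[OF _ gr(5), of 1] inH_mono[OF _ ar(5), of 1] s by auto
    show v: "inH s (v r)" unfolding v_def using gr ar by auto
    have v1: "inH (s + 1) (v r)" unfolding v_def using gr ar by auto
    show "inH s (D r)" unfolding D_def using gr ar by auto
    show "N s (v r) \<le> Mg + Ma" unfolding v_def[abs_def] using N_triangle_diff[OF gr(5) ar(5)] gr ar by simp
    have "N (s + 1) (v r) \<le> Mg + Ma" unfolding v_def[abs_def] using N_triangle_diff[OF gr(4) ar(4)] gr ar by simp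
    moreover have "N s (D r) \<le> 2 powr (s + 1) * cL s * (N (s + 1) (g r) + N (s + 1) (a r)) * N (s + 1) (v r)"
      unfolding D_def[abs_def] v_def[abs_def] using gr ar s by (intro N_B_diff[OF s]) auto
    moreover have "2 powr (s + 1) * cL s * (N (s + 1) (g r) + N (s + 1) (a r)) * N (s + 1) (v r)
       \<le> 2 powr (s + 1) * cL s * (Mg + Ma) * (Mg + Ma)" using gr ar c Mg Ma calculation(1) by (intro mult_mono add_mono) auto
    ultimately show "N s (D r) \<le> 2 powr (s + 1) * cL s * (Mg + Ma) * (Mg + Ma)" by linarith
    have vh: "herm (v r)" unfolding v_def using gr ar by (auto intro: herm_diff)
    note Lg = L1i_1[OF s gr(5)] L1_1_le[OF s gr(5)] and Lv = L1i_1[OF s v] L1_1_le[OF s v] L1i_0[OF s v] L1_0_le[OF s v]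
      and La = L1i_1[OF s ar(5)] L1_1_le[OF s ar(5)]
    have Bgv: "inH s (B (g r) (v r))" and Bva: "inH s (B (v r) (a r))" using s gr v1 ar by (auto intro!: inH_B_quad[OF s])
    have Deq: "D r = (\<lambda>z. B (g r) (v r) z + B (v r) (a r) z)" unfolding D_def v_def using B_diff[OF g1] by auto
    have ipD: "ip s (v r) (D r) = ip s (B (g r) (v r)) (v r) + ip s (B (v r) (a r)) (v r)"
      unfolding Deq by (subst ip_commute) (rule ip_add_left[OF Bgv Bva v])
    have "ip s (B (g r) (v r)) (v r) \<le> s * 2 powr (s - 1) * (L1 1 (g r) * N s (v r) + L1 1 (v r) * N s (g r)) * N s (v r)"
      by (rule abs_le_D1[OF ip_B[OF _ gr(2) Lg(1) gr(5) v1 Lv(1)]]) (use s in simp)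
    also have "\<dots> \<le> s * 2 powr (s - 1) * ((cL s * M) * N s (v r) + (cL s * N s (v r)) * M) * N s (v r)"
    proof -
      have "L1 1 (g r) \<le> cL s * M" by (rule order_trans[OF Lg(2) mult_left_mono[OF g(2)[OF r] c]])
      then have "L1 1 (g r) * N s (v r) + L1 1 (v r) * N s (g r) \<le> (cL s * M) * N s (v r) + (cL s * N s (v r)) * M"
        using c M by (intro add_mono mult_mono Lv(2) g(2)[OF r]) simp_all
      then show ?thesis using s by (intro mult_right_mono mult_left_mono) simp_all
    qed
    also have "\<dots> = s * 2 powr (s - 1) * (2 * cL s * M) * (N s (v r))\<^sup>2" by (simp add: power2_eq_square algebra_simps)
    finally have i1: "ip s (B (g r) (v r)) (v r) \<le> s * 2 powr (s - 1) * (2 * cL s * M) * (N s (v r))\<^sup>2" .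
    have "ip s (B (v r) (a r)) (v r) \<le> N s (B (v r) (a r)) * N s (v r)" using ip_le[OF Bva v] by (rule abs_le_D1)
    also have "\<dots> \<le> (2 powr (s + 1) * cL s * Ma * N s (v r)) * N s (v r)"
    proof (rule mult_right_mono)
      have "N s (B (v r) (a r)) \<le> 2 powr s * (L1 0 (v r) * N (s + 1) (a r) + N s (v r) * L1 1 (a r))"
        using s v Lv ar La by (intro N_B) auto
      also have "\<dots> \<le> 2 powr s * ((cL s * N s (v r)) * Ma + N s (v r) * (cL s * Ma))"
      proof -
        have "L1 1 (a r) \<le> cL s * Ma" by (rule order_trans[OF La(2) mult_left_mono[OF ar(8) c]])
        then have "L1 0 (v r) * N (s + 1) (a r) + N s (v r) * L1 1 (a r) \<le> (cL s * N s (v r)) * Ma + N s (v r) * (cL s * Ma)"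
          using c Ma by (intro add_mono mult_mono Lv(4) ar(7)) simp_all
        then show ?thesis by (intro mult_left_mono) simp_all
      qed
      also have "\<dots> = 2 powr (s + 1) * cL s * Ma * N s (v r)" by (simp add: powr_add algebra_simps)
      finally show "N s (B (v r) (a r)) \<le> 2 powr (s + 1) * cL s * Ma * N s (v r)" .
    qed simp
    finally have i2: "ip s (B (v r) (a r)) (v r) \<le> (2 powr (s + 1) * cL s * Ma) * (N s (v r))\<^sup>2"
      by (simp add: power2_eq_square algebra_simps)
    show "ip s (v r) (D r) \<le> C * (N s (v r))\<^sup>2" unfolding ipD C_def stabC_def distrib_right using i1 i2 by linarith
  qed
  define D0 where "D0 = 2 powr (s + 1) * cL s * (Mg + Ma) * (Mg + Ma)"
  have D0: "0 \<le> D0" using c Mg Ma by (simp add: D0_def)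
  define E where "E = D0\<^sup>2 + (2 * (Mg + Ma) + 2 * D0 + 1) * (Mg + Ma)"
  have E: "0 \<le> E" using D0 Mg Ma by (simp add: E_def)
  define Q where "Q = exp (2 * C * S) * (S * E) + 1"
  have Q: "0 < Q" using t E by (auto simp: Q_def intro!: add_nonneg_pos mult_nonneg_nonneg)
  \<comment> \<open>Keeps the residual per unit of time, \<open>(Mg + Ma) * h\<close>, below 1 and
    the accumulated error \<open>Q * h\<close> below \<open>\<epsilon>\<close>.\<close>
  define h0 where "h0 = min (1 / (Mg + Ma + 1)) (\<epsilon> / Q)"
  have h0: "0 < h0" using \<epsilon> Q Mg Ma by (simp add: h0_def)
  obtain n :: nat where n: "t / h0 < real n" using reals_Archimedean2 by blast
  have n0: "0 < n" using n t h0 by (cases n) (auto simp: divide_less_0_iff)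
  define h where "h = t / real n"
  have h: "0 \<le> h" "h < h0" using n n0 t h0 by (auto simp: h_def field_simps)
  have hn: "real n * h = t" using n0 by (simp add: h_def)
  have h': "h \<le> 1" "(Mg + Ma) * h \<le> 1" "Q * h \<le> \<epsilon>"
  proof -
    have 1: "h * (Mg + Ma + 1) \<le> 1" using h Mg Ma pos_le_divide_eq[of "Mg + Ma + 1" h 1] by (simp add: h0_def)
    have "0 \<le> h * Mg" "0 \<le> h * Ma" using h Mg Ma by auto
    with 1 h show "h \<le> 1" "(Mg + Ma) * h \<le> 1" by (simp_all add: algebra_simps)
    have "h \<le> \<epsilon> / Q" using h by (simp add: h0_def)
    then show "Q * h \<le> \<epsilon>" using Q by (simp add: pos_le_divide_eq mult.commute)
  qed
  have kS: "real k * h \<in> {0..S}" if "k \<le> n" for k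
  proof -
    have "real k * h \<le> real n * h" using that h by (intro mult_right_mono) auto
    then show ?thesis using hn t h by auto
  qed
  have diff: "real (Suc k) * h - real k * h = h" for k by (simp add: algebra_simps)
  have err: "N s (\<lambda>z. v (real (Suc k) * h) z - v (real k * h) z - of_real h * D (real k * h) z) \<le> ((Mg + Ma) * h) * h"
    if k: "k < n" for k
  proof -
    let ?r = "real k * h" and ?t = "real (Suc k) * h"
    have rt: "?r \<in> {0..S}" "?t \<in> {0..S}" using kS[of k] kS[of "Suc k"] k by auto
    note gr = ssol_D[OF g(1) s rt(1)] and gt = ssol_D[OF g(1) s rt(2)] and ar = ssol_D[OF a s rt(1)] and at = ssol_D[OF a s rt(2)]
    let ?p = "\<lambda>x z. x ?t z - x ?r z - of_real h * Bq (x ?r) z"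
    have "(\<lambda>z. v ?t z - v ?r z - of_real h * D ?r z) = (\<lambda>z. ?p g z - ?p a z)" by (simp add: v_def D_def algebra_simps)
    then have "N s (\<lambda>z. v ?t z - v ?r z - of_real h * D ?r z) \<le> N s (?p g) + N s (?p a)"
      by (simp only:) (intro N_triangle_diff inH_diff inH_mult_left gr gt ar at)
    also have "\<dots> \<le> Mg * h\<^sup>2 + Ma * h\<^sup>2" using ssol_diff[OF g(1) rt] ssol_diff[OF a rt] unfolding diff by simp
    finally show ?thesis by (simp add: power2_eq_square algebra_simps)
  qed
  have "(N s (v (real n * h)))\<^sup>2 \<le> exp (2 * C * (real n * h)) *
     ((N s (v (real 0 * h)))\<^sup>2 + real n * h * (h * D0\<^sup>2 + (2 * (Mg + Ma) + 2 * D0 + 1) * ((Mg + Ma) * h)))"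
    by (rule energy_Gronwall[where v="\<lambda>k. v (real k * h)" and D="\<lambda>k. D (real k * h)"])
      (use est kS err h h' C D0 Mg Ma in \<open>auto simp: D0_def\<close>)
  also have "\<dots> \<le> exp (2 * C * S) * ((N s (v 0))\<^sup>2 + S * (h * E))"
  proof -
    have "h * D0\<^sup>2 + (2 * (Mg + Ma) + 2 * D0 + 1) * ((Mg + Ma) * h) = h * E" by (simp add: E_def algebra_simps)
    moreover have "real n * h * (h * E) \<le> S * (h * E)" using hn t h E by (intro mult_right_mono) auto
    moreover have "exp (2 * C * (real n * h)) \<le> exp (2 * C * S)" using hn t C by (simp add: mult_left_mono)
    ultimately show ?thesis using h E t hn by (intro mult_mono) (auto intro!: add_nonneg_nonneg mult_nonneg_nonneg)
  qed
  also have "\<dots> \<le> exp (2 * C * S) * (N s (v 0))\<^sup>2 + Q * h" using h by (simp add: Q_def algebra_simps)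
  finally show "(Nd s (g t) (a t))\<^sup>2 \<le> exp (2 * stabC s M Ma * S) * (Nd s (g 0) (a 0))\<^sup>2 + \<epsilon>"
    unfolding hn C_def[symmetric] using h'(3) by (simp add: v_def[abs_def])
qed

section \<open>Solutions in physical and in Fourier variables\<close>

lemma wt_cong_AE: "AE x in lborel. a x = b x \<Longrightarrow> AE x in lborel. wt m a x = wt m b x"
  by (auto simp: wt_def elim: eventually_mono)

lemma inH_cong_AE:
  assumes "AE x in lborel. a x = b x" "inH m a" and [measurable]: "b \<in> borel_measurable borel"
  shows "inH m b" using sqi_cong_AE[OF wt_cong_AE[OF assms(1)], of m] assms(2) by (simp add: inH_def)

lemma N_cong_AE:
  assumes "AE x in lborel. a x = b x" and [measurable]: "a \<in> borel_measurable borel" "b \<in> borel_measurable borel"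
  shows "N m a = N m b" unfolding N_def by (rule l2norm_cong_AE[OF wt_cong_AE[OF assms(1)]]) auto

lemma ft_measurable: "square_integrable f \<Longrightarrow> ft f \<in> borel_measurable borel" using sqi_ft by auto

lemma fourier_measurable: "square_integrable f \<Longrightarrow> fourier f \<in> borel_measurable borel" using sqi_fourier by auto

lemma sobolev_iff: "f \<in> sobolev s \<longleftrightarrow> square_integrable f \<and> inH s (ft f)"
proof (cases "square_integrable f")
  case True
  note [measurable] = ft_measurable[OF True] fourier_measurable[OF True]
  have "AE x in lborel. ft f x = fourier f x" using fourier_ft_AE[OF True] by eventually_elim simp
  then have "inH s (fourier f) \<longleftrightarrow> inH s (ft f)" using inH_cong_AE[OF fourier_ft_AE[OF True], of s]
      inH_cong_AE[of "ft f" "fourier f" s] by auto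
  moreover have "(cmod (wt s (fourier f) x))\<^sup>2 = (1 + (norm x)\<^sup>2) powr s * (cmod (fourier f x))\<^sup>2" for x
    by (simp add: cmod_wt power_mult_distrib jb_powr_square)
  ultimately show ?thesis using True by (auto simp: sobolev_def inH_def square_integrable_def[of "wt s (fourier f)"])
qed (simp add: sobolev_def)

lemma sobolev_norm_ft: assumes f: "square_integrable f" shows "sobolev_norm s f = N s (ft f)"
proof -
  have "sobolev_norm s f = N s (fourier f)" by (simp add: sobolev_norm_def N_def l2norm_def cmod_wt power_mult_distrib jb_powr_square)
  also have "\<dots> = N s (ft f)" by (rule N_cong_AE[OF fourier_ft_AE[OF f] fourier_measurable[OF f] ft_measurable[OF f]])
  finally show ?thesis .
qed

lemma sobolev_dist_ft:
  assumes f: "square_integrable f" and g: "square_integrable g"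
  shows "sobolev_dist s f g = Nd s (ft f) (ft g)" unfolding sobolev_dist_def sobolev_norm_ft[OF square_integrable_diff[OF f g]]
  by (rule N_cong_AE[OF ft_diff[OF f g]])
    (use ft_measurable[OF f] ft_measurable[OF g] ft_measurable[OF square_integrable_diff[OF f g]] in auto)

lemma ft_cong_AE:
  assumes "AE x in lborel. f x = g x" "square_integrable f" "square_integrable g"
  shows "AE z in lborel. ft f z = ft g z" using fourier_cong_AE[OF assms] fourier_ft_AE[OF assms(2)] fourier_ft_AE[OF assms(3)]
  by eventually_elim simp

lemma ft_surj:
  assumes "sqi a" "herm a" shows "\<exists>f. square_integrable f \<and> (AE x in lborel. ft f x = a x)"
proof -
  obtain f where f: "square_integrable f" "AE x in lborel. fourier f x = a x" using herm_imp_fourier[OF assms] by blast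
  have "AE x in lborel. ft f x = a x" using f(2) fourier_ft_AE[OF f(1)] by eventually_elim simp
  with f show ?thesis by blast
qed

text \<open>The symmetry of the symbol makes the product Hermitian, hence the transform of a real
  function; so the choice in \<open>fourier_multiplier\<close> is made from a nonempty set.\<close>

lemma fourier_multiplier:
  assumes f: "square_integrable f" and m: "\<And>x. m (- x) = cnj (m x)" and sq: "sqi (\<lambda>x. m x * ft f x)"
  shows "square_integrable (fourier_multiplier m f)" and "AE x in lborel. fourier (fourier_multiplier m f) x = m x * ft f x"
proof -
  have "herm (\<lambda>x. m x * ft f x)" using m herm_ft[of f] by (simp add: herm_def)
  from herm_imp_fourier[OF sq this] obtain g where g: "square_integrable g"
    "AE x in lborel. fourier g x = m x * ft f x" by blast
  have "AE x in lborel. fourier g x = m x * fourier f x" using g(2) fourier_ft_AE[OF f] by eventually_elim simp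
  with g have "\<exists>g. square_integrable g \<and> (AE x in lborel. fourier g x = m x * fourier f x)" by blast
  from someI_ex[OF this] have *: "square_integrable (fourier_multiplier m f)"
    "AE x in lborel. fourier (fourier_multiplier m f) x = m x * fourier f x" by (simp_all add: fourier_multiplier_def)
  then show "square_integrable (fourier_multiplier m f)" by simp
  show "AE x in lborel. fourier (fourier_multiplier m f) x = m x * ft f x" using *(2) fourier_ft_AE[OF f] by eventually_elim simp
qed

text \<open>Each product of a Riesz transform with a derivative is transformed into a convolution;
  the two factors \<open>\<i>\<close> multiply to -1, and the combination of both products has the
  kernel \<open>K\<close>. As \<open>s > 2\<close>, the transforms of all factors lie in L1 and in
  L2, so that the product formula applies.\<close>

lemma convection:
  assumes s: "2 < s" and \<theta>: "\<theta> \<in> sobolev s"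
  shows "(\<lambda>x. - sqg_convection \<theta> x) \<in> sobolev (s - 1)"
    and "AE z in lborel. ft (\<lambda>x. - sqg_convection \<theta> x) z = Bq (ft \<theta>) z"
proof -
  have sq: "square_integrable \<theta>" and a: "inH s (ft \<theta>)" using \<theta> by (auto simp: sobolev_iff)
  define a where "a = ft \<theta>"
  have as: "inH s a" using a by (simp add: a_def)
  have a0: "sqi a" "inH 1 a" "L1i 0 a" "L1i 1 a"
    using inH_mono[OF _ as, of 0] inH_mono[OF _ as, of 1] L1i_0[OF s as] L1i_1[OF s as] s by (auto simp: inH_0)
  have [measurable]: "a \<in> borel_measurable borel" using a0 by auto
  define r p where "r k z = \<i> * of_real (z $ k / norm z) * a z" and "p k z = \<i> * of_real (z $ k) * a z" for k :: 2 and z :: plane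
  have [measurable]: "r k \<in> borel_measurable borel" "p k \<in> borel_measurable borel" for k unfolding r_def p_def by measurable
  have rle: "cmod (r k z) \<le> 1 * cmod (a z)" for k z
  proof -
    have "\<bar>z $ k / norm z\<bar> \<le> 1" using component_le_norm_cart[of z k] by (auto simp: divide_le_eq_1)
    from mult_right_mono[OF this, of "cmod (a z)"] show ?thesis by (simp add: r_def norm_mult norm_divide)
  qed
  have ple: "cmod (p k z) \<le> 1 * cmod (wt 1 a z)" for k z
  proof -
    have "\<bar>z $ k\<bar> \<le> jb z" using component_le_norm_cart[of z k] norm_le_jb[of z] by linarith
    from mult_right_mono[OF this, of "cmod (a z)"] show ?thesis by (simp add: p_def norm_mult cmod_wt)
  qed
  have rsq: "sqi (r k)" for k by (rule sqi_dominated[OF a0(1) _ rle]) measurable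
  have psq: "sqi (p k)" for k by (rule sqi_dominated[OF a0(2)[unfolded inH_def] _ ple]) measurable
  have rL: "integrable lborel (r k)" for k
    by (rule integrable_dominated[of _ a]) (use a0(3) rle in \<open>auto simp: L1i_def wt_0\<close>)
  have pL: "integrable lborel (p k)" for k
    by (rule integrable_dominated[of _ "wt 1 a"]) (use a0(4) ple in \<open>auto simp: L1i_def\<close>)
  have R: "square_integrable (riesz k \<theta>)" "AE z in lborel. fourier (riesz k \<theta>) z = r k z" for k unfolding riesz_def
    using fourier_multiplier[OF sq, of "\<lambda>z. \<i> * of_real (z $ k / norm z)"] rsq[of k] by (simp_all add: r_def[abs_def] a_def)
  have P: "square_integrable (partial_deriv k \<theta>)" "AE z in lborel. fourier (partial_deriv k \<theta>) z = p k z" for k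
    unfolding partial_deriv_def using fourier_multiplier[OF sq, of "\<lambda>z. \<i> * of_real (z $ k)"] psq[of k]
    by (simp_all add: p_def[abs_def] a_def)
  define F where "F b x = (if b then riesz 2 \<theta> x * partial_deriv 1 \<theta> x else riesz 1 \<theta> x * partial_deriv 2 \<theta> x)" for b x
  have F: "square_integrable (F b)"
    "AE z in lborel. fourier (F b) z = (if b then conv (r 2) (p 1) z else conv (r 1) (p 2) z) / (2 * pi)" for b
    unfolding F_def using fourier_product[OF R rL rsq P pL psq] by (cases b; simp)+
  have conv: "(\<lambda>x. - sqg_convection \<theta> x) = (\<lambda>x. \<Sum>b\<in>UNIV. (if b then 1 else - 1) * F b x)"
    by (simp add: fun_eq_iff sqg_convection_def sqg_velocity_def UNIV_bool F_def sum_2)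
  have sqc: "square_integrable (\<lambda>x. - sqg_convection \<theta> x)" unfolding conv by (rule square_integrable_sum) (rule F)
  have "AE z in lborel. fourier (\<lambda>x. - sqg_convection \<theta> x) z = (\<Sum>b\<in>UNIV. of_real (if b then 1 else - 1) * fourier (F b) z)"
    unfolding conv by (rule fourier_sum) (use F in auto)
  then have "AE z in lborel. fourier (\<lambda>x. - sqg_convection \<theta> x) z = (conv (r 2) (p 1) z - conv (r 1) (p 2) z) / (2 * pi)"
    using F(2)[of True] F(2)[of False] by eventually_elim (simp add: UNIV_bool diff_divide_distrib)
  moreover have "(conv (r 2) (p 1) z - conv (r 1) (p 2) z) / (2 * pi) = Bq a z" for z
  proof -
    have i: "integrable lborel (\<lambda>y. r j (z - y) * p k y)" for j k by (intro sqi_mult_integrable sqi_reflect rsq psq)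
    have "conv (r 2) (p 1) z - conv (r 1) (p 2) z = (LINT y|lborel. r 2 (z - y) * p 1 y - r 1 (z - y) * p 2 y)"
      unfolding conv_def using i by simp
    also have "\<dots> = (LINT y|lborel. of_real (K (z - y) y) * a (z - y) * a y)"
    proof (intro LINT_cong refl)
      fix y
      define \<zeta> where "\<zeta> = z - y"
      have "r 2 \<zeta> * p 1 y - r 1 \<zeta> * p 2 y
          = of_real ((\<zeta> $ 1 / norm \<zeta>) * y $ 2 - (\<zeta> $ 2 / norm \<zeta>) * y $ 1) * a \<zeta> * a y"
        by (simp add: r_def p_def algebra_simps)
      also have "(\<zeta> $ 1 / norm \<zeta>) * y $ 2 - (\<zeta> $ 2 / norm \<zeta>) * y $ 1 = K \<zeta> y"
        by (simp add: K_def diff_divide_distrib)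
      finally show "r 2 (z - y) * p 1 y - r 1 (z - y) * p 2 y = of_real (K (z - y) y) * a (z - y) * a y" by (simp add: \<zeta>_def)
    qed
    finally show ?thesis by (simp add: B_def)
  qed
  ultimately have fB: "AE z in lborel. fourier (\<lambda>x. - sqg_convection \<theta> x) z = Bq a z" by simp
  show ft: "AE z in lborel. ft (\<lambda>x. - sqg_convection \<theta> x) z = Bq (ft \<theta>) z"
    using fB fourier_ft_AE[OF sqc] by eventually_elim (simp add: a_def)
  have "inH (s - 1) (Bq a)" using s as by (intro inH_B_quad[OF s]) auto
  then have "inH (s - 1) (ft (\<lambda>x. - sqg_convection \<theta> x))"
    by (rule inH_cong_AE[rotated]) (use ft ft_measurable[OF sqc] in \<open>auto simp: a_def elim: eventually_mono\<close>)
  then show "(\<lambda>x. - sqg_convection \<theta> x) \<in> sobolev (s - 1)" using sqc by (simp add: sobolev_iff)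
qed

definition RS :: "(real \<Rightarrow> cfun) \<Rightarrow> (real \<times> real set) set \<Rightarrow> cfun" where
  "RS b p x = (\<Sum>(\<tau>, L)\<in>p. of_real (measure lborel L) * b \<tau> x)"

lemma sobolev_dist_RS:
  assumes p: "p tagged_division_of {u..v}" and F: "\<And>\<tau>. \<tau> \<in> {u..v} \<Longrightarrow> square_integrable (F \<tau>)"
    and b: "\<And>\<tau>. \<tau> \<in> {u..v} \<Longrightarrow> AE z in lborel. ft (F \<tau>) z = b \<tau> z" "\<And>\<tau>. \<tau> \<in> {u..v} \<Longrightarrow> b \<tau> \<in> borel_measurable borel"
    and I: "square_integrable I"
  shows "sobolev_dist r (\<lambda>x. \<Sum>(\<tau>, L)\<in>p. measure lborel L * F \<tau> x) I = Nd r (RS b p) (ft I)"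
proof -
  have fin: "finite p" using p by auto
  have tag: "fst i \<in> {u..v}" if "i \<in> p" for i using tag_in_interval[OF p[folded box_real(2)], of "fst i" "snd i"] that by simp
  have eq: "(\<lambda>x. \<Sum>(\<tau>, L)\<in>p. measure lborel L * F \<tau> x) = (\<lambda>x. \<Sum>i\<in>p. measure lborel (snd i) * F (fst i) x)"
    by (simp add: case_prod_beta)
  have sq: "square_integrable (\<lambda>x. \<Sum>i\<in>p. measure lborel (snd i) * F (fst i) x)"
    by (rule square_integrable_sum) (use F tag in auto)
  have "AE z in lborel. \<forall>i\<in>p. ft (F (fst i)) z = b (fst i) z" using fin b tag by (intro AE_finite_allI) auto
  moreover have "AE z in lborel. ft (\<lambda>x. \<Sum>i\<in>p. measure lborel (snd i) * F (fst i) x) z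
      = (\<Sum>i\<in>p. of_real (measure lborel (snd i)) * ft (F (fst i)) z)" by (rule ft_sum) (use fin F tag in auto)
  ultimately have AE: "AE z in lborel. ft (\<lambda>x. \<Sum>i\<in>p. measure lborel (snd i) * F (fst i) x) z - ft I z = RS b p z - ft I z"
    by eventually_elim (simp add: RS_def case_prod_beta)
  have [measurable]: "RS b p \<in> borel_measurable borel"
    unfolding RS_def[abs_def] case_prod_beta using b(2) tag by (intro borel_measurable_sum borel_measurable_times) auto
  show ?thesis unfolding eq sobolev_dist_ft[OF sq I] by (rule N_cong_AE[OF AE]) (use ft_measurable[OF sq] ft_measurable[OF I] in auto)
qed

lemma content_tagged_division:
  assumes "p tagged_division_of {u..v::real}" "u \<le> v" shows "(\<Sum>(\<tau>, L)\<in>p. measure lborel L) = v - u"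
  using additive_content_tagged_division[OF assms(1)[folded box_real(2)]] assms(2) by simp

lemma N_RS_diff_le:
  assumes p: "p tagged_division_of {u..v}" and uv: "u \<le> v" and b: "\<And>\<tau>. \<tau> \<in> {u..v} \<Longrightarrow> inH m (b \<tau>)"
    and c: "inH m c" and e: "\<And>\<tau>. \<tau> \<in> {u..v} \<Longrightarrow> Nd m (b \<tau>) c \<le> e"
  shows "N m (\<lambda>x. RS b p x - of_real (v - u) * c x) \<le> (v - u) * e"
proof -
  have tag: "fst i \<in> {u..v}" if "i \<in> p" for i using tag_in_interval[OF p[folded box_real(2)], of "fst i" "snd i"] that by simp
  have vu: "v - u = (\<Sum>i\<in>p. measure lborel (snd i))" using content_tagged_division[OF p uv] by (simp add: case_prod_beta)
  have "(\<lambda>x. RS b p x - of_real (v - u) * c x)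
      = (\<lambda>x. \<Sum>i\<in>p. of_real (measure lborel (snd i)) * (b (fst i) x - c x))"
    unfolding vu by (simp add: RS_def case_prod_beta fun_eq_iff right_diff_distrib sum_subtractf sum_distrib_right)
  then have "N m (\<lambda>x. RS b p x - of_real (v - u) * c x)
     \<le> (\<Sum>i\<in>p. N m (\<lambda>x. of_real (measure lborel (snd i)) * (b (fst i) x - c x)))"
    by (simp only:) (intro N_sum_le inH_mult_left inH_diff b tag c; simp)
  also have "\<dots> \<le> (\<Sum>i\<in>p. measure lborel (snd i) * e)" using e tag by (intro sum_mono) (simp add: mult_left_mono)
  also have "\<dots> = (v - u) * e" unfolding vu by (simp add: sum_distrib_right)
  finally show ?thesis .
qed

lemma RS_Un:
  assumes p: "p tagged_division_of {u..v::real}" and q: "q tagged_division_of {v..w}" and le: "u \<le> v" "v \<le> w"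
  shows "(p \<union> q) tagged_division_of {u..w}" and "RS b (p \<union> q) x = RS b p x + RS b q x"
proof -
  have "(p \<union> q) tagged_division_of ({u..v} \<union> {v..w})"
    by (rule tagged_division_Un[OF p q]) (auto simp: interior_atLeastAtMost_real)
  then show "(p \<union> q) tagged_division_of {u..w}" using le by (simp add: ivl_disj_un_two_touch)
  show "RS b (p \<union> q) x = RS b p x + RS b q x" unfolding RS_def
  proof (rule sum.union_inter_neutral)
    show "finite p" "finite q" using p q by auto
    \<comment> \<open>An element common to both divisions lies in \<open>{v}\<close> and has length
      0, so counting it once in the union does no harm.\<close>
    show "\<forall>i\<in>p \<inter> q. (case i of (\<tau>, L) \<Rightarrow> of_real (measure lborel L) * b \<tau> x) = 0"
    proof safe
      fix \<tau> L assume i: "(\<tau>, L) \<in> p" "(\<tau>, L) \<in> q"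
      have "L \<subseteq> {u..v}" "L \<subseteq> {v..w}" using tagged_division_ofD(3)[OF p i(1)] tagged_division_ofD(3)[OF q i(2)] by auto
      then have L: "L \<subseteq> {v}" by fastforce
      obtain c d where cd: "L = {c..d}" using tagged_division_ofD(4)[OF p i(1)] by auto
      have "c = v" "d = v" if "c \<le> d" using subsetD[OF L[unfolded cd], of c] subsetD[OF L[unfolded cd], of d] that by auto
      then have "measure lborel L = 0" unfolding cd by (cases "c \<le> d") auto
      then show "of_real (measure lborel L) * b \<tau> x = 0" by simp
    qed
  qed
qed

text \<open>Heine-Cantor for a curve in H^s. The distance is kept as a bare function of two times,
  since functions with the norm \<open>N s\<close> are not made into a metric space type.\<close>

lemma pseudometric_uniformly_continuous:
  fixes d :: "real \<Rightarrow> real \<Rightarrow> real"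
  assumes S: "compact S" and cont: "\<And>t e. t \<in> S \<Longrightarrow> 0 < e \<Longrightarrow> \<exists>\<delta>>0. \<forall>\<tau>\<in>S. \<bar>\<tau> - t\<bar> < \<delta> \<longrightarrow> d \<tau> t < e"
    and tri: "\<And>x y z. x \<in> S \<Longrightarrow> y \<in> S \<Longrightarrow> z \<in> S \<Longrightarrow> d x y \<le> d x z + d y z" and e: "0 < e"
  shows "\<exists>\<delta>>0. \<forall>x\<in>S. \<forall>y\<in>S. \<bar>x - y\<bar> < \<delta> \<longrightarrow> d x y < e"
proof -
  have "\<forall>t\<in>S. \<exists>\<delta>>0. \<forall>\<tau>\<in>S. \<bar>\<tau> - t\<bar> < \<delta> \<longrightarrow> d \<tau> t < e / 2" using cont[of _ "e / 2"] e by simp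
  then obtain \<delta> where \<delta>: "\<And>t. t \<in> S \<Longrightarrow> 0 < \<delta> t" "\<And>t \<tau>. t \<in> S \<Longrightarrow> \<tau> \<in> S \<Longrightarrow> \<bar>\<tau> - t\<bar> < \<delta> t \<Longrightarrow> d \<tau> t < e / 2"
    by metis
  obtain \<epsilon> where \<epsilon>: "0 < \<epsilon>" "\<And>x. x \<in> S \<Longrightarrow> \<exists>U\<in>(\<lambda>t. ball t (\<delta> t)) ` S. ball x \<epsilon> \<subseteq> U"
    by (rule Heine_Borel_lemma[OF S, of "(\<lambda>t. ball t (\<delta> t)) ` S"]) (use \<delta>(1) in auto)
  show ?thesis
  proof (intro exI[of _ \<epsilon>] conjI ballI impI \<epsilon>(1))
    fix x y assume xy: "x \<in> S" "y \<in> S" "\<bar>x - y\<bar> < \<epsilon>"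
    obtain t where t: "t \<in> S" "ball x \<epsilon> \<subseteq> ball t (\<delta> t)" using \<epsilon>(2)[OF xy(1)] by auto
    have "x \<in> ball t (\<delta> t)" "y \<in> ball t (\<delta> t)" using t(2) xy(3) \<epsilon>(1) by (auto simp: dist_real_def subset_iff)
    then have "d x t < e / 2" "d y t < e / 2" using \<delta>(2)[OF t(1)] xy by (auto simp: dist_real_def abs_minus_commute)
    then show "d x y < e" using tri[OF xy(1,2) t(1)] by linarith
  qed
qed

text \<open>An equality everywhere: each value of \<open>B\<close> is an integral, and reflected
  null sets are null.\<close>

lemma B_cong_AE:
  assumes a: "AE x in lborel. a x = a' x" and b: "AE x in lborel. b x = b' x"
    and [measurable]: "a \<in> borel_measurable borel" "a' \<in> borel_measurable borel" "b \<in> borel_measurable borel" "b' \<in> borel_measurable borel"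
  shows "B a b = B a' b'"
proof
  fix x
  have m: "AE y in lborel. a (x - y) = a' (x - y)" by (rule AE_reflect_plane[OF a])
  have "(LINT y|lborel. of_real (K (x - y) y) * a (x - y) * b y)
      = (LINT y|lborel. of_real (K (x - y) y) * a' (x - y) * b' y)"
  proof (rule integral_cong_AE)
    show "AE y in lborel. of_real (K (x - y) y) * a (x - y) * b y = of_real (K (x - y) y) * a' (x - y) * b' y"
      using m b by eventually_elim simp
  qed measurable
  then show "B a b x = B a' b' x" by (simp add: B_def)
qed

text \<open>A fine division of \<open>{0..r}\<close>, extended by one of \<open>{r..t}\<close>,
  approximates both integrals, so the increment of the solution is close to the Riemann sum over
  \<open>{r..t}\<close>. By uniform continuity in time this sum is close to \<open>t - r\<close>
  times the velocity at \<open>r\<close>.\<close>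

lemma sqg_solution_rsol:
  assumes s: "2 < s" and T': "0 \<le> T'" and \<theta>0: "\<theta>0 \<in> sobolev s" and sol: "sqg_solution s T' \<theta>0 \<theta>"
  shows "\<exists>M. rsol s M T' (\<lambda>t. ft (\<theta> t))" and "Nd 0 (ft (\<theta> 0)) (ft \<theta>0) = 0"
proof -
  define b where "b t = ft (\<theta> t)" for t
  have \<theta>: "\<theta> t \<in> sobolev s" if "t \<in> {0..T'}" for t
    using sol that by (auto simp: sqg_solution_def sobolev_continuous_on_def)
  have sq: "square_integrable (\<theta> t)" and b: "inH s (b t)" if "t \<in> {0..T'}" for t
    using \<theta>[OF that] by (auto simp: sobolev_iff b_def)
  have sq0: "square_integrable \<theta>0" using \<theta>0 by (simp add: sobolev_iff)
  have hb: "herm (b t)" for t by (simp add: b_def herm_ft)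
  have bm: "b t \<in> borel_measurable borel" if "t \<in> {0..T'}" for t using b[OF that] by auto
  have dist: "sobolev_dist s (\<theta> t) (\<theta> r) = Nd s (b t) (b r)" if "t \<in> {0..T'}" "r \<in> {0..T'}" for r t
    unfolding b_def by (rule sobolev_dist_ft[OF sq[OF that(1)] sq[OF that(2)]])
  have cont: "\<exists>\<delta>>0. \<forall>\<tau>\<in>{0..T'}. \<bar>\<tau> - t\<bar> < \<delta> \<longrightarrow> Nd s (b \<tau>) (b t) < e" if "t \<in> {0..T'}" "0 < e" for t e
  proof -
    have "\<exists>d>0. \<forall>\<tau>\<in>{0..T'}. \<bar>\<tau> - t\<bar> < d \<longrightarrow> sobolev_dist s (\<theta> \<tau>) (\<theta> t) < e"
      using sol that by (auto simp: sqg_solution_def sobolev_continuous_on_def)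
    then obtain d where "0 < d" "\<And>\<tau>. \<tau> \<in> {0..T'} \<Longrightarrow> \<bar>\<tau> - t\<bar> < d \<Longrightarrow> sobolev_dist s (\<theta> \<tau>) (\<theta> t) < e" by auto
    then show ?thesis using dist[OF _ that(1)] by (intro exI[of _ d]) simp
  qed
  have uc: "\<exists>\<delta>>0. \<forall>x\<in>{0..T'}. \<forall>y\<in>{0..T'}. \<bar>x - y\<bar> < \<delta> \<longrightarrow> Nd s (b x) (b y) < e" if "0 < e" for e
  proof (rule pseudometric_uniformly_continuous[where d="\<lambda>x y. Nd s (b x) (b y)", OF _ cont _ that])
    fix x y z assume "x \<in> {0..T'}" "y \<in> {0..T'}" "z \<in> {0..T'}"
    note i = b[OF this(1)] b[OF this(2)] b[OF this(3)]
    have "Nd s (b x) (b y) \<le> Nd s (b x) (b z) + Nd s (b z) (b y)" by (rule N_triangle_via[OF i(1) i(3) i(2)])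
    then show "Nd s (b x) (b y) \<le> Nd s (b x) (b z) + Nd s (b y) (b z)" by (simp add: N_minus_commute[of s "b z" "b y"])
  qed auto
  have "\<exists>M. \<forall>t\<in>{0..T'}. N s (b t) \<le> M"
  proof -
    have "continuous_on {0..T'} (\<lambda>t. N s (b t))"
    proof (rule continuous_on_iff[THEN iffD2], intro ballI allI impI)
      fix t e assume t: "t \<in> {0..T'}" and e: "(0::real) < e"
      obtain \<delta> where \<delta>: "0 < \<delta>" "\<forall>\<tau>\<in>{0..T'}. \<bar>\<tau> - t\<bar> < \<delta> \<longrightarrow> Nd s (b \<tau>) (b t) < e" using cont[OF t e] by blast
      show "\<exists>d>0. \<forall>\<tau>\<in>{0..T'}. dist \<tau> t < d \<longrightarrow> dist (N s (b \<tau>)) (N s (b t)) < e"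
      proof (intro exI[of _ \<delta>] conjI ballI impI \<delta>(1))
        fix \<tau> assume \<tau>: "\<tau> \<in> {0..T'}" "dist \<tau> t < \<delta>"
        have "Nd s (b \<tau>) (b t) < e" using \<delta>(2) \<tau> by (auto simp: dist_real_def)
        then show "dist (N s (b \<tau>)) (N s (b t)) < e"
          using N_le_diff_add[OF b[OF \<tau>(1)] b[OF t]] N_le_diff_add[OF b[OF t] b[OF \<tau>(1)]]
          by (auto simp: dist_real_def N_minus_commute[of s "b t" "b \<tau>"])
      qed
    qed
    then have "compact ((\<lambda>t. N s (b t)) ` {0..T'})" by (intro compact_continuous_image) auto
    then have "bdd_above ((\<lambda>t. N s (b t)) ` {0..T'})" by (intro bounded_imp_bdd_above compact_imp_bounded)
    then show ?thesis by (auto simp: bdd_above_def)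
  qed
  then obtain M where M: "\<And>t. t \<in> {0..T'} \<Longrightarrow> N s (b t) \<le> M" by blast
  have M0: "0 \<le> M" using order_trans[OF N_nonneg M[of 0]] T' by auto
  define Q where "Q = 2 powr s * cL s * (M + M)"
  have Q: "0 \<le> Q" using M0 cL_ge_1[of s] by (auto simp: Q_def)
  have Bin: "inH (s - 1) (Bq (b t))" if "t \<in> {0..T'}" for t using b[OF that] s by (intro inH_B_quad[OF s]) auto
  have BD: "Nd (s - 1) (Bq (b t)) (Bq (b r)) \<le> Q * Nd s (b t) (b r)"
    if "t \<in> {0..T'}" "r \<in> {0..T'}" for t r
  proof -
    have "Nd (s - 1) (Bq (b t)) (Bq (b r)) \<le> 2 powr s * cL s * (N s (b t) + N s (b r)) * Nd s (b t) (b r)"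
      using N_B_diff[OF s, of "s - 1" "b t" "b r"] b[OF that(1)] b[OF that(2)] s by simp
    also have "\<dots> \<le> Q * Nd s (b t) (b r)" unfolding Q_def using M[OF that(1)] M[OF that(2)] cL_ge_1[of s]
      by (intro mult_right_mono mult_left_mono) auto
    finally show ?thesis .
  qed
  have "\<forall>t\<in>{0..T'}. \<exists>I. has_sobolev_integral (s - 1) (\<lambda>\<tau> x. - sqg_convection (\<theta> \<tau>) x) I 0 t \<and>
      (AE x in lborel. \<theta> t x = \<theta>0 x + I x)" using sol by (auto simp: sqg_solution_def)
  from bchoice[OF this] obtain I where "\<forall>t\<in>{0..T'}. has_sobolev_integral (s - 1) (\<lambda>\<tau> x. - sqg_convection (\<theta> \<tau>) x) (I t) 0 t \<and>
      (AE x in lborel. \<theta> t x = \<theta>0 x + I t x)" ..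
  then have I: "\<And>t. t \<in> {0..T'} \<Longrightarrow> has_sobolev_integral (s - 1) (\<lambda>\<tau> x. - sqg_convection (\<theta> \<tau>) x) (I t) 0 t"
    and AEI: "\<And>t. t \<in> {0..T'} \<Longrightarrow> AE x in lborel. \<theta> t x = \<theta>0 x + I t x" by simp_all
  have Is: "I t \<in> sobolev (s - 1)" if "t \<in> {0..T'}" for t using I[OF that] by (simp add: has_sobolev_integral_def)
  have sqI: "square_integrable (I t)" and inI: "inH (s - 1) (ft (I t))" if "t \<in> {0..T'}" for t
    using Is[OF that] by (auto simp: sobolev_iff)
  have ftI: "AE w in lborel. ft (I t) w = b t w - ft \<theta>0 w" if t: "t \<in> {0..T'}" for t
  proof -
    have "AE x in lborel. I t x = \<theta> t x - \<theta>0 x" using AEI[OF t] by eventually_elim simp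
    from ft_cong_AE[OF this sqI[OF t] square_integrable_diff[OF sq[OF t] sq0]] ft_diff[OF sq[OF t] sq0]
    show ?thesis by eventually_elim (simp add: b_def)
  qed
  define R where "R p = RS (\<lambda>\<tau>. Bq (b \<tau>)) p" for p
  have approx: "\<exists>d>0. \<forall>p. p tagged_division_of {0..t} \<and> (\<lambda>\<tau>. ball \<tau> d) fine p \<longrightarrow> Nd (s - 1) (R p) (ft (I t)) < \<eta>"
    if t: "t \<in> {0..T'}" and \<eta>: "0 < \<eta>" for t \<eta>
  proof -
    obtain d where d: "0 < d" "\<And>p. p tagged_division_of {0..t} \<Longrightarrow> (\<lambda>\<tau>. ball \<tau> d) fine p \<Longrightarrow>
        sobolev_dist (s - 1) (\<lambda>x. \<Sum>(\<tau>, L)\<in>p. measure lborel L * - sqg_convection (\<theta> \<tau>) x) (I t) < \<eta>"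
      using I[OF t] \<eta> unfolding has_sobolev_integral_def by blast
    have sub: "\<tau> \<in> {0..T'}" if "\<tau> \<in> {0..t}" for \<tau> using that t by auto
    have "Nd (s - 1) (R p) (ft (I t)) < \<eta>" if p: "p tagged_division_of {0..t}" "(\<lambda>\<tau>. ball \<tau> d) fine p" for p
    proof -
      have "sobolev_dist (s - 1) (\<lambda>x. \<Sum>(\<tau>, L)\<in>p. measure lborel L * - sqg_convection (\<theta> \<tau>) x) (I t) = Nd (s - 1) (R p) (ft (I t))"
        unfolding R_def
      proof (rule sobolev_dist_RS[OF p(1) _ _ _ sqI[OF t]])
        fix \<tau> assume "\<tau> \<in> {0..t}"
        then have \<tau>: "\<tau> \<in> {0..T'}" by (rule sub)
        show "square_integrable (\<lambda>x. - sqg_convection (\<theta> \<tau>) x)" using convection(1)[OF s \<theta>[OF \<tau>]] by (simp add: sobolev_iff)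
        show "AE w in lborel. ft (\<lambda>x. - sqg_convection (\<theta> \<tau>) x) w = Bq (b \<tau>) w"
          using convection(2)[OF s \<theta>[OF \<tau>]] by (simp add: b_def)
        show "Bq (b \<tau>) \<in> borel_measurable borel" using Bin[OF \<tau>] by auto
      qed
      with d(2)[OF p] show ?thesis by simp
    qed
    with d(1) show ?thesis by blast
  qed
  have gauge: "gauge (\<lambda>\<tau>::real. ball \<tau> d)" if "0 < d" for d using that by (rule gauge_ball)
  \<comment> \<open>Over \<open>{0..0}\<close> all Riemann sums vanish, hence so does the integral;
    this identifies the initial value.\<close>
  have "N 0 (ft (I 0)) = 0"
  proof (rule antisym[OF field_le_epsilon N_nonneg])
    fix \<eta> :: real assume \<eta>: "0 < \<eta>"
    have 0: "0 \<in> {0..T'}" using T' by simp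
    obtain d where d: "0 < d" "\<And>p. p tagged_division_of {0..0} \<Longrightarrow> (\<lambda>\<tau>. ball \<tau> d) fine p \<Longrightarrow> Nd (s - 1) (R p) (ft (I 0)) < \<eta>"
      using approx[OF 0 \<eta>] by blast
    obtain p where p: "p tagged_division_of {0..0::real}" "(\<lambda>\<tau>. ball \<tau> d) fine p"
      by (rule fine_division_exists_real[OF gauge[OF d(1)]])
    have RS0: "N (s - 1) (\<lambda>w. R p w - of_real (0 - 0) * Bq (b 0) w) \<le> (0 - 0) * 0" unfolding R_def
      by (rule N_RS_diff_le[OF p(1)]) (use Bin[OF 0] in auto)
    have inR: "inH (s - 1) (R p)"
    proof -
      have tag: "fst i \<in> {0..T'}" if "i \<in> p" for i
        using tag_in_interval[OF p(1)[folded box_real(2)], of "fst i" "snd i"] that T' by simp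
      have "R p = (\<lambda>w. \<Sum>i\<in>p. of_real (measure lborel (snd i)) * Bq (b (fst i)) w)"
        by (simp add: R_def RS_def[abs_def] case_prod_beta)
      then show ?thesis by (simp only:) (intro inH_sum inH_mult_left Bin tag)
    qed
    have "N (s - 1) (ft (I 0)) \<le> Nd (s - 1) (ft (I 0)) (R p) + N (s - 1) (R p)" by (rule N_le_diff_add[OF inI[OF 0] inR])
    also have "\<dots> \<le> \<eta>" using RS0 d(2)[OF p] N_minus_commute[of "s - 1" "ft (I 0)" "R p"] by simp
    finally show "N 0 (ft (I 0)) \<le> 0 + \<eta>" using N_mono[of 0 "s - 1" "ft (I 0)"] inI[OF 0] s by simp
  qed
  moreover have "N 0 (ft (I 0)) = Nd 0 (b 0) (ft \<theta>0)"
    using T' by (intro N_cong_AE ftI ft_measurable sqI borel_measurable_diff bm sq0) auto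
  ultimately show "Nd 0 (ft (\<theta> 0)) (ft \<theta>0) = 0" by (simp add: b_def)

  have "rsol s M T' b" unfolding rsol_def
  proof (intro conjI ballI allI impI)
    fix t assume "t \<in> {0..T'}" then show "inH s (b t)" "herm (b t)" "N s (b t) \<le> M" using b hb M by auto
  next
    fix e :: real assume e: "0 < e"
    define e' where "e' = e / (Q + 1)"
    have e': "0 < e'" "Q * e' \<le> e" using e Q by (auto simp: e'_def field_simps)
    obtain \<delta> where \<delta>: "0 < \<delta>" "\<And>x y. x \<in> {0..T'} \<Longrightarrow> y \<in> {0..T'} \<Longrightarrow> \<bar>x - y\<bar> < \<delta> \<Longrightarrow> Nd s (b x) (b y) < e'"
      using uc[OF e'(1)] by blast
    show "consistent e T' b"
    proof (intro exI[of _ \<delta>] conjI allI impI \<delta>(1))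
      fix r t assume rt: "0 \<le> r \<and> r \<le> t \<and> t \<le> T' \<and> t - r < \<delta>"
      then have r: "r \<in> {0..T'}" and t: "t \<in> {0..T'}" by auto
      let ?c = "\<lambda>w. of_real (t - r) * Bq (b r) w"
      have c: "inH (s - 1) ?c" by (intro inH_mult_left Bin r)
      have "N 0 (\<lambda>w. b t w - b r w - ?c w) = N 0 (\<lambda>w. ft (I t) w - ft (I r) w - ?c w)"
      proof (rule N_cong_AE)
        show "AE w in lborel. b t w - b r w - ?c w = ft (I t) w - ft (I r) w - ?c w" using ftI[OF t] ftI[OF r] by eventually_elim simp
        have [measurable]: "?c \<in> borel_measurable borel" using c by auto
        note [measurable] = bm[OF t] bm[OF r] ft_measurable[OF sqI[OF t]] ft_measurable[OF sqI[OF r]]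
        show "(\<lambda>w. b t w - b r w - ?c w) \<in> borel_measurable borel" "(\<lambda>w. ft (I t) w - ft (I r) w - ?c w) \<in> borel_measurable borel"
          by measurable
      qed
      also have "\<dots> \<le> N (s - 1) (\<lambda>w. ft (I t) w - ft (I r) w - ?c w)" using s by (intro N_mono inH_diff inI t r c) auto
      also have "\<dots> \<le> e * (t - r)"
      proof (rule field_le_epsilon)
        fix \<eta> :: real assume \<eta>: "0 < \<eta>"
        then have \<eta>2: "0 < \<eta> / 2" by simp
        obtain d1 where d1: "0 < d1" "\<And>p. p tagged_division_of {0..r} \<Longrightarrow> (\<lambda>\<tau>. ball \<tau> d1) fine p \<Longrightarrow> Nd (s - 1) (R p) (ft (I r)) < \<eta> / 2"
          using approx[OF r \<eta>2] by blast
        obtain d2 where d2: "0 < d2" "\<And>p. p tagged_division_of {0..t} \<Longrightarrow> (\<lambda>\<tau>. ball \<tau> d2) fine p \<Longrightarrow> Nd (s - 1) (R p) (ft (I t)) < \<eta> / 2"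
          using approx[OF t \<eta>2] by blast
        define d where "d = min d1 d2"
        have d: "0 < d" "d \<le> d1" "d \<le> d2" using d1 d2 by (auto simp: d_def)
        have fine: "(\<lambda>\<tau>. ball \<tau> d1) fine p" "(\<lambda>\<tau>. ball \<tau> d2) fine p" if "(\<lambda>\<tau>. ball \<tau> d) fine p" for p :: "(real \<times> real set) set"
          using that d by (fastforce simp: fine_def)+
        obtain p where p: "p tagged_division_of {0..r}" "(\<lambda>\<tau>. ball \<tau> d) fine p"
          by (rule fine_division_exists_real[OF gauge[OF d(1)]])
        obtain q where q: "q tagged_division_of {r..t}" "(\<lambda>\<tau>. ball \<tau> d) fine q"
          by (rule fine_division_exists_real[OF gauge[OF d(1)]])
        have pq: "(p \<union> q) tagged_division_of {0..t}" "\<And>w. R (p \<union> q) w = R p w + R q w"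
          unfolding R_def using RS_Un[OF p(1) q(1)] rt by auto
        have 1: "Nd (s - 1) (R p) (ft (I r)) < \<eta> / 2" using d1(2)[OF p(1)] fine(1)[OF p(2)] by simp
        have 2: "N (s - 1) (\<lambda>w. R p w + R q w - ft (I t) w) < \<eta> / 2"
          using d2(2)[OF pq(1)] fine(2)[OF fine_Un[OF p(2) q(2)]] by (simp add: pq(2))
        have 3: "Nd (s - 1) (R q) ?c \<le> (t - r) * (Q * e')" unfolding R_def
        proof (rule N_RS_diff_le[OF q(1)])
          fix \<tau> assume "\<tau> \<in> {r..t}"
          then have \<tau>: "\<tau> \<in> {0..T'}" "\<bar>\<tau> - r\<bar> < \<delta>" using rt by auto
          show "inH (s - 1) (Bq (b \<tau>))" by (rule Bin[OF \<tau>(1)])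
          have "Nd s (b \<tau>) (b r) \<le> e'" using \<delta>(2)[OF \<tau>(1) r \<tau>(2)] by simp
          then show "Nd (s - 1) (Bq (b \<tau>)) (Bq (b r)) \<le> Q * e'"
            using BD[OF \<tau>(1) r] mult_left_mono[OF _ Q] by (meson order_trans)
        qed (use rt Bin[OF r] in auto)
        have inR: "inH (s - 1) (R p)" if "p tagged_division_of {u..v}" "{u..v} \<subseteq> {0..T'}" for p u v
        proof -
          have tag: "fst i \<in> {0..T'}" if "i \<in> p" for i
            using tag_in_interval[OF \<open>p tagged_division_of {u..v}\<close>[folded box_real(2)], of "fst i" "snd i"] that \<open>{u..v} \<subseteq> {0..T'}\<close> by auto
          have "R p = (\<lambda>w. \<Sum>i\<in>p. of_real (measure lborel (snd i)) * Bq (b (fst i)) w)"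
            by (simp add: R_def RS_def[abs_def] case_prod_beta)
          then show ?thesis by (simp only:) (intro inH_sum inH_mult_left Bin tag)
        qed
        have ip: "inH (s - 1) (R p)" "inH (s - 1) (R q)" using inR[OF p(1)] inR[OF q(1)] rt by auto
        have i1: "inH (s - 1) (\<lambda>w. R p w - ft (I r) w)" and i2: "inH (s - 1) (\<lambda>w. R p w + R q w - ft (I t) w)"
          and i3: "inH (s - 1) (\<lambda>w. R q w - ?c w)" by (intro inH_diff inH_add ip inI t r c)+
        have "(\<lambda>w. ft (I t) w - ft (I r) w - ?c w)
            = (\<lambda>w. ((R p w - ft (I r) w) + (R q w - ?c w)) - (R p w + R q w - ft (I t) w))" by (simp add: fun_eq_iff)
        then have "N (s - 1) (\<lambda>w. ft (I t) w - ft (I r) w - ?c w)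
          = N (s - 1) (\<lambda>w. ((R p w - ft (I r) w) + (R q w - ?c w)) - (R p w + R q w - ft (I t) w))" by simp
        also have "\<dots> \<le> N (s - 1) (\<lambda>w. (R p w - ft (I r) w) + (R q w - ?c w)) + N (s - 1) (\<lambda>w. R p w + R q w - ft (I t) w)"
          by (rule N_triangle_diff[OF inH_add[OF i1 i3] i2])
        finally have "N (s - 1) (\<lambda>w. ft (I t) w - ft (I r) w - ?c w) \<le> \<eta> / 2 + (t - r) * (Q * e') + \<eta> / 2"
          using N_triangle[OF i1 i3] 1 2 3 by linarith
        moreover have "(t - r) * (Q * e') \<le> (t - r) * e" using e'(2) rt by (intro mult_left_mono) auto
        ultimately show "N (s - 1) (\<lambda>w. ft (I t) w - ft (I r) w - ?c w) \<le> e * (t - r) + \<eta>" by (simp add: mult.commute)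
      qed
      finally show "N 0 (\<lambda>w. b t w - b r w - ?c w) \<le> e * (t - r)" .
    qed
  qed
  then show "\<exists>M. rsol s M T' (\<lambda>t. ft (\<theta> t))" by (auto simp: b_def[abs_def])
qed

text \<open>On each interval of a division the velocity at the tag is compared with the increment,
  using residuals from the tag to both end points; the one towards the left end runs backwards in
  time. Being quadratic, they sum to the order of the mesh.\<close>

lemma ssol_sqg_solution:
  assumes s: "2 < s" and G: "ssol s M S G" and S: "0 \<le> S" and f: "square_integrable f" and f0: "AE z in lborel. ft f z = G 0 z"
  shows "\<exists>\<theta>. sqg_solution s S f \<theta> \<and> (\<forall>t\<in>{0..S}. \<theta> t \<in> sobolev s \<and> (AE z in lborel. ft (\<theta> t) z = G t z))"
proof -
  note D = ssol_D[OF G s]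
  have "\<exists>g. square_integrable g \<and> (AE z in lborel. ft g z = G t z)" if "t \<in> {0..S}" for t
    using ft_surj[of "G t"] D(2,6)[OF that] by (auto simp: inH_0)
  then obtain \<theta> where sq: "\<And>t. t \<in> {0..S} \<Longrightarrow> square_integrable (\<theta> t)"
    and \<theta>: "\<And>t. t \<in> {0..S} \<Longrightarrow> AE z in lborel. ft (\<theta> t) z = G t z" by metis
  have Gm: "G t \<in> borel_measurable borel" if "t \<in> {0..S}" for t using D(1)[OF that] by auto
  have \<theta>s: "\<theta> t \<in> sobolev s" if t: "t \<in> {0..S}" for t
  proof -
    have "AE z in lborel. G t z = ft (\<theta> t) z" using \<theta>[OF t] by eventually_elim simp
    from inH_cong_AE[OF this D(5)[OF t] ft_measurable[OF sq[OF t]]] sq[OF t] show ?thesis by (simp add: sobolev_iff)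
  qed
  have M0: "0 \<le> M" using order_trans[OF N_nonneg D(3)[of 0]] S by auto
  have dist: "sobolev_dist s (\<theta> t) (\<theta> r) \<le> M * \<bar>t - r\<bar>" if t: "t \<in> {0..S}" and r: "r \<in> {0..S}" for t r
  proof -
    have "sobolev_dist s (\<theta> t) (\<theta> r) = Nd s (G t) (G r)" unfolding sobolev_dist_ft[OF sq[OF t] sq[OF r]]
    proof (rule N_cong_AE)
      show "AE z in lborel. ft (\<theta> t) z - ft (\<theta> r) z = G t z - G r z" using \<theta>[OF t] \<theta>[OF r] by eventually_elim simp
    qed (use Gm[OF t] Gm[OF r] ft_measurable[OF sq[OF t]] ft_measurable[OF sq[OF r]] in auto)
    also have "\<dots> \<le> Nd (s + 1) (G t) (G r)" by (intro N_mono inH_diff D t r) auto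
    also have "\<dots> \<le> M * \<bar>t - r\<bar>" by (rule ssol_lipschitz[OF G r t])
    finally show ?thesis .
  qed
  have "sobolev_continuous_on s {0..S} \<theta>" unfolding sobolev_continuous_on_def
  proof (intro conjI ballI allI impI \<theta>s)
    fix t e assume t: "t \<in> {0..S}" and e: "(0::real) < e"
    show "\<exists>d>0. \<forall>\<tau>\<in>{0..S}. \<bar>\<tau> - t\<bar> < d \<longrightarrow> sobolev_dist s (\<theta> \<tau>) (\<theta> t) < e"
    proof (intro exI[of _ "e / (M + 1)"] conjI ballI impI)
      fix \<tau> assume \<tau>: "\<tau> \<in> {0..S}" "\<bar>\<tau> - t\<bar> < e / (M + 1)"
      have "(M + 1) * \<bar>\<tau> - t\<bar> < e" using \<tau>(2) M0 by (simp add: field_simps)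
      then show "sobolev_dist s (\<theta> \<tau>) (\<theta> t) < e" using dist[OF \<tau>(1) t] by (simp add: distrib_right)
    qed (use e M0 in auto)
  qed
  moreover have "\<exists>I. has_sobolev_integral (s - 1) (\<lambda>\<tau> x. - sqg_convection (\<theta> \<tau>) x) I 0 t \<and> (AE x in lborel. \<theta> t x = f x + I x)"
    if t: "t \<in> {0..S}" for t
  proof -
    define I where "I x = \<theta> t x - f x" for x
    have 0: "0 \<in> {0..S}" using S by simp
    have sqI: "square_integrable I" unfolding I_def by (rule square_integrable_diff[OF sq[OF t] f])
    have ftI: "AE z in lborel. ft I z = G t z - G 0 z"
      using ft_diff[OF sq[OF t] f] \<theta>[OF t] f0 unfolding I_def by eventually_elim simp
    have Is: "I \<in> sobolev (s - 1)"
    proof -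
      have "AE z in lborel. G t z - G 0 z = ft I z" using ftI by eventually_elim simp
      moreover have "inH (s - 1) (\<lambda>z. G t z - G 0 z)" using inH_mono[of "s - 1" s] D(5)[OF t] D(5)[OF 0] by (intro inH_diff) auto
      ultimately show ?thesis using inH_cong_AE[OF _ _ ft_measurable[OF sqI]] sqI by (simp add: sobolev_iff)
    qed
    have sub: "\<tau> \<in> {0..S}" if "\<tau> \<in> {0..t}" for \<tau> using that t by auto
    have conv: "AE z in lborel. ft (\<lambda>x. - sqg_convection (\<theta> \<tau>) x) z = Bq (G \<tau>) z" if \<tau>: "\<tau> \<in> {0..S}" for \<tau>
    proof -
      have "Bq (ft (\<theta> \<tau>)) = Bq (G \<tau>)"
        by (rule B_cong_AE[OF \<theta>[OF \<tau>] \<theta>[OF \<tau>]]) (intro ft_measurable sq \<tau> Gm)+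
      then show ?thesis using convection(2)[OF s \<theta>s[OF \<tau>]] by simp
    qed
    have "has_sobolev_integral (s - 1) (\<lambda>\<tau> x. - sqg_convection (\<theta> \<tau>) x) I 0 t" unfolding has_sobolev_integral_def
    proof (intro conjI ballI allI impI Is)
      fix \<tau> assume "\<tau> \<in> {0..t}"
      then show "(\<lambda>x. - sqg_convection (\<theta> \<tau>) x) \<in> sobolev (s - 1)" using convection(1)[OF s \<theta>s] sub by blast
    next
      fix e :: real assume e: "0 < e"
      define d where "d = e / (2 * M * t + 1)"
      have t0: "0 \<le> t" using t by simp
      have d: "0 < d" "t * (2 * M * d) < e"
      proof -
        have pos: "0 < 2 * M * t + 1" using M0 t0 by (auto intro!: add_nonneg_pos)
        then show "0 < d" using e by (simp add: d_def)
        have "d * (2 * M * t + 1) = e" using pos by (simp add: d_def)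
        then show "t * (2 * M * d) < e" using \<open>0 < d\<close> by (simp add: algebra_simps)
      qed
      show "\<exists>d>0. \<forall>p. p tagged_division_of {0..t} \<and> (\<lambda>\<tau>. ball \<tau> d) fine p \<longrightarrow>
         sobolev_dist (s - 1) (\<lambda>x. \<Sum>(\<tau>, K)\<in>p. measure lborel K * - sqg_convection (\<theta> \<tau>) x) I < e"
      proof (intro exI[of _ d] conjI allI impI d(1))
        fix p assume "p tagged_division_of {0..t} \<and> (\<lambda>\<tau>. ball \<tau> d) fine p"
        then have p: "p tagged_division_of {0..t}" and fine: "(\<lambda>\<tau>. ball \<tau> d) fine p" by auto
        \<comment> \<open>Error on one tagged interval; \<open>Inf\<close> and \<open>Sup\<close>
          recover its end points from the set, in the form in which the telescoping sum over a
          division is stated.\<close>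
        define E where "E i z = of_real (measure lborel (snd i)) * Bq (G (fst i)) z - (G (Sup (snd i)) z - G (Inf (snd i)) z)"
          for i :: "real \<times> real set" and z
        have E: "inH s (E i) \<and> N s (E i) \<le> measure lborel (snd i) * (2 * M * d)" if i: "i \<in> p" for i
        proof -
          obtain \<tau> L where iL: "i = (\<tau>, L)" by (cases i)
          note pL = i[unfolded iL]
          obtain u v where uv: "L = {u..v}" using tagged_division_ofD(4)[OF p pL] by auto
          have \<tau>L: "\<tau> \<in> {u..v}" using tagged_division_ofD(2)[OF p pL] uv by simp
          have Lsub: "{u..v} \<subseteq> {0..t}" using tagged_division_ofD(3)[OF p pL] uv by simp
          have ball: "{u..v} \<subseteq> ball \<tau> d" using fine pL uv by (auto simp: fine_def)
          have le: "u \<le> \<tau>" "\<tau> \<le> v" "u \<le> v" using \<tau>L by auto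
          have "u \<in> {u..v}" "v \<in> {u..v}" using le by auto
          then have dd: "\<tau> - u < d" "v - \<tau> < d" using subsetD[OF ball, of u] subsetD[OF ball, of v] le by (auto simp: dist_real_def)
          have u: "u \<in> {0..S}" and v: "v \<in> {0..S}" and \<tau>: "\<tau> \<in> {0..S}" using sub Lsub le by auto
          let ?F = "\<lambda>x z. G x z - G \<tau> z - of_real (x - \<tau>) * Bq (G \<tau>) z"
          have iF: "inH s (?F x)" if "x \<in> {0..S}" for x by (intro inH_diff inH_mult_left D that \<tau>)
          have Eeq: "E i = (\<lambda>z. ?F u z - ?F v z)" using le by (simp add: fun_eq_iff E_def iL uv algebra_simps)
          have "N s (E i) \<le> N s (?F u) + N s (?F v)" unfolding Eeq by (rule N_triangle_diff[OF iF[OF u] iF[OF v]])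
          also have "\<dots> \<le> M * (u - \<tau>)\<^sup>2 + M * (v - \<tau>)\<^sup>2"
            using ssol_diff[OF G \<tau> u] ssol_diff[OF G \<tau> v] by simp
          also have "\<dots> \<le> M * (d * (v - u)) + M * (d * (v - u))"
          proof -
            have "(u - \<tau>)\<^sup>2 = (\<tau> - u) * (\<tau> - u)" "(v - \<tau>)\<^sup>2 = (v - \<tau>) * (v - \<tau>)" by (auto simp: power2_eq_square algebra_simps)
            then have "(u - \<tau>)\<^sup>2 \<le> d * (v - u)" "(v - \<tau>)\<^sup>2 \<le> d * (v - u)" using le dd d(1) by (auto intro!: mult_mono)
            then show ?thesis using M0 by (intro add_mono mult_left_mono) auto
          qed
          finally have "N s (E i) \<le> measure lborel (snd i) * (2 * M * d)" using le by (simp add: iL uv algebra_simps)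
          moreover have "inH s (E i)" unfolding Eeq by (intro inH_diff[OF iF[OF u] iF[OF v]])
          ultimately show ?thesis by simp
        qed
        have "sobolev_dist (s - 1) (\<lambda>x. \<Sum>(\<tau>, L)\<in>p. measure lborel L * - sqg_convection (\<theta> \<tau>) x) I
            = Nd (s - 1) (RS (\<lambda>\<tau>. Bq (G \<tau>)) p) (ft I)"
        proof (rule sobolev_dist_RS[OF p _ _ _ sqI])
          fix \<tau> assume "\<tau> \<in> {0..t}"
          then have \<tau>: "\<tau> \<in> {0..S}" by (rule sub)
          show "square_integrable (\<lambda>x. - sqg_convection (\<theta> \<tau>) x)" using convection(1)[OF s \<theta>s[OF \<tau>]] by (simp add: sobolev_iff)
          show "AE z in lborel. ft (\<lambda>x. - sqg_convection (\<theta> \<tau>) x) z = Bq (G \<tau>) z" by (rule conv[OF \<tau>])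
          show "Bq (G \<tau>) \<in> borel_measurable borel" using D(9)[OF \<tau>] by auto
        qed
        also have "\<dots> = N (s - 1) (\<lambda>z. \<Sum>i\<in>p. E i z)"
        proof (rule N_cong_AE)
          have tel: "G t z - G 0 z = (\<Sum>i\<in>p. G (Sup (snd i)) z - G (Inf (snd i)) z)" for z
            using additive_tagged_division_1[OF t0 p, of "\<lambda>\<tau>. G \<tau> z"] by (simp add: case_prod_beta)
          show "AE z in lborel. RS (\<lambda>\<tau>. Bq (G \<tau>)) p z - ft I z = (\<Sum>i\<in>p. E i z)" using ftI
          proof eventually_elim
            fix z assume "ft I z = G t z - G 0 z"
            then show "RS (\<lambda>\<tau>. Bq (G \<tau>)) p z - ft I z = (\<Sum>i\<in>p. E i z)"
              by (simp only: tel) (simp add: RS_def E_def case_prod_beta sum_subtractf)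
          qed
          show "(\<lambda>z. \<Sum>i\<in>p. E i z) \<in> borel_measurable borel"
            using inH_measurable[OF conjunct1[OF E]] by (intro borel_measurable_sum) simp
          have tag: "fst i \<in> {0..S}" if "i \<in> p" for i
            using tag_in_interval[OF p[folded box_real(2)], of "fst i" "snd i"] that sub by simp
          have "RS (\<lambda>\<tau>. Bq (G \<tau>)) p \<in> borel_measurable borel"
            unfolding RS_def[abs_def] case_prod_beta using D(9)[OF tag] by (intro borel_measurable_sum borel_measurable_times) auto
          then show "(\<lambda>z. RS (\<lambda>\<tau>. Bq (G \<tau>)) p z - ft I z) \<in> borel_measurable borel"
            using ft_measurable[OF sqI] by measurable
        qed
        also have "\<dots> \<le> N s (\<lambda>z. \<Sum>i\<in>p. E i z)" using E by (intro N_mono inH_sum) auto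
        also have "\<dots> \<le> (\<Sum>i\<in>p. N s (E i))" using E by (intro N_sum_le) auto
        also have "\<dots> \<le> (\<Sum>i\<in>p. measure lborel (snd i) * (2 * M * d))" using E by (intro sum_mono) auto
        also have "\<dots> = t * (2 * M * d)"
          using content_tagged_division[OF p t0] by (simp add: case_prod_beta sum_distrib_right[symmetric])
        also have "\<dots> < e" by (rule d(2))
        finally show "sobolev_dist (s - 1) (\<lambda>x. \<Sum>(\<tau>, K)\<in>p. measure lborel K * - sqg_convection (\<theta> \<tau>) x) I < e" .
      qed
    qed
    moreover have "AE x in lborel. \<theta> t x = f x + I x" by (simp add: I_def)
    ultimately show ?thesis by blast
  qed
  ultimately have "sqg_solution s S f \<theta>" by (simp add: sqg_solution_def)
  with \<theta>s \<theta> show ?thesis by blast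
qed

section \<open>Oscillating perturbations\<close>

lemma K_add: "K \<zeta> (y + y') = K \<zeta> y + K \<zeta> y'" by (simp add: K_def add_divide_distrib[symmetric] algebra_simps)

lemma K_scaleR: "K \<zeta> (c *\<^sub>R y) = c * K \<zeta> y" by (simp add: K_def algebra_simps)

text \<open>Up to a factor of modulus 1 this is the transform of the inner product of
  \<open>v\<close> with the velocity belonging to \<open>a\<close>, which is the speed at which an
  oscillation of frequency \<open>v\<close> is transported.\<close>

definition Kmul :: "plane \<Rightarrow> cfun \<Rightarrow> cfun" where
  "Kmul v a \<zeta> = of_real (K \<zeta> v) * a \<zeta>"

lemma Kmul_le: "cmod (Kmul v a \<zeta>) \<le> norm v * cmod (a \<zeta>)"
  using mult_right_mono[OF K_le_norm[of \<zeta> v], of "cmod (a \<zeta>)"] by (simp add: Kmul_def norm_mult)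

lemma Kmul_measurable [measurable]: "a \<in> borel_measurable borel \<Longrightarrow> Kmul v a \<in> borel_measurable borel"
  unfolding Kmul_def[abs_def] by measurable

lemma sqi_Kmul: assumes "sqi a" shows "sqi (Kmul v a)" by (rule sqi_dominated[OF assms, where C="norm v"]) (use assms Kmul_le in auto)

lemma integrable_Kmul: assumes "integrable lborel a" shows "integrable lborel (Kmul v a)"
proof (rule integrable_dominated)
  show "integrable lborel (\<lambda>\<zeta>. norm v * cmod (a \<zeta>))" using assms by simp
  show "Kmul v a \<in> borel_measurable lborel" using borel_measurable_integrable[OF assms] by simp
qed (simp add: Kmul_le)

lemma conv_Kmul_scaleR: "conv (Kmul (c *\<^sub>R v) a) b x = of_real c * conv (Kmul v a) b x"
  by (simp add: conv_def Kmul_def K_scaleR mult.assoc)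

text \<open>The drift of a localised profile transported to frequency \<open>v\<close> grows linearly in \<open>v\<close>.\<close>

lemma B_shift:
  assumes a: "sqi a" and b: "inH 1 b"
  shows "B a (\<lambda>y. b (y - v)) x = B a b (x - v) + conv (Kmul v a) b (x - v) / (2 * pi)"
proof -
  have sb: "sqi b" using inH_mono[OF _ b, of 0] by (simp add: inH_0)
  have [measurable]: "a \<in> borel_measurable borel" "b \<in> borel_measurable borel" using a sb by auto
  define \<zeta> where "\<zeta> = x - v"
  define F where "F y = of_real (K (\<zeta> - y) (y + v)) * a (\<zeta> - y) * b y" for y
  have "(LINT y|lborel. of_real (K (x - y) y) * a (x - y) * b (y - v)) = (LINT y|lborel. F (y - v))"
    by (simp add: F_def \<zeta>_def algebra_simps)
  also have "\<dots> = (LINT y|lborel. F y)" by (rule integral_translate_plane) (simp add: F_def[abs_def])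
  also have "\<dots> = (LINT y|lborel. of_real (K (\<zeta> - y) y) * a (\<zeta> - y) * b y + Kmul v a (\<zeta> - y) * b y)"
    by (intro LINT_cong refl) (simp add: F_def K_add Kmul_def algebra_simps)
  also have "\<dots> = (LINT y|lborel. of_real (K (\<zeta> - y) y) * a (\<zeta> - y) * b y) + conv (Kmul v a) b \<zeta>"
    unfolding conv_def by (intro LINT_add B_integrable a b sqi_mult_integrable sqi_reflect sqi_Kmul sb)
  finally show ?thesis by (simp add: B_def \<zeta>_def add_divide_distrib)
qed

lemma compact_support_weight:
  assumes b: "sqi b" and A: "0 \<le> A" "\<And>x. A < norm x \<Longrightarrow> b x = 0" and m: "0 \<le> m"
  shows "inH m b" and "N m b \<le> (1 + A) powr m * l2norm b"
proof -
  have le: "cmod (wt m b x) \<le> (1 + A) powr m * cmod (b x)" for x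
  proof (cases "norm x \<le> A")
    case True
    have "jb x \<le> 1 + A" using jb_add_le[of 0 x] True by (simp add: jb_def)
    then have "jb x powr m \<le> (1 + A) powr m" using m by (intro powr_mono2) auto
    then show ?thesis by (simp add: cmod_wt mult_right_mono)
  qed (use A(2)[of x] in \<open>simp add: cmod_wt\<close>)
  show inH: "inH m b" unfolding inH_def by (rule sqi_dominated[OF b _ le]) (use b in measurable)
  show "N m b \<le> (1 + A) powr m * l2norm b" unfolding N_def
    by (rule l2norm_mono_AE[OF AE_I2[OF le] _ b]) (use inH in \<open>auto simp: inH_def\<close>)
qed

lemma continuous_conv:
  assumes k: "integrable lborel k" and \<phi>: "continuous_on UNIV \<phi>" "\<And>x. cmod (\<phi> x) \<le> C"
  shows "continuous_on UNIV (conv k \<phi>)"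
proof -
  have [measurable]: "k \<in> borel_measurable borel" "\<phi> \<in> borel_measurable borel"
    using k borel_measurable_continuous_onI[OF \<phi>(1)] by auto
  have eq: "conv k \<phi> = (\<lambda>z. LINT y|lborel. \<phi> (z - y) * k y)" using conv_commute[of k \<phi>] by (simp add: conv_def fun_eq_iff)
  show ?thesis unfolding eq continuous_on_sequentially comp_def
  proof (intro allI ballI impI, elim conjE)
    fix x :: "nat \<Rightarrow> plane" and a assume x: "x \<longlonglongrightarrow> a"
    show "(\<lambda>n. LINT y|lborel. \<phi> (x n - y) * k y) \<longlonglongrightarrow> (LINT y|lborel. \<phi> (a - y) * k y)"
    proof (rule integral_dominated_convergence[where w="\<lambda>y. C * cmod (k y)"])
      show "AE y in lborel. (\<lambda>n. \<phi> (x n - y) * k y) \<longlonglongrightarrow> \<phi> (a - y) * k y"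
      proof (rule AE_I2)
        fix y
        have "isCont \<phi> (a - y)" using \<phi>(1) by (simp add: continuous_on_eq_continuous_at)
        from isCont_tendsto_compose[OF this tendsto_diff[OF x tendsto_const]]
        show "(\<lambda>n. \<phi> (x n - y) * k y) \<longlonglongrightarrow> \<phi> (a - y) * k y" by (intro tendsto_mult tendsto_const)
      qed
      show "AE y in lborel. norm (\<phi> (x n - y) * k y) \<le> C * cmod (k y)" for n
        using \<phi>(2) by (simp add: norm_mult mult_right_mono)
    qed (use k in auto)
  qed
qed

lemma l2norm_trunc_pos:
  assumes W: "continuous_on UNIV W" and W0: "W 0 \<noteq> 0"
  shows "0 < l2norm (trunc W 1)"
proof (rule ccontr)
  assume "\<not> 0 < l2norm (trunc W 1)"
  then have "l2norm (trunc W 1) = 0" using l2norm_nonneg[of "trunc W 1"] by linarith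
  moreover have [measurable]: "W \<in> borel_measurable borel" by (rule borel_measurable_continuous_onI[OF W])
  have "compact (W ` cball 0 1)" by (intro compact_continuous_image continuous_on_subset[OF W]) auto
  then obtain C where "\<forall>y\<in>W ` cball 0 1. cmod y \<le> C" using compact_imp_bounded bounded_iff by blast
  then have C: "\<And>x. x \<in> cball 0 1 \<Longrightarrow> cmod (W x) \<le> C" by simp
  have "sqi (trunc W 1)"
  proof (rule sqi_dominated[of "indicator (cball 0 1)" _ C])
    show "sqi (indicator (cball 0 1))" by (rule sqi_indicator) auto
    show "cmod (trunc W 1 x) \<le> C * cmod (indicator (cball 0 1) x)" for x using C[of x] by (auto simp: trunc_def indicator_def)
  qed simp
  ultimately have AE: "AE x in lborel. trunc W 1 x = 0" by (intro l2norm_eq_0_AE)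
  have "open (W -` (- {0}))" by (rule continuous_on_open_vimage[THEN iffD1, OF open_UNIV W, rule_format, of "- {0}", simplified]) auto
  then have op: "open (ball 0 1 \<inter> W -` (- {0}))" by (intro open_Int) auto
  have "0 \<in> ball 0 1 \<inter> W -` (- {0})" using W0 by simp
  then have "ball 0 1 \<inter> W -` (- {0}) \<noteq> {}" by blast
  moreover have "ball 0 1 \<inter> W -` (- {0}) \<in> null_sets lborel"
  proof -
    have "AE x in lborel. x \<notin> ball 0 1 \<inter> W -` (- {0})"
      using AE by eventually_elim (auto simp: trunc_def indicator_def split: if_splits)
    then show ?thesis using op by (subst (asm) AE_iff_null_sets[symmetric]) auto
  qed
  ultimately show False using open_not_negligible[OF op] by (simp add: negligible_iff_null_sets null_sets_completionI)
qed

text \<open>At a nonzero frequency the symbols for the two coordinate directions do not vanish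
  together, so a nonzero state has a nonzero velocity in one of them.\<close>

lemma Kmul_nonzero:
  assumes a: "sqi a" "l2norm a \<noteq> 0" shows "\<exists>e. norm e = 1 \<and> l2norm (Kmul e a) \<noteq> 0"
proof (rule ccontr)
  assume no: "\<not> ?thesis"
  have z: "AE x in lborel. Kmul (axis k 1) a x = 0" for k using no by (intro l2norm_eq_0_AE sqi_Kmul a) auto
  have "AE x in lborel. x \<noteq> (0::plane)" by (rule AE_I'[of "{0}"]) auto
  with z[of 1] z[of 2] have "AE x in lborel. a x = 0"
  proof eventually_elim
    fix x :: plane assume h: "Kmul (axis 1 1) a x = 0" "Kmul (axis 2 1) a x = 0" "x \<noteq> 0"
    show "a x = 0"
    proof (rule ccontr)
      assume "a x \<noteq> 0"
      then have "x $ 1 = 0" "x $ 2 = 0" using h by (auto simp: Kmul_def K_def axis_def)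
      then have "x = 0" by (simp add: vec_eq_iff forall_2)
      then show False using h(3) by simp
    qed
  qed
  then have "l2norm a = l2norm (\<lambda>x. 0)" by (intro l2norm_cong_AE) (use a in auto)
  then show False using a(2) by simp
qed

text \<open>\<open>\<beta>\<close> is the reflected conjugate of a compactly supported approximation
  \<open>\<phi>\<close> of \<open>V\<close>. Then \<open>conv V \<beta> 0\<close> is the inner
  product of \<open>V\<close> with \<open>\<phi>\<close>, nonzero since the error is below the norm
  of \<open>V\<close>, and continuity keeps the convolution nonzero nearby. Compact support keeps
  the shifted profile close to its centre frequency.\<close>

lemma oscillation_profile:
  assumes a: "sqi a" "integrable lborel a" "l2norm a \<noteq> 0"
  shows "\<exists>e \<beta> A. norm e = 1 \<and> continuous_on UNIV \<beta> \<and> 0 \<le> A \<and> (\<forall>w. A < norm w \<longrightarrow> \<beta> w = 0) \<and>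
    0 < l2norm (trunc (conv (Kmul e a) \<beta>) 1)"
proof -
  obtain e where e: "norm e = 1" "l2norm (Kmul e a) \<noteq> 0" using Kmul_nonzero[OF a(1,3)] by blast
  define V where "V = Kmul e a"
  have V: "sqi V" "integrable lborel V" "0 < l2norm V"
    using sqi_Kmul[OF a(1)] integrable_Kmul[OF a(2)] e(2) l2norm_nonneg[of V] by (auto simp: V_def less_le)
  obtain \<phi> R where \<phi>: "continuous_on UNIV \<phi>" "\<forall>x. R < norm x \<longrightarrow> \<phi> x = 0" "l2dist V \<phi> < l2norm V"
    using compact_continuous_dense[OF V(1,3)] by blast
  have s\<phi>: "sqi \<phi>" by (rule sqi_compact_support(1)[OF \<phi>(1,2)])
  have [measurable]: "V \<in> borel_measurable borel" "\<phi> \<in> borel_measurable borel" using V(1) s\<phi> by auto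
  define \<beta> where "\<beta> y = cnj (\<phi> (- y))" for y
  have c\<beta>: "continuous_on UNIV \<beta>" unfolding \<beta>_def by (intro continuous_intros continuous_on_compose2[OF \<phi>(1)]) auto
  have supp: "\<forall>w. max R 0 < norm w \<longrightarrow> \<beta> w = 0" using \<phi>(2) by (simp add: \<beta>_def)
  obtain C where C: "\<forall>x. cmod (\<beta> x) \<le> C" using sqi_compact_support(3)[OF c\<beta> supp] by blast
  have "conv V \<beta> 0 = (LINT x|lborel. V x * cnj (\<phi> x))"
    using integral_reflect_plane[of "\<lambda>x. V x * cnj (\<phi> x)" 0] by (simp add: conv_def \<beta>_def)
  moreover have "(LINT x|lborel. V x * cnj (\<phi> x)) \<noteq> 0"
  proof
    assume z: "(LINT x|lborel. V x * cnj (\<phi> x)) = 0"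
    have "(LINT x|lborel. V x * cnj (V x - \<phi> x)) = (LINT x|lborel. V x * cnj (V x)) - (LINT x|lborel. V x * cnj (\<phi> x))"
      by (subst LINT_diff[symmetric])
        (auto intro!: sqi_mult_integrable V s\<phi> LINT_cong simp: right_diff_distrib)
    also have "(LINT x|lborel. V x * cnj (V x)) = of_real ((l2norm V)\<^sup>2)"
      unfolding l2norm_square integral_complex_of_real[symmetric]
      by (intro LINT_cong refl complex_norm_square[symmetric])
    finally have "(l2norm V)\<^sup>2 = cmod (LINT x|lborel. V x * cnj (V x - \<phi> x))" using z by (simp add: norm_power)
    also have "\<dots> \<le> l2norm V * l2norm (\<lambda>x. cnj (V x - \<phi> x))"
      by (rule l2norm_Cauchy_Schwarz_complex[OF V(1) sqi_cnj[OF sqi_diff[OF V(1) s\<phi>]]])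
    also have "\<dots> = l2norm V * l2dist V \<phi>" by (simp only: l2norm_cnj)
    also have "\<dots> < l2norm V * l2norm V" using \<phi>(3) V(3) by (rule mult_strict_left_mono)
    finally show False by (simp add: power2_eq_square)
  qed
  ultimately have "0 < l2norm (trunc (conv V \<beta>) 1)" using C by (intro l2norm_trunc_pos continuous_conv[OF V(2) c\<beta>]) auto
  with e(1) c\<beta> supp show ?thesis unfolding V_def by (intro exI[of _ e] exI[of _ \<beta>] exI[of _ "max R 0"]) auto
qed

text \<open>By \<open>B_shift\<close> the bump at \<open>real n *\<^sub>R e\<close> contributes
  \<open>n / (2 * pi)\<close> times a translated convolution plus a bounded term. The mirror bump,
  which makes the function real, acts around the opposite frequency, and only its tail is seen in
  the unit ball considered.\<close>

lemma oscillation_growth: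
  assumes a: "sqi a" "integrable lborel a" and e: "norm e = 1"
    and \<beta>: "continuous_on UNIV \<beta>" "0 \<le> A" "\<forall>z. A < norm z \<longrightarrow> \<beta> z = 0"
    and w: "0 < l2norm (trunc (conv (Kmul e a) \<beta>) 1)"
  defines "c \<equiv> l2norm (trunc (conv (Kmul e a) \<beta>) 1) / (4 * pi)"
  shows "\<forall>\<^sub>F n in sequentially. c * real n \<le> l2norm (\<lambda>z. indicator (cball (real n *\<^sub>R e) 1) z *
    B a (\<lambda>y. \<beta> (y - real n *\<^sub>R e) + cnj (\<beta> (- y - real n *\<^sub>R e))) z)"
proof -
  define V where "V = Kmul e a"
  have V: "sqi V" "integrable lborel V" using sqi_Kmul[OF a(1)] integrable_Kmul[OF a(2)] by (auto simp: V_def)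
  \<comment> \<open>The sign turns the sum of the two bumps into a difference, to which
    \<open>B_diff_right\<close> applies.\<close>
  define \<beta>' where "\<beta>' y = - cnj (\<beta> (- y))" for y
  have s\<beta>: "sqi \<beta>" by (rule sqi_compact_support(1)[OF \<beta>(1,3)])
  have s\<beta>': "sqi \<beta>'" unfolding \<beta>'_def using sqi_uminus[OF sqi_cnj[OF sqi_reflect[OF s\<beta>, of 0]]] by simp
  have supp': "\<forall>z. A < norm z \<longrightarrow> \<beta>' z = 0" using \<beta>(3) by (simp add: \<beta>'_def)
  have i1: "inH 1 b" if "sqi b" "\<forall>z. A' < norm z \<longrightarrow> b z = 0" "0 \<le> A'" for b A'
    by (rule compact_support_weight(1)[OF that(1,3)]) (use that in auto)
  have ish: "inH 1 (\<lambda>y. b (y - v))" if b: "sqi b" "\<forall>z. A < norm z \<longrightarrow> b z = 0" for b v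
  proof (rule i1[OF sqi_translate[OF b(1)], of "A + norm v"])
    show "\<forall>z. A + norm v < norm z \<longrightarrow> b (z - v) = 0"
    proof (intro allI impI)
      fix z :: plane assume "A + norm v < norm z"
      then have "A < norm (z - v)" using norm_triangle_ineq2[of z v] by linarith
      then show "b (z - v) = 0" using b(2) by simp
    qed
  qed (use \<beta>(2) in simp)
  have \<beta>1: "inH 1 \<beta>" "inH 1 \<beta>'" using i1[OF s\<beta> \<beta>(3,2)] i1[OF s\<beta>' supp' \<beta>(2)] by auto
  have L0: "L1i 0 a" using a(2) by (simp add: L1i_def wt_0)
  have sB: "sqi (B a b)" if "inH 1 b" for b using inH_B'[of 0 a b] a(1) L0 that by (simp add: inH_0)
  define W W' where "W = conv V \<beta>" and "W' = conv V \<beta>'"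
  have sW: "sqi W" "sqi W'" unfolding W_def W'_def by (intro sqi_conv V s\<beta> s\<beta>')+
  define w where "w = l2norm (trunc W 1)"
  have w0: "0 < w" using w by (simp add: w_def W_def V_def)
  define Q where "Q = l2norm (B a \<beta>) + l2norm (B a \<beta>')"
  have "(\<lambda>n. l2dist (trunc W' n) W') \<longlonglongrightarrow> 0" by (rule trunc_tendsto[OF sW(2)])
  then have ev1: "\<forall>\<^sub>F n in sequentially. l2dist (trunc W' n) W' < w / 4" by (rule order_tendstoD(2)) (use w0 in simp)
  have ev2: "\<forall>\<^sub>F n in sequentially. Q * (8 * pi) / w \<le> real n"
    using eventually_ge_at_top[of "nat \<lceil>Q * (8 * pi) / w\<rceil>"] by eventually_elim (simp add: nat_le_iff ceiling_le_iff)
  show ?thesis using ev1 ev2 eventually_ge_at_top[of 2]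
  proof eventually_elim
    fix n :: nat assume n1: "l2dist (trunc W' n) W' < w / 4" and n2: "Q * (8 * pi) / w \<le> real n" and n3: "2 \<le> n"
    define v where "v = real n *\<^sub>R e"
    have nv: "norm v = real n" using e by (simp add: v_def)
    let ?I = "\<lambda>z. indicator (cball v 1) z :: complex"
    let ?k = "of_real (real n / (2 * pi))"
    define X where "X z = B a (\<lambda>y. \<beta> (y - v) + cnj (\<beta> (- y - v))) z" for z
    have m: "(\<lambda>z. ?I z * f z) \<in> borel_measurable borel" if "sqi f" for f
      using that by (intro borel_measurable_times borel_measurable_indicator) auto
    have sI: "sqi (\<lambda>z. ?I z * f z)" "l2norm (\<lambda>z. ?I z * f z) \<le> l2norm f" if "sqi f" for f
    proof -
      show s: "sqi (\<lambda>z. ?I z * f z)" by (rule sqi_dominated[OF that m[OF that], of 1]) (simp add: indicator_def)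
      have "l2norm (\<lambda>z. ?I z * f z) \<le> 1 * l2norm f" by (rule l2norm_mono_AE[OF _ s that]) (auto simp: indicator_def)
      then show "l2norm (\<lambda>z. ?I z * f z) \<le> l2norm f" by simp
    qed
    have "(\<lambda>y. \<beta> (y - v) + cnj (\<beta> (- y - v))) = (\<lambda>y. \<beta> (y - v) - \<beta>' (y - (- v)))"
      by (simp add: \<beta>'_def fun_eq_iff)
    then have X: "X z = B a (\<lambda>y. \<beta> (y - v)) z - B a (\<lambda>y. \<beta>' (y - (- v))) z" for z
      unfolding X_def by (simp only:) (rule B_diff_right[OF a(1) ish[OF s\<beta> \<beta>(3)] ish[OF s\<beta>' supp']])
    have sX: "sqi X" unfolding X[abs_def] by (intro sqi_diff sB ish s\<beta> \<beta>(3) s\<beta>' supp')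
    have shift1: "B a (\<lambda>y. \<beta> (y - v)) z = B a \<beta> (z - v) + ?k * W (z - v)" for z
      unfolding B_shift[OF a(1) \<beta>1(1)] by (simp add: v_def conv_Kmul_scaleR W_def V_def)
    have shift2: "B a (\<lambda>y. \<beta>' (y - (- v))) z = B a \<beta>' (z + v) - ?k * W' (z + v)" for z
    proof -
      have "- v = (- real n) *\<^sub>R e" by (simp add: v_def)
      then have "conv (Kmul (- v) a) \<beta>' x = - of_real (real n) * W' x" for x
        by (simp only: conv_Kmul_scaleR) (simp add: W'_def V_def)
      then show ?thesis unfolding B_shift[OF a(1) \<beta>1(2)] by simp
    qed
    have W1: "l2norm (\<lambda>z. ?I z * W (z - v)) = w"
    proof -
      have "(\<lambda>z. ?I z * W (z - v)) = (\<lambda>z. trunc W 1 (z - v))"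
        by (auto simp: trunc_def fun_eq_iff indicator_def dist_norm norm_minus_commute)
      then show ?thesis using l2norm_translate[OF sqi_trunc[OF sW(1), of 1], of v] by (simp add: w_def)
    qed
    have W2: "l2norm (\<lambda>z. ?I z * W' (z + v)) \<le> w / 4"
    proof -
      have st: "sqi (\<lambda>x. trunc W' n x - W' x)" by (intro sqi_diff sqi_trunc sW)
      have "l2norm (\<lambda>z. ?I z * W' (z - (- v))) \<le> 1 * l2norm (\<lambda>z. trunc W' n (z - (- v)) - W' (z - (- v)))"
      proof (rule l2norm_mono_AE[OF AE_I2])
        fix z
        have "real n < norm (z + v)" if "norm (v - z) \<le> 1"
        proof -
          have "norm (2 *\<^sub>R v) \<le> norm (z + v) + norm (v - z)"
            using norm_triangle_ineq[of "z + v" "v - z"] by (simp add: scaleR_2)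
          then show ?thesis using that nv n3 by simp
        qed
        then show "cmod (?I z * W' (z - (- v))) \<le> 1 * cmod (trunc W' n (z - (- v)) - W' (z - (- v)))"
          using norm_minus_cancel[of "z + v"] by (auto simp: indicator_def trunc_def dist_norm)
      qed (use sI(1)[OF sqi_translate[OF sW(2), of "- v"]] sqi_translate[OF st, of "- v"] in auto)
      also have "\<dots> = l2dist (trunc W' n) W'" using l2norm_translate[OF st, of "- v"] by simp
      finally show ?thesis using n1 by simp
    qed
    have sh: "sqi (\<lambda>z. f (z + v))" "l2norm (\<lambda>z. f (z + v)) = l2norm f" if "sqi f" for f
      using sqi_translate[OF that, of "- v"] l2norm_translate[OF that, of "- v"] by simp_all
    define P where "P z = B a \<beta>' (z + v) - B a \<beta> (z - v)" for z
    have sP: "sqi P" unfolding P_def by (intro sqi_diff sh(1) sqi_translate sB \<beta>1)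
    have P: "l2norm P \<le> Q" using l2norm_triangle_diff[OF sh(1)[OF sB[OF \<beta>1(2)]] sqi_translate[OF sB[OF \<beta>1(1)], of v]]
        sh(2)[OF sB[OF \<beta>1(2)]] l2norm_translate[OF sB[OF \<beta>1(1)], of v] by (simp add: P_def[abs_def] Q_def)
    have "real n / (2 * pi) * w = l2norm (\<lambda>z. ?k * (?I z * W (z - v)))"
      by (simp only: l2norm_mult_left W1) (simp add: norm_divide)
    also have "(\<lambda>z. ?k * (?I z * W (z - v))) = (\<lambda>z. (?I z * X z + ?I z * P z) - ?k * (?I z * W' (z + v)))"
      by (rule ext, simp only: X shift1 shift2 P_def) (simp add: algebra_simps)
    also have "l2norm \<dots> \<le> l2norm (\<lambda>z. ?I z * X z + ?I z * P z) + l2norm (\<lambda>z. ?k * (?I z * W' (z + v)))"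
      by (intro l2norm_triangle_diff sqi_add sqi_mult_left sI sX sP sh sW)
    finally have 1: "real n / (2 * pi) * w \<le> l2norm (\<lambda>z. ?I z * X z + ?I z * P z) + l2norm (\<lambda>z. ?k * (?I z * W' (z + v)))" .
    have 2: "l2norm (\<lambda>z. ?I z * X z + ?I z * P z) \<le> l2norm (\<lambda>z. ?I z * X z) + l2norm (\<lambda>z. ?I z * P z)"
      by (intro l2norm_triangle sI sX sP)
    have 3: "l2norm (\<lambda>z. ?k * (?I z * W' (z + v))) \<le> real n / (2 * pi) * (w / 4)"
    proof -
      have "l2norm (\<lambda>z. ?k * (?I z * W' (z + v))) = real n / (2 * pi) * l2norm (\<lambda>z. ?I z * W' (z + v))"
        by (simp only: l2norm_mult_left) (simp add: norm_divide)
      also have "\<dots> \<le> real n / (2 * pi) * (w / 4)" using W2 by (intro mult_left_mono) auto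
      finally show ?thesis .
    qed
    have 4: "Q \<le> real n / (2 * pi) * (w / 4)" using n2 w0 by (simp add: field_simps)
    \<comment> \<open>A quarter of the main term is ceded to the tail of the mirror bump and another
      quarter to the bounded terms; \<open>c\<close> is the remaining half.\<close>
    have "c * real n = real n / (2 * pi) * w - real n / (2 * pi) * (w / 4) - real n / (2 * pi) * (w / 4)"
      by (simp add: c_def w_def W_def V_def field_simps)
    then have "c * real n \<le> l2norm (\<lambda>z. ?I z * X z)" using 1 2 3 4 P sI(2)[OF sP] by linarith
    then show "c * real n \<le> l2norm (\<lambda>z. indicator (cball (real n *\<^sub>R e) 1) z *
        B a (\<lambda>y. \<beta> (y - real n *\<^sub>R e) + cnj (\<beta> (- y - real n *\<^sub>R e))) z)" by (simp add: X_def v_def)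
  qed
qed

section \<open>Growth of a perturbation over short times\<close>

lemma quadratic_error_bound:
  fixes d :: "real \<Rightarrow> real \<Rightarrow> real"
  assumes tri: "\<And>x y z. u \<le> x \<Longrightarrow> x \<le> y \<Longrightarrow> y \<le> z \<Longrightarrow> z \<le> v \<Longrightarrow> d x z \<le> d x y + d y z"
    and le: "\<And>x y. u \<le> x \<Longrightarrow> x \<le> y \<Longrightarrow> y \<le> v \<Longrightarrow> d x y \<le> C * (y - x) + D * (y - x)\<^sup>2"
    and xy: "u \<le> x" "x \<le> y" "y \<le> v"
  shows "d x y \<le> C * (y - x)"
proof -
  \<comment> \<open>Subdivision into \<open>Suc m\<close> equal pieces leaves the linear part
    unchanged and divides the quadratic part by \<open>Suc m\<close>: a mean value inequality for a
    subadditive quantity.\<close>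
  have "d x y \<le> C * (y - x) + D * (y - x)\<^sup>2 / real (Suc m)" for m
  proof -
    define h where "h = (y - x) / real (Suc m)"
    have h: "0 \<le> h" "real (Suc m) * h = y - x" using xy by (auto simp: h_def)
    have "d x (x + real k * h) \<le> real k * (C * h + D * h\<^sup>2)" if "k \<le> Suc m" for k using that
    proof (induction k)
      case 0
      then show ?case using le[of x x] xy by simp
    next
      case (Suc k)
      have "real (Suc k) * h \<le> real (Suc m) * h" using Suc.prems h(1) by (intro mult_right_mono) auto
      then have end_le: "x + real (Suc k) * h \<le> v" using h(2) xy by linarith
      have *: "u \<le> x + real k * h" "x + real k * h \<le> x + real (Suc k) * h"
        using h(1) xy by (auto simp: algebra_simps intro: add_nonneg_nonneg order_trans)
      have "d x (x + real (Suc k) * h) \<le> d x (x + real k * h) + d (x + real k * h) (x + real (Suc k) * h)"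
        by (rule tri) (use * xy h(1) end_le in auto)
      moreover have "d (x + real k * h) (x + real (Suc k) * h) \<le> C * h + D * h\<^sup>2"
        using le[OF * end_le] by (simp add: algebra_simps)
      moreover have "d x (x + real k * h) \<le> real k * (C * h + D * h\<^sup>2)" using Suc by simp
      ultimately show ?case by (simp add: algebra_simps)
    qed
    from this[of "Suc m"] have "d x y \<le> C * (real (Suc m) * h) + D * (real (Suc m) * h * h)"
      using h(2) by (simp add: power2_eq_square algebra_simps)
    also have "D * (real (Suc m) * h * h) = D * (y - x)\<^sup>2 / real (Suc m)" unfolding h(2) by (simp add: h_def power2_eq_square)
    finally show ?thesis by (simp only: h(2))
  qed
  moreover have "(\<lambda>m. C * (y - x) + D * (y - x)\<^sup>2 / real (Suc m)) \<longlonglongrightarrow> C * (y - x) + 0"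
    by (intro tendsto_add tendsto_const LIMSEQ_Suc[OF lim_const_over_n])
  ultimately have "d x y \<le> C * (y - x) + 0" by (intro LIMSEQ_le_const) auto
  then show ?thesis by simp
qed

text \<open>Restriction to frequencies near \<open>v\<close>, where the drift of the perturbation is
  bounded below. There a derivative is worth a factor of order \<open>norm v\<close>, so weighted
  norms of the errors turn into negative powers of \<open>norm v\<close>.\<close>

definition loc :: "plane \<Rightarrow> cfun \<Rightarrow> cfun" where
  "loc v f x = indicator (cball v 1) x * f x"

lemma loc_add: "loc v (\<lambda>x. f x + g x) = (\<lambda>x. loc v f x + loc v g x)"
  and loc_mult: "loc v (\<lambda>x. c * f x) = (\<lambda>x. c * loc v f x)" by (auto simp: loc_def fun_eq_iff algebra_simps)

lemma sqi_loc: assumes f: "sqi f" shows "sqi (loc v f)"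
proof (rule sqi_dominated[OF f, of _ 1])
  show "loc v f \<in> borel_measurable borel" unfolding loc_def[abs_def]
    using f by (intro borel_measurable_times borel_measurable_indicator) auto
qed (simp add: loc_def indicator_def)

lemma l2norm_loc_le:
  assumes f: "inH m f" and m: "0 \<le> m" and v: "2 \<le> norm v"
  shows "l2norm (loc v f) \<le> (2 / norm v) powr m * N m f" unfolding N_def
proof (rule l2norm_mono_AE[OF AE_I2])
  show "sqi (loc v f)" using inH_mono[OF m f] by (intro sqi_loc) (simp add: inH_0)
  show "sqi (wt m f)" using f by (simp add: inH_def)
  fix x
  show "cmod (loc v f x) \<le> (2 / norm v) powr m * cmod (wt m f x)"
  proof (cases "norm (v - x) \<le> 1")
    case True
    have "norm v / 2 \<le> jb x" using norm_triangle_ineq2[of v "v - x"] True norm_le_jb[of x] v by simp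
    moreover have "0 < norm v" using v by linarith
    ultimately have "1 \<le> (2 / norm v) * jb x" by (simp add: field_simps)
    then have "1 \<le> (2 / norm v * jb x) powr m" using m by (intro ge_one_powr_ge_zero)
    also have "\<dots> = (2 / norm v) powr m * jb x powr m" by (rule powr_mult)
    finally show ?thesis using mult_right_mono[of 1 "(2 / norm v) powr m * jb x powr m" "cmod (f x)"]
      by (simp add: loc_def indicator_def cmod_wt mult.assoc)
  qed (simp add: loc_def indicator_def dist_norm)
qed simp

text \<open>The first factor is charged in H^{s-1} only, where the perturbation tends to 0, unlike
  in H^s.\<close>

lemma N_B_low:
  assumes s: "2 < s" and x: "inH s x" and y: "inH s y"
  shows "N (s - 1) (B x y) \<le> 2 powr s * cL s * N (s - 1) x * N s y"
proof -
  have x1: "inH (s - 1) x" using inH_mono[OF _ x, of "s - 1"] by simp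
  have L0: "L1 0 x \<le> cL s * N (s - 1) x"
  proof -
    have "L1 0 x \<le> l2norm (jbc (s - 1 - 0)) * N (s - 1) x" by (rule L1_le_N[OF _ x1]) (use s in simp)
    also have "\<dots> \<le> cL s * N (s - 1) x" by (intro mult_right_mono) (auto simp: cL_def)
    finally show ?thesis .
  qed
  have "N (s - 1) (B x y) \<le> 2 powr (s - 1) * (L1 0 x * N s y + N (s - 1) x * L1 1 y)"
    using N_B[OF _ x1 L1i_0[OF s x], of y] y L1i_1[OF s y] s by simp
  also have "\<dots> \<le> 2 powr (s - 1) * ((cL s * N (s - 1) x) * N s y + N (s - 1) x * (cL s * N s y))"
    by (intro mult_left_mono add_mono mult_right_mono L0 L1_1_le s y) auto
  also have "\<dots> = 2 powr s * cL s * N (s - 1) x * N s y" by (simp add: powr_diff algebra_simps)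
  finally show ?thesis .
qed

text \<open>Mean value inequality for the difference of \<open>g\<close> and \<open>a\<close>
  against a fixed velocity \<open>H\<close>, in a seminorm \<open>\<nu>\<close>. It serves twice:
  for the norm of H^{s-1} with \<open>H\<close> zero, and for the localised L2 norm with the
  linearised velocity.\<close>

lemma ssol_increment:
  fixes \<nu> :: "cfun \<Rightarrow> real"
  assumes s: "2 < s" and g: "ssol s Mg S g" and a: "ssol s Ma S a"
    and add: "\<And>x y. inH (s - 1) x \<Longrightarrow> inH (s - 1) y \<Longrightarrow> \<nu> (\<lambda>w. x w + y w) \<le> \<nu> x + \<nu> y"
    and scale: "\<And>c x. inH (s - 1) x \<Longrightarrow> \<nu> (\<lambda>w. of_real c * x w) = \<bar>c\<bar> * \<nu> x"
    and le: "\<And>x. inH s x \<Longrightarrow> \<nu> x \<le> C * N s x" and C: "0 \<le> C"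
    and H: "inH (s - 1) H" and \<tau>: "\<tau> \<le> S"
    and E: "\<And>r. r \<in> {0..\<tau>} \<Longrightarrow> \<nu> (\<lambda>w. Bq (g r) w - Bq (a r) w - H w) \<le> E"
    and rt: "0 \<le> r" "r \<le> t" "t \<le> \<tau>"
  shows "\<nu> (\<lambda>w. (g t w - a t w) - (g r w - a r w) - of_real (t - r) * H w) \<le> E * (t - r)"
proof -
  note Dg = ssol_D[OF g s] and Da = ssol_D[OF a s]
  have i1: "inH (s - 1) x" if "inH s x" for x using inH_mono[OF _ that, of "s - 1"] by simp
  define d where "d r t = \<nu> (\<lambda>w. (g t w - a t w) - (g r w - a r w) - of_real (t - r) * H w)" for r t
  have id: "inH (s - 1) (\<lambda>w. (g t w - a t w) - (g r w - a r w) - of_real (t - r) * H w)"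
    if "r \<in> {0..S}" "t \<in> {0..S}" for r t by (intro inH_diff inH_mult_left H i1 Dg Da that)
  have "d r t \<le> E * (t - r)"
  proof (rule quadratic_error_bound[where u=0 and v=\<tau> and D="C * (Mg + Ma)", OF _ _ rt])
    fix x y z assume xyz: "0 \<le> x" "x \<le> y" "y \<le> z" "z \<le> \<tau>"
    have "(\<lambda>w. (g z w - a z w) - (g x w - a x w) - of_real (z - x) * H w)
      = (\<lambda>w. ((g y w - a y w) - (g x w - a x w) - of_real (y - x) * H w)
        + ((g z w - a z w) - (g y w - a y w) - of_real (z - y) * H w))" by (simp add: fun_eq_iff algebra_simps)
    then show "d x z \<le> d x y + d y z" unfolding d_def by (simp only:) (intro add id; use xyz \<tau> in auto)
  next
    fix x y assume xy: "0 \<le> x" "x \<le> y" "y \<le> \<tau>"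
    then have x: "x \<in> {0..S}" and y: "y \<in> {0..S}" and x\<tau>: "x \<in> {0..\<tau>}" using \<tau> by auto
    let ?G = "\<lambda>w. g y w - g x w - of_real (y - x) * Bq (g x) w"
    let ?A = "\<lambda>w. a y w - a x w - of_real (y - x) * Bq (a x) w"
    let ?F = "\<lambda>w. Bq (g x) w - Bq (a x) w - H w"
    have iG: "inH s ?G" and iA: "inH s ?A" by (intro inH_diff inH_mult_left Dg Da x y)+
    have iF: "inH (s - 1) ?F" by (intro inH_diff H i1 Dg Da x)
    have GA: "inH s (\<lambda>w. ?G w - ?A w)" by (intro inH_diff iG iA)
    have "(\<lambda>w. (g y w - a y w) - (g x w - a x w) - of_real (y - x) * H w)
       = (\<lambda>w. (?G w - ?A w) + of_real (y - x) * ?F w)" by (simp add: fun_eq_iff algebra_simps)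
    then have "d x y \<le> \<nu> (\<lambda>w. ?G w - ?A w) + \<nu> (\<lambda>w. of_real (y - x) * ?F w)"
      unfolding d_def by (simp only:) (intro add i1 GA inH_mult_left iF)
    moreover have "\<nu> (\<lambda>w. of_real (y - x) * ?F w) \<le> (y - x) * E"
      unfolding scale[OF iF] using E[OF x\<tau>] xy by (simp add: mult_left_mono)
    moreover have "\<nu> (\<lambda>w. ?G w - ?A w) \<le> C * (Mg * (y - x)\<^sup>2 + Ma * (y - x)\<^sup>2)"
    proof -
      have "Nd s ?G ?A \<le> N s ?G + N s ?A" by (rule N_triangle_diff[OF iG iA])
      then have "Nd s ?G ?A \<le> Mg * (y - x)\<^sup>2 + Ma * (y - x)\<^sup>2" using ssol_diff[OF g x y] ssol_diff[OF a x y] by linarith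
      from mult_left_mono[OF this C] le[OF GA] show ?thesis by linarith
    qed
    ultimately show "d x y \<le> E * (y - x) + C * (Mg + Ma) * (y - x)\<^sup>2" by (simp add: algebra_simps)
  qed
  then show ?thesis by (simp add: d_def)
qed

text \<open>With \<open>q\<close> the difference of \<open>g\<close> and \<open>a\<close>, its
  velocity differs from \<open>B (a 0) h\<close> by three terms: \<open>B x q\<close> with
  \<open>x\<close> the deviation of \<open>g\<close> from \<open>a 0\<close>, \<open>B q a\<close>,
  and \<open>B (a 0) y\<close> with \<open>y\<close> the deviation of \<open>q\<close> from
  \<open>h\<close>. The first two are small in H^{s-1}, as \<open>x\<close> and \<open>q\<close>
  are. In the third, \<open>y\<close> is of order \<open>\<tau>\<close> in H^{s-1} and a derivative
  is lost; near frequency \<open>v\<close> a time \<open>\<tau>\<close> of order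
  \<open>1 / norm v\<close> makes up for it.\<close>

lemma perturbation_growth:
  assumes s: "2 < s" and g: "ssol s Mg S g" and a: "ssol s Ma S a"
    and M: "\<And>t. t \<in> {0..S} \<Longrightarrow> N s (g t) \<le> M" "\<And>t. t \<in> {0..S} \<Longrightarrow> N s (a t) \<le> M"
    and p: "\<And>t. t \<in> {0..S} \<Longrightarrow> Nd s (g t) (a t) \<le> \<epsilon>" "\<And>t. t \<in> {0..S} \<Longrightarrow> Nd (s - 1) (g t) (a t) \<le> \<delta>"
    and v: "2 \<le> norm v" and \<tau>: "0 \<le> \<tau>" "\<tau> \<le> S"
  defines "h \<equiv> \<lambda>z. g 0 z - a 0 z" and "Q \<equiv> 2 powr s * cL s"
  shows "l2norm (loc v (\<lambda>z. (g \<tau> z - a \<tau> z) - h z - of_real \<tau> * B (a 0) h z))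
    \<le> ((2 / norm v) powr (s - 1) * (Q * ((\<delta> + Ma * \<tau>) * \<epsilon> + \<delta> * M))
       + (2 / norm v) powr (s - 2) * (2 powr (s - 2) * L1 (s - 2) (a 0) * (Q * (2 * M) * \<epsilon>)) * \<tau>) * \<tau>"
proof -
  note Dg = ssol_D[OF g s] and Da = ssol_D[OF a s]
  have i1: "inH (s - 1) x" if "inH s x" for x using inH_mono[OF _ that, of "s - 1"] by simp
  have i2: "inH (s - 2) x" if "inH s x" for x using inH_mono[OF _ that, of "s - 2"] by simp
  have i11: "inH 1 x" "sqi x" if "inH s x" for x using inH_mono[OF _ that, of 1] inH_mono[OF _ that, of 0] s by (auto simp: inH_0)
  have 0: "0 \<in> {0..S}" using \<tau> by simp
  have Q: "0 \<le> Q" using cL_ge_1[of s] by (simp add: Q_def)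
  have nn: "0 \<le> M" "0 \<le> \<epsilon>" "0 \<le> \<delta>" "0 \<le> Ma"
    using order_trans[OF N_nonneg M(2)[OF 0]] order_trans[OF N_nonneg p(1)[OF 0]]
      order_trans[OF N_nonneg p(2)[OF 0]] order_trans[OF N_nonneg Da(3)[OF 0]] by auto
  have ip: "inH s (\<lambda>z. g t z - a t z)" if "t \<in> {0..S}" for t by (intro inH_diff Dg Da that)
  have h: "inH s h" unfolding h_def by (rule ip[OF 0])
  define H where "H = B (a 0) h"
  have H: "inH (s - 1) H" unfolding H_def using s h Da(5)[OF 0] by (intro inH_B_quad[OF s]) auto
  have Bin: "inH (s - 1) (B x y)" if "inH s x" "inH s y" for x y using s that by (intro inH_B_quad[OF s]) auto
  have incr: "N (s - 1) (\<lambda>z. (g t z - a t z) - h z) \<le> Q * (2 * M) * \<epsilon> * t" if t: "0 \<le> t" "t \<le> S" for t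
  proof -
    have "N (s - 1) (\<lambda>z. (g t z - a t z) - (g 0 z - a 0 z) - of_real (t - 0) * 0) \<le> Q * (2 * M) * \<epsilon> * (t - 0)"
    proof (rule ssol_increment[OF s g a, where \<nu>="N (s - 1)" and C=1 and \<tau>=S and H="\<lambda>_. 0"])
      show "N (s - 1) x \<le> 1 * N s x" if "inH s x" for x using N_mono[OF _ that, of "s - 1"] by simp
      fix r assume r: "r \<in> {0..S}"
      have "Nd (s - 1) (Bq (g r)) (Bq (a r))
        \<le> 2 powr s * cL s * (N s (g r) + N s (a r)) * Nd s (g r) (a r)"
        using N_B_diff[OF s, of "s - 1" "g r" "a r"] Dg(5)[OF r] Da(5)[OF r] s by simp
      also have "\<dots> \<le> Q * (2 * M) * \<epsilon>"
        unfolding Q_def using M[OF r] p(1)[OF r] nn cL_ge_1[of s] by (intro mult_mono mult_left_mono mult_nonneg_nonneg add_nonneg_nonneg) auto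
      finally show "N (s - 1) (\<lambda>z. Bq (g r) z - Bq (a r) z - 0) \<le> Q * (2 * M) * \<epsilon>" by simp
    qed (use t in \<open>auto intro: N_triangle\<close>)
    then show ?thesis by (simp add: h_def)
  qed
  define E1 where "E1 = Q * ((\<delta> + Ma * \<tau>) * \<epsilon> + \<delta> * M)"
  define E2 where "E2 = 2 powr (s - 2) * L1 (s - 2) (a 0) * (Q * (2 * M) * \<epsilon>)"
  have La: "L1i (s - 2) (a 0)" by (rule inH_L1i[OF _ Da(5)[OF 0]]) simp
  have E: "l2norm (loc v (\<lambda>z. Bq (g r) z - Bq (a r) z - H z))
      \<le> (2 / norm v) powr (s - 1) * E1 + (2 / norm v) powr (s - 2) * E2 * \<tau>" if r\<tau>: "r \<in> {0..\<tau>}" for r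
  proof -
    have r: "r \<in> {0..S}" using r\<tau> \<tau> by auto
    define q where "q z = g r z - a r z" for z
    define x where "x z = g r z - a 0 z" for z
    define y where "y z = q z - h z" for z
    have q: "inH s q" "N s q \<le> \<epsilon>" "N (s - 1) q \<le> \<delta>" using ip[OF r] p[OF r] by (simp_all add: q_def[abs_def])
    have x: "inH s x" unfolding x_def by (intro inH_diff Dg(5)[OF r] Da(5)[OF 0])
    have y: "inH s y" unfolding y_def by (intro inH_diff q(1) h)
    have Nx: "N (s - 1) x \<le> \<delta> + Ma * \<tau>"
    proof -
      have "x = (\<lambda>z. q z + (a r z - a 0 z))" by (simp add: x_def q_def fun_eq_iff)
      then have "N (s - 1) x \<le> N (s - 1) q + Nd (s - 1) (a r) (a 0)" by (simp only:) (intro N_triangle i1 q inH_diff Da r 0)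
      moreover have "Nd (s - 1) (a r) (a 0) \<le> Nd (s + 1) (a r) (a 0)" by (intro N_mono inH_diff Da r 0) auto
      moreover have "Nd (s + 1) (a r) (a 0) \<le> Ma * \<bar>r - 0\<bar>" by (rule ssol_lipschitz[OF a 0 r])
      moreover have "Ma * \<bar>r - 0\<bar> \<le> Ma * \<tau>" using r\<tau> nn by (intro mult_left_mono) auto
      ultimately show ?thesis using q(3) by linarith
    qed
    define F1 where "F1 z = B x q z + B q (a r) z" for z
    have F1: "inH (s - 1) F1" unfolding F1_def by (intro inH_add Bin x q Da r)
    have NF1: "N (s - 1) F1 \<le> E1"
    proof -
      have "N (s - 1) F1 \<le> N (s - 1) (B x q) + N (s - 1) (B q (a r))" unfolding F1_def by (intro N_triangle Bin x q Da r)
      also have "N (s - 1) (B x q) \<le> Q * N (s - 1) x * N s q" unfolding Q_def by (rule N_B_low[OF s x q(1)])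
      also have "N (s - 1) (B q (a r)) \<le> Q * N (s - 1) q * N s (a r)" unfolding Q_def by (rule N_B_low[OF s q(1) Da(5)[OF r]])
      also have "Q * N (s - 1) x * N s q + Q * N (s - 1) q * N s (a r) \<le> Q * (\<delta> + Ma * \<tau>) * \<epsilon> + Q * \<delta> * M"
        using Q nn \<tau> by (intro add_mono mult_mono mult_left_mono mult_nonneg_nonneg add_nonneg_nonneg Nx q M(2)[OF r]) auto
      finally show ?thesis by (simp add: E1_def algebra_simps)
    qed
    have F2: "inH (s - 2) (B (a 0) y)" and NF2: "N (s - 2) (B (a 0) y) \<le> E2 * \<tau>"
    proof -
      have y1: "inH (s - 2 + 1) y" using i1[OF y] by simp
      show "inH (s - 2) (B (a 0) y)" by (rule inH_B'[OF _ i11(2)[OF Da(5)[OF 0]] La y1]) (use s in simp)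
      have "N (s - 2) (B (a 0) y) \<le> 2 powr (s - 2) * (L1 (s - 2) (a 0) * N (s - 2 + 1) y)"
        by (rule N_B'[OF _ i11(2)[OF Da(5)[OF 0]] La y1]) (use s in simp)
      also have "N (s - 2 + 1) y = N (s - 1) (\<lambda>z. (g r z - a r z) - h z)" by (simp add: y_def[abs_def] q_def)
      also have "2 powr (s - 2) * (L1 (s - 2) (a 0) * \<dots>) \<le> 2 powr (s - 2) * (L1 (s - 2) (a 0) * (Q * (2 * M) * \<epsilon> * \<tau>))"
      proof (intro mult_left_mono)
        have "Q * (2 * M) * \<epsilon> * r \<le> Q * (2 * M) * \<epsilon> * \<tau>" using r\<tau> Q nn by (intro mult_left_mono) auto
        then show "N (s - 1) (\<lambda>z. (g r z - a r z) - h z) \<le> Q * (2 * M) * \<epsilon> * \<tau>"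
          using order_trans[OF incr[of r]] r by auto
      qed auto
      finally show "N (s - 2) (B (a 0) y) \<le> E2 * \<tau>" by (simp add: E2_def mult_ac)
    qed
    have "Bq (g r) z - Bq (a r) z - H z = F1 z + B (a 0) y z" for z
    proof -
      have "Bq (g r) z - Bq (a r) z = B (g r) q z + B q (a r) z"
        unfolding q_def using B_diff[OF i11(1)[OF Dg(5)[OF r]] i11(1)[OF Da(5)[OF r]]] by simp
      moreover have "B x q z = B (g r) q z - B (a 0) q z" unfolding x_def by (rule B_diff_left) (intro i11 Dg(5)[OF r] Da(5)[OF 0] q(1))+
      moreover have "B (a 0) y z = B (a 0) q z - H z" unfolding y_def H_def by (rule B_diff_right) (intro i11 h Da(5)[OF 0] q(1))+
      ultimately show ?thesis by (simp add: F1_def)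
    qed
    then have "l2norm (loc v (\<lambda>z. Bq (g r) z - Bq (a r) z - H z)) = l2norm (\<lambda>z. loc v F1 z + loc v (B (a 0) y) z)"
      by (simp add: loc_add)
    also have "\<dots> \<le> l2norm (loc v F1) + l2norm (loc v (B (a 0) y))"
      using inH_mono[of 0 "s - 1" F1] inH_mono[of 0 "s - 2" "B (a 0) y"] F1 F2 s by (intro l2norm_triangle sqi_loc) (auto simp: inH_0)
    also have "\<dots> \<le> (2 / norm v) powr (s - 1) * N (s - 1) F1 + (2 / norm v) powr (s - 2) * N (s - 2) (B (a 0) y)"
      using s by (intro add_mono l2norm_loc_le F1 F2 v) auto
    also have "\<dots> \<le> (2 / norm v) powr (s - 1) * E1 + (2 / norm v) powr (s - 2) * (E2 * \<tau>)"
      by (intro add_mono mult_left_mono NF1 NF2) auto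
    finally show ?thesis by (simp add: mult.assoc)
  qed
  have "l2norm (loc v (\<lambda>z. (g \<tau> z - a \<tau> z) - (g 0 z - a 0 z) - of_real (\<tau> - 0) * H z))
     \<le> ((2 / norm v) powr (s - 1) * E1 + (2 / norm v) powr (s - 2) * E2 * \<tau>) * (\<tau> - 0)"
  proof (rule ssol_increment[OF s g a, where \<nu>="\<lambda>f. l2norm (loc v f)" and C="(2 / norm v) powr s" and \<tau>=\<tau>])
    have sq: "sqi (loc v x)" if "inH (s - 1) x" for x using inH_mono[OF _ that, of 0] s by (intro sqi_loc) (simp add: inH_0)
    show "l2norm (loc v (\<lambda>z. x z + y z)) \<le> l2norm (loc v x) + l2norm (loc v y)" if "inH (s - 1) x" "inH (s - 1) y" for x y
      unfolding loc_add by (intro l2norm_triangle sq that)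
    show "l2norm (loc v (\<lambda>z. of_real c * x z)) = \<bar>c\<bar> * l2norm (loc v x)" for c x by (simp add: loc_mult)
    show "l2norm (loc v x) \<le> (2 / norm v) powr s * N s x" if "inH s x" for x using that s v by (intro l2norm_loc_le) auto
  qed (use H E \<tau> in auto)
  then show ?thesis by (simp add: h_def H_def E1_def E2_def)
qed

text \<open>Two bumps, at \<open>v\<close> and mirrored at \<open>-v\<close>, so that the
  perturbation belongs to a real function.\<close>

definition osc :: "cfun \<Rightarrow> plane \<Rightarrow> cfun" where
  "osc \<beta> v y = \<beta> (y - v) + cnj (\<beta> (- y - v))"

lemma herm_osc: "herm (osc \<beta> v)" by (simp add: herm_def osc_def add.commute)

lemma
  assumes \<beta>: "sqi \<beta>" "0 \<le> A" "\<forall>x. A < norm x \<longrightarrow> \<beta> x = 0" and m: "0 \<le> m"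
  shows inH_osc: "inH m (osc \<beta> v)" and N_osc_le: "N m (osc \<beta> v) \<le> (1 + (A + norm v)) powr m * (2 * l2norm \<beta>)"
proof -
  have s1: "sqi (\<lambda>y. \<beta> (y - v))" "l2norm (\<lambda>y. \<beta> (y - v)) = l2norm \<beta>"
    using sqi_translate[OF \<beta>(1)] l2norm_translate[OF \<beta>(1)] by auto
  have eq: "- y - v = - v - y" for y by (rule minus_diff_commute)
  have s2: "sqi (\<lambda>y. cnj (\<beta> (- y - v)))" "l2norm (\<lambda>y. cnj (\<beta> (- y - v))) = l2norm \<beta>"
    using sqi_cnj[OF sqi_reflect[OF \<beta>(1), of "- v"]] l2norm_reflect[OF \<beta>(1), of "- v"] unfolding eq by simp_all
  have sq: "sqi (osc \<beta> v)" unfolding osc_def[abs_def] by (intro sqi_add s1 s2)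
  have l2: "l2norm (osc \<beta> v) \<le> 2 * l2norm \<beta>"
    using l2norm_triangle[OF s1(1) s2(1)] s1(2) s2(2) by (simp add: osc_def[abs_def])
  have A: "0 \<le> A + norm v" using \<beta>(2) by simp
  have supp: "osc \<beta> v x = 0" if "A + norm v < norm x" for x
  proof -
    have "A < norm (x - v)" "A < norm (- x - v)" using norm_triangle_ineq2[of x v] norm_triangle_ineq2[of "- x" v] that by auto
    then show ?thesis using \<beta>(3) by (simp add: osc_def)
  qed
  show "inH m (osc \<beta> v)" by (rule compact_support_weight(1)[OF sq A supp m])
  have "N m (osc \<beta> v) \<le> (1 + (A + norm v)) powr m * l2norm (osc \<beta> v)" by (rule compact_support_weight(2)[OF sq A supp m])
  also have "\<dots> \<le> (1 + (A + norm v)) powr m * (2 * l2norm \<beta>)" by (intro mult_left_mono l2) simp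
  finally show "N m (osc \<beta> v) \<le> (1 + (A + norm v)) powr m * (2 * l2norm \<beta>)" .
qed

lemma eventually_real_ge: "\<forall>\<^sub>F n in sequentially. X \<le> real n"
  using filterlim_real_sequentially by (simp add: filterlim_at_top)

text \<open>H^s stability keeps the perturbation below \<open>\<epsilon>\<close>; L2 stability and
  interpolation keep it below \<open>\<delta>\<close> in H^{s-1}. Near frequency \<open>n\<close>
  its drift is at least \<open>\<gamma>\<close> times \<open>real n powr (1 - s)\<close>, and the
  constants are arranged so that all errors consume at most half of this, for all large
  \<open>n\<close> alike.\<close>

lemma norm_inflation:
  assumes s: "2 < s" and a: "ssol s Ma S a" and S: "0 < S" and nz: "N 0 (a 0) \<noteq> 0" and \<epsilon>: "0 < \<epsilon>"
  shows "\<exists>\<kappa>>0. \<exists>c>0. \<exists>g :: nat \<Rightarrow> real \<Rightarrow> cfun. \<forall>\<^sub>F n in sequentially. (\<exists>M. ssol s M S (g n)) \<and>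
    (\<forall>t\<in>{0..S}. Nd s (g n t) (a t) \<le> \<epsilon>) \<and> \<kappa> / real n \<le> S \<and>
    c \<le> Nd s (g n (\<kappa> / real n)) (g n 0)"
proof -
  note Da = ssol_D[OF a s]
  have 0: "0 \<in> {0..S}" using S by simp
  have Ma: "0 \<le> Ma" using order_trans[OF N_nonneg Da(3)[OF 0]] .
  have i11: "inH 1 x" "sqi x" if "inH s x" for x using inH_mono[OF _ that, of 1] inH_mono[OF _ that, of 0] s by (auto simp: inH_0)
  have ra: "rsol s Ma S a" by (rule ssol_imp_rsol[OF s a Da(8)])
  define R where "R = N s (a 0) + 1"
  have R: "0 \<le> R" by (simp add: R_def)
  obtain M' d0 where d0: "0 < d0" and ex0: "\<forall>b. inH (s + 2) b \<and> herm b \<and> N s b \<le> R \<and> Nd 0 b (a 0) < d0 \<longrightarrow>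
      (\<exists>G M2. ssol s M2 S G \<and> G 0 = b \<and> (\<forall>t\<in>{0..S}. N s (G t) \<le> M'))"
    using smooth_existence[OF s ra S R] by (elim exE conjE) (rule that)
  have ex: "\<exists>G M2. ssol s M2 S G \<and> G 0 = b \<and> (\<forall>t\<in>{0..S}. N s (G t) \<le> M')"
    if "inH (s + 2) b" "herm b" "N s b \<le> R" "Nd 0 b (a 0) < d0" for b by (rule mp[OF spec[OF ex0]]) (use that in blast)
  define M where "M = max M' Ma"
  have M0: "0 \<le> M" using Ma by (simp add: M_def)
  define Cs where "Cs = exp (stabC s M' Ma * S)"
  define Ce where "Ce = exp (cL s * M * S)"
  have Cs: "0 < Cs" and Ce: "0 < Ce" by (simp_all add: Cs_def Ce_def)
  have a0: "sqi (a 0)" "integrable lborel (a 0)" "l2norm (a 0) \<noteq> 0"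
    using i11(2)[OF Da(5)[OF 0]] L1i_0[OF s Da(5)[OF 0]] nz by (auto simp: L1i_def wt_0 N_0)
  obtain e \<beta> A where e: "norm e = 1" and \<beta>: "continuous_on UNIV \<beta>" "0 \<le> A" "\<forall>z. A < norm z \<longrightarrow> \<beta> z = 0"
    and w: "0 < l2norm (trunc (conv (Kmul e (a 0)) \<beta>) 1)" using oscillation_profile[OF a0] by blast
  have s\<beta>: "sqi \<beta>" by (rule sqi_compact_support(1)[OF \<beta>(1,3)])
  define cw where "cw = l2norm (trunc (conv (Kmul e (a 0)) \<beta>) 1) / (4 * pi)"
  have cw: "0 < cw" using w by (simp add: cw_def)
  define v where "v n = real n *\<^sub>R e" for n
  have nv: "norm (v n) = real n" for n using e by (simp add: v_def)
  have growth: "\<forall>\<^sub>F n in sequentially. cw * real n \<le> l2norm (loc (v n) (B (a 0) (osc \<beta> (v n))))"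
    using oscillation_growth[OF a0(1,2) e \<beta> w] by (simp add: cw_def v_def loc_def[abs_def] osc_def[abs_def])
  define C\<beta> where "C\<beta> = (2 + A) powr s * (2 * l2norm \<beta>)"
  have C\<beta>: "0 \<le> C\<beta>" by (simp add: C\<beta>_def)
  \<comment> \<open>Amplitude: \<open>\<rho> * C\<beta> \<le> 1\<close> keeps the data below
    \<open>R\<close>, and \<open>\<rho> * C\<beta> \<le> \<epsilon> / Cs\<close> keeps the solutions
    within \<open>\<epsilon>\<close> after amplification by \<open>Cs\<close>.\<close>
  define \<rho> where "\<rho> = min 1 (\<epsilon> / Cs) / (C\<beta> + 1)"
  have \<rho>: "0 < \<rho>" "\<rho> * C\<beta> \<le> 1" "\<rho> * C\<beta> \<le> \<epsilon> / Cs"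
  proof -
    have pos: "0 < min 1 (\<epsilon> / Cs)" using \<epsilon> Cs by simp
    then show "0 < \<rho>" using C\<beta> by (simp add: \<rho>_def)
    have "\<rho> * C\<beta> \<le> \<rho> * (C\<beta> + 1)" using \<open>0 < \<rho>\<close> by simp
    also have "\<dots> = min 1 (\<epsilon> / Cs)" using C\<beta> by (simp add: \<rho>_def)
    finally show "\<rho> * C\<beta> \<le> 1" "\<rho> * C\<beta> \<le> \<epsilon> / Cs" by auto
  qed
  define h where "h n = (\<lambda>z. of_real (\<rho> * real n powr (- s)) * osc \<beta> (v n) z)" for n
  have hin: "inH m (h n)" if "0 \<le> m" for m n unfolding h_def by (intro inH_mult_left inH_osc[OF s\<beta> \<beta>(2,3)] that)
  have hh: "herm (h n)" for n unfolding h_def by (rule herm_real_mult[OF herm_osc])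
  have Nh: "N s (h n) \<le> \<rho> * C\<beta>" "N 0 (h n) \<le> \<rho> * (2 * l2norm \<beta>) / real n" if n: "1 \<le> n" for n
  proof -
    have "N s (h n) = \<rho> * real n powr (- s) * N s (osc \<beta> (v n))" using \<rho>(1) by (simp add: h_def norm_mult)
    also have "\<dots> \<le> \<rho> * real n powr (- s) * ((1 + (A + real n)) powr s * (2 * l2norm \<beta>))"
      using N_osc_le[OF s\<beta> \<beta>(2,3), of s "v n"] s \<rho> by (intro mult_left_mono) (auto simp: nv)
    also have "\<dots> \<le> \<rho> * real n powr (- s) * (((2 + A) * real n) powr s * (2 * l2norm \<beta>))"
    proof -
      have "1 + (A + real n) \<le> (2 + A) * real n" using n \<beta>(2) mult_left_mono[of 1 "real n" A] by (simp add: algebra_simps)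
      then show ?thesis using s \<beta>(2) \<rho> by (intro mult_left_mono mult_right_mono powr_mono2) auto
    qed
    also have "\<dots> = \<rho> * C\<beta> * (real n powr (- s) * real n powr s)" by (simp add: C\<beta>_def powr_mult)
    also have "\<dots> = \<rho> * C\<beta>" using n by (simp add: powr_add[symmetric])
    finally show "N s (h n) \<le> \<rho> * C\<beta>" .
    have o0: "N 0 (osc \<beta> (v n)) \<le> 2 * l2norm \<beta>"
      using N_osc_le[OF s\<beta> \<beta>(2,3), of 0 "v n"] \<beta>(2) by (simp add: nv split: if_splits)
    have "N 0 (h n) = \<rho> * real n powr (- s) * N 0 (osc \<beta> (v n))" using \<rho>(1) by (simp add: h_def norm_mult)
    also have "\<dots> \<le> \<rho> * real n powr (- 1) * (2 * l2norm \<beta>)"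
      using s \<rho>(1) n by (intro mult_mono mult_left_mono powr_mono o0) auto
    also have "\<dots> = \<rho> * (2 * l2norm \<beta>) / real n" using n by (simp add: powr_minus divide_inverse)
    finally show "N 0 (h n) \<le> \<rho> * (2 * l2norm \<beta>) / real n" .
  qed
  have N0ev: "\<forall>\<^sub>F n in sequentially. N 0 (h n) < y" if y: "0 < y" for y
    using eventually_real_ge[of "\<rho> * (2 * l2norm \<beta>) / y + 1"] eventually_ge_at_top[of 1]
  proof eventually_elim
    fix n assume n: "\<rho> * (2 * l2norm \<beta>) / y + 1 \<le> real n" "1 \<le> n"
    have "\<rho> * (2 * l2norm \<beta>) / y < real n" using n by linarith
    then have "\<rho> * (2 * l2norm \<beta>) / real n < y" using y n(2) by (simp add: field_simps)
    then show "N 0 (h n) < y" using Nh(2)[OF n(2)] by linarith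
  qed
  define b where "b n = (\<lambda>z. a 0 z + h n z)" for n
  have bh: "(\<lambda>z. b n z - a 0 z) = h n" for n by (simp add: b_def)
  have "\<forall>n\<in>{n. 1 \<le> n \<and> N 0 (h n) < d0}. \<exists>G. \<exists>M2. ssol s M2 S G \<and> G 0 = b n \<and> (\<forall>t\<in>{0..S}. N s (G t) \<le> M')"
  proof
    fix n assume "n \<in> {n. 1 \<le> n \<and> N 0 (h n) < d0}"
    then have n: "1 \<le> n" "N 0 (h n) < d0" by auto
    have "N s (b n) \<le> N s (a 0) + N s (h n)" unfolding b_def using s by (intro N_triangle Da 0 hin) auto
    then have "N s (b n) \<le> R" using Nh(1)[OF n(1)] \<rho>(2) by (simp add: R_def)
    moreover have "inH (s + 2) (b n)" unfolding b_def using s by (intro inH_add Da 0 hin) auto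
    moreover have "herm (b n)" unfolding b_def by (intro herm_add Da 0 hh)
    ultimately show "\<exists>G. \<exists>M2. ssol s M2 S G \<and> G 0 = b n \<and> (\<forall>t\<in>{0..S}. N s (G t) \<le> M')"
      using n(2) by (intro ex) (simp_all add: bh)
  qed
  from bchoice[OF this] obtain g where
    "\<forall>n\<in>{n. 1 \<le> n \<and> N 0 (h n) < d0}. \<exists>M2. ssol s M2 S (g n) \<and> g n 0 = b n \<and> (\<forall>t\<in>{0..S}. N s (g n t) \<le> M')" ..
  then have g: "\<exists>M2. ssol s M2 S (g n)" "g n 0 = b n" "\<And>t. t \<in> {0..S} \<Longrightarrow> N s (g n t) \<le> M'" if "1 \<le> n" "N 0 (h n) < d0" for n
    using that by auto
  have gs: "Nd s (g n t) (a t) \<le> \<epsilon>" "Nd 0 (g n t) (a t) \<le> Ce * N 0 (h n)"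
    if n: "1 \<le> n" "N 0 (h n) < d0" and t: "t \<in> {0..S}" for n t
  proof -
    obtain M2 where G: "ssol s M2 S (g n)" using g(1)[OF n] ..
    have "(Nd s (g n t) (a t))\<^sup>2 \<le> exp (2 * stabC s M' Ma * S) * (Nd s (g n 0) (a 0))\<^sup>2"
      by (rule ssol_stab[OF s G g(3)[OF n] a t])
    also have "\<dots> = (Cs * N s (h n))\<^sup>2" by (simp add: g(2)[OF n] bh Cs_def power_mult_distrib exp_double[symmetric] mult.assoc)
    finally have "Nd s (g n t) (a t) \<le> Cs * N s (h n)" by (rule power2_le_imp_le) (use Cs in simp)
    also have "\<dots> \<le> Cs * (\<epsilon> / Cs)" using Nh(1)[OF n(1)] \<rho>(3) Cs by (intro mult_left_mono) auto
    finally show "Nd s (g n t) (a t) \<le> \<epsilon>" using Cs by simp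
    have r1: "rsol s M S (g n)" by (rule rsol_mono[OF ssol_imp_rsol[OF s G g(3)[OF n]]]) (auto simp: M_def)
    have r2: "rsol s M S a" by (rule rsol_mono[OF ra]) (auto simp: M_def)
    have "(Nd 0 (g n t) (a t))\<^sup>2 \<le> exp (2 * (cL s * M) * S) * (Nd 0 (g n 0) (a 0))\<^sup>2" by (rule rsol_stab[OF s r1 r2 t])
    also have "\<dots> = (Ce * N 0 (h n))\<^sup>2" by (simp add: g(2)[OF n] bh Ce_def power_mult_distrib exp_double[symmetric] mult.assoc)
    finally show "Nd 0 (g n t) (a t) \<le> Ce * N 0 (h n)" by (rule power2_le_imp_le) (use Ce in simp)
  qed
  define Q where "Q = 2 powr s * cL s"
  have Q: "0 \<le> Q" using cL_ge_1[of s] by (simp add: Q_def)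
  define E2 where "E2 = 2 powr (s - 2) * (2 powr (s - 2) * L1 (s - 2) (a 0) * (Q * (2 * M) * \<epsilon>))"
  have E2: "0 \<le> E2" using Q M0 \<epsilon> by (simp add: E2_def)
  \<comment> \<open>Rate of the drift. Its errors get the shares \<open>\<gamma> / 4\<close> for
    \<open>E2 * \<kappa>\<close> and \<open>\<gamma> / 8\<close> each for
    \<open>E1 * \<delta>\<close> and \<open>E3 * \<tau>\<close>. The term with \<open>E2\<close>
    does not become small with \<open>n\<close>, hence the choice of \<open>\<kappa>\<close> after
    \<open>E2\<close>.\<close>
  define \<gamma> where "\<gamma> = \<rho> * cw"
  have \<gamma>: "0 < \<gamma>" using \<rho> cw by (simp add: \<gamma>_def)
  define \<kappa> where "\<kappa> = \<gamma> / (4 * (E2 + 1))"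
  have \<kappa>: "0 < \<kappa>" "E2 * \<kappa> \<le> \<gamma> / 4"
  proof -
    show "0 < \<kappa>" using \<gamma> E2 by (simp add: \<kappa>_def)
    have "(E2 + 1) * \<kappa> = \<gamma> / 4" using E2 by (simp add: \<kappa>_def field_simps)
    then show "E2 * \<kappa> \<le> \<gamma> / 4" using \<open>0 < \<kappa>\<close> by (simp add: algebra_simps)
  qed
  define E1 where "E1 = 2 powr (s - 1) * (Q * (\<epsilon> + M))"
  have E1: "0 \<le> E1" using Q M0 \<epsilon> by (simp add: E1_def)
  define \<delta> where "\<delta> = \<gamma> / (8 * (E1 + 1))"
  have \<delta>: "0 < \<delta>" "E1 * \<delta> \<le> \<gamma> / 8"
  proof -
    show "0 < \<delta>" using \<gamma> E1 by (simp add: \<delta>_def)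
    have "(E1 + 1) * \<delta> = \<gamma> / 8" using E1 by (simp add: \<delta>_def field_simps)
    then show "E1 * \<delta> \<le> \<gamma> / 8" using \<open>0 < \<delta>\<close> by (simp add: algebra_simps)
  qed
  define E3 where "E3 = 2 powr (s - 1) * (Q * (Ma * \<epsilon>))"
  have E3: "0 \<le> E3" using Q Ma \<epsilon> by (simp add: E3_def)
  obtain C where C: "0 \<le> C" "\<And>x. inH s x \<Longrightarrow> N (s - 1) x \<le> \<delta> / (2 * \<epsilon>) * N s x + C * N 0 x"
    using N_interpolation[of "s - 1" s "\<delta> / (2 * \<epsilon>)"] s \<delta>(1) \<epsilon> by auto
  define y where "y = \<delta> / (2 * (C * Ce + 1))"
  have y: "0 < y" "C * Ce * y \<le> \<delta> / 2"
  proof -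
    have C': "0 \<le> C * Ce" using C Ce by simp
    show "0 < y" using \<delta>(1) C' by (simp add: y_def)
    have "(C * Ce + 1) * y = \<delta> / 2" using C' by (simp add: y_def field_simps)
    then show "C * Ce * y \<le> \<delta> / 2" using \<open>0 < y\<close> by (simp add: algebra_simps)
  qed
  \<comment> \<open>\<open>2 * c\<close> bounds the motion of the perturbation from below; one
    \<open>c\<close> is set aside for the motion of \<open>a\<close> itself, which is of order
    \<open>1 / n\<close>.\<close>
  define c where "c = \<kappa> * \<gamma> / (4 * 2 powr s)"
  have c: "0 < c" using \<kappa> \<gamma> by (simp add: c_def)
  have "\<forall>\<^sub>F n in sequentially. (\<exists>M. ssol s M S (g n)) \<and>
    (\<forall>t\<in>{0..S}. Nd s (g n t) (a t) \<le> \<epsilon>) \<and> \<kappa> / real n \<le> S \<and>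
    c \<le> Nd s (g n (\<kappa> / real n)) (g n 0)"
    using growth N0ev[OF d0] N0ev[OF y(1)] eventually_real_ge[of "\<kappa> / S"] eventually_real_ge[of "8 * E3 * \<kappa> / \<gamma>"]
      eventually_real_ge[of "Ma * \<kappa> / c"] eventually_ge_at_top[of 2]
  proof eventually_elim
    fix n :: nat
    assume gr: "cw * real n \<le> l2norm (loc (v n) (B (a 0) (osc \<beta> (v n))))" and hd0: "N 0 (h n) < d0" and hy: "N 0 (h n) < y"
      and n\<kappa>: "\<kappa> / S \<le> real n" and nE: "8 * E3 * \<kappa> / \<gamma> \<le> real n" and nMa: "Ma * \<kappa> / c \<le> real n" and n2: "2 \<le> n"
    have n1: "1 \<le> n" and npos: "0 < real n" using n2 by auto
    note g = g[OF n1 hd0] and gs = gs[OF n1 hd0]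
    obtain M2 where G: "ssol s M2 S (g n)" using g(1) ..
    note Dg = ssol_D[OF G s]
    define \<tau> where "\<tau> = \<kappa> / real n"
    have \<tau>: "0 < \<tau>" "\<tau> \<le> S" "E3 * \<tau> \<le> \<gamma> / 8" "Ma * \<tau> \<le> c"
    proof -
      show "0 < \<tau>" using \<kappa>(1) npos by (simp add: \<tau>_def)
      show "\<tau> \<le> S" using n\<kappa> S npos by (simp add: \<tau>_def field_simps)
      show "E3 * \<tau> \<le> \<gamma> / 8" using nE \<gamma> npos by (simp add: \<tau>_def field_simps)
      show "Ma * \<tau> \<le> c" using nMa c npos by (simp add: \<tau>_def field_simps)
    qed
    have \<tau>S: "\<tau> \<in> {0..S}" using \<tau> by simp
    have pin: "inH s (\<lambda>z. g n t z - a t z)" if "t \<in> {0..S}" for t by (intro inH_diff Dg Da that)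
    have low: "Nd (s - 1) (g n t) (a t) \<le> \<delta>" if t: "t \<in> {0..S}" for t
    proof -
      have "Nd (s - 1) (g n t) (a t) \<le> \<delta> / (2 * \<epsilon>) * Nd s (g n t) (a t) + C * Nd 0 (g n t) (a t)"
        by (rule C(2)[OF pin[OF t]])
      moreover have "\<delta> / (2 * \<epsilon>) * Nd s (g n t) (a t) \<le> \<delta> / (2 * \<epsilon>) * \<epsilon>"
        using gs(1)[OF t] \<delta>(1) \<epsilon> by (intro mult_left_mono) auto
      moreover have "C * Nd 0 (g n t) (a t) \<le> C * (Ce * y)"
      proof (intro mult_left_mono C(1))
        have "Ce * N 0 (h n) \<le> Ce * y" using hy Ce by (intro mult_left_mono) auto
        then show "Nd 0 (g n t) (a t) \<le> Ce * y" using gs(2)[OF t] by linarith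
      qed
      moreover have "\<delta> / (2 * \<epsilon>) * \<epsilon> = \<delta> / 2" using \<epsilon> by simp
      ultimately show ?thesis using y(2) by (simp add: mult.assoc)
    qed
    have h0: "(\<lambda>z. g n 0 z - a 0 z) = h n" unfolding g(2) by (rule bh)
    have h0': "g n 0 z - a 0 z = h n z" for z using fun_cong[OF h0] .
    define X where "X z = (g n \<tau> z - a \<tau> z) - h n z" for z
    define H where "H = B (a 0) (h n)"
    have X: "inH s X" unfolding X_def using s by (intro inH_diff pin \<tau>S hin) simp
    have hs: "inH s (h n)" using s by (intro hin) simp
    have H: "sqi H" unfolding H_def using inH_B'[of 0 "a 0" "h n"] a0 hin[of 1 n] L1i_0[OF s Da(5)[OF 0]] by (simp add: inH_0)
    \<comment> \<open>The common order in \<open>n\<close> of the localised drift and of its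
      errors.\<close>
    define \<Lambda> where "\<Lambda> = real n powr (1 - s)"
    have \<Lambda>: "0 < \<Lambda>" using npos by (simp add: \<Lambda>_def)
    have pw1: "(2 / real n) powr (s - 1) = 2 powr (s - 1) * \<Lambda>"
      using npos by (simp add: \<Lambda>_def powr_divide powr_diff field_simps)
    have pw2: "(2 / real n) powr (s - 2) * \<tau> = 2 powr (s - 2) * \<kappa> * \<Lambda>"
      using npos by (simp add: \<Lambda>_def \<tau>_def powr_divide powr_diff field_simps power2_eq_square)
    have "l2norm (loc (v n) (\<lambda>z. X z - of_real \<tau> * H z))
      \<le> ((2 / real n) powr (s - 1) * (Q * ((\<delta> + Ma * \<tau>) * \<epsilon> + \<delta> * M))
       + (2 / real n) powr (s - 2) * (2 powr (s - 2) * L1 (s - 2) (a 0) * (Q * (2 * M) * \<epsilon>)) * \<tau>) * \<tau>"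
    proof -
      have "N s (g n t) \<le> M" "N s (a t) \<le> M" if "t \<in> {0..S}" for t using g(3)[OF that] Da(8)[OF that] by (auto simp: M_def)
      then show ?thesis
        using perturbation_growth[OF s G a, of M \<epsilon> \<delta> "v n" \<tau>] gs(1) low \<tau> n2 unfolding h0' nv Q_def X_def H_def by simp
    qed
    also have "\<dots> = (2 powr (s - 1) * \<Lambda> * (Q * ((\<delta> + Ma * \<tau>) * \<epsilon> + \<delta> * M)) + 2 powr (s - 2) * \<kappa> * \<Lambda> *
       (2 powr (s - 2) * L1 (s - 2) (a 0) * (Q * (2 * M) * \<epsilon>))) * \<tau>"
      unfolding pw1 pw2[symmetric] by (simp add: algebra_simps)
    also have "\<dots> = \<Lambda> * \<tau> * (E1 * \<delta> + E3 * \<tau> + E2 * \<kappa>)"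
      by (simp add: E1_def E2_def E3_def algebra_simps)
    also have "\<dots> \<le> \<Lambda> * \<tau> * (\<gamma> / 2)"
      using \<kappa>(2) \<delta>(2) \<tau>(1,3) \<Lambda> by (intro mult_left_mono) auto
    finally have err: "l2norm (loc (v n) (\<lambda>z. X z - of_real \<tau> * H z)) \<le> \<Lambda> * \<tau> * (\<gamma> / 2)" .
    have low_H: "\<Lambda> * \<tau> * \<gamma> \<le> l2norm (loc (v n) (\<lambda>z. of_real \<tau> * H z))"
    proof -
      have "H z = of_real (\<rho> * real n powr (- s)) * B (a 0) (osc \<beta> (v n)) z" for z
        using B_mult[of 1 "a 0" "of_real (\<rho> * real n powr (- s))" "osc \<beta> (v n)" z] by (simp add: H_def h_def)
      then have "l2norm (loc (v n) (\<lambda>z. of_real \<tau> * H z))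
         = \<tau> * (\<rho> * real n powr (- s) * l2norm (loc (v n) (B (a 0) (osc \<beta> (v n)))))"
        using \<tau>(1) \<rho>(1) by (simp add: loc_mult norm_mult)
      moreover have "\<tau> * (\<rho> * real n powr (- s) * (cw * real n)) \<le> \<tau> * (\<rho> * real n powr (- s) * l2norm (loc (v n) (B (a 0) (osc \<beta> (v n)))))"
        using gr \<tau>(1) \<rho>(1) by (intro mult_left_mono) auto
      moreover have "\<tau> * (\<rho> * real n powr (- s) * (cw * real n)) = \<Lambda> * \<tau> * \<gamma>"
        using npos by (simp add: \<Lambda>_def \<gamma>_def powr_diff powr_minus field_simps)
      ultimately show ?thesis by simp
    qed
    have sX: "sqi X" by (rule i11(2)[OF X])
    have "(\<lambda>z. of_real \<tau> * H z) = (\<lambda>z. X z + (- 1) * (X z - of_real \<tau> * H z))" by (simp add: fun_eq_iff)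
    then have "l2norm (loc (v n) (\<lambda>z. of_real \<tau> * H z))
      = l2norm (\<lambda>z. loc (v n) X z + (- 1) * loc (v n) (\<lambda>z. X z - of_real \<tau> * H z) z)"
      by (simp only: loc_add loc_mult)
    also have "\<dots> \<le> l2norm (loc (v n) X) + l2norm (\<lambda>z. (- 1) * loc (v n) (\<lambda>z. X z - of_real \<tau> * H z) z)"
      by (intro l2norm_triangle sqi_mult_left sqi_loc sqi_diff sX H)
    also have "l2norm (\<lambda>z. (- 1) * loc (v n) (\<lambda>z. X z - of_real \<tau> * H z) z) = l2norm (loc (v n) (\<lambda>z. X z - of_real \<tau> * H z))"
      by (simp only: l2norm_mult_left) simp
    finally have "\<Lambda> * \<tau> * (\<gamma> / 2) \<le> l2norm (loc (v n) X)" using err low_H by (simp add: field_simps)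
    also have "\<dots> \<le> (2 / real n) powr s * N s X" using l2norm_loc_le[OF X, of "v n"] s n2 by (simp add: nv)
    finally have "\<Lambda> * \<tau> * (\<gamma> / 2) \<le> (2 / real n) powr s * N s X" .
    moreover have "(2 / real n) powr s * (2 * c) = \<Lambda> * \<tau> * (\<gamma> / 2)"
      using npos by (simp add: c_def \<Lambda>_def \<tau>_def powr_divide powr_diff field_simps)
    ultimately have "(2 / real n) powr s * (2 * c) \<le> (2 / real n) powr s * N s X" by simp
    then have X2: "2 * c \<le> N s X" using npos by simp
    have "N s X \<le> Nd s (g n \<tau>) (g n 0) + Nd s (a \<tau>) (a 0)"
    proof -
      have "X = (\<lambda>z. (g n \<tau> z - g n 0 z) - (a \<tau> z - a 0 z))" by (simp add: X_def fun_eq_iff h0'[symmetric])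
      then show ?thesis by (simp only:) (intro N_triangle_diff inH_diff Dg Da \<tau>S 0)
    qed
    moreover have "Nd s (a \<tau>) (a 0) \<le> c"
    proof -
      have "Nd s (a \<tau>) (a 0) \<le> Nd (s + 1) (a \<tau>) (a 0)" by (intro N_mono inH_diff Da \<tau>S 0) simp
      also have "\<dots> \<le> Ma * \<bar>\<tau> - 0\<bar>" by (rule ssol_lipschitz[OF a 0 \<tau>S])
      finally show ?thesis using \<tau>(1,4) by simp
    qed
    ultimately have "c \<le> Nd s (g n \<tau>) (g n 0)" using X2 by linarith
    then show "(\<exists>M. ssol s M S (g n)) \<and> (\<forall>t\<in>{0..S}. Nd s (g n t) (a t) \<le> \<epsilon>) \<and> \<kappa> / real n \<le> S \<and>
      c \<le> Nd s (g n (\<kappa> / real n)) (g n 0)" using g(1) gs(1) \<tau>(2) by (simp add: \<tau>_def)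
  qed
  with \<kappa>(1) c show ?thesis by blast
qed

section \<open>The solution map and the contradiction\<close>

lemma solution_map_value:
  assumes s: "2 < s" and T: "0 < T" "T < S" and G: "ssol s M S G" and f: "square_integrable f" and f0: "AE x in lborel. ft f x = G 0 x"
  shows "f \<in> sqg_domain s T" and "square_integrable (sqg_solution_map s T f)"
    and "AE x in lborel. ft (sqg_solution_map s T f) x = G T x"
proof -
  have S: "0 \<le> S" using T by simp
  have 0: "0 \<in> {0..S}" using S by simp
  note D = ssol_D[OF G s]
  have fs: "f \<in> sobolev s"
  proof -
    have "AE x in lborel. G 0 x = ft f x" using f0 by eventually_elim simp
    from inH_cong_AE[OF this D(5)[OF 0] ft_measurable[OF f]] f show ?thesis by (simp add: sobolev_iff)
  qed
  obtain \<theta> where \<theta>: "sqg_solution s S f \<theta>" using ssol_sqg_solution[OF s G S f f0] by blast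
  with fs T show "f \<in> sqg_domain s T" by (auto simp: sqg_domain_def)
  have "\<exists>y. \<exists>T'>T. \<exists>\<theta>. sqg_solution s T' f \<theta> \<and> y = \<theta> T" using \<theta> T by blast
  from someI_ex[OF this] obtain T' \<theta>' where T': "T < T'" and \<theta>': "sqg_solution s T' f \<theta>'" and eq: "sqg_solution_map s T f = \<theta>' T"
    unfolding sqg_solution_map_def[symmetric] by (elim exE conjE) (rule that)
  have "\<theta>' T \<in> sobolev s" using \<theta>' T T' by (auto simp: sqg_solution_def sobolev_continuous_on_def)
  then have sq: "square_integrable (\<theta>' T)" and in\<theta>: "inH s (ft (\<theta>' T))" by (auto simp: sobolev_iff)
  then show "square_integrable (sqg_solution_map s T f)" by (simp add: eq)
  have T'0: "0 \<le> T'" using T T' by simp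
  obtain M' where M': "rsol s M' T' (\<lambda>t. ft (\<theta>' t))" using sqg_solution_rsol(1)[OF s T'0 fs \<theta>'] ..
  define S' where "S' = min S T'"
  have S': "T \<in> {0..S'}" "S' \<le> S" "S' \<le> T'" "0 \<in> {0..S'}" "0 \<in> {0..T'}" using T T' by (auto simp: S'_def)
  have r1: "rsol s M' S' (\<lambda>t. ft (\<theta>' t))" by (rule rsol_mono[OF M' order_refl S'(3)])
  have r2: "rsol s M S' G" by (rule rsol_mono[OF ssol_imp_rsol[OF s G D(8)] order_refl S'(2)])
  \<comment> \<open>The solution map chooses some solution on some interval; on the common interval
    \<open>{0..S'}\<close> uniqueness of rough solutions identifies it with
    \<open>G\<close>.\<close>
  have "Nd 0 (ft (\<theta>' T)) (G T) = 0"
  proof (rule rsol_unique[OF s r1 r2 S'(1)])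
    have "AE x in lborel. ft (\<theta>' 0) x - ft f x = ft (\<theta>' 0) x - G 0 x" using f0 by eventually_elim simp
    then have "Nd 0 (ft (\<theta>' 0)) (ft f) = Nd 0 (ft (\<theta>' 0)) (G 0)"
      using rsol_D(1)[OF M' S'(5)] D(5)[OF 0] ft_measurable[OF f] by (intro N_cong_AE borel_measurable_diff) auto
    then show "Nd 0 (ft (\<theta>' 0)) (G 0) = 0" using sqg_solution_rsol(2)[OF s T'0 fs \<theta>'] by simp
  qed
  then have "AE x in lborel. ft (\<theta>' T) x = G T x"
    using inH_mono[OF _ in\<theta>, of 0] D(6)[of T] T s by (intro AE_eq_l2normI) (auto simp: N_0 inH_0)
  then show "AE x in lborel. ft (sqg_solution_map s T f) x = G T x" by (simp add: eq)
qed

text \<open>Truncation in frequency gives smoothness. The state has to be nonzero since otherwise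
  there is no velocity to transport a perturbation; should the truncation vanish, a small multiple
  of the indicator of the unit ball is added, which is Hermitian.\<close>

lemma smooth_nonzero_approximation:
  assumes s: "0 \<le> s" and b: "inH s b" "herm b" and e: "0 < e"
  shows "\<exists>a. inH (s + 2) a \<and> herm a \<and> Nd s a b < e \<and> N 0 a \<noteq> 0"
proof -
  have sb: "sqi b" using inH_mono[OF s b(1)] by (simp add: inH_0)
  have "wt s (\<lambda>z. trunc b n z - b z) = (\<lambda>z. trunc (wt s b) n z - wt s b z)" for n
    by (simp add: wt_def trunc_def fun_eq_iff algebra_simps)
  then have "(\<lambda>n. Nd s (trunc b n) b) \<longlonglongrightarrow> 0"
    using trunc_tendsto[of "wt s b"] b(1) by (simp add: N_def inH_def)
  then have "\<forall>\<^sub>F n in sequentially. Nd s (trunc b n) b < e / 2" by (rule order_tendstoD(2)) (use e in simp)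
  then obtain n where n: "Nd s (trunc b n) b < e / 2" using eventually_happens'[OF sequentially_bot] by blast
  have tin: "inH m (trunc b n)" for m by (rule inH_trunc[OF sb])
  show ?thesis
  proof (cases "N 0 (trunc b n) = 0")
    case False
    then show ?thesis using n e tin trunc_herm[OF b(2), of n] by (intro exI[of _ "trunc b n"]) auto
  next
    case True
    define k :: "cfun" where "k = trunc (\<lambda>_. 1) 1"
    have "k = indicator (cball 0 1)" by (simp add: k_def trunc_def fun_eq_iff)
    then have sk: "sqi k" using sqi_indicator[of "cball 0 1"] by simp
    have kin: "inH m k" if "0 \<le> m" for m
      by (rule compact_support_weight(1)[OF sk, of 1]) (use that in \<open>auto simp: k_def trunc_def indicator_def\<close>)
    have k0: "0 < N 0 k" unfolding k_def N_0 by (rule l2norm_trunc_pos) auto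
    have hk: "herm k" unfolding k_def by (rule trunc_herm) (simp add: herm_def)
    define c where "c = e / 2 / (N s k + 1)"
    have c: "0 < c" "c * N s k < e / 2"
    proof -
      have pos: "0 < N s k + 1" using N_nonneg[of s k] by linarith
      then show "0 < c" using e by (simp add: c_def)
      have "y / x * x = y" if "0 < x" for x y :: real using that by simp
      from this[OF pos, of "e / 2"] have "c * (N s k + 1) = e / 2" unfolding c_def .
      then show "c * N s k < e / 2" using \<open>0 < c\<close> by (simp add: algebra_simps)
    qed
    define a where "a z = trunc b n z + of_real c * k z" for z
    have ck: "inH m (\<lambda>z. of_real c * k z)" if "0 \<le> m" for m by (intro inH_mult_left kin that)
    have ain: "inH m a" if "0 \<le> m" for m unfolding a_def by (intro inH_add tin ck that)
    have "Nd s a b \<le> Nd s (trunc b n) b + N s (\<lambda>z. of_real c * k z)"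
    proof -
      have "(\<lambda>z. a z - b z) = (\<lambda>z. (trunc b n z - b z) + of_real c * k z)" by (simp add: a_def fun_eq_iff)
      then show ?thesis by (simp only:) (intro N_triangle inH_diff tin b ck s)
    qed
    then have near: "Nd s a b < e" using n c by simp
    have "N 0 a \<noteq> 0"
    proof
      assume a0: "N 0 a = 0"
      have "(\<lambda>z. of_real c * k z) = (\<lambda>z. a z - trunc b n z)" by (simp add: a_def fun_eq_iff)
      then have "N 0 (\<lambda>z. of_real c * k z) \<le> N 0 a + N 0 (trunc b n)"
        by (simp only:) (intro N_triangle_diff ain tin order_refl)
      then show False using a0 True c k0 by (simp add: mult_le_0_iff)
    qed
    moreover have "herm a" unfolding a_def by (intro herm_add trunc_herm b herm_real_mult hk)
    moreover have "inH (s + 2) a" using s by (intro ain) simp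
    ultimately show ?thesis using near by blast
  qed
qed

lemma rsol_zero: "rsol s 0 S (\<lambda>t x. 0)" by (auto simp: rsol_def herm_def B_def intro!: exI[of _ 1])

text \<open>Uniform continuity of the time-\<open>T\<close> map near \<open>a\<close>, restricted to
  smooth solutions and stated on the Fourier side, where the choice behind the solution map no
  longer occurs.\<close>

definition flow_modulus :: "real \<Rightarrow> real \<Rightarrow> cfun \<Rightarrow> real \<Rightarrow> real \<Rightarrow> real \<Rightarrow> bool" where
  "flow_modulus s T a r d e \<longleftrightarrow> (\<forall>G1 G2 M1 M2 S1 S2. T < S1 \<and> T < S2 \<and> ssol s M1 S1 G1 \<and> ssol s M2 S2 G2 \<and>
    Nd s (G1 0) a < r \<and> Nd s (G2 0) a < r \<and> Nd s (G1 0) (G2 0) < d \<longrightarrow> Nd s (G1 T) (G2 T) < e)"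

lemma ssol_flow_not_uniformly_continuous:
  assumes s: "2 < s" and T: "0 < T" "T < T'" and \<theta>: "rsol s M T' \<theta>" and r: "0 < r"
    and uc: "\<And>e. 0 < e \<Longrightarrow> \<exists>d>0. flow_modulus s T (\<theta> 0) r d e"
  shows False
proof -
  have 0: "0 \<in> {0..T'}" using T by simp
  note \<theta>0 = rsol_D[OF \<theta> 0]
  define R where "R = N s (\<theta> 0) + r"
  have R: "0 < R" using r by (simp add: R_def add_nonneg_pos)
  \<comment> \<open>The distance \<open>r\<close> at time 0 is spent in quarters: on the
    approximation of \<open>\<theta> 0\<close> by \<open>a0\<close>, on the perturbation, and on the
    multiplication by \<open>\<Lambda> \<tau> \<le> T1 / T\<close>, which the second argument of
    \<open>min\<close> limits.\<close>
  define T1 where "T1 = T + min (T' - T) (T * r / (4 * R))"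
  have T1: "T < T1" "T1 \<le> T'" "(T1 - T) / T * R \<le> r / 4"
  proof -
    show "T < T1" "T1 \<le> T'" using T r R by (auto simp: T1_def)
    have "T1 - T \<le> T * r / (4 * R)" by (simp add: T1_def)
    then show "(T1 - T) / T * R \<le> r / 4" using T R by (simp add: field_simps)
  qed
  have T1pos: "0 < T1" using T T1 by simp
  obtain M' d0 where d0: "0 < d0" and ex: "\<forall>b. inH (s + 2) b \<and> herm b \<and> N s b \<le> R \<and> Nd 0 b (\<theta> 0) < d0 \<longrightarrow>
      (\<exists>G M2. ssol s M2 T1 G \<and> G 0 = b \<and> (\<forall>t\<in>{0..T1}. N s (G t) \<le> M'))"
    using smooth_existence[OF s rsol_mono[OF \<theta> order_refl T1(2)] T1pos less_imp_le[OF R]] by (elim exE conjE) (rule that)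
  have "0 \<le> s" using s by simp
  then obtain a0 where a0: "inH (s + 2) a0" "herm a0" "Nd s a0 (\<theta> 0) < min (r / 4) d0" "N 0 a0 \<noteq> 0"
    using smooth_nonzero_approximation[of s "\<theta> 0" "min (r / 4) d0"] \<theta>0 r d0 by auto
  have a0s: "inH s a0" using inH_mono[OF _ a0(1)] by simp
  have Na0: "N s a0 \<le> N s (\<theta> 0) + r / 4" using N_le_diff_add[OF a0s \<theta>0(1)] a0(3) by simp
  have "Nd 0 a0 (\<theta> 0) < d0" using N_mono[OF _ inH_diff[OF a0s \<theta>0(1)], of 0] a0(3) s by simp
  then obtain A MA where A: "ssol s MA T1 A" and A0: "A 0 = a0" using mp[OF spec[OF ex, of a0]] a0(1,2) Na0 r by (auto simp: R_def)
  note DA = ssol_D[OF A s]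
  define a where "a t x = - A (T1 - t) x" for t x
  have a: "ssol s MA T1 a" unfolding a_def[abs_def] by (rule ssol_reverse[OF A s])
  note Da = ssol_D[OF a s]
  have MA: "0 \<le> MA" using order_trans[OF N_nonneg DA(3)[of 0]] T1pos by simp
  \<comment> \<open>If the reversed solution started at 0 it would stay 0 by uniqueness, whereas it
    ends at \<open>a0\<close> with the opposite sign.\<close>
  have "N 0 (a 0) \<noteq> 0"
  proof
    assume z: "N 0 (a 0) = 0"
    have "N 0 (\<lambda>x. a T1 x - 0) = 0" by (rule rsol_unique[OF s ssol_imp_rsol[OF s a Da(8)] rsol_zero]) (use z T1pos in auto)
    then show False using a0(4) by (simp add: a_def[abs_def] A0)
  qed
  from norm_inflation[OF s a T1pos this, of "r / 4"] r obtain \<kappa> c and g :: "nat \<Rightarrow> real \<Rightarrow> cfun"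
    where \<kappa>: "0 < \<kappa>" and c: "0 < c" and g: "\<forall>\<^sub>F n in sequentially. (\<exists>M. ssol s M T1 (g n)) \<and>
    (\<forall>t\<in>{0..T1}. Nd s (g n t) (a t) \<le> r / 4) \<and> \<kappa> / real n \<le> T1 \<and>
    c \<le> Nd s (g n (\<kappa> / real n)) (g n 0)" by auto
  have "0 < c / 4" using c by simp
  from uc[OF this] obtain d where d: "0 < d" and ucd: "flow_modulus s T (\<theta> 0) r d (c / 4)" by (elim exE conjE) (rule that)
  have "\<exists>n. 1 \<le> n \<and> ((\<exists>M. ssol s M T1 (g n)) \<and>
    (\<forall>t\<in>{0..T1}. Nd s (g n t) (a t) \<le> r / 4) \<and> \<kappa> / real n \<le> T1 \<and>
    c \<le> Nd s (g n (\<kappa> / real n)) (g n 0)) \<and> \<kappa> / (T1 - T) + 1 \<le> real n \<and> \<kappa> * R / (T * d) + 1 \<le> real n \<and>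
    4 * \<kappa> * (MA + r) / (T * c) \<le> real n" by (rule eventually_happens'[OF sequentially_bot])
      (intro eventually_conj eventually_ge_at_top g eventually_real_ge)
  then obtain n Mg where n: "1 \<le> n" and G: "ssol s Mg T1 (g n)" and ga: "\<And>t. t \<in> {0..T1} \<Longrightarrow> Nd s (g n t) (a t) \<le> r / 4"
    and big: "c \<le> Nd s (g n (\<kappa> / real n)) (g n 0)" and \<kappa>T: "\<kappa> / real n \<le> T1"
    and n1: "\<kappa> / (T1 - T) + 1 \<le> real n" and n2: "\<kappa> * R / (T * d) + 1 \<le> real n" and n3: "4 * \<kappa> * (MA + r) / (T * c) \<le> real n"
    by auto
  note Dg = ssol_D[OF G s]
  have npos: "0 < real n" using n by simp
  have Mg: "0 \<le> Mg" using order_trans[OF N_nonneg Dg(3)[of 0]] T1pos by simp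
  define \<tau>2 where "\<tau>2 = \<kappa> / real n"
  \<comment> \<open>At \<open>\<tau> = 0\<close> the scaled solution would be available exactly up
    to time \<open>T\<close> and not longer. So \<open>\<tau>2\<close> is compared with a positive
    \<open>\<tau>1\<close>, small in terms of \<open>Mg\<close>, which may depend on
    \<open>n\<close>.\<close>
  define \<tau>1 where "\<tau>1 = min \<tau>2 (c / (4 * (Mg + 1)))"
  have \<tau>: "0 < \<tau>1" "\<tau>1 \<le> \<tau>2" "\<tau>2 < T1 - T" "Mg * \<tau>1 \<le> c / 4" "\<tau>2 \<le> T1"
  proof -
    have "0 < c / (4 * (Mg + 1))" using c Mg by (intro divide_pos_pos) auto
    then show "0 < \<tau>1" using \<kappa> npos by (simp add: \<tau>1_def \<tau>2_def)
    show "\<tau>1 \<le> \<tau>2" by (simp add: \<tau>1_def)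
    have "\<kappa> / (T1 - T) < real n" using n1 by linarith
    then show "\<tau>2 < T1 - T" using T1(1) npos by (simp add: \<tau>2_def field_simps)
    have "(Mg + 1) * \<tau>1 \<le> (Mg + 1) * (c / (4 * (Mg + 1)))" using Mg by (intro mult_left_mono) (auto simp: \<tau>1_def)
    also have "\<dots> = c / 4" using Mg by (simp add: field_simps)
    finally show "Mg * \<tau>1 \<le> c / 4" using \<open>0 < \<tau>1\<close> by (simp add: algebra_simps)
    show "\<tau>2 \<le> T1" using \<kappa>T by (simp add: \<tau>2_def)
  qed
  define G0 where "G0 t x = - g n (T1 - t) x" for t x
  have G0: "ssol s Mg T1 G0" unfolding G0_def[abs_def] by (rule ssol_reverse[OF G s])
  note DG = ssol_D[OF G0 s]
  have z1: "0 \<in> {0..T1}" "T1 \<in> {0..T1}" using T1pos by auto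
  have G0a: "Nd s (G0 0) a0 \<le> r / 4"
  proof -
    have "(\<lambda>x. G0 0 x - a0 x) = (\<lambda>x. - (g n T1 x - a T1 x))" by (simp add: fun_eq_iff G0_def a_def A0)
    then have "Nd s (G0 0) a0 = Nd s (g n T1) (a T1)" by (simp only: N_uminus)
    then show ?thesis using ga[OF z1(2)] by simp
  qed
  have NG0: "N s (G0 0) \<le> R" using N_le_diff_add[OF DG(5)[OF z1(1)] a0s] G0a Na0 r by (simp add: R_def)
  \<comment> \<open>As \<open>\<Lambda> \<tau> * T = T1 - \<tau>\<close>, the scaled solution at
    time \<open>T\<close> shows \<open>G0\<close> at time \<open>T1 - \<tau>\<close>, that is,
    \<open>g n\<close> at \<open>\<tau>\<close> up to sign and a scalar.\<close>
  define \<Lambda> where "\<Lambda> \<tau> = (T1 - \<tau>) / T" for \<tau>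
  define H where "H \<tau> t x = of_real (\<Lambda> \<tau>) * G0 (\<Lambda> \<tau> * t) x" for \<tau> t x
  have H: "\<exists>M. ssol s M (T1 / \<Lambda> \<tau>) (H \<tau>)" "T < T1 / \<Lambda> \<tau>" "Nd s (H \<tau> 0) (\<theta> 0) < r"
    "H \<tau> T = (\<lambda>x. of_real (\<Lambda> \<tau>) * (- g n \<tau> x))" "1 \<le> \<Lambda> \<tau>" if t: "0 < \<tau>" "\<tau> < T1 - T" for \<tau>
  proof -
    have L: "1 < \<Lambda> \<tau>" using t T by (simp add: \<Lambda>_def field_simps)
    then show "1 \<le> \<Lambda> \<tau>" by simp
    have "0 < \<Lambda> \<tau>" using L by simp
    from ssol_scale[OF G0 s this Mg] show "\<exists>M. ssol s M (T1 / \<Lambda> \<tau>) (H \<tau>)" unfolding H_def[abs_def] by blast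
    have LT: "\<Lambda> \<tau> * T = T1 - \<tau>" using T by (simp add: \<Lambda>_def)
    have "T * \<Lambda> \<tau> < T1" using LT t by (simp add: mult.commute)
    then show "T < T1 / \<Lambda> \<tau>" using L by (simp add: field_simps)
    show "H \<tau> T = (\<lambda>x. of_real (\<Lambda> \<tau>) * (- g n \<tau> x))" by (simp add: H_def LT G0_def fun_eq_iff)
    have "(\<lambda>x. H \<tau> 0 x - \<theta> 0 x) = (\<lambda>x. (of_real (\<Lambda> \<tau> - 1) * G0 0 x + (G0 0 x - a0 x)) + (a0 x - \<theta> 0 x))"
      by (simp add: H_def fun_eq_iff algebra_simps)
    then have "Nd s (H \<tau> 0) (\<theta> 0) \<le> N s (\<lambda>x. of_real (\<Lambda> \<tau> - 1) * G0 0 x + (G0 0 x - a0 x)) + Nd s a0 (\<theta> 0)"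
      by (simp only:) (intro N_triangle inH_add inH_diff inH_mult_left DG z1 a0s \<theta>0)
    moreover have "N s (\<lambda>x. of_real (\<Lambda> \<tau> - 1) * G0 0 x + (G0 0 x - a0 x))
       \<le> N s (\<lambda>x. of_real (\<Lambda> \<tau> - 1) * G0 0 x) + Nd s (G0 0) a0"
      by (intro N_triangle inH_diff inH_mult_left DG z1 a0s)
    moreover have "N s (\<lambda>x. of_real (\<Lambda> \<tau> - 1) * G0 0 x) \<le> r / 4"
    proof -
      have "N s (\<lambda>x. of_real (\<Lambda> \<tau> - 1) * G0 0 x) = (\<Lambda> \<tau> - 1) * N s (G0 0)"
        unfolding N_mult_left norm_of_real using L by simp
      also have "\<dots> \<le> (T1 - T) / T * R"
      proof (intro mult_mono NG0)
        show "\<Lambda> \<tau> - 1 \<le> (T1 - T) / T" using t T by (simp add: \<Lambda>_def field_simps)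
      qed (use T T1 in auto)
      finally show ?thesis using T1(3) by linarith
    qed
    ultimately show "Nd s (H \<tau> 0) (\<theta> 0) < r" using G0a a0(3) r by linarith
  qed
  have t1: "0 < \<tau>1" "\<tau>1 < T1 - T" and t2: "0 < \<tau>2" "\<tau>2 < T1 - T" using \<tau> by auto
  have LL: "\<bar>\<Lambda> \<tau>1 - \<Lambda> \<tau>2\<bar> \<le> \<kappa> / (real n * T)"
  proof -
    have "\<Lambda> \<tau>1 - \<Lambda> \<tau>2 = (\<tau>2 - \<tau>1) / T" by (simp add: \<Lambda>_def diff_divide_distrib)
    also have "\<bar>\<dots>\<bar> \<le> \<tau>2 / T" using \<tau> T by (simp add: divide_right_mono)
    finally show ?thesis by (simp add: \<tau>2_def)
  qed
  have HH: "Nd s (H \<tau>1 0) (H \<tau>2 0) < d"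
  proof -
    have "(\<lambda>x. H \<tau>1 0 x - H \<tau>2 0 x) = (\<lambda>x. of_real (\<Lambda> \<tau>1 - \<Lambda> \<tau>2) * G0 0 x)"
      by (simp add: H_def fun_eq_iff algebra_simps)
    then have "Nd s (H \<tau>1 0) (H \<tau>2 0) = \<bar>\<Lambda> \<tau>1 - \<Lambda> \<tau>2\<bar> * N s (G0 0)" by (simp only: N_mult_left norm_of_real)
    also have "\<dots> \<le> \<kappa> / (real n * T) * R" by (intro mult_mono LL NG0) (use \<kappa> T in auto)
    also have "\<dots> < d"
    proof -
      have "\<kappa> * R / (T * d) < real n" using n2 by linarith
      then show ?thesis using d T npos by (simp add: field_simps)
    qed
    finally show ?thesis .
  qed
  obtain M1 M2 where H12: "ssol s M1 (T1 / \<Lambda> \<tau>1) (H \<tau>1)" "ssol s M2 (T1 / \<Lambda> \<tau>2) (H \<tau>2)" using H(1)[OF t1] H(1)[OF t2] by blast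
  have close: "Nd s (H \<tau>1 T) (H \<tau>2 T) < c / 4"
    using ucd H12 HH H(2,3)[OF t1] H(2,3)[OF t2] unfolding flow_modulus_def by blast
  have \<tau>in: "\<tau>1 \<in> {0..T1}" "\<tau>2 \<in> {0..T1}" using \<tau> by auto
  have Ng: "N s (g n \<tau>1) \<le> MA + r"
    using N_le_diff_add[OF Dg(5)[OF \<tau>in(1)] Da(5)[OF \<tau>in(1)]] ga[OF \<tau>in(1)] Da(8)[OF \<tau>in(1)] r by linarith
  \<comment> \<open>Uniform continuity gives \<open>c / 4\<close> and the change of the scalar
    another \<open>c / 4\<close>. With \<open>c / 4\<close> for the passage from
    \<open>\<tau>1\<close> to 0 the total stays below \<open>c\<close>.\<close>
  have "Nd s (g n \<tau>2) (g n \<tau>1) \<le> c / 2"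
  proof -
    define D where "D x = g n \<tau>2 x - g n \<tau>1 x" for x
    have Din: "inH s D" unfolding D_def by (intro inH_diff Dg \<tau>in)
    have Hin: "inH s (H \<tau>1 T)" "inH s (H \<tau>2 T)" unfolding H(4)[OF t1] H(4)[OF t2] by (intro inH_mult_left inH_uminus Dg \<tau>in)+
    have "(\<lambda>x. of_real (\<Lambda> \<tau>2) * D x)
      = (\<lambda>x. (H \<tau>1 T x - H \<tau>2 T x) + of_real (\<Lambda> \<tau>1 - \<Lambda> \<tau>2) * g n \<tau>1 x)"
      by (simp add: H(4)[OF t1] H(4)[OF t2] D_def fun_eq_iff algebra_simps)
    then have "N s (\<lambda>x. of_real (\<Lambda> \<tau>2) * D x) \<le> Nd s (H \<tau>1 T) (H \<tau>2 T) + N s (\<lambda>x. of_real (\<Lambda> \<tau>1 - \<Lambda> \<tau>2) * g n \<tau>1 x)"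
      by (simp only:) (intro N_triangle inH_diff inH_mult_left Hin Dg \<tau>in)
    moreover have "N s (\<lambda>x. of_real (\<Lambda> \<tau>1 - \<Lambda> \<tau>2) * g n \<tau>1 x) \<le> c / 4"
    proof -
      have "N s (\<lambda>x. of_real (\<Lambda> \<tau>1 - \<Lambda> \<tau>2) * g n \<tau>1 x) = \<bar>\<Lambda> \<tau>1 - \<Lambda> \<tau>2\<bar> * N s (g n \<tau>1)"
        by (simp only: N_mult_left norm_of_real)
      also have "\<dots> \<le> \<kappa> / (real n * T) * (MA + r)" by (intro mult_mono LL Ng) (use \<kappa> T in auto)
      also have "\<dots> \<le> c / 4" using n3 T c npos by (simp add: field_simps)
      finally show ?thesis .
    qed
    moreover have "N s D \<le> N s (\<lambda>x. of_real (\<Lambda> \<tau>2) * D x)"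
    proof -
      have "1 * N s D \<le> \<bar>\<Lambda> \<tau>2\<bar> * N s D" using H(5)[OF t2] by (intro mult_right_mono) auto
      then show ?thesis by (simp only: N_mult_left norm_of_real mult_1)
    qed
    ultimately have "N s D \<le> c / 2" using close by linarith
    then show ?thesis by (simp add: D_def[abs_def])
  qed
  moreover have "Nd s (g n \<tau>1) (g n 0) \<le> c / 4"
  proof -
    have "Nd s (g n \<tau>1) (g n 0) \<le> Nd (s + 1) (g n \<tau>1) (g n 0)" by (intro N_mono inH_diff Dg \<tau>in z1) simp
    also have "\<dots> \<le> Mg * \<bar>\<tau>1 - 0\<bar>" by (rule ssol_lipschitz[OF G z1(1) \<tau>in(1)])
    finally show ?thesis using \<tau> by simp
  qed
  moreover have "Nd s (g n \<tau>2) (g n 0) \<le> Nd s (g n \<tau>2) (g n \<tau>1) + Nd s (g n \<tau>1) (g n 0)"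
    by (intro N_triangle_via Dg \<tau>in z1)
  ultimately show False using big c by (simp add: \<tau>2_def)
qed

theorem theorem1p2:
  fixes s T :: real
  assumes "s > 2" and "T > 0"
  shows "\<not> (\<exists>\<theta>0 \<in> sqg_domain s T. \<exists>V.
           sobolev_neighbourhood_in s (sqg_domain s T) \<theta>0 V \<and>
           sobolev_uniformly_continuous_on s V (sqg_solution_map s T))"
proof
  assume "\<exists>\<theta>0 \<in> sqg_domain s T. \<exists>V. sobolev_neighbourhood_in s (sqg_domain s T) \<theta>0 V \<and>
           sobolev_uniformly_continuous_on s V (sqg_solution_map s T)"
  then obtain \<theta>0 V where \<theta>0: "\<theta>0 \<in> sqg_domain s T" and V: "sobolev_neighbourhood_in s (sqg_domain s T) \<theta>0 V"
    and uc: "sobolev_uniformly_continuous_on s V (sqg_solution_map s T)" by blast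
  obtain r where r: "0 < r" and rV: "\<And>f. f \<in> sqg_domain s T \<Longrightarrow> sobolev_dist s f \<theta>0 < r \<Longrightarrow> f \<in> V"
    using V by (auto simp: sobolev_neighbourhood_in_def)
  obtain T' \<theta> where \<theta>s: "\<theta>0 \<in> sobolev s" and T': "T < T'" and \<theta>: "sqg_solution s T' \<theta>0 \<theta>"
    using \<theta>0 by (auto simp: sqg_domain_def)
  have s: "2 < s" and T'0: "0 \<le> T'" using assms T' by auto
  obtain M where M: "rsol s M T' (\<lambda>t. ft (\<theta> t))" using sqg_solution_rsol(1)[OF s T'0 \<theta>s \<theta>] ..
  have sq0: "square_integrable \<theta>0" and in0: "inH s (ft \<theta>0)" using \<theta>s by (auto simp: sobolev_iff)
  have in1: "inH s (ft (\<theta> 0))" using rsol_D(1)[OF M, of 0] T'0 by simp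
  have init: "AE x in lborel. ft (\<theta> 0) x = ft \<theta>0 x"
    using sqg_solution_rsol(2)[OF s T'0 \<theta>s \<theta>] inH_mono[OF _ in0, of 0] inH_mono[OF _ in1, of 0] s
    by (intro AE_eq_l2normI) (auto simp: N_0 inH_0)
  have repr: "\<exists>f. square_integrable f \<and> (AE x in lborel. ft f x = G 0 x)" if "ssol s M S G" "T < S" for M S G
    using ft_surj[of "G 0"] ssol_D(2,6)[OF that(1) s, of 0] assms that(2) by (simp add: inH_0)
  have dist: "sobolev_dist s f g = Nd s a b"
    if f: "square_integrable f" "AE x in lborel. ft f x = a x" "inH s a" and g: "square_integrable g" "AE x in lborel. ft g x = b x" "inH s b"
    for f g a b unfolding sobolev_dist_ft[OF f(1) g(1)]
  proof (rule N_cong_AE)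
    show "AE x in lborel. ft f x - ft g x = a x - b x" using f(2) g(2) by eventually_elim simp
  qed (use ft_measurable[OF f(1)] ft_measurable[OF g(1)] f(3) g(3) in auto)
  show False
  proof (rule ssol_flow_not_uniformly_continuous[OF s assms(2) T' M r])
    fix e :: real assume e: "0 < e"
    obtain d where d: "0 < d" and ucd: "\<And>f g. f \<in> V \<Longrightarrow> g \<in> V \<Longrightarrow> sobolev_dist s f g < d \<Longrightarrow>
        sobolev_dist s (sqg_solution_map s T f) (sqg_solution_map s T g) < e"
      using uc e unfolding sobolev_uniformly_continuous_on_def by blast
    show "\<exists>d>0. flow_modulus s T (ft (\<theta> 0)) r d e"
      unfolding flow_modulus_def
    proof (intro exI[of _ d] conjI allI impI d, elim conjE)
      fix G1 G2 M1 M2 S1 S2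
      assume S: "T < S1" "T < S2" and G: "ssol s M1 S1 G1" "ssol s M2 S2 G2"
        and near: "Nd s (G1 0) (ft (\<theta> 0)) < r" "Nd s (G2 0) (ft (\<theta> 0)) < r" "Nd s (G1 0) (G2 0) < d"
      obtain f1 where f1: "square_integrable f1" "AE x in lborel. ft f1 x = G1 0 x" using repr[OF G(1) S(1)] by blast
      obtain f2 where f2: "square_integrable f2" "AE x in lborel. ft f2 x = G2 0 x" using repr[OF G(2) S(2)] by blast
      have G0: "inH s (G1 0)" "inH s (G2 0)" "inH s (G1 T)" "inH s (G2 T)" using ssol_D(5)[OF G(1) s] ssol_D(5)[OF G(2) s] S assms by auto
      note v1 = solution_map_value[OF s assms(2) S(1) G(1) f1]
      note v2 = solution_map_value[OF s assms(2) S(2) G(2) f2]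
      have init': "AE x in lborel. ft \<theta>0 x = ft (\<theta> 0) x" using init by eventually_elim simp
      have "f1 \<in> V" using near(1) dist[OF f1 G0(1) sq0 init' in1] by (intro rV v1) simp
      moreover have "f2 \<in> V" using near(2) dist[OF f2 G0(2) sq0 init' in1] by (intro rV v2) simp
      moreover have "sobolev_dist s f1 f2 < d" using near(3) dist[OF f1 G0(1) f2 G0(2)] by simp
      ultimately have "sobolev_dist s (sqg_solution_map s T f1) (sqg_solution_map s T f2) < e" by (rule ucd)
      then show "Nd s (G1 T) (G2 T) < e" using dist[OF v1(2,3) G0(3) v2(2,3) G0(4)] by simp
    qed
  qed
qed

end
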